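(* Consider the extended stochastic approximation recursion described in the context. Suppose the step-size, compactness, ergodicity, kernel-continuity, growth, interior-target, quasi-strong-monotonicity and error conditions of the context hold, with $1/2<\delta\le1$. When $\delta=1$, suppose also $2\zeta\alpha_0>1$. Suppose $0\le\omega_{\mathsf M}<\delta-1/2$, and fix $0\le\beta<\min\{\omega_{\mathsf B},\,\delta-\omega_{\mathsf M}-1/2\}$ and $c>0$. If $B_k=0$ almost surely for all $k$, interpret $\omega_{\mathsf B}=\infty$; if $M_{k+1}=0$ almost surely for all $k$, take $\omega_{\mathsf M}=0$. Then there are positive constants $C$ and $K$ such that, for all $k_0\ge K$, $$\mathbb P\Bigl(\|\theta_k-\theta^\star\|\le c\,k^{-\beta}\ \text{ for all }k\ge k_0\,\Bigm|\,\mathcal G_0^+\Bigr)\ \ge\ 1-C\,U_2(W_0)(1+\log k_0)^2\,k_0^{-(2(\delta-\beta-\omega_{\mathsf M})-1)}.$$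
   Context: Setting. $\|\cdot\|$ is the Euclidean norm and $\langle\cdot,\cdot\rangle$ the Euclidean inner product. $\Theta\subseteq\mathbb R^d$ and $\Pi_\Theta$ is Euclidean projection onto $\Theta$. $\mathcal W$ is a Borel subset of a Euclidean space, $F:\Theta\times\mathcal W\to\mathbb R^d$ is jointly Borel measurable, and $\{P_\theta:\theta\in\Theta\}$ is a family of Markov transition kernels on $\mathcal W$ with $(\theta,w)\mapsto P_\theta(w,E)$ Borel measurable for each Borel $E$. Write $(P_\theta f)(w):=\int f(y)P_\theta(w,dy)$, $P_\theta^k$ for the $k$-step kernel, $U_p(w):=1+\|w\|^p$ for $p\in\{1,2\}$. Extended recursion. On a probability space, $(\theta_0,W_0)$ is $\Theta\times\mathcal W$-valued and $$\theta_{k+1}=\Pi_\Theta\bigl(\theta_k+\alpha_k(F(\theta_k,W_k)+M_{k+1}+B_k)\bigr),\qquad k\ge0,$$ with $\mathbb R^d$-valued random vectors $M_{k+1},B_k$. Let $\chi_{k+1}$ be a random element collecting all information revealed during update $k$, including $M_{k+1}$, and set $\mathcal G_0^-:=\sigma(\theta_0,W_0)$, $\mathcal G_k^+:=\mathcal G_k^-\vee\sigma(\chi_{k+1})$, $\mathcal G_{k+1}^-:=\mathcal G_k^+\vee\sigma(W_{k+1})$ for $k\ge0$. The variables $\theta_k,W_k,B_k$ are $\mathcal G_k^-$-measurable, and $\mathbb P(W_{k+1}\in E\mid\mathcal G_k^+)=P_{\theta_k}(W_k,E)$ for all Borel $E$ and $k\ge0$. (In)equalities between random quantities hold almost surely.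 Constants are deterministic; they may depend on fixed model and result parameters but not on running indices, sample paths or realizations of the initial variables. Conditions. - Step sizes: $\alpha_0>0$, $\delta\in(0,1]$, and $\alpha_k=\alpha_0k^{-\delta}$ for all $k\ge1$ (the step size at $k=0$ is $\alpha_0$). - Compactness: $\Theta$ is nonempty, compact and convex. - Ergodicity: (i) each $P_\theta$ is irreducible and aperiodic (as a general-state-space chain); there are a positive integer $N$, a nonempty Borel set $\mathcal W_0\subseteq\mathcal W$, $\epsilon_0>0$ and a probability measure $\varphi$ on $\mathcal W$ with $P_\theta^N(w,E)\ge\epsilon_0\varphi(E)$ for all $\theta\in\Theta$, $w\in\mathcal W_0$ and Borel $E$; and there are constants $0\le\lambda<1$, $b\ge0$ with $(P_\theta U_2)(w)\le\lambda U_2(w)+b\,\mathbb I_{\mathcal W_0}(w)$ for all $\theta\in\Theta$, $w\in\mathcal W$. (ii) $\mathbb E[U_2(W_0)]<\infty$. Part (i) ensures that each $P_\theta$ has a unique stationary distribution $\nu_\theta$ with $\sup_\theta\nu_\theta(U_2)<\infty$; set $\bar F(\theta):=\int_{\mathcal W}F(\theta,w)\,\nu_\theta(dw)$. - Kernel continuity: there is $L_P>0$ with $|(P_\theta f)(w)-(P_{\theta'}f)(w)|\le L_PU_1(w)\|\theta-\theta'\|$ for all $\theta,\theta'\in\Theta$, $w\in\mathcal W$ and Borel $f:\mathcal W\to\mathbb R$ with $|f|\le U_1$. - Growth: there are $L_F,C_F>0$ with $\|F(\theta,w)-F(\theta',w)\|\le L_F(1+\|w\|)\|\theta-\theta'\|$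 and $\sup_{\theta\in\Theta}\|F(\theta,w)\|\le C_F(1+\|w\|)$ for all $\theta,\theta'\in\Theta$, $w\in\mathcal W$. - Interior target: there is $\theta^\star\in\operatorname{int}(\Theta)$ with $\bar F(\theta^\star)=0$. - Quasi-strong monotonicity: there is $\zeta>0$ with $\langle\theta-\theta^\star,\bar F(\theta)\rangle\le-\zeta\|\theta-\theta^\star\|^2$ for all $\theta\in\Theta$. - Error condition: (i) for all $k\ge0$, $M_{k+1}$ is $\mathcal G_k^+$-measurable and conditionally square integrable, $\mathbb E[M_{k+1}\mid\mathcal G_k^-]=0$ and $\mathbb E[\|M_{k+1}\|^2\mid\mathcal G_k^-]\le\mathsf m_k^2U_2(W_k)$; (ii) for all $k\ge0$, $B_k$ is $\mathcal G_k^-$-measurable and $\|B_k\|\le\mathsf b_k$; (iii) there are constants $C_{\mathsf M},C_{\mathsf B},\omega_{\mathsf M}\ge0$ and $\omega_{\mathsf B}>0$ such that the deterministic scales satisfy $\mathsf m_k\le C_{\mathsf M}(k+1)^{\omega_{\mathsf M}}$ and $\mathsf b_k\le C_{\mathsf B}(k+1)^{-\omega_{\mathsf B}}$ for all $k\ge0$. *)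

theory Defs
  imports "HOL-Probability.Probability"
begin

abbreviation borel_on :: "'b::topological_space set \<Rightarrow> 'b measure" where
  "borel_on A \<equiv> restrict_space borel A"

definition U :: "nat \<Rightarrow> 'b::real_normed_vector \<Rightarrow> real" where
  "U p w = 1 + norm w ^ p"

definition step_size :: "real \<Rightarrow> real \<Rightarrow> nat \<Rightarrow> real" where
  "step_size \<alpha>0 \<delta> k = (if k = 0 then \<alpha>0 else \<alpha>0 * real k powr (- \<delta>))"


section \<open>Markov kernels on a general state space\<close>

text \<open>A Markov kernel on a measurable space \<open>S\<close> is an element of
  \<open>S \<rightarrow>\<^sub>M prob_algebra S\<close>.\<close>

primrec kernel_iter :: "'b measure \<Rightarrow> ('b \<Rightarrow> 'b measure) \<Rightarrow> nat \<Rightarrow> 'b \<Rightarrow> 'b measure" where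
  "kernel_iter S Q 0 = return S"
| "kernel_iter S Q (Suc n) = (\<lambda>w. Q w \<bind> kernel_iter S Q n)"

text \<open>Irreducibility and aperiodicity follow Meyn and Tweedie, \<^emph>\<open>Markov Chains and Stochastic
  Stability\<close>: a chain is irreducible if it has an irreducibility measure, and aperiodic if the
  largest \<open>d\<close> for which a \<open>d\<close>-cycle exists is 1.  Exceptional sets of cycles are
  null sets of a maximal irreducibility measure, which is unique up to equivalence.\<close>

definition irreducibility_measure :: "'b measure \<Rightarrow> ('b \<Rightarrow> 'b measure) \<Rightarrow> 'b measure \<Rightarrow> bool" where
  "irreducibility_measure S Q \<phi> \<longleftrightarrow>
     sigma_finite_measure \<phi> \<and> sets \<phi> = sets S \<and> emeasure \<phi> (space S) \<noteq> 0 \<and>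
     (\<forall>E\<in>sets S. 0 < emeasure \<phi> E \<longrightarrow>
        (\<forall>w\<in>space S. \<exists>n\<ge>1. 0 < emeasure (kernel_iter S Q n w) E))"

definition maximal_irreducibility_measure ::
    "'b measure \<Rightarrow> ('b \<Rightarrow> 'b measure) \<Rightarrow> 'b measure \<Rightarrow> bool" where
  "maximal_irreducibility_measure S Q \<psi> \<longleftrightarrow>
     irreducibility_measure S Q \<psi> \<and>
     (\<forall>\<phi>. irreducibility_measure S Q \<phi> \<longrightarrow> absolutely_continuous \<psi> \<phi>)"

definition irreducible_kernel :: "'b measure \<Rightarrow> ('b \<Rightarrow> 'b measure) \<Rightarrow> bool" where
  "irreducible_kernel S Q \<longleftrightarrow> (\<exists>\<phi>. irreducibility_measure S Q \<phi>)"

definition kernel_cycle ::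
    "'b measure \<Rightarrow> ('b \<Rightarrow> 'b measure) \<Rightarrow> 'b measure \<Rightarrow> nat \<Rightarrow> (nat \<Rightarrow> 'b set) \<Rightarrow> bool" where
  "kernel_cycle S Q \<psi> d D \<longleftrightarrow>
     (\<forall>i<d. D i \<in> sets S) \<and> disjoint_family_on D {..<d} \<and>
     (\<forall>i<d. \<forall>w\<in>D i. emeasure (Q w) (D (Suc i mod d)) = 1) \<and>
     space S - (\<Union>i<d. D i) \<in> null_sets \<psi>"

definition aperiodic_kernel :: "'b measure \<Rightarrow> ('b \<Rightarrow> 'b measure) \<Rightarrow> bool" where
  "aperiodic_kernel S Q \<longleftrightarrow>
     (\<exists>\<psi>. maximal_irreducibility_measure S Q \<psi> \<and>
        (\<forall>d\<ge>2. \<nexists>D. kernel_cycle S Q \<psi> d D))"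

definition stationary :: "'b measure \<Rightarrow> ('b \<Rightarrow> 'b measure) \<Rightarrow> 'b measure \<Rightarrow> bool" where
  "stationary S Q \<nu> \<longleftrightarrow> \<nu> \<in> space (prob_algebra S) \<and> \<nu> \<bind> Q = \<nu>"

definition stationary_dist :: "'b measure \<Rightarrow> ('b \<Rightarrow> 'b measure) \<Rightarrow> 'b measure" where
  "stationary_dist S Q = (THE \<nu>. stationary S Q \<nu>)"

definition mean_field ::
    "'b measure \<Rightarrow> ('a \<Rightarrow> 'b \<Rightarrow> 'b measure) \<Rightarrow> ('a \<Rightarrow> 'b \<Rightarrow> 'a::euclidean_space) \<Rightarrow> 'a \<Rightarrow> 'a" where
  "mean_field S P F \<theta> = (\<integral>w. F \<theta> w \<partial>stationary_dist S (P \<theta>))"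

text \<open>The drift inequality uses the nonnegative integral, so it includes finiteness of
  \<open>P\<^sub>\<theta> U\<^sub>2\<close>.\<close>

definition ergodicity ::
    "'a set \<Rightarrow> 'b::euclidean_space set \<Rightarrow> ('a \<Rightarrow> 'b \<Rightarrow> 'b measure) \<Rightarrow> bool" where
  "ergodicity \<Theta> \<W> P \<longleftrightarrow>
     (\<forall>\<theta>\<in>\<Theta>. irreducible_kernel (borel_on \<W>) (P \<theta>) \<and> aperiodic_kernel (borel_on \<W>) (P \<theta>)) \<and>
     (\<exists>(N::nat) W0 (\<epsilon>0::real) \<phi> (\<rho>::real) (b::real).
        0 < N \<and> W0 \<in> sets (borel_on \<W>) \<and> W0 \<noteq> {} \<and> 0 < \<epsilon>0 \<and>
        \<phi> \<in> space (prob_algebra (borel_on \<W>)) \<and>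
        (\<forall>\<theta>\<in>\<Theta>. \<forall>w\<in>W0. \<forall>E\<in>sets (borel_on \<W>).
           measure (kernel_iter (borel_on \<W>) (P \<theta>) N w) E \<ge> \<epsilon>0 * measure \<phi> E) \<and>
        0 \<le> \<rho> \<and> \<rho> < 1 \<and> 0 \<le> b \<and>
        (\<forall>\<theta>\<in>\<Theta>. \<forall>w\<in>\<W>.
           (\<integral>\<^sup>+y. ennreal (U 2 y) \<partial>P \<theta> w) \<le> ennreal (\<rho> * U 2 w + b * indicator W0 w)))"


section \<open>Information and conditioning\<close>

definition sigma_join :: "'w measure \<Rightarrow> 'w measure \<Rightarrow> 'w measure" where
  "sigma_join A B = sigma (space A) (sets A \<union> sets B)"

text \<open>The sigma-algebras before (\<open>G_minus k\<close>) and after (\<open>G_plus k\<close>) the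
  information \<open>\<xi> (Suc k)\<close> of update \<open>k\<close> is revealed; \<open>\<xi> k\<close> takes values in the
  measurable space \<open>X k\<close>.\<close>

primrec G_minus ::
    "'w measure \<Rightarrow> (nat \<Rightarrow> 'c measure) \<Rightarrow> (nat \<Rightarrow> 'w \<Rightarrow> 'a::euclidean_space) \<Rightarrow>
     (nat \<Rightarrow> 'w \<Rightarrow> 'b::euclidean_space) \<Rightarrow> (nat \<Rightarrow> 'w \<Rightarrow> 'c) \<Rightarrow> nat \<Rightarrow> 'w measure" where
  "G_minus M X \<theta> W \<xi> 0 =
     vimage_algebra (space M) (\<lambda>x. (\<theta> 0 x, W 0 x)) (borel \<Otimes>\<^sub>M borel)"
| "G_minus M X \<theta> W \<xi> (Suc k) =
     sigma_join
       (sigma_join (G_minus M X \<theta> W \<xi> k) (vimage_algebra (space M) (\<xi> (Suc k)) (X (Suc k))))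
       (vimage_algebra (space M) (W (Suc k)) borel)"

definition G_plus ::
    "'w measure \<Rightarrow> (nat \<Rightarrow> 'c measure) \<Rightarrow> (nat \<Rightarrow> 'w \<Rightarrow> 'a::euclidean_space) \<Rightarrow>
     (nat \<Rightarrow> 'w \<Rightarrow> 'b::euclidean_space) \<Rightarrow> (nat \<Rightarrow> 'w \<Rightarrow> 'c) \<Rightarrow> nat \<Rightarrow> 'w measure" where
  "G_plus M X \<theta> W \<xi> k =
     sigma_join (G_minus M X \<theta> W \<xi> k) (vimage_algebra (space M) (\<xi> (Suc k)) (X (Suc k)))"

definition cprob :: "'w measure \<Rightarrow> 'w measure \<Rightarrow> 'w set \<Rightarrow> 'w \<Rightarrow> real" where
  "cprob M G A = real_cond_exp M G (indicator A)"

definition cond_mean_zero :: "'w measure \<Rightarrow> 'w measure \<Rightarrow> ('w \<Rightarrow> 'a::euclidean_space) \<Rightarrow> bool" where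
  "cond_mean_zero M G Y \<longleftrightarrow>
     (\<forall>i\<in>Basis. AE x in M. real_cond_exp M G (\<lambda>x. Y x \<bullet> i) x = 0)"

definition extended_recursion ::
    "'w measure \<Rightarrow> (nat \<Rightarrow> 'c measure) \<Rightarrow> 'a::euclidean_space set \<Rightarrow> 'b::euclidean_space set \<Rightarrow>
     ('a \<Rightarrow> 'b \<Rightarrow> 'a) \<Rightarrow> ('a \<Rightarrow> 'b \<Rightarrow> 'b measure) \<Rightarrow> (nat \<Rightarrow> real) \<Rightarrow>
     (nat \<Rightarrow> 'w \<Rightarrow> 'a) \<Rightarrow> (nat \<Rightarrow> 'w \<Rightarrow> 'b) \<Rightarrow> (nat \<Rightarrow> 'w \<Rightarrow> 'c) \<Rightarrow>
     (nat \<Rightarrow> 'w \<Rightarrow> 'a) \<Rightarrow> (nat \<Rightarrow> 'w \<Rightarrow> 'a) \<Rightarrow> bool" where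
  "extended_recursion M X \<Theta> \<W> F P \<alpha> \<theta> W \<xi> Mt B \<longleftrightarrow>
     prob_space M \<and>
     \<theta> 0 \<in> M \<rightarrow>\<^sub>M borel_on \<Theta> \<and>
     (\<forall>k. W k \<in> M \<rightarrow>\<^sub>M borel_on \<W>) \<and>
     (\<forall>k. \<xi> (Suc k) \<in> M \<rightarrow>\<^sub>M X (Suc k)) \<and>
     (\<forall>k. AE x in M. \<theta> (Suc k) x =
        closest_point \<Theta> (\<theta> k x + \<alpha> k *\<^sub>R (F (\<theta> k x) (W k x) + Mt (Suc k) x + B k x))) \<and>
     (\<forall>k. \<theta> k \<in> borel_measurable (G_minus M X \<theta> W \<xi> k) \<and>
          W k \<in> borel_measurable (G_minus M X \<theta> W \<xi> k) \<and>
          B k \<in> borel_measurable (G_minus M X \<theta> W \<xi> k) \<and>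
          Mt (Suc k) \<in> borel_measurable (G_plus M X \<theta> W \<xi> k)) \<and>
     (\<forall>k. \<forall>E\<in>sets (borel_on \<W>). AE x in M.
        cprob M (G_plus M X \<theta> W \<xi> k) {y \<in> space M. W (Suc k) y \<in> E} x
          = measure (P (\<theta> k x) (W k x)) E)"

text \<open>Conditional second moments are taken with the nonnegative conditional expectation, which
  needs no integrability; the scales \<open>m\<close> and \<open>b\<close> are nonnegative (for \<open>m\<close>
  an upper bound alone would not control \<open>m k ^ 2\<close>).\<close>

definition error_condition ::
    "'w measure \<Rightarrow> (nat \<Rightarrow> 'c measure) \<Rightarrow> (nat \<Rightarrow> 'w \<Rightarrow> 'a::euclidean_space) \<Rightarrow>
     (nat \<Rightarrow> 'w \<Rightarrow> 'b::euclidean_space) \<Rightarrow> (nat \<Rightarrow> 'w \<Rightarrow> 'c) \<Rightarrow>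
     (nat \<Rightarrow> 'w \<Rightarrow> 'a) \<Rightarrow> (nat \<Rightarrow> 'w \<Rightarrow> 'a) \<Rightarrow>
     (nat \<Rightarrow> real) \<Rightarrow> (nat \<Rightarrow> real) \<Rightarrow> real \<Rightarrow> real \<Rightarrow> real \<Rightarrow> real \<Rightarrow> bool" where
  "error_condition M X \<theta> W \<xi> Mt B m b CM CB \<omega>M \<omega>B \<longleftrightarrow>
     (\<forall>k. Mt (Suc k) \<in> borel_measurable (G_plus M X \<theta> W \<xi> k) \<and>
          (AE x in M. nn_cond_exp M (G_minus M X \<theta> W \<xi> k)
             (\<lambda>y. ennreal ((norm (Mt (Suc k) y))\<^sup>2)) x < \<infinity>) \<and>
          cond_mean_zero M (G_minus M X \<theta> W \<xi> k) (Mt (Suc k)) \<and>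
          (AE x in M. nn_cond_exp M (G_minus M X \<theta> W \<xi> k)
             (\<lambda>y. ennreal ((norm (Mt (Suc k) y))\<^sup>2)) x \<le> ennreal ((m k)\<^sup>2 * U 2 (W k x)))) \<and>
     (\<forall>k. B k \<in> borel_measurable (G_minus M X \<theta> W \<xi> k) \<and>
          (AE x in M. norm (B k x) \<le> b k)) \<and>
     0 \<le> CM \<and> 0 \<le> CB \<and> 0 \<le> \<omega>M \<and> 0 < \<omega>B \<and>
     (\<forall>k. 0 \<le> m k \<and> m k \<le> CM * (real k + 1) powr \<omega>M) \<and>
     (\<forall>k. 0 \<le> b k \<and> b k \<le> CB * (real k + 1) powr (- \<omega>B))"

text \<open>Conventions for absent error terms: the noise exponent is 0 if the martingale noise vanishes
  almost surely, and the bias exponent is infinite if the bias vanishes almost surely.\<close>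

definition noise_exponent ::
    "'w measure \<Rightarrow> (nat \<Rightarrow> 'w \<Rightarrow> 'a::euclidean_space) \<Rightarrow> real \<Rightarrow> real" where
  "noise_exponent M Mt \<omega>M = (if \<forall>k. AE x in M. Mt (Suc k) x = 0 then 0 else \<omega>M)"

definition bias_exponent ::
    "'w measure \<Rightarrow> (nat \<Rightarrow> 'w \<Rightarrow> 'a::euclidean_space) \<Rightarrow> real \<Rightarrow> ereal" where
  "bias_exponent M B \<omega>B = (if \<forall>k. AE x in M. B k x = 0 then \<infinity> else ereal \<omega>B)"

end

theory Submission
  imports Defs
begin

text \<open>The Markovian noise is turned into a martingale by a Poisson equation, and the distance of the
rescaled error to a small ball is then almost a supermartingale.

\<^emph>\<open>Poisson equation.\<close> Put \<open>V = sqrt U\<^sub>2\<close>.  Off the small set \<open>V\<close> contracts, so a chain started in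
\<open>{V \<le> R}\<close> enters the small set within a fixed number \<open>n\<close> of steps with probability at least one half.
The average \<open>Q\<close> of \<open>P\<^sup>N, \<dots>, P\<^sup>N\<^sup>+\<^sup>n\<close> is therefore minorized on a whole sublevel set and inherits the
drift (\<open>hitting_minorization\<close>).  Harris' argument makes \<open>Q\<close> a contraction of a weighted oscillation,
with constants that depend only on the drift and minorization data and hence not on \<open>\<theta>\<close>
(\<open>harris_contraction\<close>, \<open>harris_constants\<close>).  The series \<open>h = \<Sum>\<^sub>m (Q\<^sup>m f - \<nu> f)\<close> solves \<open>h - Q h = f - \<nu> f\<close>,
and since \<open>I - Q = (I - P) R\<close> for a finite sum \<open>R\<close> of powers of \<open>P\<close>, the function \<open>u = R h\<close> solves the
Poisson equation for \<open>P\<close>.  The oscillation of every solution is bounded by its right-hand side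
(\<open>poisson_oscillation\<close>); applied to the difference of the solutions for two parameters, this gives
Lipschitz continuity in \<open>\<theta>\<close> (\<open>uniform_poisson_equation\<close>).

\<^emph>\<open>Lyapunov function.\<close> Let \<open>e\<^sub>k = \<theta>\<^sub>k - \<theta>\<^sup>*\<close>, and let \<open>D\<^sub>k = max 0 (k\<^sup>\<beta> |e\<^sub>k| - c/2)\<close> be the distance of
the rescaled error to the ball of radius \<open>c/2\<close>.  Where \<open>D\<^sub>k > 0\<close>, the error is at least of order
\<open>k\<^sup>-\<^sup>\<beta>\<close> and dominates the bias, because \<open>\<beta> < \<omega>\<^sub>B\<close>; the monotonicity of the mean field then pays for the
bias and for the growth of \<open>k\<^sup>\<beta>\<close> (\<open>distance_descent\<close>).  Adding to \<open>D\<^sub>k\<^sup>2\<close> (essentially) the inner product of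
its gradient with \<open>\<alpha>\<^sub>k u(\<theta>\<^sub>k, W\<^sub>k)\<close> cancels the Markovian noise up to second order in the step size
(\<open>corrector_increment\<close>).  With \<open>r = 2(\<delta> - \<beta> - \<omega>\<^sub>M) - 1\<close>, the result \<open>Z\<^sub>k\<close> satisfies, for large \<open>k\<close> and
every event \<open>A\<close> of \<open>G_minus k\<close>,
\<open>\<integral>\<^sub>A Z\<^sub>k\<^sub>+\<^sub>1 \<le> \<integral>\<^sub>A Z\<^sub>k - (2 \<kappa>/k) \<integral>\<^sub>A D\<^sub>k\<^sup>2 + C k\<^sup>-\<^sup>(\<^sup>r\<^sup>+\<^sup>1\<^sup>) \<integral>\<^sub>A U\<^sub>2(W\<^sub>k)\<close> (\<open>lyapunov_step\<close>),
and if \<open>A\<close> is contained in an event \<open>A'\<close> of \<open>G_plus 0\<close>, the drift bounds the last integral by a multiple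
of \<open>\<integral>\<^sub>A\<^sub>' U\<^sub>2(W\<^sub>0)\<close> (\<open>U2_bound_subset\<close>).

\<^emph>\<open>Tail.\<close> One can take \<open>\<kappa> > r/2\<close>; for \<open>\<delta> = 1\<close> this is where \<open>2 \<zeta> \<alpha>\<^sub>0 > 1\<close> enters (\<open>contraction_margin\<close>).
Hence \<open>\<integral>\<^sub>A Z\<^sub>k\<close> is at most of order \<open>k\<^sup>-\<^sup>r\<close> (\<open>decay_rate\<close>).  From time \<open>k\<^sub>0\<close> on, the negative term is
dropped and the failure event is split by the time of the first failure, at which \<open>D\<^sub>k \<ge> c/2\<close>; both
the initial value and the accumulated errors are of order \<open>k\<^sub>0\<^sup>-\<^sup>r\<close> (\<open>first_failure_bound\<close>, \<open>tail_bound\<close>).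
As \<open>A\<close> ranges over \<open>G_plus 0\<close>, these bounds on \<open>A\<close> become the bound on the conditional probability
(\<open>cprob_lower_bound\<close>).\<close>

section \<open>Markov operators on functions of weighted growth\<close>

definition weighted :: "'b measure \<Rightarrow> ('b \<Rightarrow> real) \<Rightarrow> ('b \<Rightarrow> real) set" where
  "weighted S V = {f \<in> borel_measurable S. \<exists>a. \<forall>x\<in>space S. \<bar>f x\<bar> \<le> a * V x}"

lemma weightedI: "f \<in> borel_measurable S \<Longrightarrow> (\<And>x. x \<in> space S \<Longrightarrow> \<bar>f x\<bar> \<le> a * V x) \<Longrightarrow> f \<in> weighted S V"
  by (auto simp: weighted_def)

lemma weighted_measurable: "f \<in> weighted S V \<Longrightarrow> f \<in> borel_measurable S"
  by (auto simp: weighted_def)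

lemma weighted_lin:
  assumes "f \<in> weighted S V" "g \<in> weighted S V"
  shows "(\<lambda>x. p * f x + q * g x) \<in> weighted S V"
proof -
  obtain a c where a: "\<And>x. x \<in> space S \<Longrightarrow> \<bar>f x\<bar> \<le> a * V x" and c: "\<And>x. x \<in> space S \<Longrightarrow> \<bar>g x\<bar> \<le> c * V x"
    and [measurable]: "f \<in> borel_measurable S" "g \<in> borel_measurable S"
    using assms by (auto simp: weighted_def)
  show ?thesis
  proof (rule weightedI[where a="\<bar>p\<bar> * a + \<bar>q\<bar> * c"])
    fix x assume x: "x \<in> space S"
    have "\<bar>p * f x + q * g x\<bar> \<le> \<bar>p\<bar> * \<bar>f x\<bar> + \<bar>q\<bar> * \<bar>g x\<bar>"
      by (metis abs_mult abs_triangle_ineq)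
    also have "\<dots> \<le> \<bar>p\<bar> * (a * V x) + \<bar>q\<bar> * (c * V x)"
      by (intro add_mono mult_left_mono a c x) auto
    finally show "\<bar>p * f x + q * g x\<bar> \<le> (\<bar>p\<bar> * a + \<bar>q\<bar> * c) * V x" by (simp add: algebra_simps)
  qed simp
qed

lemma weighted_add: "f \<in> weighted S V \<Longrightarrow> g \<in> weighted S V \<Longrightarrow> (\<lambda>x. f x + g x) \<in> weighted S V"
  using weighted_lin[of f S V g 1 1] by simp

lemma weighted_diff: "f \<in> weighted S V \<Longrightarrow> g \<in> weighted S V \<Longrightarrow> (\<lambda>x. f x - g x) \<in> weighted S V"
  using weighted_lin[of f S V g 1 "-1"] by simp

lemma weighted_cmult: "f \<in> weighted S V \<Longrightarrow> (\<lambda>x. p * f x) \<in> weighted S V"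
  using weighted_lin[of f S V f p 0] by simp

lemma weighted_abs: "f \<in> weighted S V \<Longrightarrow> (\<lambda>x. \<bar>f x\<bar>) \<in> weighted S V"
  by (auto simp: weighted_def)

text \<open>The contraction argument concerns averages of powers of a kernel.  Working with positive operators
instead of kernels makes such averages instances of the same notion, without constructing mixtures
of measures.\<close>

locale markov_operator =
  fixes S :: "'b measure" and V :: "'b \<Rightarrow> real" and T :: "('b \<Rightarrow> real) \<Rightarrow> ('b \<Rightarrow> real)" and L :: real
  assumes V_meas: "V \<in> borel_measurable S"
    and V_ge_1: "\<And>x. x \<in> space S \<Longrightarrow> 1 \<le> V x"
    and T_meas: "\<And>f. f \<in> weighted S V \<Longrightarrow> T f \<in> borel_measurable S"
    and T_lin: "\<And>f g p q x. f \<in> weighted S V \<Longrightarrow> g \<in> weighted S V \<Longrightarrow> x \<in> space S \<Longrightarrow>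
        T (\<lambda>y. p * f y + q * g y) x = p * T f x + q * T g x"
    and T_mono: "\<And>f g x. f \<in> weighted S V \<Longrightarrow> g \<in> weighted S V \<Longrightarrow> (\<And>y. y \<in> space S \<Longrightarrow> f y \<le> g y) \<Longrightarrow>
        x \<in> space S \<Longrightarrow> T f x \<le> T g x"
    and T_one: "\<And>x. x \<in> space S \<Longrightarrow> T (\<lambda>_. 1) x = 1"
    and T_V: "\<And>x. x \<in> space S \<Longrightarrow> T V x \<le> L * V x"
begin

lemma V_weighted: "V \<in> weighted S V"
  using V_ge_1 by (intro weightedI[where a=1] V_meas) force

lemma const_weighted: "(\<lambda>_. c) \<in> weighted S V"
proof (rule weightedI[where a="\<bar>c\<bar>"])
  show "x \<in> space S \<Longrightarrow> \<bar>c\<bar> \<le> \<bar>c\<bar> * V x" for x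
    using mult_left_mono[OF V_ge_1, of x "\<bar>c\<bar>"] by simp
qed simp

lemma sum_weighted: "finite I \<Longrightarrow> (\<And>i. i \<in> I \<Longrightarrow> f i \<in> weighted S V) \<Longrightarrow> (\<lambda>x. \<Sum>i\<in>I. f i x) \<in> weighted S V"
  by (induction I rule: finite_induct) (auto intro: weighted_add const_weighted)

lemma T_add: "f \<in> weighted S V \<Longrightarrow> g \<in> weighted S V \<Longrightarrow> x \<in> space S \<Longrightarrow> T (\<lambda>y. f y + g y) x = T f x + T g x"
  using T_lin[of f g x 1 1] by simp

lemma T_diff: "f \<in> weighted S V \<Longrightarrow> g \<in> weighted S V \<Longrightarrow> x \<in> space S \<Longrightarrow> T (\<lambda>y. f y - g y) x = T f x - T g x"
  using T_lin[of f g x 1 "-1"] by simp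

lemma T_cmult: "f \<in> weighted S V \<Longrightarrow> x \<in> space S \<Longrightarrow> T (\<lambda>y. p * f y) x = p * T f x"
  using T_lin[of f f x p 0] by simp

lemma T_const: "x \<in> space S \<Longrightarrow> T (\<lambda>_. c) x = c"
  using T_cmult[OF const_weighted, of x c 1] T_one by simp

lemma T_sum: "finite I \<Longrightarrow> (\<And>i. i \<in> I \<Longrightarrow> f i \<in> weighted S V) \<Longrightarrow> x \<in> space S \<Longrightarrow>
    T (\<lambda>y. \<Sum>i\<in>I. f i y) x = (\<Sum>i\<in>I. T (f i) x)"
  by (induction I rule: finite_induct) (auto simp: T_const T_add sum_weighted)

lemma T_abs_le: "f \<in> weighted S V \<Longrightarrow> g \<in> weighted S V \<Longrightarrow> (\<And>y. y \<in> space S \<Longrightarrow> \<bar>f y\<bar> \<le> g y) \<Longrightarrow>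
    x \<in> space S \<Longrightarrow> \<bar>T f x\<bar> \<le> T g x"
  using T_mono[of f g x] T_mono[of "\<lambda>y. - 1 * f y" g x] T_cmult[of f x "-1"] weighted_cmult[of f S V "-1"]
  by (fastforce simp: abs_le_iff)

lemma T_bound:
  assumes f: "f \<in> borel_measurable S" and a: "\<And>y. y \<in> space S \<Longrightarrow> \<bar>f y\<bar> \<le> a * V y" and x: "x \<in> space S"
  shows "\<bar>T f x\<bar> \<le> a * L * V x"
proof -
  have "0 \<le> a * V x" using a[OF x] by linarith
  then have "0 \<le> a" using V_ge_1[OF x] by (simp add: zero_le_mult_iff)
  have "\<bar>T f x\<bar> \<le> T (\<lambda>y. a * V y) x"
    using f a x by (intro T_abs_le weighted_cmult V_weighted weightedI[where a=a]) auto
  also have "\<dots> = a * T V x" by (rule T_cmult[OF V_weighted x])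
  also have "\<dots> \<le> a * (L * V x)" by (intro mult_left_mono T_V x) fact
  finally show ?thesis by simp
qed

lemma T_weighted: "f \<in> weighted S V \<Longrightarrow> T f \<in> weighted S V"
proof -
  assume f: "f \<in> weighted S V"
  then obtain a where "\<And>x. x \<in> space S \<Longrightarrow> \<bar>f x\<bar> \<le> a * V x" by (auto simp: weighted_def)
  then show ?thesis
    using T_bound[OF weighted_measurable[OF f]] by (intro weightedI[OF T_meas[OF f], where a="a * L"]) auto
qed

lemma T_cong: "f \<in> weighted S V \<Longrightarrow> g \<in> weighted S V \<Longrightarrow> (\<And>y. y \<in> space S \<Longrightarrow> f y = g y) \<Longrightarrow> x \<in> space S \<Longrightarrow> T f x = T g x"
  using T_mono[of f g x] T_mono[of g f x] by force

lemma T_nonneg: "f \<in> weighted S V \<Longrightarrow> (\<And>y. y \<in> space S \<Longrightarrow> 0 \<le> f y) \<Longrightarrow> x \<in> space S \<Longrightarrow> 0 \<le> T f x"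
  using T_mono[of "\<lambda>_. 0" f x] T_const[of x 0] const_weighted[of 0] by simp

lemma T_pow_weighted: "f \<in> weighted S V \<Longrightarrow> (T ^^ n) f \<in> weighted S V"
  by (induction n) (auto intro: T_weighted)

lemma T_pow_lin: "f \<in> weighted S V \<Longrightarrow> g \<in> weighted S V \<Longrightarrow> x \<in> space S \<Longrightarrow>
    (T ^^ n) (\<lambda>y. p * f y + q * g y) x = p * (T ^^ n) f x + q * (T ^^ n) g x"
proof (induction n arbitrary: x)
  case (Suc n)
  have "(T ^^ Suc n) (\<lambda>y. p * f y + q * g y) x = T ((T ^^ n) (\<lambda>y. p * f y + q * g y)) x" by simp
  also have "\<dots> = T (\<lambda>y. p * (T ^^ n) f y + q * (T ^^ n) g y) x"
    using Suc by (intro T_cong T_pow_weighted weighted_lin) auto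
  also have "\<dots> = p * (T ^^ Suc n) f x + q * (T ^^ Suc n) g x"
    using Suc by (simp add: T_lin T_pow_weighted)
  finally show ?case .
qed simp

lemma T_pow_mono: "f \<in> weighted S V \<Longrightarrow> g \<in> weighted S V \<Longrightarrow> (\<And>y. y \<in> space S \<Longrightarrow> f y \<le> g y) \<Longrightarrow>
    x \<in> space S \<Longrightarrow> (T ^^ n) f x \<le> (T ^^ n) g x"
  by (induction n arbitrary: x) (auto intro!: T_mono T_pow_weighted)

lemma T_pow_one: "x \<in> space S \<Longrightarrow> (T ^^ n) (\<lambda>_. 1) x = 1"
proof (induction n arbitrary: x)
  case (Suc n)
  have "T ((T ^^ n) (\<lambda>_. 1)) x = T (\<lambda>_. 1) x"
    using Suc by (intro T_cong T_pow_weighted const_weighted) auto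
  then show ?case using Suc by (simp add: T_one)
qed simp

lemma markov_operator_pow:
  assumes "\<And>x. x \<in> space S \<Longrightarrow> (T ^^ n) V x \<le> L' * V x"
  shows "markov_operator S V (T ^^ n) L'"
  using assms
  by unfold_locales
    (auto simp: V_meas V_ge_1 T_pow_lin T_pow_one intro: T_pow_mono weighted_measurable[OF T_pow_weighted])

lemma T_pow_bound:
  assumes f: "f \<in> weighted S V" and a: "\<And>y. y \<in> space S \<Longrightarrow> \<bar>f y\<bar> \<le> a" and x: "x \<in> space S"
  shows "\<bar>(T ^^ n) f x\<bar> \<le> a"
  using a x
proof (induction n arbitrary: x)
  case (Suc n)
  have "\<bar>T ((T ^^ n) f) x\<bar> \<le> T (\<lambda>_. a) x"
    using Suc f by (intro T_abs_le T_pow_weighted const_weighted) auto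
  then show ?case using T_const[OF Suc.prems(2)] by simp
qed auto

end

lemma markov_operator_average:
  assumes "finite I" "I \<noteq> {}" and T: "\<And>i. i \<in> I \<Longrightarrow> markov_operator S V (T i) L"
  shows "markov_operator S V (\<lambda>f x. (\<Sum>i\<in>I. T i f x) / real (card I)) L"
proof -
  obtain i0 where "i0 \<in> I" using assms by auto
  then interpret t0: markov_operator S V "T i0" L by (rule T)
  have card: "real (card I) > 0" using assms by (simp add: card_gt_0_iff)
  show ?thesis
  proof
    show "f \<in> weighted S V \<Longrightarrow> (\<lambda>x. (\<Sum>i\<in>I. T i f x) / real (card I)) \<in> borel_measurable S" for f
      using markov_operator.T_meas[OF T] by auto
    fix f g p q x assume fg: "f \<in> weighted S V" "g \<in> weighted S V" "x \<in> space S"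
    show "(\<Sum>i\<in>I. T i (\<lambda>y. p * f y + q * g y) x) / real (card I) =
       p * ((\<Sum>i\<in>I. T i f x) / real (card I)) + q * ((\<Sum>i\<in>I. T i g x) / real (card I))"
      using fg by (simp add: markov_operator.T_lin[OF T] sum.distrib sum_distrib_left[symmetric] add_divide_distrib)
  next
    fix f g x assume fg: "f \<in> weighted S V" "g \<in> weighted S V" "\<And>y. y \<in> space S \<Longrightarrow> f y \<le> g y" "x \<in> space S"
    show "(\<Sum>i\<in>I. T i f x) / real (card I) \<le> (\<Sum>i\<in>I. T i g x) / real (card I)"
      using fg by (intro divide_right_mono sum_mono markov_operator.T_mono[OF T]) auto
  next
    fix x assume x: "x \<in> space S"
    show "(\<Sum>i\<in>I. T i (\<lambda>_. 1) x) / real (card I) = 1"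
      using x card by (simp add: markov_operator.T_one[OF T])
    have "(\<Sum>i\<in>I. T i V x) \<le> (\<Sum>i\<in>I. L * V x)"
      using x by (intro sum_mono markov_operator.T_V[OF T]) auto
    then show "(\<Sum>i\<in>I. T i V x) / real (card I) \<le> L * V x"
      using card by (simp add: field_simps)
  qed (auto simp: t0.V_meas t0.V_ge_1)
qed

section \<open>Harris contraction\<close>

text \<open>A function whose oscillation is bounded by \<open>g x + g y\<close> differs from a constant by at most \<open>g\<close>: the
infimum of \<open>f + g\<close> lies above every value of \<open>f - g\<close>.\<close>

lemma center_oscillation:
  fixes f V :: "'b \<Rightarrow> real"
  assumes "X \<noteq> {}" and osc: "\<And>x y. x \<in> X \<Longrightarrow> y \<in> X \<Longrightarrow> \<bar>f x - f y\<bar> \<le> g x + g y"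
  obtains c where "\<And>x. x \<in> X \<Longrightarrow> \<bar>f x - c\<bar> \<le> g x"
proof
  let ?c = "INF x\<in>X. f x + g x"
  obtain x0 where x0: "x0 \<in> X" using assms by auto
  have lb: "f y - g y \<le> f x + g x" if "x \<in> X" "y \<in> X" for x y
    using osc[OF that] by linarith
  have bdd: "bdd_below ((\<lambda>x. f x + g x) ` X)"
    using lb[OF _ x0] by (intro bdd_belowI[where m="f x0 - g x0"]) auto
  fix x assume x: "x \<in> X"
  have "?c \<le> f x + g x" by (rule cINF_lower[OF bdd x])
  moreover have "f x - g x \<le> ?c" using assms lb x by (intro cINF_greatest) auto
  ultimately show "\<bar>f x - ?c\<bar> \<le> g x" by linarith
qed

context markov_operator
begin

text \<open>After centring, \<open>f\<close> is dominated by \<open>a (1 + \<beta> V)\<close>.  If \<open>V x + V y \<ge> R\<close>, the drift alone gains the factor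
\<open>\<gamma>\<close>.  Otherwise both points lie where \<open>T\<close> dominates \<open>e ph\<close>; this common part cancels in the difference
and removes \<open>2 e\<close> from the constant term, which outweighs the loss \<open>2 \<beta> k\<close> from the drift.\<close>

lemma harris_contraction:
  assumes gk: "0 \<le> g" "0 \<le> k" and drift: "\<And>x. x \<in> space S \<Longrightarrow> T V x \<le> g * V x + k"
    and e: "0 < e" "e \<le> 1" and \<beta>: "0 < \<beta>" "2 * \<beta> * k \<le> e"
    and \<gamma>: "1 - e / 2 \<le> \<gamma>" "g \<le> \<gamma>" "\<kappa> \<le> \<gamma>" "\<gamma> \<le> 1" "2 + \<beta> * (\<kappa> * R) \<le> \<gamma> * (2 + \<beta> * R)" "g * R + 2 * k \<le> \<kappa> * R"
    and \<kappa>: "g \<le> \<kappa>"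
    and ph: "\<And>f h p q. f \<in> weighted S V \<Longrightarrow> h \<in> weighted S V \<Longrightarrow> ph (\<lambda>x. p * f x + q * h x) = p * ph f + q * ph h" "ph (\<lambda>_. 1) = 1"
       "\<And>f. f \<in> weighted S V \<Longrightarrow> (\<And>x. x \<in> space S \<Longrightarrow> 0 \<le> f x) \<Longrightarrow> 0 \<le> ph f"
    and minor: "\<And>f x. f \<in> weighted S V \<Longrightarrow> (\<And>x. x \<in> space S \<Longrightarrow> 0 \<le> f x) \<Longrightarrow> x \<in> space S \<Longrightarrow> V x \<le> R \<Longrightarrow> e * ph f \<le> T f x"
    and f: "f \<in> weighted S V" and a: "0 \<le> a"
    and osc: "\<And>x y. x \<in> space S \<Longrightarrow> y \<in> space S \<Longrightarrow> \<bar>f x - f y\<bar> \<le> a * (2 + \<beta> * (V x + V y))"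
    and x: "x \<in> space S" and y: "y \<in> space S"
  shows "\<bar>T f x - T f y\<bar> \<le> \<gamma> * a * (2 + \<beta> * (V x + V y))"
proof -
  obtain c where c: "\<And>x. x \<in> space S \<Longrightarrow> \<bar>f x - c\<bar> \<le> a * (1 + \<beta> * V x)"
    using osc x by (rule_tac center_oscillation[of "space S" f "\<lambda>x. a * (1 + \<beta> * V x)"]) (auto simp: algebra_simps)
  define h where "h = (\<lambda>x. f x - c)"
  define G where "G = (\<lambda>x. a * (1 + \<beta> * V x))"
  have h: "h \<in> weighted S V" unfolding h_def by (intro weighted_diff f const_weighted)
  have G_eq: "G = (\<lambda>x. a * 1 + (a * \<beta>) * V x)" by (auto simp: G_def algebra_simps)
  have G: "G \<in> weighted S V" unfolding G_eq by (intro weighted_lin V_weighted const_weighted)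
  have hG: "\<bar>h z\<bar> \<le> G z" if "z \<in> space S" for z using c[OF that] by (simp add: h_def G_def)
  have Th: "T f x - T f y = T h x - T h y"
    unfolding h_def using x y f by (simp add: T_diff const_weighted T_const)
  have TG: "T G z \<le> a * (1 + \<beta> * (g * V z + k))" if "z \<in> space S" for z
  proof -
    have "T G z = a * T (\<lambda>_. 1) z + (a * \<beta>) * T V z" unfolding G_eq by (intro T_lin const_weighted V_weighted that)
    also have "\<dots> \<le> a * 1 + (a * \<beta>) * (g * V z + k)"
      using T_one[OF that] drift[OF that] a \<beta> by (intro add_mono mult_left_mono) auto
    finally show ?thesis by (simp add: algebra_simps)
  qed
  define s where "s = V x + V y"
  have V1: "1 \<le> V x" "1 \<le> V y" using V_ge_1 x y by auto
  then have s: "2 \<le> s" by (simp add: s_def)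
  show ?thesis
  proof (cases "V x \<le> R \<and> V y \<le> R \<and> s \<le> R")
    case True
    have *: "\<bar>T h z - e * ph h\<bar> \<le> T G z - e * ph G" if z: "z \<in> space S" "V z \<le> R" for z
    proof -
      have "e * ph (\<lambda>x. 1 * G x + p * h x) \<le> T (\<lambda>x. 1 * G x + p * h x) z" if "p = 1 \<or> p = -1" for p
      proof (intro minor weighted_lin G h z)
        show "0 \<le> 1 * G y + p * h y" if "y \<in> space S" for y
          using hG[OF that] \<open>p = 1 \<or> p = -1\<close> by (auto simp: abs_le_iff)
      qed
      from this[of 1] this[of "-1"] show ?thesis
        unfolding T_lin[OF G h z(1)] ph(1)[OF G h] by (simp add: algebra_simps abs_le_iff)
    qed
    have phG: "a \<le> ph G"
    proof -
      have "0 \<le> a * (\<beta> * V x)" if "x \<in> space S" for x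
        using V_ge_1[OF that] a \<beta> by auto
      then have "0 \<le> ph (\<lambda>x. 1 * G x + (- a) * 1)"
        by (intro ph weighted_lin G const_weighted) (auto simp: G_def algebra_simps)
      then show ?thesis unfolding ph(1)[OF G const_weighted] ph(2) by simp
    qed
    have "\<bar>T h x - T h y\<bar> \<le> (T G x - e * ph G) + (T G y - e * ph G)"
      using *[OF x] *[OF y] True by linarith
    also have "\<dots> \<le> a * (1 + \<beta> * (g * V x + k)) + a * (1 + \<beta> * (g * V y + k)) - 2 * (e * a)"
      using TG[OF x] TG[OF y] mult_left_mono[OF phG, of e] e by linarith
    also have "\<dots> = a * (2 - 2 * e + 2 * \<beta> * k + \<beta> * (g * s))" by (simp add: s_def algebra_simps)
    also have "\<dots> \<le> a * (\<gamma> * (2 + \<beta> * s))"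
    proof (intro mult_left_mono a)
      have "\<beta> * (g * s) \<le> \<beta> * (\<gamma> * s)" using \<beta> \<gamma> s by (intro mult_left_mono mult_right_mono) auto
      moreover have "2 - 2 * e + 2 * \<beta> * k \<le> \<gamma> * 2" using \<beta> \<gamma> e by simp
      ultimately show "2 - 2 * e + 2 * \<beta> * k + \<beta> * (g * s) \<le> \<gamma> * (2 + \<beta> * s)" by (simp add: algebra_simps)
    qed
    finally show ?thesis by (simp add: Th s_def algebra_simps)
  next
    case False
    then have sR: "R \<le> s" using V1 by (auto simp: s_def)
    have "\<bar>T h x - T h y\<bar> \<le> T G x + T G y"
      using T_abs_le[OF h G hG x] T_abs_le[OF h G hG y] by linarith
    also have "\<dots> \<le> a * (1 + \<beta> * (g * V x + k)) + a * (1 + \<beta> * (g * V y + k))"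
      using TG[OF x] TG[OF y] by linarith
    also have "\<dots> = a * (2 + \<beta> * (g * s + 2 * k))" by (simp add: s_def algebra_simps)
    also have "\<dots> \<le> a * (\<gamma> * (2 + \<beta> * s))"
    proof (intro mult_left_mono a)
      have "g * (s - R) \<le> \<kappa> * (s - R)" using sR \<kappa> by (intro mult_right_mono) auto
      then have "g * s + 2 * k \<le> \<kappa> * s" using \<gamma> by (simp add: algebra_simps)
      then have "\<beta> * (g * s + 2 * k) \<le> \<beta> * (\<kappa> * s)" using \<beta> by (intro mult_left_mono) auto
      moreover have "0 \<le> \<beta> * ((\<gamma> - \<kappa>) * (s - R))" using \<beta> \<gamma> sR by simp
      ultimately show "2 + \<beta> * (g * s + 2 * k) \<le> \<gamma> * (2 + \<beta> * s)" using \<gamma>(5) by (simp add: algebra_simps)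
    qed
    finally show ?thesis by (simp add: Th s_def algebra_simps)
  qed
qed

end

section \<open>Minorization of averaged powers\<close>

text \<open>\<open>avg_op\<close> is the operator \<open>Q\<close> and \<open>potential_op\<close> the operator \<open>R\<close> with \<open>I - Q = (I - T) R\<close>.\<close>

definition avg_op :: "(('b \<Rightarrow> real) \<Rightarrow> ('b \<Rightarrow> real)) \<Rightarrow> nat \<Rightarrow> nat \<Rightarrow> ('b \<Rightarrow> real) \<Rightarrow> 'b \<Rightarrow> real" where
  "avg_op T n N f x = (\<Sum>j\<in>{..n}. (T ^^ (j + N)) f x) / real (card {..n})"

definition potential_op :: "(('b \<Rightarrow> real) \<Rightarrow> ('b \<Rightarrow> real)) \<Rightarrow> nat \<Rightarrow> nat \<Rightarrow> ('b \<Rightarrow> real) \<Rightarrow> 'b \<Rightarrow> real" where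
  "potential_op T n N f x = (\<Sum>j\<in>{..n}. \<Sum>i<j+N. (T ^^ i) f x) / real (card {..n})"

lemma geometric_limit:
  fixes x :: "nat \<Rightarrow> real"
  assumes \<gamma>: "0 \<le> \<gamma>" "\<gamma> < 1" and step: "\<And>m. \<bar>x (Suc m) - x m\<bar> \<le> K * \<gamma> ^ m"
  obtains c where "x \<longlonglongrightarrow> c" "\<And>m. \<bar>x m - c\<bar> \<le> K * \<gamma> ^ m / (1 - \<gamma>)"
proof -
  have dist: "\<bar>x (m + j) - x m\<bar> \<le> K * \<gamma> ^ m * (1 - \<gamma> ^ j) / (1 - \<gamma>)" for m j
  proof (induction j)
    case (Suc j)
    have "\<bar>x (m + Suc j) - x m\<bar> \<le> \<bar>x (Suc (m + j)) - x (m + j)\<bar> + \<bar>x (m + j) - x m\<bar>" by simp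
    also have "\<dots> \<le> K * \<gamma> ^ (m + j) + K * \<gamma> ^ m * (1 - \<gamma> ^ j) / (1 - \<gamma>)"
      by (intro add_mono step Suc)
    also have "\<dots> = K * \<gamma> ^ m * (1 - \<gamma> ^ Suc j) / (1 - \<gamma>)"
      using \<gamma> by (simp add: field_simps power_add)
    finally show ?case .
  qed simp
  have "0 \<le> K" using order_trans[OF abs_ge_zero step[of 0]] by simp
  have le: "\<bar>x (m + j) - x m\<bar> \<le> K * \<gamma> ^ m / (1 - \<gamma>)" for m j
  proof (rule order_trans[OF dist], intro divide_right_mono)
    show "K * \<gamma> ^ m * (1 - \<gamma> ^ j) \<le> K * \<gamma> ^ m"
      using \<gamma> \<open>0 \<le> K\<close> by (intro mult_left_le) auto
  qed (use \<gamma> in simp)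
  have "(\<lambda>m. K * \<gamma> ^ m / (1 - \<gamma>)) \<longlonglongrightarrow> K * 0 / (1 - \<gamma>)"
    using \<gamma> by (intro tendsto_intros LIMSEQ_power_zero) auto
  then have lim0: "(\<lambda>m. K * \<gamma> ^ m / (1 - \<gamma>)) \<longlonglongrightarrow> 0" by simp
  have "Cauchy x"
  proof (rule CauchyI)
    fix e :: real assume "0 < e"
    then obtain m0 where m0: "\<bar>K * \<gamma> ^ m0 / (1 - \<gamma>)\<bar> < e / 2"
      using lim0[THEN LIMSEQ_D, of "e/2"] by auto
    have "\<bar>x m - x n\<bar> < e" if "m0 \<le> m" "m0 \<le> n" for m n
    proof -
      have "\<bar>x k - x m0\<bar> < e / 2" if "m0 \<le> k" for k
        using order_le_less_trans[OF le[of m0 "k - m0"] order_le_less_trans[OF abs_ge_self m0]] that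
        by (simp only: le_add_diff_inverse)
      from this[OF that(1)] this[OF that(2)]
      show ?thesis by linarith
    qed
    then show "\<exists>M. \<forall>m\<ge>M. \<forall>n\<ge>M. norm (x m - x n) < e" by auto
  qed
  then obtain c where c: "x \<longlonglongrightarrow> c" using Cauchy_convergent_iff convergent_def by blast
  show ?thesis
  proof (rule that[OF c])
    fix m
    have "(\<lambda>j. \<bar>x m - x (j + m)\<bar>) \<longlonglongrightarrow> \<bar>x m - c\<bar>"
      by (intro tendsto_intros LIMSEQ_ignore_initial_segment c)
    then show "\<bar>x m - c\<bar> \<le> K * \<gamma> ^ m / (1 - \<gamma>)"
      by (rule LIMSEQ_le_const2) (use le[of m] in \<open>auto simp: abs_minus_commute add.commute\<close>)
  qed
qed

locale drift_operator = markov_operator S V T "lam + b"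
  for S :: "'b measure" and V T lam b +
  fixes eps :: real and N :: nat and W0 :: "'b set" and ph :: "('b \<Rightarrow> real) \<Rightarrow> real"
  assumes lam: "0 \<le> lam" "lam < 1" and b: "0 \<le> b" and eps: "0 < eps" and N: "0 < N"
    and drift: "\<And>x. x \<in> space S \<Longrightarrow> T V x \<le> lam * V x + b * indicator W0 x"
    and ph_lin: "\<And>f h p q. f \<in> weighted S V \<Longrightarrow> h \<in> weighted S V \<Longrightarrow> ph (\<lambda>x. p * f x + q * h x) = p * ph f + q * ph h"
    and ph_one: "ph (\<lambda>_. 1) = 1"
    and ph_nonneg: "\<And>f. f \<in> weighted S V \<Longrightarrow> (\<And>x. x \<in> space S \<Longrightarrow> 0 \<le> f x) \<Longrightarrow> 0 \<le> ph f"
    and minor: "\<And>f x. f \<in> weighted S V \<Longrightarrow> (\<And>x. x \<in> space S \<Longrightarrow> 0 \<le> f x) \<Longrightarrow> x \<in> space S \<Longrightarrow> x \<in> W0 \<Longrightarrow>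
        eps * ph f \<le> (T ^^ N) f x"
begin

lemma pow_drift_exact: "x \<in> space S \<Longrightarrow> (T ^^ i) V x \<le> lam ^ i * V x + b * (1 - lam ^ i) / (1 - lam)"
proof (induction i arbitrary: x)
  case (Suc i)
  have "(T ^^ Suc i) V x \<le> T (\<lambda>y. lam ^ i * V y + (b * (1 - lam ^ i) / (1 - lam)) * 1) x"
    using Suc weighted_lin[OF V_weighted const_weighted, of "lam ^ i" "b * (1 - lam ^ i) / (1 - lam)" 1]
    by (auto intro!: T_mono T_pow_weighted V_weighted)
  also have "\<dots> = lam ^ i * T V x + (b * (1 - lam ^ i) / (1 - lam)) * 1"
    using Suc.prems by (simp only: T_lin[OF V_weighted const_weighted] T_one)
  also have "\<dots> \<le> lam ^ i * (lam * V x + b) + b * (1 - lam ^ i) / (1 - lam)"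
  proof -
    have "T V x \<le> lam * V x + b"
      using drift[OF Suc.prems] b by (cases "x \<in> W0") auto
    then show ?thesis using lam by (simp add: mult_left_mono)
  qed
  also have "\<dots> = lam ^ Suc i * V x + b * (1 - lam ^ Suc i) / (1 - lam)"
    using lam by (simp add: field_simps)
  finally show ?case .
qed simp

lemma pow_drift: "x \<in> space S \<Longrightarrow> (T ^^ i) V x \<le> lam ^ i * V x + b / (1 - lam)"
proof (rule order_trans[OF pow_drift_exact], assumption, intro add_left_mono divide_right_mono)
  show "b * (1 - lam ^ i) \<le> b" using lam b by (intro mult_left_le) auto
qed (use lam in simp)

lemma pow_V_bound: "x \<in> space S \<Longrightarrow> (T ^^ i) V x \<le> (1 + b / (1 - lam)) * V x"
proof -
  assume x: "x \<in> space S"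
  have "lam ^ i * V x \<le> 1 * V x" using lam V_ge_1[OF x] by (intro mult_right_mono power_le_one) auto
  moreover have "b / (1 - lam) * 1 \<le> b / (1 - lam) * V x"
    using lam b V_ge_1[OF x] by (intro mult_left_mono) auto
  ultimately show ?thesis using pow_drift[OF x, of i] by (simp add: algebra_simps)
qed

lemma markov_pow: "markov_operator S V (T ^^ i) (1 + b / (1 - lam))"
  by (rule markov_operator_pow) (rule pow_V_bound)

lemma markov_avg_op: "markov_operator S V (avg_op T n N) (1 + b / (1 - lam))"
  unfolding avg_op_def[abs_def] by (rule markov_operator_average) (auto intro: markov_pow)

lemma avg_op_drift: assumes x: "x \<in> space S" shows "avg_op T n N V x \<le> lam * V x + b / (1 - lam)"
proof -
  have "(T ^^ (j + N)) V x \<le> lam * V x + b / (1 - lam)" for j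
  proof -
    have "lam ^ (j + N) \<le> lam ^ 1" using lam N by (intro power_decreasing) auto
    then have "lam ^ (j + N) * V x \<le> lam * V x" using V_ge_1[OF x] by (intro mult_right_mono) auto
    then show ?thesis using pow_drift[OF x, of "j + N"] by linarith
  qed
  then have "(\<Sum>j\<in>{..n}. (T ^^ (j + N)) V x) \<le> real (card {..n}) * (lam * V x + b / (1 - lam))"
    by (intro sum_bounded_above) auto
  then show ?thesis unfolding avg_op_def by (simp add: divide_le_eq mult.commute)
qed

text \<open>\<open>1 - lam ^ n * V x\<close> is a lower bound for the probability of meeting \<open>W0\<close> within \<open>n\<close> steps, and from
\<open>W0\<close> the next \<open>N\<close> steps contribute \<open>eps * ph f\<close>.  The induction on \<open>n\<close> conditions on the first step and
uses that \<open>V\<close> contracts by \<open>lam\<close> outside \<open>W0\<close>.\<close>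

lemma hitting_minorization:
  assumes f: "f \<in> weighted S V" "\<And>x. x \<in> space S \<Longrightarrow> 0 \<le> f x" and x: "x \<in> space S"
  shows "eps * ph f * (1 - lam ^ n * V x) \<le> (\<Sum>j\<in>{..n}. (T ^^ (j + N)) f x)"
  using x
proof (induction n arbitrary: x)
  have g0: "0 \<le> (T ^^ j) f x" if "x \<in> space S" for x j
    using that by (induction j arbitrary: x) (auto intro!: T_nonneg T_pow_weighted f)
  have a: "0 \<le> eps * ph f" using eps ph_nonneg[OF f] by simp
  {
    case 0
    have "eps * ph f * (1 - V x) \<le> (T ^^ N) f x"
    proof (cases "x \<in> W0")
      case True
      have "eps * ph f * (1 - V x) \<le> eps * ph f * 1"
        using a V_ge_1[OF 0] by (intro mult_left_mono) auto
      then show ?thesis using minor[OF f 0 True] by simp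
    next
      case False
      have "eps * ph f * (1 - V x) \<le> 0" using a V_ge_1[OF 0] by (simp add: mult_nonneg_nonpos)
      then show ?thesis using g0[OF 0, of N] by simp
    qed
    then show ?case by simp
  next
    case (Suc n)
    have sum: "(\<Sum>j\<in>{..Suc n}. (T ^^ (j + N)) f x) = (T ^^ N) f x + (\<Sum>j\<in>{..n}. T ((T ^^ (j + N)) f) x)"
      by (simp add: sum.atMost_Suc_shift del: sum.atMost_Suc)
    show ?case
    proof (cases "x \<in> W0")
      case True
      have "eps * ph f * (1 - lam ^ Suc n * V x) \<le> eps * ph f * 1"
        using a V_ge_1[OF Suc.prems] lam by (intro mult_left_mono) auto
      moreover have "0 \<le> (\<Sum>j\<in>{..n}. T ((T ^^ (j + N)) f) x)"
        using g0[OF Suc.prems, of "Suc _"] by (intro sum_nonneg) auto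
      ultimately show ?thesis using minor[OF f Suc.prems True] unfolding sum by simp
    next
      case False
      have "T V x \<le> lam * V x" using drift[OF Suc.prems] False by simp
      then have "eps * ph f * (lam ^ n * T V x) \<le> eps * ph f * (lam ^ n * (lam * V x))"
        using a lam by (intro mult_left_mono) auto
      then have "eps * ph f * (1 - lam ^ Suc n * V x) \<le> (eps * ph f) * 1 + (- (eps * ph f * lam ^ n)) * T V x"
        by (simp add: algebra_simps)
      also have "\<dots> = T (\<lambda>y. (eps * ph f) * 1 + (- (eps * ph f * lam ^ n)) * V y) x"
        using Suc.prems by (simp only: T_lin[OF const_weighted V_weighted] T_one)
      also have "\<dots> \<le> T (\<lambda>y. \<Sum>j\<in>{..n}. (T ^^ (j + N)) f y) x"
        using Suc by (intro T_mono weighted_lin const_weighted V_weighted sum_weighted T_pow_weighted f) (auto simp: algebra_simps)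
      also have "\<dots> = (\<Sum>j\<in>{..n}. T ((T ^^ (j + N)) f) x)"
        using Suc.prems by (intro T_sum T_pow_weighted f) auto
      finally show ?thesis unfolding sum using g0[OF Suc.prems, of N] by simp
    qed
  }
qed

lemma avg_op_minor:
  assumes f: "f \<in> weighted S V" "\<And>x. x \<in> space S \<Longrightarrow> 0 \<le> f x" and x: "x \<in> space S"
    and R: "V x \<le> R" "lam ^ n * R \<le> 1 / 2"
  shows "min eps 1 / (2 * real (n + 1)) * ph f \<le> avg_op T n N f x"
proof -
  have ph: "0 \<le> ph f" by (rule ph_nonneg[OF f])
  have "lam ^ n * V x \<le> 1 / 2" using mult_left_mono[OF R(1), of "lam ^ n"] R(2) lam by simp
  then have "eps * ph f * (1 / 2) \<le> eps * ph f * (1 - lam ^ n * V x)"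
    using eps ph by (intro mult_left_mono) auto
  then have 1: "eps * ph f * (1 / 2) \<le> (\<Sum>j\<in>{..n}. (T ^^ (j + N)) f x)"
    using hitting_minorization[OF f x, of n] by linarith
  have "min eps 1 * ph f \<le> eps * ph f" using ph by (intro mult_right_mono) auto
  then have "min eps 1 * ph f / 2 / real (n + 1) \<le> (\<Sum>j\<in>{..n}. (T ^^ (j + N)) f x) / real (n + 1)"
    using 1 by (intro divide_right_mono) auto
  then show ?thesis by (simp add: avg_op_def field_simps)
qed

end

text \<open>The level \<open>R\<close> is chosen from the drift of the averages, which is the same for every averaging length;
only then is the length \<open>n\<close> chosen large enough for the minorization on \<open>{V \<le> R}\<close>.  All constants
depend on \<open>lam\<close>, \<open>b\<close> and \<open>eps\<close> alone, which later makes them uniform in the parameter of a family.\<close>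

lemma harris_constants:
  fixes lam b eps :: real
  assumes lam: "0 \<le> lam" "lam < 1" and b: "0 \<le> b" and eps: "0 < eps"
  obtains n C \<gamma> where "0 < C" "0 \<le> \<gamma>" "\<gamma> < 1"
    "\<And>S V T N W0 ph f a m x y. drift_operator S V T lam b eps N W0 ph \<Longrightarrow> f \<in> borel_measurable S \<Longrightarrow>
       (\<And>x. x \<in> space S \<Longrightarrow> \<bar>f x\<bar> \<le> a * V x) \<Longrightarrow> x \<in> space S \<Longrightarrow> y \<in> space S \<Longrightarrow>
       \<bar>(avg_op T n N ^^ m) f x - (avg_op T n N ^^ m) f y\<bar> \<le> C * \<gamma> ^ m * a * (V x + V y)"
proof -
  define k where "k = b / (1 - lam)"
  define R where "R = 2 * k / (1 - lam) + 1"
  define g1 where "g1 = lam + 2 * k / R"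
  have k: "0 \<le> k" using lam b by (simp add: k_def)
  have R: "1 \<le> R" using k lam by (simp add: R_def)
  have "R * (1 - lam) = 2 * k + (1 - lam)" using lam by (simp add: R_def distrib_right)
  then have "2 * k < R * (1 - lam)" using lam by simp
  then have g1: "g1 < 1" "lam \<le> g1" using R k by (auto simp: g1_def field_simps)
  have "(\<lambda>n. lam ^ n * R) \<longlonglongrightarrow> 0 * R" using lam by (intro tendsto_intros LIMSEQ_power_zero) auto
  then have "\<forall>\<^sub>F n in sequentially. lam ^ n * R < 1 / 2" by (rule order_tendstoD) simp
  then obtain n where n: "lam ^ n * R \<le> 1 / 2" by (auto simp: eventually_sequentially intro: less_imp_le)
  \<comment> \<open>The minimum keeps the minorization constant at most 1.\<close>
  define e where "e = min eps 1 / (2 * real (n + 1))"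
  have e: "0 < e" "e \<le> 1" using eps by (auto simp: e_def field_simps min_def)
  \<comment> \<open>Small enough for \<open>2 \<beta> k \<le> e\<close>: the drift may cost at most half of the gain \<open>2 e\<close>.\<close>
  define \<beta> where "\<beta> = e / (2 * (k + 1))"
  have \<beta>: "0 < \<beta>" "2 * \<beta> * k \<le> e" using e k by (auto simp: \<beta>_def field_simps)
  define \<gamma> where "\<gamma> = max (1 - e / 2) ((2 + \<beta> * (g1 * R)) / (2 + \<beta> * R))"
  have pos: "0 < 2 + \<beta> * R" using \<beta> R by (intro add_pos_nonneg) auto
  have g1': "g1 \<le> (2 + \<beta> * (g1 * R)) / (2 + \<beta> * R)" using pos g1 by (simp add: field_simps)
  have "\<beta> * (g1 * R) < \<beta> * R" using g1 \<beta> R by simp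
  then have \<gamma>1: "\<gamma> < 1" using pos e by (simp add: \<gamma>_def)
  have \<gamma>2: "(2 + \<beta> * (g1 * R)) / (2 + \<beta> * R) \<le> \<gamma>" by (simp add: \<gamma>_def)
  then have \<gamma>3: "2 + \<beta> * (g1 * R) \<le> \<gamma> * (2 + \<beta> * R)" using pos by (simp add: divide_le_eq)
  have \<gamma>0: "0 \<le> \<gamma>" using e by (simp add: \<gamma>_def)
  have gR: "lam * R + 2 * k \<le> g1 * R" using R by (simp add: g1_def field_simps)
  show ?thesis
  proof (rule that[of "1 / \<beta> + 1" \<gamma> n])
    fix S :: "'c measure" and V T N W0 ph f a m x y
    assume D: "drift_operator S V T lam b eps N W0 ph" and f: "f \<in> borel_measurable S"
      and fa: "\<And>x. x \<in> space S \<Longrightarrow> \<bar>f x\<bar> \<le> a * V x" and x: "x \<in> space S" and y: "y \<in> space S"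
    interpret drift_operator S V T lam b eps N W0 ph by (rule D)
    interpret q: markov_operator S V "avg_op T n N" "1 + b / (1 - lam)" by (rule markov_avg_op)
    have fV: "f \<in> weighted S V" by (rule weightedI[OF f fa])
    have "0 \<le> a * V x" using fa[OF x] by linarith
    then have a: "0 \<le> a" using V_ge_1[OF x] by (simp add: zero_le_mult_iff)
    have "\<bar>(avg_op T n N ^^ m) f x - (avg_op T n N ^^ m) f y\<bar> \<le> \<gamma> ^ m * (a / \<beta>) * (2 + \<beta> * (V x + V y))"
      using x y
    proof (induction m arbitrary: x y)
      case 0
      have "\<bar>f x - f y\<bar> \<le> a * (V x + V y)" using fa[OF 0(1)] fa[OF 0(2)] by (simp add: algebra_simps)
      also have "\<dots> \<le> (a / \<beta>) * (2 + \<beta> * (V x + V y))" using a \<beta> by (simp add: field_simps)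
      finally show ?case by simp
    next
      case (Suc m)
      have "\<bar>avg_op T n N ((avg_op T n N ^^ m) f) x - avg_op T n N ((avg_op T n N ^^ m) f) y\<bar>
          \<le> \<gamma> * (\<gamma> ^ m * (a / \<beta>)) * (2 + \<beta> * (V x + V y))"
        by (rule q.harris_contraction[where g=lam and k=k and e=e and \<kappa>=g1 and R=R and ph=ph])
          (use Suc avg_op_drift[of _ n] avg_op_minor[OF _ _ _ _ n, folded e_def] ph_lin ph_one ph_nonneg
             lam k e \<beta> g1 \<gamma>0 \<gamma>1 \<gamma>2 \<gamma>3 g1' gR a q.T_pow_weighted[OF fV] in
            \<open>auto simp: k_def \<gamma>_def intro: order_trans\<close>)
      then show ?case by (simp add: mult.assoc)
    qed
    also have "\<dots> \<le> (1 / \<beta> + 1) * \<gamma> ^ m * a * (V x + V y)"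
    proof -
      have "2 \<le> V x + V y" using V_ge_1[OF x] V_ge_1[OF y] by simp
      then have "2 + \<beta> * (V x + V y) \<le> \<beta> * (1 / \<beta> + 1) * (V x + V y)" using \<beta> by (simp add: algebra_simps)
      then have "\<gamma> ^ m * (a / \<beta>) * (2 + \<beta> * (V x + V y)) \<le> \<gamma> ^ m * (a / \<beta>) * (\<beta> * (1 / \<beta> + 1) * (V x + V y))"
        using \<gamma>0 a \<beta> by (intro mult_left_mono) auto
      also have "\<gamma> ^ m * (a / \<beta>) * (\<beta> * (1 / \<beta> + 1) * (V x + V y)) = (1 / \<beta> + 1) * \<gamma> ^ m * a * (V x + V y)"
        using \<beta> by simp
      finally show ?thesis .
    qed
    finally show "\<bar>(avg_op T n N ^^ m) f x - (avg_op T n N ^^ m) f y\<bar> \<le> (1 / \<beta> + 1) * \<gamma> ^ m * a * (V x + V y)" .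
  qed (use \<beta> \<gamma>0 \<gamma>1 in \<open>auto intro: add_pos_pos\<close>)
qed

section \<open>The Poisson equation of a contracting operator\<close>

definition avg_limit :: "(('b \<Rightarrow> real) \<Rightarrow> ('b \<Rightarrow> real)) \<Rightarrow> nat \<Rightarrow> nat \<Rightarrow> 'b \<Rightarrow> ('b \<Rightarrow> real) \<Rightarrow> real" where
  "avg_limit T n N x0 f = lim (\<lambda>m. (avg_op T n N ^^ m) f x0)"

definition poisson_sol :: "(('b \<Rightarrow> real) \<Rightarrow> ('b \<Rightarrow> real)) \<Rightarrow> nat \<Rightarrow> nat \<Rightarrow> 'b \<Rightarrow> ('b \<Rightarrow> real) \<Rightarrow> 'b \<Rightarrow> real" where
  "poisson_sol T n N x0 f = potential_op T n N (\<lambda>x. \<Sum>m. (avg_op T n N ^^ m) f x - avg_limit T n N x0 f)"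

text \<open>The conclusion of Harris' theorem as a hypothesis.  One constant \<open>L\<close> bounds all powers on \<open>V\<close>, so that
sums of powers have explicit bounds.\<close>

locale contracting_operator = markov_operator S V T L
  for S :: "'b measure" and V T L +
  fixes n N :: nat and C \<gamma> :: real and x0 :: 'b
  assumes x0: "x0 \<in> space S" and C: "0 < C" and \<gamma>: "0 \<le> \<gamma>" "\<gamma> < 1"
    and pow_V: "\<And>i x. x \<in> space S \<Longrightarrow> (T ^^ i) V x \<le> L * V x"
    and contr: "\<And>f a m x y. f \<in> borel_measurable S \<Longrightarrow> (\<And>x. x \<in> space S \<Longrightarrow> \<bar>f x\<bar> \<le> a * V x) \<Longrightarrow>
       x \<in> space S \<Longrightarrow> y \<in> space S \<Longrightarrow>
       \<bar>(avg_op T n N ^^ m) f x - (avg_op T n N ^^ m) f y\<bar> \<le> C * \<gamma> ^ m * a * (V x + V y)"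
begin

abbreviation "Q \<equiv> avg_op T n N"
abbreviation "R \<equiv> potential_op T n N"

lemma L_pos: "0 < L"
proof -
  have "1 = T (\<lambda>_. 1) x0" using T_one x0 by simp
  also have "\<dots> \<le> T V x0" using V_ge_1 x0 by (intro T_mono const_weighted V_weighted) auto
  also have "\<dots> \<le> L * V x0" by (rule T_V[OF x0])
  finally show ?thesis using V_ge_1[OF x0] by (smt (verit) mult_nonpos_nonneg)
qed

lemma markov_pow: "markov_operator S V (T ^^ i) L"
  by (rule markov_operator_pow) (rule pow_V)

lemma markov_Q: "markov_operator S V Q L"
  unfolding avg_op_def[abs_def] by (rule markov_operator_average) (auto intro: markov_pow)

sublocale q: markov_operator S V Q L by (rule markov_Q)

lemma pow_bound: "f \<in> borel_measurable S \<Longrightarrow> (\<And>y. y \<in> space S \<Longrightarrow> \<bar>f y\<bar> \<le> a * V y) \<Longrightarrow> x \<in> space S \<Longrightarrow>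
    \<bar>(T ^^ i) f x\<bar> \<le> a * L * V x"
  by (rule markov_operator.T_bound[OF markov_pow])

lemma a_nonneg: "(\<And>y. y \<in> space S \<Longrightarrow> \<bar>f y\<bar> \<le> a * V y) \<Longrightarrow> 0 \<le> a"
  using V_ge_1[OF x0] x0 by (metis abs_ge_zero order_trans zero_le_mult_iff not_one_le_zero)

lemma R_weighted: "f \<in> weighted S V \<Longrightarrow> R f \<in> weighted S V"
proof -
  assume f: "f \<in> weighted S V"
  have "R f = (\<lambda>x. (1 / real (card {..n})) * (\<Sum>j\<in>{..n}. \<Sum>i<j+N. (T ^^ i) f x))"
    by (auto simp: potential_op_def)
  also have "\<dots> \<in> weighted S V" by (intro weighted_cmult sum_weighted T_pow_weighted f) auto
  finally show ?thesis .
qed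

lemma R_bound:
  assumes f: "f \<in> borel_measurable S" and a: "\<And>y. y \<in> space S \<Longrightarrow> \<bar>f y\<bar> \<le> a * V y" and x: "x \<in> space S"
  shows "\<bar>R f x\<bar> \<le> a * (L * real (n + N)) * V x"
proof -
  have "0 \<le> a" using a by (rule a_nonneg)
  have "\<bar>\<Sum>i<j+N. (T ^^ i) f x\<bar> \<le> real (n + N) * (a * L * V x)" if "j \<le> n" for j
  proof -
    have "\<bar>\<Sum>i<j+N. (T ^^ i) f x\<bar> \<le> (\<Sum>i<j+N. \<bar>(T ^^ i) f x\<bar>)" by (rule sum_abs)
    also have "\<dots> \<le> real (card {..<j+N}) * (a * L * V x)"
      by (intro sum_bounded_above pow_bound f a x)
    also have "\<dots> \<le> real (n + N) * (a * L * V x)"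
      using that \<open>0 \<le> a\<close> L_pos V_ge_1[OF x] by (intro mult_right_mono) auto
    finally show ?thesis .
  qed
  then have "(\<Sum>j\<in>{..n}. \<bar>\<Sum>i<j+N. (T ^^ i) f x\<bar>) \<le> real (card {..n}) * (real (n + N) * (a * L * V x))"
    by (intro sum_bounded_above) simp
  then have "\<bar>\<Sum>j\<in>{..n}. \<Sum>i<j+N. (T ^^ i) f x\<bar> \<le> real (card {..n}) * (real (n + N) * (a * L * V x))"
    by (rule order_trans[OF sum_abs])
  then show ?thesis by (simp add: potential_op_def divide_le_eq algebra_simps)
qed

lemma T_sum_telescope: "f \<in> weighted S V \<Longrightarrow> x \<in> space S \<Longrightarrow>
    (\<Sum>i<m. (T ^^ i) f x) - T (\<lambda>y. \<Sum>i<m. (T ^^ i) f y) x = f x - (T ^^ m) f x"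
proof -
  assume f: "f \<in> weighted S V" and x: "x \<in> space S"
  have "T (\<lambda>y. \<Sum>i<m. (T ^^ i) f y) x = (\<Sum>i<m. (T ^^ Suc i) f x)"
    using x f by (subst T_sum) (auto intro: T_pow_weighted)
  then show ?thesis
    using sum_lessThan_telescope'[of "\<lambda>i. (T ^^ i) f x" m] by (simp add: sum_subtractf)
qed

lemma T_R:
  assumes f: "f \<in> weighted S V" and x: "x \<in> space S"
  shows "T (R f) x = (\<Sum>j\<in>{..n}. T (\<lambda>y. \<Sum>i<j+N. (T ^^ i) f y) x) / real (card {..n})"
proof -
  have "R f = (\<lambda>x. (1 / real (card {..n})) * (\<Sum>j\<in>{..n}. \<Sum>i<j+N. (T ^^ i) f x))"
    by (auto simp: potential_op_def)
  then have "T (R f) x = (1 / real (card {..n})) * T (\<lambda>x. \<Sum>j\<in>{..n}. \<Sum>i<j+N. (T ^^ i) f x) x"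
    using x f by (simp only:) (intro T_cmult sum_weighted T_pow_weighted, auto)
  also have "T (\<lambda>x. \<Sum>j\<in>{..n}. \<Sum>i<j+N. (T ^^ i) f x) x = (\<Sum>j\<in>{..n}. T (\<lambda>y. \<Sum>i<j+N. (T ^^ i) f y) x)"
    using x f by (intro T_sum sum_weighted T_pow_weighted) auto
  finally show ?thesis by simp
qed

lemma R_minus_TR:
  assumes f: "f \<in> weighted S V" and x: "x \<in> space S"
  shows "R f x - T (R f) x = f x - Q f x"
proof -
  have "R f x - T (R f) x = (\<Sum>j\<in>{..n}. f x - (T ^^ (j + N)) f x) / real (card {..n})"
    unfolding T_R[OF f x] potential_op_def T_sum_telescope[OF f x, symmetric] by (simp add: sum_subtractf diff_divide_distrib)
  then show ?thesis by (simp add: avg_op_def sum_subtractf diff_divide_distrib)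
qed

lemma Q_pow_T: assumes f: "f \<in> weighted S V" and x: "x \<in> space S" shows "(Q ^^ m) (T f) x = T ((Q ^^ m) f) x"
  using f x
proof (induction m arbitrary: x f)
  case (Suc m)
  have 1: "Q (T g) y = T (Q g) y" if g: "g \<in> weighted S V" and y: "y \<in> space S" for g y
  proof -
    have "Q g = (\<lambda>x. (1 / real (card {..n})) * (\<Sum>j\<in>{..n}. (T ^^ (j + N)) g x))" by (auto simp: avg_op_def)
    then have "T (Q g) y = (1 / real (card {..n})) * T (\<lambda>x. \<Sum>j\<in>{..n}. (T ^^ (j + N)) g x) y"
      using y g by (simp only:) (intro T_cmult sum_weighted T_pow_weighted, auto)
    also have "T (\<lambda>x. \<Sum>j\<in>{..n}. (T ^^ (j + N)) g x) y = (\<Sum>j\<in>{..n}. T ((T ^^ (j + N)) g) y)"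
      using y g by (intro T_sum T_pow_weighted) auto
    finally have "T (Q g) y = (\<Sum>j\<in>{..n}. T ((T ^^ (j + N)) g) y) / real (card {..n})" by simp
    then show ?thesis unfolding avg_op_def[of T n N "T g"] by (simp add: funpow_swap1)
  qed
  have "(Q ^^ Suc m) (T f) x = Q ((Q ^^ m) (T f)) x" by simp
  also have "\<dots> = Q (T ((Q ^^ m) f)) x"
    using Suc by (intro q.T_cong q.T_pow_weighted T_weighted) auto
  also have "\<dots> = T ((Q ^^ Suc m) f) x" using Suc by (simp add: 1 q.T_pow_weighted)
  finally show ?case .
qed simp

abbreviation "erg_mean \<equiv> avg_limit T n N x0"

definition rate_const :: real where "rate_const = C * (L + 1) / (1 - \<gamma>)"

text \<open>Applying \<open>Q\<close> to \<open>(Q ^^ m) f - (Q ^^ m) f x\<close> bounds successive differences by the contracted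
oscillation, so the iterates converge geometrically; their limit is constant because their
oscillation vanishes.\<close>

lemma Q_limit:
  assumes f: "f \<in> borel_measurable S" and a: "\<And>x. x \<in> space S \<Longrightarrow> \<bar>f x\<bar> \<le> a * V x"
  shows "x \<in> space S \<Longrightarrow> (\<lambda>m. (Q ^^ m) f x) \<longlonglongrightarrow> erg_mean f"
    and "x \<in> space S \<Longrightarrow> \<bar>(Q ^^ m) f x - erg_mean f\<bar> \<le> rate_const * \<gamma> ^ m * a * V x"
proof -
  have fV: "f \<in> weighted S V" by (rule weightedI[OF f a])
  have a0: "0 \<le> a" using a by (rule a_nonneg)
  have step: "\<bar>(Q ^^ Suc m) f x - (Q ^^ m) f x\<bar> \<le> C * (L + 1) * a * V x * \<gamma> ^ m" if x: "x \<in> space S" for x m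
  proof -
    define c where "c = (Q ^^ m) f x"
    have K: "0 \<le> C * \<gamma> ^ m * a" using C \<gamma> a0 by simp
    have "\<bar>(Q ^^ Suc m) f x - c\<bar> = \<bar>Q (\<lambda>y. (Q ^^ m) f y - c) x\<bar>"
      using q.T_diff[OF q.T_pow_weighted[OF fV, of m] const_weighted[of c] x] q.T_const[OF x] by simp
    also have "\<dots> \<le> Q (\<lambda>y. (C * \<gamma> ^ m * a) * V y + (C * \<gamma> ^ m * a * V x) * 1) x"
      using contr[OF f a, of _ x m] x
      by (intro q.T_abs_le weighted_diff weighted_lin q.T_pow_weighted fV const_weighted V_weighted) (auto simp: c_def algebra_simps)
    also have "\<dots> = (C * \<gamma> ^ m * a) * Q V x + (C * \<gamma> ^ m * a * V x) * 1"
      unfolding q.T_lin[OF V_weighted const_weighted x] q.T_one[OF x] by (rule refl)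
    also have "\<dots> \<le> (C * \<gamma> ^ m * a) * (L * V x) + (C * \<gamma> ^ m * a * V x) * 1"
      using mult_left_mono[OF q.T_V[OF x] K] by simp
    finally show ?thesis by (simp add: c_def algebra_simps)
  qed
  have "\<exists>c. (\<lambda>m. (Q ^^ m) f x) \<longlonglongrightarrow> c \<and> (\<forall>m. \<bar>(Q ^^ m) f x - c\<bar> \<le> C * (L + 1) * a * V x * \<gamma> ^ m / (1 - \<gamma>))"
    if x: "x \<in> space S" for x
  proof -
    obtain l where "(\<lambda>m. (Q ^^ m) f x) \<longlonglongrightarrow> l" "\<And>m. \<bar>(Q ^^ m) f x - l\<bar> \<le> C * (L + 1) * a * V x * \<gamma> ^ m / (1 - \<gamma>)"
      by (rule geometric_limit[OF \<gamma> step[OF x]]) blast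
    then show ?thesis by blast
  qed
  then have "\<forall>x\<in>space S. \<exists>c. (\<lambda>m. (Q ^^ m) f x) \<longlonglongrightarrow> c \<and> (\<forall>m. \<bar>(Q ^^ m) f x - c\<bar> \<le> C * (L + 1) * a * V x * \<gamma> ^ m / (1 - \<gamma>))"
    by blast
  from bchoice[OF this] obtain c where
      c: "\<And>x. x \<in> space S \<Longrightarrow> (\<lambda>m. (Q ^^ m) f x) \<longlonglongrightarrow> c x"
      "\<And>x m. x \<in> space S \<Longrightarrow> \<bar>(Q ^^ m) f x - c x\<bar> \<le> C * (L + 1) * a * V x * \<gamma> ^ m / (1 - \<gamma>)"
    by blast
  have c_eq: "c x = c x0" if x: "x \<in> space S" for x
  proof -
    have 1: "(\<lambda>m. C * \<gamma> ^ m * a * (V x + V x0)) \<longlonglongrightarrow> C * 0 * a * (V x + V x0)"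
      using \<gamma> by (intro tendsto_intros LIMSEQ_power_zero) auto
    have 2: "(\<lambda>m. \<bar>(Q ^^ m) f x - (Q ^^ m) f x0\<bar>) \<longlonglongrightarrow> \<bar>c x - c x0\<bar>"
      by (intro tendsto_rabs tendsto_diff c(1) x x0)
    have "\<bar>(Q ^^ m) f x - (Q ^^ m) f x0\<bar> \<le> C * \<gamma> ^ m * a * (V x + V x0)" for m
      by (rule contr[OF f a x x0])
    then have "\<bar>c x - c x0\<bar> \<le> C * 0 * a * (V x + V x0)"
      by (intro LIMSEQ_le[OF 2 1]) blast
    then show ?thesis by simp
  qed
  have "erg_mean f = c x0" unfolding avg_limit_def by (rule limI) (rule c(1)[OF x0])
  then have clx: "c x = erg_mean f" if "x \<in> space S" for x using c_eq[OF that] by simp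
  have rate_const: "C * (L + 1) * a * V x * \<gamma> ^ m / (1 - \<gamma>) = rate_const * \<gamma> ^ m * a * V x" for x m
    by (simp add: rate_const_def)
  show "x \<in> space S \<Longrightarrow> (\<lambda>m. (Q ^^ m) f x) \<longlonglongrightarrow> erg_mean f"
    using c(1)[of x] clx[of x] by (simp only:)
  show "x \<in> space S \<Longrightarrow> \<bar>(Q ^^ m) f x - erg_mean f\<bar> \<le> rate_const * \<gamma> ^ m * a * V x"
    using c(2)[of x m] clx[of x] by (simp only: rate_const)
qed

lemma Q_limit_weighted: "f \<in> weighted S V \<Longrightarrow> x \<in> space S \<Longrightarrow> (\<lambda>m. (Q ^^ m) f x) \<longlonglongrightarrow> erg_mean f"
  unfolding weighted_def using Q_limit(1) by fastforce

lemma erg_mean_lin: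
  assumes f: "f \<in> weighted S V" and g: "g \<in> weighted S V"
  shows "erg_mean (\<lambda>x. p * f x + r * g x) = p * erg_mean f + r * erg_mean g"
proof (rule LIMSEQ_unique[OF Q_limit_weighted[OF weighted_lin[OF f g] x0]])
  show "(\<lambda>m. (Q ^^ m) (\<lambda>x. p * f x + r * g x) x0) \<longlonglongrightarrow> p * erg_mean f + r * erg_mean g"
    unfolding q.T_pow_lin[OF f g x0] by (intro tendsto_intros Q_limit_weighted f g x0)
qed

lemma erg_mean_mono:
  assumes f: "f \<in> weighted S V" and g: "g \<in> weighted S V" and le: "\<And>x. x \<in> space S \<Longrightarrow> f x \<le> g x"
  shows "erg_mean f \<le> erg_mean g"
  by (rule LIMSEQ_le[OF Q_limit_weighted[OF f x0] Q_limit_weighted[OF g x0]])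
    (use q.T_pow_mono[OF f g le x0] in auto)

lemma erg_mean_one: "erg_mean (\<lambda>_. 1) = 1"
  by (rule LIMSEQ_unique[OF Q_limit_weighted[OF const_weighted x0]]) (simp add: q.T_pow_one[OF x0])

text \<open>This invariance makes the limit functional a stationary distribution: \<open>T\<close> commutes with the
iterates of \<open>Q\<close> and fixes constants.\<close>

lemma erg_mean_T: assumes f: "f \<in> weighted S V" shows "erg_mean (T f) = erg_mean f"
proof (rule LIMSEQ_unique[OF Q_limit_weighted[OF T_weighted[OF f] x0]])
  obtain a where a: "\<And>x. x \<in> space S \<Longrightarrow> \<bar>f x\<bar> \<le> a * V x" and fm: "f \<in> borel_measurable S"
    using f by (auto simp: weighted_def)
  have "(\<lambda>m. rate_const * \<gamma> ^ m * a * L * V x0) \<longlonglongrightarrow> rate_const * 0 * a * L * V x0"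
    using \<gamma> by (intro tendsto_intros LIMSEQ_power_zero) auto
  then have lim: "(\<lambda>m. rate_const * \<gamma> ^ m * a * L * V x0) \<longlonglongrightarrow> 0" by simp
  have "\<bar>(Q ^^ m) (T f) x0 - erg_mean f\<bar> \<le> rate_const * \<gamma> ^ m * a * L * V x0" for m
  proof -
    have "(Q ^^ m) (T f) x0 - erg_mean f = T (\<lambda>y. (Q ^^ m) f y - erg_mean f) x0"
      using T_diff[OF q.T_pow_weighted[OF f] const_weighted x0, of m "erg_mean f"] T_const[OF x0] Q_pow_T[OF f x0] by simp
    also have "\<bar>\<dots>\<bar> \<le> rate_const * \<gamma> ^ m * a * L * V x0"
      using Q_limit(2)[OF fm a] x0 weighted_measurable[OF weighted_diff[OF q.T_pow_weighted[OF f, of m] const_weighted]]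
      by (intro T_bound) auto
    finally show ?thesis .
  qed
  then have "(\<lambda>m. (Q ^^ m) (T f) x0 - erg_mean f) \<longlonglongrightarrow> 0"
    by (intro Lim_null_comparison[OF _ lim]) auto
  then show "(\<lambda>m. (Q ^^ m) (T f) x0) \<longlonglongrightarrow> erg_mean f" by (simp add: LIM_zero_iff)
qed

abbreviation "poisson \<equiv> poisson_sol T n N x0"

text \<open>The partial sums of the series satisfy \<open>hm k - Q (hm k) = f - (Q ^^ k) f\<close>.  Their uniform geometric
convergence in the weighted norm lets this pass to the limit.\<close>

lemma poisson_solves:
  assumes f: "f \<in> weighted S V"
  shows "poisson f \<in> weighted S V" "x \<in> space S \<Longrightarrow> poisson f x - T (poisson f) x = f x - erg_mean f"
proof -
  obtain a where a: "\<And>x. x \<in> space S \<Longrightarrow> \<bar>f x\<bar> \<le> a * V x" and fm: "f \<in> borel_measurable S"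
    using f by (auto simp: weighted_def)
  define h where "h = (\<lambda>x. \<Sum>m. (Q ^^ m) f x - erg_mean f)"
  define hm where "hm = (\<lambda>k x. \<Sum>m<k. (Q ^^ m) f x - erg_mean f)"
  define D where "D = rate_const * a / (1 - \<gamma>)"
  have [measurable]: "(Q ^^ m) f \<in> borel_measurable S" for m by (rule weighted_measurable[OF q.T_pow_weighted[OF f]])
  have h_m[measurable]: "h \<in> borel_measurable S" unfolding h_def by measurable
  have dist: "\<bar>h x - hm k x\<bar> \<le> D * \<gamma> ^ k * V x" if x: "x \<in> space S" for x k
  proof -
    have s: "\<bar>hm (Suc m) x - hm m x\<bar> \<le> rate_const * a * V x * \<gamma> ^ m" for m
      using Q_limit(2)[OF fm a x, of m] by (simp add: hm_def algebra_simps)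
    obtain c where c: "(\<lambda>m. hm m x) \<longlonglongrightarrow> c" "\<And>m. \<bar>hm m x - c\<bar> \<le> rate_const * a * V x * \<gamma> ^ m / (1 - \<gamma>)"
      using geometric_limit[OF \<gamma> s] by blast
    have "h x = c" unfolding h_def using c(1) by (intro sums_unique[symmetric]) (simp add: sums_def hm_def)
    then show ?thesis using c(2)[of k] by (simp add: D_def abs_minus_commute mult_ac)
  qed
  have hV: "h \<in> weighted S V" using dist[of _ 0] by (intro weightedI[OF h_m, where a=D]) (simp add: hm_def)
  have hmV: "hm k \<in> weighted S V" for k
    unfolding hm_def by (intro sum_weighted weighted_diff q.T_pow_weighted f const_weighted) auto
  have Qhm: "hm k x - Q (hm k) x = f x - (Q ^^ k) f x" if x: "x \<in> space S" for k x
  proof -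
    have "Q (hm k) x = (\<Sum>m<k. (Q ^^ Suc m) f x - erg_mean f)"
      unfolding hm_def using x
      by (subst q.T_sum) (auto intro!: weighted_diff q.T_pow_weighted f const_weighted simp: q.T_diff q.T_pow_weighted f const_weighted q.T_const)
    then have "hm k x - Q (hm k) x = (\<Sum>m<k. (Q ^^ m) f x - (Q ^^ Suc m) f x)"
      by (simp only: hm_def sum_subtractf[symmetric]) simp
    then show ?thesis using sum_lessThan_telescope'[of "\<lambda>m. (Q ^^ m) f x" k] by simp
  qed
  have hQ: "h x - Q h x = f x - erg_mean f" if x: "x \<in> space S" for x
  proof -
    have "\<bar>h x - Q h x - (f x - (Q ^^ k) f x)\<bar> \<le> D * (1 + L) * V x * \<gamma> ^ k" for k
    proof -
      have "\<bar>Q (\<lambda>y. h y - hm k y) x\<bar> \<le> D * \<gamma> ^ k * L * V x"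
        using dist by (intro q.T_bound weighted_measurable[OF weighted_diff[OF hV hmV]] x) auto
      moreover have "Q (\<lambda>y. h y - hm k y) x = Q h x - Q (hm k) x" by (intro q.T_diff hV hmV x)
      ultimately show ?thesis using dist[OF x, of k] Qhm[OF x, of k] by (simp add: algebra_simps)
    qed
    moreover have "(\<lambda>k. D * (1 + L) * V x * \<gamma> ^ k) \<longlonglongrightarrow> D * (1 + L) * V x * 0"
      using \<gamma> by (intro tendsto_intros LIMSEQ_power_zero) auto
    moreover have "(\<lambda>k. \<bar>h x - Q h x - (f x - (Q ^^ k) f x)\<bar>) \<longlonglongrightarrow> \<bar>h x - Q h x - (f x - erg_mean f)\<bar>"
      by (intro tendsto_intros Q_limit_weighted f x)
    ultimately have "\<bar>h x - Q h x - (f x - erg_mean f)\<bar> \<le> D * (1 + L) * V x * 0"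
      by (intro LIMSEQ_le) auto
    then show ?thesis by simp
  qed
  show "poisson f \<in> weighted S V" unfolding poisson_sol_def h_def[symmetric] by (rule R_weighted[OF hV])
  show "x \<in> space S \<Longrightarrow> poisson f x - T (poisson f) x = f x - erg_mean f"
    unfolding poisson_sol_def h_def[symmetric] using R_minus_TR[OF hV] hQ by simp
qed

text \<open>A solution satisfies \<open>d = Q d + R g - const\<close>.  Iterating, the oscillation of \<open>(Q ^^ m) d\<close> disappears and
that of the sum of \<open>(Q ^^ i) (R g)\<close> is a geometric series.  Constants have no oscillation and drop
out.\<close>

lemma poisson_oscillation:
  assumes d: "d \<in> weighted S V" and g: "g \<in> borel_measurable S" and a: "\<And>x. x \<in> space S \<Longrightarrow> \<bar>g x\<bar> \<le> a * V x"
    and eq: "\<And>x. x \<in> space S \<Longrightarrow> d x - T d x = g x - \<kappa>"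
    and x: "x \<in> space S" and y: "y \<in> space S"
  shows "\<bar>d x - d y\<bar> \<le> a * (C * L * real (n + N) / (1 - \<gamma>)) * (V x + V y)"
proof -
  obtain a' where a': "\<And>x. x \<in> space S \<Longrightarrow> \<bar>d x\<bar> \<le> a' * V x" and dm: "d \<in> borel_measurable S"
    using d by (auto simp: weighted_def)
  have gV: "g \<in> weighted S V" by (rule weightedI[OF g a])
  define r where "r = (\<Sum>j\<in>{..n}. real (j + N)) / real (card {..n})"
  have pow_eq: "(T ^^ i) d z - (T ^^ Suc i) d z = (T ^^ i) g z - \<kappa>" if z: "z \<in> space S" for z i
    using z
  proof (induction i arbitrary: z)
    case (Suc i)
    have "T (\<lambda>y. (T ^^ i) d y - (T ^^ Suc i) d y) z = T (\<lambda>y. (T ^^ i) g y - \<kappa>) z"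
      using Suc by (intro T_cong weighted_diff T_pow_weighted d gV const_weighted) auto
    then show ?case
      using Suc.prems T_diff[OF T_pow_weighted[OF d] T_pow_weighted[OF d], of z i "Suc i"]
        T_diff[OF T_pow_weighted[OF gV] const_weighted, of z i \<kappa>] T_const by simp
  qed (simp add: eq)
  have dQ: "d z - Q d z = R g z - \<kappa> * r" if z: "z \<in> space S" for z
  proof -
    have "d z - (T ^^ m) d z = (\<Sum>i<m. (T ^^ i) g z) - \<kappa> * real m" for m
    proof -
      have "(\<Sum>i<m. (T ^^ i) d z - (T ^^ Suc i) d z) = (\<Sum>i<m. (T ^^ i) g z - \<kappa>)"
        by (intro sum.cong refl pow_eq z)
      then show ?thesis
        using sum_lessThan_telescope'[of "\<lambda>i. (T ^^ i) d z" m] by (simp add: sum_subtractf mult.commute)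
    qed
    then have "(\<Sum>j\<in>{..n}. d z - (T ^^ (j + N)) d z) / real (card {..n}) =
        (\<Sum>j\<in>{..n}. (\<Sum>i<j+N. (T ^^ i) g z) - \<kappa> * real (j + N)) / real (card {..n})" by simp
    then show ?thesis
      by (simp add: avg_op_def potential_op_def r_def sum_subtractf diff_divide_distrib sum_distrib_left del: of_nat_add)
  qed
  have dQm: "d z - (Q ^^ m) d z = (\<Sum>i<m. (Q ^^ i) (R g) z) - \<kappa> * r * real m" if z: "z \<in> space S" for z m
  proof -
    have "(Q ^^ i) d z - (Q ^^ Suc i) d z = (Q ^^ i) (R g) z - \<kappa> * r" for i
      using z
    proof (induction i arbitrary: z)
      case (Suc i)
      have "Q (\<lambda>y. (Q ^^ i) d y - (Q ^^ Suc i) d y) z = Q (\<lambda>y. (Q ^^ i) (R g) y - \<kappa> * r) z"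
        using Suc by (intro q.T_cong weighted_diff q.T_pow_weighted d gV const_weighted R_weighted) auto
      then show ?case
        using Suc.prems q.T_diff[OF q.T_pow_weighted[OF d] q.T_pow_weighted[OF d], of z i "Suc i"]
          q.T_diff[OF q.T_pow_weighted[OF R_weighted[OF gV]] const_weighted, of z i "\<kappa> * r"] q.T_const by simp
    qed (simp add: dQ)
    then have "(\<Sum>i<m. (Q ^^ i) d z - (Q ^^ Suc i) d z) = (\<Sum>i<m. (Q ^^ i) (R g) z - \<kappa> * r)"
      by (intro sum.cong refl)
    then show ?thesis
      using sum_lessThan_telescope'[of "\<lambda>i. (Q ^^ i) d z" m] by (simp add: sum_subtractf mult.commute)
  qed
  define aR where "aR = a * (L * real (n + N))"
  have aR: "0 \<le> aR" using a_nonneg[OF a] L_pos by (simp add: aR_def)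
  have V: "0 \<le> V x + V y" using V_ge_1[OF x] V_ge_1[OF y] by simp
  have "\<bar>d x - d y\<bar> \<le> C * \<gamma> ^ m * a' * (V x + V y) + C * aR * (V x + V y) / (1 - \<gamma>)" for m
  proof -
    have "d x - d y = ((Q ^^ m) d x - (Q ^^ m) d y) + (\<Sum>i<m. (Q ^^ i) (R g) x - (Q ^^ i) (R g) y)"
      using dQm[OF x, of m] dQm[OF y, of m] unfolding sum_subtractf by linarith
    then have "\<bar>d x - d y\<bar> \<le> \<bar>(Q ^^ m) d x - (Q ^^ m) d y\<bar> + \<bar>\<Sum>i<m. (Q ^^ i) (R g) x - (Q ^^ i) (R g) y\<bar>"
      by linarith
    also have "\<dots> \<le> \<bar>(Q ^^ m) d x - (Q ^^ m) d y\<bar> + (\<Sum>i<m. \<bar>(Q ^^ i) (R g) x - (Q ^^ i) (R g) y\<bar>)"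
      by (intro add_left_mono sum_abs)
    also have "\<dots> \<le> C * \<gamma> ^ m * a' * (V x + V y) + (\<Sum>i<m. C * \<gamma> ^ i * aR * (V x + V y))"
    proof (rule add_mono)
      show "\<bar>(Q ^^ m) d x - (Q ^^ m) d y\<bar> \<le> C * \<gamma> ^ m * a' * (V x + V y)"
        by (rule contr[OF dm a' x y])
      have "\<bar>R g z\<bar> \<le> aR * V z" if "z \<in> space S" for z
        unfolding aR_def by (rule R_bound[OF g a that])
      then show "(\<Sum>i<m. \<bar>(Q ^^ i) (R g) x - (Q ^^ i) (R g) y\<bar>) \<le> (\<Sum>i<m. C * \<gamma> ^ i * aR * (V x + V y))"
        by (intro sum_mono contr[OF weighted_measurable[OF R_weighted[OF gV]] _ x y])
    qed
    also have "(\<Sum>i<m. C * \<gamma> ^ i * aR * (V x + V y)) = C * aR * (V x + V y) * (\<Sum>i<m. \<gamma> ^ i)"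
      by (simp add: sum_distrib_left mult_ac)
    also have "\<dots> \<le> C * aR * (V x + V y) * (1 / (1 - \<gamma>))"
    proof (intro mult_left_mono)
      have "(\<Sum>i<m. \<gamma> ^ i) = (1 - \<gamma> ^ m) / (1 - \<gamma>)" using \<gamma> by (subst sum_gp_strict) auto
      also have "\<dots> \<le> 1 / (1 - \<gamma>)" using \<gamma> by (intro divide_right_mono) auto
      finally show "(\<Sum>i<m. \<gamma> ^ i) \<le> 1 / (1 - \<gamma>)" .
    qed (use C aR V in auto)
    finally show ?thesis by simp
  qed
  moreover have "(\<lambda>m. C * \<gamma> ^ m * a' * (V x + V y) + C * aR * (V x + V y) / (1 - \<gamma>))
      \<longlonglongrightarrow> C * 0 * a' * (V x + V y) + C * aR * (V x + V y) / (1 - \<gamma>)"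
    using \<gamma> by (intro tendsto_intros LIMSEQ_power_zero) auto
  ultimately have "\<bar>d x - d y\<bar> \<le> C * 0 * a' * (V x + V y) + C * aR * (V x + V y) / (1 - \<gamma>)"
    by (intro LIMSEQ_le_const) blast+
  then show ?thesis by (simp add: aR_def mult_ac)
qed

end

section \<open>Stationary distributions of drifting kernels\<close>

definition kernel_op :: "('b \<Rightarrow> 'b measure) \<Rightarrow> ('b \<Rightarrow> real) \<Rightarrow> 'b \<Rightarrow> real" where
  "kernel_op K f x = (\<integral>y. f y \<partial>K x)"

lemma prob_kernelD:
  assumes "K \<in> A \<rightarrow>\<^sub>M prob_algebra S" "x \<in> space A"
  shows "prob_space (K x)" "sets (K x) = sets S" "space (K x) = space S"
  using measurable_space[OF assms] by (auto simp: space_prob_algebra dest: sets_eq_imp_space_eq)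

lemma weighted_integrable:
  assumes f: "f \<in> weighted S V" and V: "V \<in> borel_measurable S" "\<And>x. x \<in> space S \<Longrightarrow> 1 \<le> V x"
    and mu: "sets \<mu> = sets S" and fin: "(\<integral>\<^sup>+x. ennreal (V x) \<partial>\<mu>) < \<infinity>"
  shows "integrable \<mu> f"
proof -
  obtain a where a: "\<And>x. x \<in> space S \<Longrightarrow> \<bar>f x\<bar> \<le> a * V x" and fm: "f \<in> borel_measurable S"
    using f by (auto simp: weighted_def)
  note sets_eq_imp_space_eq[OF mu, simp]
  have [measurable]: "f \<in> borel_measurable \<mu>" "V \<in> borel_measurable \<mu>" using fm V(1) by (simp_all cong: measurable_cong_sets add: mu)
  show ?thesis
  proof (rule integrableI_bounded)
    have "(\<integral>\<^sup>+x. ennreal (norm (f x)) \<partial>\<mu>) \<le> (\<integral>\<^sup>+x. ennreal \<bar>a\<bar> * ennreal (V x) \<partial>\<mu>)"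
    proof (intro nn_integral_mono)
      fix x assume "x \<in> space \<mu>"
      then have x: "x \<in> space S" by simp
      have "a * V x \<le> \<bar>a\<bar> * V x" using V(2)[OF x] by (intro mult_right_mono) auto
      then have "ennreal (norm (f x)) \<le> ennreal (\<bar>a\<bar> * V x)" using a[OF x] by (intro ennreal_leI) auto
      then show "ennreal (norm (f x)) \<le> ennreal \<bar>a\<bar> * ennreal (V x)" by (simp add: ennreal_mult')
    qed
    also have "\<dots> = ennreal \<bar>a\<bar> * (\<integral>\<^sup>+x. ennreal (V x) \<partial>\<mu>)" by (rule nn_integral_cmult) simp
    also have "\<dots> < \<infinity>" using fin by (simp add: ennreal_mult_less_top)
    finally show "(\<integral>\<^sup>+x. ennreal (norm (f x)) \<partial>\<mu>) < \<infinity>" .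
  qed simp
qed

locale markov_kernel =
  fixes S :: "'b measure" and V :: "'b \<Rightarrow> real" and K :: "'b \<Rightarrow> 'b measure" and L :: real
  assumes K[measurable]: "K \<in> S \<rightarrow>\<^sub>M prob_algebra S"
    and Vm[measurable]: "V \<in> borel_measurable S" and V1: "\<And>x. x \<in> space S \<Longrightarrow> 1 \<le> V x"
    and L0: "0 \<le> L" and KV: "\<And>x. x \<in> space S \<Longrightarrow> (\<integral>\<^sup>+y. ennreal (V y) \<partial>K x) \<le> ennreal (L * V x)"
begin

lemma K_subprob[measurable]: "K \<in> S \<rightarrow>\<^sub>M subprob_algebra S"
  by (rule measurable_prob_algebraD[OF K])

lemma K_integrable: "f \<in> weighted S V \<Longrightarrow> x \<in> space S \<Longrightarrow> integrable (K x) f"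
  using KV[of x] by (intro weighted_integrable[where S=S and V=V]) (auto simp: prob_kernelD[OF K] V1 intro: le_less_trans)

lemma kernel_op_eq_nn:
  assumes f: "f \<in> weighted S V" "\<And>x. x \<in> space S \<Longrightarrow> 0 \<le> f x" and x: "x \<in> space S"
  shows "(\<integral>\<^sup>+y. ennreal (f y) \<partial>K x) = ennreal (kernel_op K f x)"
  unfolding kernel_op_def using f x
  by (intro nn_integral_eq_integral K_integrable) (auto simp: prob_kernelD[OF K x])

sublocale markov_operator S V "kernel_op K" L
proof
  show "V \<in> borel_measurable S" "\<And>x. x \<in> space S \<Longrightarrow> 1 \<le> V x" by (fact Vm V1)+
  show "kernel_op K f \<in> borel_measurable S" if "f \<in> weighted S V" for f
  proof -
    have [measurable]: "f \<in> borel_measurable S" using that by (rule weighted_measurable)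
    show ?thesis unfolding kernel_op_def[abs_def]
      by (rule measurable_compose[OF K_subprob integral_measurable_subprob_algebra]) simp
  qed
  show "kernel_op K (\<lambda>y. p * f y + q * g y) x = p * kernel_op K f x + q * kernel_op K g x"
    if "f \<in> weighted S V" "g \<in> weighted S V" "x \<in> space S" for f g p q x
    unfolding kernel_op_def using that by (simp add: K_integrable)
  show "kernel_op K f x \<le> kernel_op K g x"
    if "f \<in> weighted S V" "g \<in> weighted S V" "\<And>y. y \<in> space S \<Longrightarrow> f y \<le> g y" "x \<in> space S" for f g x
    unfolding kernel_op_def using that by (intro integral_mono K_integrable) (auto simp: prob_kernelD[OF K])
  show "kernel_op K (\<lambda>_. 1) x = 1" if x: "x \<in> space S" for x
    unfolding kernel_op_def using prob_space.prob_space[OF prob_kernelD(1)[OF K x]] by simp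
  show "kernel_op K V x \<le> L * V x" if x: "x \<in> space S" for x
  proof -
    have "V \<in> weighted S V" using V1 by (intro weightedI[OF Vm, where a=1]) force
    then have "ennreal (kernel_op K V x) \<le> ennreal (L * V x)"
      using KV[OF x] V1 by (subst kernel_op_eq_nn[symmetric]) (auto intro: x order_trans[OF zero_le_one])
    moreover have "0 \<le> L * V x" using L0 V1[OF x] by auto
    ultimately show ?thesis by simp
  qed
qed

lemma kernel_iter_measurable[measurable]: "kernel_iter S K n \<in> S \<rightarrow>\<^sub>M prob_algebra S"
proof (induction n)
  case (Suc n)
  note Suc[measurable]
  show ?case unfolding kernel_iter.simps by measurable
qed simp

lemma pow_kernel_op_nonneg: "f \<in> weighted S V \<Longrightarrow> (\<And>x. x \<in> space S \<Longrightarrow> 0 \<le> f x) \<Longrightarrow> x \<in> space S \<Longrightarrow> 0 \<le> (kernel_op K ^^ n) f x"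
  by (induction n arbitrary: x) (auto intro!: T_nonneg T_pow_weighted)

lemma nn_integral_kernel_iter:
  assumes f: "f \<in> weighted S V" "\<And>x. x \<in> space S \<Longrightarrow> 0 \<le> f x" and x: "x \<in> space S"
  shows "(\<integral>\<^sup>+y. ennreal (f y) \<partial>kernel_iter S K n x) = ennreal ((kernel_op K ^^ n) f x)"
  using x
proof (induction n arbitrary: x)
  case 0 then show ?case using weighted_measurable[OF f(1)] by (simp add: nn_integral_return)
next
  case (Suc n)
  have [measurable]: "f \<in> borel_measurable S" using f by (auto intro: weighted_measurable)
  have m: "kernel_iter S K n \<in> K x \<rightarrow>\<^sub>M subprob_algebra S"
    using measurable_prob_algebraD[OF kernel_iter_measurable] by (simp cong: measurable_cong_sets add: prob_kernelD[OF K Suc.prems])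
  have "(\<integral>\<^sup>+y. ennreal (f y) \<partial>kernel_iter S K (Suc n) x) = (\<integral>\<^sup>+y. \<integral>\<^sup>+z. ennreal (f z) \<partial>kernel_iter S K n y \<partial>K x)"
    by (simp add: nn_integral_bind[OF _ m])
  also have "\<dots> = (\<integral>\<^sup>+y. ennreal ((kernel_op K ^^ n) f y) \<partial>K x)"
    using Suc by (intro nn_integral_cong) (auto simp: prob_kernelD[OF K])
  also have "\<dots> = ennreal ((kernel_op K ^^ Suc n) f x)"
    using kernel_op_eq_nn[OF T_pow_weighted[OF f(1)] pow_kernel_op_nonneg[OF f] Suc.prems, of n] by simp
  finally show ?case .
qed

lemma stationary_nn_integral:
  assumes st: "stationary S K \<mu>" and f: "f \<in> weighted S V" "\<And>x. x \<in> space S \<Longrightarrow> 0 \<le> f x"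
  shows "(\<integral>\<^sup>+x. ennreal (kernel_op K f x) \<partial>\<mu>) = (\<integral>\<^sup>+x. ennreal (f x) \<partial>\<mu>)"
proof -
  have mu: "sets \<mu> = sets S" "space \<mu> = space S"
    using st by (auto simp: stationary_def space_prob_algebra dest: sets_eq_imp_space_eq)
  have [measurable]: "f \<in> borel_measurable S" using f by (auto intro: weighted_measurable)
  have m: "K \<in> \<mu> \<rightarrow>\<^sub>M subprob_algebra S" using K_subprob by (simp cong: measurable_cong_sets add: mu)
  have "(\<integral>\<^sup>+x. ennreal (f x) \<partial>\<mu>) = (\<integral>\<^sup>+x. ennreal (f x) \<partial>(\<mu> \<bind> K))"
    using st by (simp add: stationary_def)
  also have "\<dots> = (\<integral>\<^sup>+x. \<integral>\<^sup>+y. ennreal (f y) \<partial>K x \<partial>\<mu>)" by (rule nn_integral_bind[OF _ m]) simp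
  also have "\<dots> = (\<integral>\<^sup>+x. ennreal (kernel_op K f x) \<partial>\<mu>)"
    using f by (intro nn_integral_cong kernel_op_eq_nn) (auto simp: mu)
  finally show ?thesis by simp
qed

end

text \<open>The functional of the minorization is integration against \<open>\<phi>\<close>; it is finite on functions of growth \<open>V\<close>
because \<open>\<phi>\<close> is dominated by the \<open>N\<close>-step law from a point of \<open>W0\<close>.\<close>

lemma drift_operatorI:
  assumes k: "markov_kernel S V K (lam + b)" and num: "0 \<le> lam" "lam < 1" "0 \<le> b" "0 < eps" "0 < N"
    and drift: "\<And>x. x \<in> space S \<Longrightarrow> (\<integral>\<^sup>+y. ennreal (V y) \<partial>K x) \<le> ennreal (lam * V x + b * indicator W0 x)"
    and phi: "\<phi> \<in> space (prob_algebra S)" and W0: "W0 \<subseteq> space S" "W0 \<noteq> {}"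
    and minor: "\<And>w E. w \<in> W0 \<Longrightarrow> E \<in> sets S \<Longrightarrow> eps * measure \<phi> E \<le> measure (kernel_iter S K N w) E"
  shows "drift_operator S V (kernel_op K) lam b eps N W0 (\<lambda>f. \<integral>x. f x \<partial>\<phi>)"
proof -
  interpret markov_kernel S V K "lam + b" by (rule k)
  have phi': "prob_space \<phi>" "sets \<phi> = sets S" "space \<phi> = space S"
    using phi by (auto simp: space_prob_algebra dest: sets_eq_imp_space_eq)
  interpret phi: prob_space \<phi> by (rule phi'(1))
  have nn_le: "ennreal eps * (\<integral>\<^sup>+x. ennreal (f x) \<partial>\<phi>) \<le> ennreal ((kernel_op K ^^ N) f w)"
    if f: "f \<in> weighted S V" "\<And>x. x \<in> space S \<Longrightarrow> 0 \<le> f x" and w: "w \<in> W0" for f w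
  proof -
    have wS: "w \<in> space S" using w W0 by auto
    note kn = prob_kernelD[OF kernel_iter_measurable wS]
    interpret kw: prob_space "kernel_iter S K N w" by (rule kn(1))
    have fm: "f \<in> borel_measurable \<phi>" using weighted_measurable[OF f(1)] by (simp cong: measurable_cong_sets add: phi')
    have "scale_measure (ennreal eps) \<phi> \<le> kernel_iter S K N w"
    proof (subst le_measure)
      show "sets (scale_measure (ennreal eps) \<phi>) = sets (kernel_iter S K N w)" by (simp add: kn phi')
      show "\<forall>A\<in>sets (scale_measure (ennreal eps) \<phi>). emeasure (scale_measure (ennreal eps) \<phi>) A \<le> emeasure (kernel_iter S K N w) A"
        using minor[OF w] num
        by (auto simp: phi.emeasure_eq_measure kw.emeasure_eq_measure ennreal_mult[symmetric] phi' intro!: ennreal_leI)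
    qed
    then have "nn_integral (scale_measure (ennreal eps) \<phi>) f \<le> nn_integral (kernel_iter S K N w) f"
      by (intro nn_integral_mono_measure) (simp_all add: kn phi')
    then show ?thesis
      using fm by (simp add: nn_integral_scale_measure nn_integral_kernel_iter[OF f wS])
  qed
  have phiV: "(\<integral>\<^sup>+x. ennreal (V x) \<partial>\<phi>) < \<infinity>"
  proof -
    obtain w where w: "w \<in> W0" using W0 by auto
    have "ennreal eps * (\<integral>\<^sup>+x. ennreal (V x) \<partial>\<phi>) \<le> ennreal ((kernel_op K ^^ N) V w)"
      by (rule nn_le[OF V_weighted _ w]) (use V1 in force)
    then have "ennreal eps * (\<integral>\<^sup>+x. ennreal (V x) \<partial>\<phi>) < \<infinity>" by (rule le_less_trans) simp
    then show ?thesis using num by (auto simp: ennreal_mult_less_top)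
  qed
  have int: "integrable \<phi> f" if "f \<in> weighted S V" for f
    by (rule weighted_integrable[OF that Vm V1 phi'(2) phiV])
  show ?thesis
  proof
    show "0 \<le> lam" "lam < 1" "0 \<le> b" "0 < eps" "0 < N" by fact+
    show "kernel_op K V x \<le> lam * V x + b * indicator W0 x" if x: "x \<in> space S" for x
    proof -
      have "ennreal (kernel_op K V x) \<le> ennreal (lam * V x + b * indicator W0 x)"
        using drift[OF x] V1 by (subst kernel_op_eq_nn[OF V_weighted _ x, symmetric]) (auto intro: order_trans[OF zero_le_one])
      moreover have "0 \<le> lam * V x + b * indicator W0 x" using num V1[OF x] by auto
      ultimately show ?thesis by simp
    qed
    show "(\<integral>x. p * f x + q * h x \<partial>\<phi>) = p * (\<integral>x. f x \<partial>\<phi>) + q * (\<integral>x. h x \<partial>\<phi>)" if "f \<in> weighted S V" "h \<in> weighted S V" for f h p q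
      using that by (simp add: int)
    show "(\<integral>x. 1 \<partial>\<phi>) = (1::real)" using phi.prob_space by simp
    show "0 \<le> (\<integral>x. f x \<partial>\<phi>)" if "f \<in> weighted S V" "\<And>x. x \<in> space S \<Longrightarrow> 0 \<le> f x" for f
      using that by (intro integral_nonneg_AE AE_I2) (simp add: phi')
    show "eps * (\<integral>x. f x \<partial>\<phi>) \<le> (kernel_op K ^^ N) f x"
      if f: "f \<in> weighted S V" "\<And>x. x \<in> space S \<Longrightarrow> 0 \<le> f x" and x: "x \<in> space S" "x \<in> W0" for f x
    proof -
      have "ennreal eps * ennreal (\<integral>x. f x \<partial>\<phi>) \<le> ennreal ((kernel_op K ^^ N) f x)"
        using nn_le[OF f x(2)] by (subst nn_integral_eq_integral[symmetric]) (auto simp: phi' f int)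
      then show ?thesis
        using num pow_kernel_op_nonneg[OF f x(1), of N] by (simp add: ennreal_mult'[symmetric])
    qed
  qed
qed

locale ergodic_kernel = markov_kernel S V K L + contracting_operator S V "kernel_op K" L n N C \<gamma> x0
  for S :: "'b measure" and V K L n N C \<gamma> x0
begin

lemma bounded_weighted: "f \<in> borel_measurable S \<Longrightarrow> (\<And>x. x \<in> space S \<Longrightarrow> \<bar>f x\<bar> \<le> B) \<Longrightarrow> f \<in> weighted S V"
proof (rule weightedI[where a="\<bar>B\<bar>"])
  assume b: "\<And>x. x \<in> space S \<Longrightarrow> \<bar>f x\<bar> \<le> B"
  fix x assume x: "x \<in> space S"
  show "\<bar>f x\<bar> \<le> \<bar>B\<bar> * V x" using b[OF x] mult_left_mono[OF V1[OF x], of "\<bar>B\<bar>"] by linarith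
qed

lemma indicator_weighted: "E \<in> sets S \<Longrightarrow> indicator E \<in> weighted S V"
  by (rule bounded_weighted[where B=1]) (auto simp: indicator_def)

lemma kernel_op_cont:
  assumes f: "\<And>i. f i \<in> borel_measurable S" and B: "\<And>i x. x \<in> space S \<Longrightarrow> \<bar>f i x\<bar> \<le> B"
    and lim: "\<And>x. x \<in> space S \<Longrightarrow> (\<lambda>i. f i x) \<longlonglongrightarrow> 0" and x: "x \<in> space S"
  shows "(\<lambda>i. kernel_op K (f i) x) \<longlonglongrightarrow> 0"
proof -
  note kx = prob_kernelD[OF K x]
  interpret kx: prob_space "K x" by (rule kx)
  have "(\<lambda>i. \<integral>y. f i y \<partial>K x) \<longlonglongrightarrow> (\<integral>y. 0 \<partial>K x)"
    using f B lim by (intro integral_dominated_convergence[where w="\<lambda>_. B"])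
      (auto simp: kx cong: measurable_cong_sets)
  then show ?thesis by (simp add: kernel_op_def)
qed

lemma Q_pow_cont:
  assumes f: "\<And>i. f i \<in> borel_measurable S" and B: "\<And>i x. x \<in> space S \<Longrightarrow> \<bar>f i x\<bar> \<le> B"
    and lim: "\<And>x. x \<in> space S \<Longrightarrow> (\<lambda>i. f i x) \<longlonglongrightarrow> 0" and x: "x \<in> space S"
  shows "(\<lambda>i. (Q ^^ m) (f i) x) \<longlonglongrightarrow> 0"
  using x
proof (induction m arbitrary: x)
  case (Suc m)
  define g where "g i = (Q ^^ m) (f i)" for i
  have fV: "f i \<in> weighted S V" for i by (rule bounded_weighted[OF f B])
  have gV: "g i \<in> weighted S V" for i unfolding g_def by (rule q.T_pow_weighted[OF fV])
  have gB: "\<bar>g i x\<bar> \<le> B" if "x \<in> space S" for i x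
    unfolding g_def by (rule q.T_pow_bound[OF fV B that])
  have "(\<lambda>i. (kernel_op K ^^ j) (g i) x) \<longlonglongrightarrow> 0" if "x \<in> space S" for j x
    using that
  proof (induction j arbitrary: x)
    case 0 then show ?case using Suc.IH by (simp add: g_def)
  next
    case (Suc j)
    then show ?case
      using kernel_op_cont[of "\<lambda>i. (kernel_op K ^^ j) (g i)" B x] T_pow_bound[OF gV gB, of _ j] weighted_measurable[OF T_pow_weighted[OF gV]]
      by simp
  qed
  then have "(\<lambda>i. Q (g i) x) \<longlonglongrightarrow> (\<Sum>j\<in>{..n}. 0) / real (card {..n})"
    unfolding avg_op_def using Suc.prems by (intro tendsto_divide tendsto_sum tendsto_const) auto
  then show ?case by (simp add: g_def)
qed (simp add: lim)

text \<open>Continuity along bounded pointwise convergence is what turns the limit functional into a measure.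
It holds for each fixed iterate by dominated convergence, and the convergence of the iterates to the
limit is uniform over functions with a common bound.\<close>

lemma erg_mean_cont0:
  assumes f: "\<And>i. f i \<in> borel_measurable S" and B: "\<And>i x. x \<in> space S \<Longrightarrow> \<bar>f i x\<bar> \<le> B"
    and lim: "\<And>x. x \<in> space S \<Longrightarrow> (\<lambda>i. f i x) \<longlonglongrightarrow> 0"
  shows "(\<lambda>i. erg_mean (f i)) \<longlonglongrightarrow> 0"
proof (rule LIMSEQ_I)
  fix r :: real assume r: "0 < r"
  have "0 \<le> B" using B[OF x0] by (meson abs_ge_zero order_trans)
  have bnd: "\<bar>f i x\<bar> \<le> B * V x" if "x \<in> space S" for i x
    using B[OF that, of i] mult_left_mono[OF V1[OF that] \<open>0 \<le> B\<close>] by simp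
  have "(\<lambda>m. rate_const * \<gamma> ^ m * B * V x0) \<longlonglongrightarrow> rate_const * 0 * B * V x0"
    using \<gamma> by (intro tendsto_intros LIMSEQ_power_zero) auto
  then have "(\<lambda>m. rate_const * \<gamma> ^ m * B * V x0) \<longlonglongrightarrow> 0" by simp
  then have "\<forall>\<^sub>F m in sequentially. rate_const * \<gamma> ^ m * B * V x0 < r / 2" using r by (intro order_tendstoD(2)) auto
  then obtain m where m: "rate_const * \<gamma> ^ m * B * V x0 < r / 2" by (auto simp: eventually_sequentially)
  obtain i0 where i0: "\<And>i. i0 \<le> i \<Longrightarrow> \<bar>(Q ^^ m) (f i) x0\<bar> < r / 2"
    using LIMSEQ_D[OF Q_pow_cont[OF f B lim x0, of m], of "r / 2"] r by auto
  have "\<bar>erg_mean (f i)\<bar> < r" if "i0 \<le> i" for i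
    using Q_limit(2)[OF f bnd x0, of m i] i0[OF that] m by linarith
  then show "\<exists>no. \<forall>n\<ge>no. norm (erg_mean (f n) - 0) < r" by auto
qed

lemma erg_mean_add: "f \<in> weighted S V \<Longrightarrow> g \<in> weighted S V \<Longrightarrow> erg_mean (\<lambda>x. f x + g x) = erg_mean f + erg_mean g"
  using erg_mean_lin[of f g 1 1] by simp

lemma erg_mean_diff: "f \<in> weighted S V \<Longrightarrow> g \<in> weighted S V \<Longrightarrow> erg_mean (\<lambda>x. f x - g x) = erg_mean f - erg_mean g"
  using erg_mean_lin[of f g 1 "-1"] by simp

lemma erg_mean_cmult: "f \<in> weighted S V \<Longrightarrow> erg_mean (\<lambda>x. p * f x) = p * erg_mean f"
  using erg_mean_lin[of f f p 0] by simp

lemma erg_mean_cong: "f \<in> weighted S V \<Longrightarrow> g \<in> weighted S V \<Longrightarrow> (\<And>x. x \<in> space S \<Longrightarrow> f x = g x) \<Longrightarrow> erg_mean f = erg_mean g"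
  using erg_mean_mono[of f g] erg_mean_mono[of g f] by force

lemma erg_mean_nonneg: "f \<in> weighted S V \<Longrightarrow> (\<And>x. x \<in> space S \<Longrightarrow> 0 \<le> f x) \<Longrightarrow> 0 \<le> erg_mean f"
  using erg_mean_mono[OF const_weighted[of 0], of f] erg_mean_cmult[OF const_weighted[of 1], of 0] by simp

definition nu :: "'b measure" where
  "nu = measure_of (space S) (sets S) (\<lambda>E. ennreal (erg_mean (indicator E)))"

lemma sets_nu[simp, measurable_cong]: "sets nu = sets S" by (simp add: nu_def)
lemma space_nu[simp]: "space nu = space S" by (simp add: nu_def)

lemma emeasure_nu: "E \<in> sets S \<Longrightarrow> emeasure nu E = ennreal (erg_mean (indicator E))"
proof (rule emeasure_measure_of[OF nu_def])
  show "sets S \<subseteq> Pow (space S)" by (rule sets.space_closed)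
  have pos: "positive (sets nu) (\<lambda>E. ennreal (erg_mean (indicator E)))"
    using erg_mean_cmult[OF const_weighted[of 1], of 0] by (simp add: positive_def indicator_def[abs_def])
  show "positive (sets nu) (\<lambda>E. ennreal (erg_mean (indicator E)))" by (rule pos)
  show "countably_additive (sets nu) (\<lambda>E. ennreal (erg_mean (indicator E)))"
  proof (rule sets.empty_continuous_imp_countably_additive[OF pos])
    show "additive (sets nu) (\<lambda>E. ennreal (erg_mean (indicator E)))"
    proof (unfold additive_def, intro ballI impI)
      fix A B assume AB: "A \<in> sets nu" "B \<in> sets nu" "A \<inter> B = {}"
      then have AB': "A \<in> sets S" "B \<in> sets S" by auto
      have "erg_mean (indicator (A \<union> B)) = erg_mean (\<lambda>x. indicator A x + indicator B x)"
        using AB(3) by (intro erg_mean_cong weighted_add indicator_weighted sets.Un AB') (auto simp: indicator_def)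
      also have "\<dots> = erg_mean (indicator A) + erg_mean (indicator B)" by (intro erg_mean_add indicator_weighted AB')
      finally have "erg_mean (indicator (A \<union> B)) = erg_mean (indicator A) + erg_mean (indicator B)" .
      then show "ennreal (erg_mean (indicator (A \<union> B))) = ennreal (erg_mean (indicator A)) + ennreal (erg_mean (indicator B))"
        using AB by (simp add: erg_mean_nonneg indicator_weighted)
    qed
    fix A :: "nat \<Rightarrow> 'b set" assume A: "range A \<subseteq> sets nu" "decseq A" "(\<Inter>i. A i) = {}"
    have "(\<lambda>i. erg_mean (indicator (A i))) \<longlonglongrightarrow> 0"
    proof (rule erg_mean_cont0[where B=1])
      show "indicator (A i) \<in> borel_measurable S" for i using A(1) by auto
      show "(\<lambda>i. indicator (A i) x) \<longlonglongrightarrow> (0::real)" for x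
        using LIMSEQ_indicator_decseq[OF A(2), of x] A(3) by simp
    qed (simp add: indicator_def)
    then show "(\<lambda>i. ennreal (erg_mean (indicator (A i)))) \<longlonglongrightarrow> 0"
      using tendsto_ennrealI by fastforce
  qed simp
qed simp

lemma prob_nu: "prob_space nu"
proof
  have "erg_mean (indicator (space S)) = erg_mean (\<lambda>_. 1)"
    by (rule erg_mean_cong) (auto intro!: indicator_weighted const_weighted)
  then show "emeasure nu (space nu) = 1" by (simp add: emeasure_nu erg_mean_one)
qed

lemma integral_nu_bounded:
  assumes u: "u \<in> borel_measurable S" "\<And>x. 0 \<le> u x" and B: "\<And>x. x \<in> space S \<Longrightarrow> u x \<le> B"
  shows "(\<integral>x. u x \<partial>nu) = erg_mean u"
proof -
  interpret nu: prob_space nu by (rule prob_nu)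
  have "\<forall>B. (\<forall>x\<in>space S. u x \<le> B) \<longrightarrow> (\<integral>x. u x \<partial>nu) = erg_mean u"
    using u
  proof (induction rule: borel_measurable_induct_real)
    case (set A)
    then show ?case by (simp add: nu.emeasure_eq_measure[symmetric] measure_def emeasure_nu erg_mean_nonneg indicator_weighted)
  next
    case (mult u c)
    show ?case
    proof (intro allI impI)
      fix B assume B: "\<forall>x\<in>space S. c * u x \<le> B"
      show "(\<integral>x. c * u x \<partial>nu) = erg_mean (\<lambda>x. c * u x)"
      proof (cases "c = 0")
        case True then show ?thesis using erg_mean_cmult[OF const_weighted[of 1], of 0] by simp
      next
        case False
        then have b: "u x \<le> B / c" if "x \<in> space S" for x using B that mult by (simp add: field_simps)
        then have "u \<in> weighted S V" using mult by (intro bounded_weighted[where B="B / c"]) auto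
        moreover have "(\<integral>x. u x \<partial>nu) = erg_mean u" using mult b by blast
        ultimately show ?thesis by (simp add: erg_mean_cmult)
      qed
    qed
  next
    case (add u v)
    show ?case
    proof (intro allI impI)
      fix B assume B: "\<forall>x\<in>space S. v x + u x \<le> B"
      then have b: "u x \<le> B" "v x \<le> B" if "x \<in> space S" for x
        using add that by (metis add_increasing add_increasing2 order_trans order_refl)+
      have "u \<in> weighted S V" "v \<in> weighted S V" using add b by (auto intro!: bounded_weighted[where B="B"])
      moreover have "integrable nu u" "integrable nu v"
        using add b by (auto intro!: nu.integrable_const_bound[where B=B] cong: measurable_cong_sets)
      moreover have "(\<integral>x. u x \<partial>nu) = erg_mean u" "(\<integral>x. v x \<partial>nu) = erg_mean v" using add b by blast+
      ultimately show "(\<integral>x. v x + u x \<partial>nu) = erg_mean (\<lambda>x. v x + u x)" by (simp add: erg_mean_add)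
    qed
  next
    case (seq U)
    show ?case
    proof (intro allI impI)
      fix B assume B: "\<forall>x\<in>space S. u x \<le> B"
      have Ule: "U i x \<le> u x" if "x \<in> space S" for i x
        using seq that by (intro incseq_le) (auto simp: incseq_def le_fun_def)
      have b: "U i x \<le> B" if "x \<in> space S" for i x using Ule[OF that, of i] B that by force
      have UV: "U i \<in> weighted S V" for i using seq b by (auto intro!: bounded_weighted[where B="B"])
      have uV: "u \<in> weighted S V" using u B by (auto intro!: bounded_weighted[where B="B"])
      have um: "u \<in> borel_measurable S" by (rule u)
      have "(\<lambda>i. erg_mean (\<lambda>x. U i x - u x)) \<longlonglongrightarrow> 0"
      proof (rule erg_mean_cont0[where B=B])
        show "(\<lambda>x. U i x - u x) \<in> borel_measurable S" for i using seq(1)[of i] um by measurable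
        show "\<bar>U i x - u x\<bar> \<le> B" if "x \<in> space S" for i x
          using Ule[OF that, of i] seq(2)[of i x] B that u(2)[of x] by (auto simp: abs_le_iff)
        show "(\<lambda>i. U i x - u x) \<longlonglongrightarrow> 0" if "x \<in> space S" for x
          using seq.hyps(4)[OF that] by (simp add: LIM_zero)
      qed
      then have "(\<lambda>i. erg_mean (U i)) \<longlonglongrightarrow> erg_mean u" by (simp add: erg_mean_diff UV uV LIM_zero_iff)
      moreover have "(\<lambda>i. \<integral>x. U i x \<partial>nu) \<longlonglongrightarrow> (\<integral>x. u x \<partial>nu)"
        using seq b um by (intro integral_dominated_convergence[where w="\<lambda>_. B"]) (auto cong: measurable_cong_sets)
      moreover have "(\<integral>x. U i x \<partial>nu) = erg_mean (U i)" for i using seq.IH b by blast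
      ultimately show "(\<integral>x. u x \<partial>nu) = erg_mean u" by (auto intro: LIMSEQ_unique)
    qed
  qed
  then show ?thesis using B by blast
qed

lemma nn_integral_nu_bounded:
  assumes u: "u \<in> borel_measurable S" "\<And>x. x \<in> space S \<Longrightarrow> 0 \<le> u x" and B: "\<And>x. x \<in> space S \<Longrightarrow> u x \<le> B"
  shows "(\<integral>\<^sup>+x. ennreal (u x) \<partial>nu) = ennreal (erg_mean u)"
proof -
  interpret nu: prob_space nu by (rule prob_nu)
  define v where "v x = max 0 (u x)" for x
  have v: "v \<in> borel_measurable S" "\<And>x. 0 \<le> v x" "\<And>x. x \<in> space S \<Longrightarrow> v x \<le> B"
    using u B by (auto simp: v_def[abs_def] intro: order_trans)
  have uv: "u x = v x" if "x \<in> space S" for x using u(2)[OF that] by (simp add: v_def)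
  have "u \<in> weighted S V" "v \<in> weighted S V" using u v B by (auto intro!: bounded_weighted[where B=B])
  then have erg_mean: "erg_mean u = erg_mean v" using uv by (intro erg_mean_cong)
  have "(\<integral>\<^sup>+x. ennreal (u x) \<partial>nu) = (\<integral>\<^sup>+x. ennreal (v x) \<partial>nu)" by (intro nn_integral_cong) (simp add: uv)
  also have "\<dots> = ennreal (\<integral>x. v x \<partial>nu)"
    using v by (intro nn_integral_eq_integral nu.integrable_const_bound[where B=B]) (auto cong: measurable_cong_sets)
  finally show ?thesis by (simp add: integral_nu_bounded[OF v] erg_mean)
qed

lemma stationary_nu: "stationary S K nu"
proof -
  interpret nu: prob_space nu by (rule prob_nu)
  have m: "K \<in> nu \<rightarrow>\<^sub>M subprob_algebra S" using K_subprob by (simp cong: measurable_cong_sets)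
  have ne: "space nu \<noteq> {}" using x0 by auto
  have "nu \<bind> K = nu"
  proof (rule measure_eqI)
    show "sets (nu \<bind> K) = sets nu"
      using ne by (subst sets_bind[where N=S]) (auto simp: prob_kernelD[OF K])
    fix E assume "E \<in> sets (nu \<bind> K)"
    then have E: "E \<in> sets S" using ne by (subst (asm) sets_bind[where N=S]) (auto simp: prob_kernelD[OF K])
    have iV: "indicator E \<in> weighted S V" by (rule indicator_weighted[OF E])
    have "emeasure (nu \<bind> K) E = (\<integral>\<^sup>+x. emeasure (K x) E \<partial>nu)"
      by (rule emeasure_bind[OF ne m E])
    also have "\<dots> = (\<integral>\<^sup>+x. ennreal (kernel_op K (indicator E) x) \<partial>nu)"
    proof (intro nn_integral_cong)
      fix x assume "x \<in> space nu"
      then have x: "x \<in> space S" by simp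
      then show "emeasure (K x) E = ennreal (kernel_op K (indicator E) x)"
        using E by (subst kernel_op_eq_nn[OF iV _ x, symmetric]) (auto simp: prob_kernelD[OF K x] ennreal_indicator)
    qed
    also have "\<dots> = ennreal (erg_mean (kernel_op K (indicator E)))"
      using T_pow_bound[OF iV, of 1 _ 1] T_nonneg[OF iV]
      by (intro nn_integral_nu_bounded[where B=1] T_meas iV) (auto simp: indicator_def abs_le_iff)
    also have "\<dots> = emeasure nu E" by (simp add: erg_mean_T[OF iV] emeasure_nu[OF E])
    finally show "emeasure (nu \<bind> K) E = emeasure nu E" .
  qed
  then show ?thesis using prob_nu by (simp add: stationary_def space_prob_algebra)
qed

text \<open>Under any stationary \<open>\<mu>\<close> the integral of \<open>(Q ^^ m) (indicator E)\<close> is \<open>\<mu> E\<close> for every \<open>m\<close>, while the integrand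
tends to the constant that defines \<open>nu E\<close>.\<close>

lemma stationary_unique:
  assumes st: "stationary S K \<mu>"
  shows "\<mu> = nu"
proof -
  have mu: "prob_space \<mu>" "sets \<mu> = sets S" "space \<mu> = space S"
    using st by (auto simp: stationary_def space_prob_algebra dest: sets_eq_imp_space_eq)
  interpret mu: prob_space \<mu> by (rule mu)
  show ?thesis
  proof (rule measure_eqI)
    fix E assume "E \<in> sets \<mu>"
    then have E: "E \<in> sets S" by (simp add: mu)
    have powT: "f \<in> weighted S V \<Longrightarrow> (\<And>x. x \<in> space S \<Longrightarrow> 0 \<le> f x) \<Longrightarrow>
        (\<integral>\<^sup>+x. ennreal ((kernel_op K ^^ j) f x) \<partial>\<mu>) = (\<integral>\<^sup>+x. ennreal (f x) \<partial>\<mu>)" for f j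
      by (induction j) (simp_all add: stationary_nn_integral[OF st T_pow_weighted pow_kernel_op_nonneg])
    have Qnn: "0 \<le> Q f x" if "f \<in> weighted S V" "\<And>x. x \<in> space S \<Longrightarrow> 0 \<le> f x" "x \<in> space S" for f x
      using that by (intro q.T_nonneg)
    have Q1: "(\<integral>\<^sup>+x. ennreal (Q f x) \<partial>\<mu>) = (\<integral>\<^sup>+x. ennreal (f x) \<partial>\<mu>)"
      if f: "f \<in> weighted S V" "\<And>x. x \<in> space S \<Longrightarrow> 0 \<le> f x" for f
    proof -
      have card: "0 < real (card {..n})" by simp
      have [measurable]: "(kernel_op K ^^ j) f \<in> borel_measurable \<mu>" for j
        using weighted_measurable[OF T_pow_weighted[OF f(1)]] by (simp cong: measurable_cong_sets add: mu)
      have "(\<integral>\<^sup>+x. ennreal (Q f x) \<partial>\<mu>) = (\<integral>\<^sup>+x. (\<Sum>j\<in>{..n}. ennreal ((kernel_op K ^^ (j + N)) f x)) / ennreal (real (card {..n})) \<partial>\<mu>)"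
        using pow_kernel_op_nonneg[OF f] card unfolding avg_op_def
        by (intro nn_integral_cong) (simp add: divide_ennreal sum_nonneg sum_ennreal mu del: card_atMost)
      also have "\<dots> = (\<Sum>j\<in>{..n}. \<integral>\<^sup>+x. ennreal ((kernel_op K ^^ (j + N)) f x) \<partial>\<mu>) / ennreal (real (card {..n}))"
        by (simp add: nn_integral_divide nn_integral_sum)
      also have "\<dots> = (\<integral>\<^sup>+x. ennreal (f x) \<partial>\<mu>)"
      proof -
        have "(\<Sum>j\<in>{..n}. \<integral>\<^sup>+x. ennreal ((kernel_op K ^^ (j + N)) f x) \<partial>\<mu>) = (\<integral>\<^sup>+x. ennreal (f x) \<partial>\<mu>) * ennreal (real (card {..n}))"
        proof -
          have "(\<Sum>j\<in>{..n}. \<integral>\<^sup>+x. ennreal ((kernel_op K ^^ (j + N)) f x) \<partial>\<mu>) = (\<Sum>j\<in>{..n}. \<integral>\<^sup>+x. ennreal (f x) \<partial>\<mu>)"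
            using powT[OF f] by (intro sum.cong refl)
          also have "\<dots> = of_nat (card {..n}) * (\<integral>\<^sup>+x. ennreal (f x) \<partial>\<mu>)" by (rule sum_constant)
          finally show ?thesis unfolding ennreal_of_nat_eq_real_of_nat by (simp only: mult.commute)
        qed
        moreover have "ennreal (real (card {..n})) \<noteq> 0" using card by (simp only: ennreal_eq_0_iff not_le)
        ultimately show ?thesis by (simp only: mult_divide_eq_ennreal[OF _ ennreal_neq_top] not_False_eq_True)
      qed
      finally show ?thesis .
    qed
    have Qm: "f \<in> weighted S V \<Longrightarrow> (\<And>x. x \<in> space S \<Longrightarrow> 0 \<le> f x) \<Longrightarrow>
        (\<forall>x\<in>space S. 0 \<le> (Q ^^ m) f x) \<and> (\<integral>\<^sup>+x. ennreal ((Q ^^ m) f x) \<partial>\<mu>) = (\<integral>\<^sup>+x. ennreal (f x) \<partial>\<mu>)" for f m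
    proof (induction m)
      case (Suc m)
      then show ?case using Q1[OF q.T_pow_weighted[OF Suc(2)], of m] q.T_nonneg[OF q.T_pow_weighted[OF Suc(2)], of m] by auto
    qed simp
    have iV: "indicator E \<in> weighted S V" by (rule indicator_weighted[OF E])
    have meas[measurable]: "(Q ^^ m) (indicator E) \<in> borel_measurable \<mu>" for m
      using weighted_measurable[OF q.T_pow_weighted[OF iV]] by (simp cong: measurable_cong_sets add: mu)
    have bd: "\<bar>(Q ^^ m) (indicator E) x\<bar> \<le> 1" if "x \<in> space S" for m x
      by (rule q.T_pow_bound[OF iV _ that]) (simp add: indicator_def)
    have "(\<lambda>m. \<integral>x. (Q ^^ m) (indicator E) x \<partial>\<mu>) \<longlonglongrightarrow> (\<integral>x. erg_mean (indicator E) \<partial>\<mu>)"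
      using Q_limit_weighted[OF iV] bd
      by (intro integral_dominated_convergence[where w="\<lambda>_. 1"]) (auto simp: mu)
    moreover have "(\<integral>x. (Q ^^ m) (indicator E) x \<partial>\<mu>) = measure \<mu> E" for m
    proof -
      have "(\<integral>x. (Q ^^ m) (indicator E) x \<partial>\<mu>) = enn2real (\<integral>\<^sup>+x. ennreal ((Q ^^ m) (indicator E) x) \<partial>\<mu>)"
        using Qm[OF iV, of m] by (intro integral_eq_nn_integral meas AE_I2) (auto simp: mu)
      also have "\<dots> = enn2real (\<integral>\<^sup>+x. ennreal (indicator E x) \<partial>\<mu>)" using Qm[OF iV, of m] by simp
      finally show ?thesis using E by (simp add: ennreal_indicator mu measure_def)
    qed
    ultimately have "measure \<mu> E = erg_mean (indicator E)"
      using mu.prob_space by (simp add: LIMSEQ_const_iff)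
    then show "emeasure \<mu> E = emeasure nu E" by (simp add: mu.emeasure_eq_measure emeasure_nu[OF E])
  qed (simp add: mu)
qed

lemma stationary_dist_eq: "stationary_dist S K = nu"
  unfolding stationary_dist_def by (rule the_equality, rule stationary_nu, rule stationary_unique)

lemma nu_V: "(\<integral>\<^sup>+x. ennreal (V x) \<partial>nu) < \<infinity>"
proof -
  have lim: "(\<lambda>i. ennreal (min (V x) (real i))) \<longlonglongrightarrow> ennreal (V x)" for x
  proof (intro tendsto_ennrealI tendsto_eventually)
    show "\<forall>\<^sub>F i in sequentially. min (V x) (real i) = V x"
      using eventually_ge_at_top[of "nat \<lceil>V x\<rceil>"] by eventually_elim linarith
  qed
  have "(\<integral>\<^sup>+x. ennreal (min (V x) (real i)) \<partial>nu) \<le> ennreal (erg_mean V)" for i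
  proof -
    have "(\<integral>\<^sup>+x. ennreal (min (V x) (real i)) \<partial>nu) = ennreal (erg_mean (\<lambda>x. min (V x) (real i)))"
      using V1 by (intro nn_integral_nu_bounded[where B="real i"]) (auto intro: order_trans[OF zero_le_one])
    also have "\<dots> \<le> ennreal (erg_mean V)"
    proof (intro ennreal_leI erg_mean_mono V_weighted bounded_weighted[where B="real i"])
      show "\<bar>min (V x) (real i)\<bar> \<le> real i" if "x \<in> space S" for x using V1[OF that] by linarith
    qed auto
    finally show ?thesis .
  qed
  moreover have "(\<lambda>i. \<integral>\<^sup>+x. ennreal (min (V x) (real i)) \<partial>nu) \<longlonglongrightarrow> (\<integral>\<^sup>+x. ennreal (V x) \<partial>nu)"
    by (rule nn_integral_LIMSEQ[OF _ _ lim]) (auto simp: incseq_def le_fun_def intro!: ennreal_leI min.mono)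
  ultimately have "(\<integral>\<^sup>+x. ennreal (V x) \<partial>nu) \<le> ennreal (erg_mean V)" by (intro LIMSEQ_le_const2) auto
  then show ?thesis by (rule le_less_trans) simp
qed

lemma nu_integrable: "f \<in> weighted S V \<Longrightarrow> integrable nu f"
  by (rule weighted_integrable[OF _ Vm V1 sets_nu nu_V])

lemma nu_kernel_op: assumes f: "f \<in> weighted S V" shows "(\<integral>x. kernel_op K f x \<partial>nu) = (\<integral>x. f x \<partial>nu)"
proof -
  have nonneg: "(\<integral>x. kernel_op K g x \<partial>nu) = (\<integral>x. g x \<partial>nu)" if g: "g \<in> weighted S V" "\<And>x. x \<in> space S \<Longrightarrow> 0 \<le> g x" for g
    using stationary_nn_integral[OF stationary_nu g] T_nonneg[OF g] weighted_measurable[OF T_weighted[OF g(1)]] weighted_measurable[OF g(1)] g(2)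
    by (subst (1 2) integral_eq_nn_integral) (auto cong: measurable_cong_sets)
  define p where "p x = (\<bar>f x\<bar> + f x) / 2" for x
  define m where "m x = (\<bar>f x\<bar> - f x) / 2" for x
  have pV: "p \<in> weighted S V" "m \<in> weighted S V"
    using weighted_cmult[OF weighted_add[OF weighted_abs[OF f] f], of "1/2"] weighted_cmult[OF weighted_diff[OF weighted_abs[OF f] f], of "1/2"]
    by (simp_all add: p_def[abs_def] m_def[abs_def])
  have f_eq: "f = (\<lambda>x. p x - m x)" by (auto simp: p_def m_def field_simps)
  have "(\<integral>x. kernel_op K f x \<partial>nu) = (\<integral>x. kernel_op K p x - kernel_op K m x \<partial>nu)"
    unfolding f_eq by (intro Bochner_Integration.integral_cong refl T_diff pV) simp
  also have "\<dots> = (\<integral>x. kernel_op K p x \<partial>nu) - (\<integral>x. kernel_op K m x \<partial>nu)"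
    by (intro Bochner_Integration.integral_diff nu_integrable T_weighted pV)
  also have "\<dots> = (\<integral>x. p x \<partial>nu) - (\<integral>x. m x \<partial>nu)"
  proof -
    have "0 \<le> p x" "0 \<le> m x" for x by (auto simp: p_def m_def)
    then show ?thesis using nonneg[OF pV(1)] nonneg[OF pV(2)] by simp
  qed
  also have "\<dots> = (\<integral>x. f x \<partial>nu)"
    unfolding f_eq by (intro Bochner_Integration.integral_diff[symmetric] nu_integrable pV)
  finally show ?thesis .
qed

text \<open>For unbounded \<open>f\<close> the value follows from the Poisson equation: the two terms of its left-hand side
have the same integral under a stationary law.\<close>

lemma integral_stationary_dist:
  assumes f: "f \<in> weighted S V" shows "integrable (stationary_dist S K) f" "(\<integral>x. f x \<partial>stationary_dist S K) = erg_mean f"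
proof -
  interpret nu: prob_space nu by (rule prob_nu)
  let ?u = "poisson f"
  have u: "?u \<in> weighted S V" by (rule poisson_solves(1)[OF f])
  have "(\<integral>x. f x - erg_mean f \<partial>nu) = (\<integral>x. ?u x - kernel_op K ?u x \<partial>nu)"
    by (intro Bochner_Integration.integral_cong refl) (simp add: poisson_solves(2)[OF f])
  also have "\<dots> = 0" using nu_kernel_op[OF u] by (simp add: nu_integrable u T_weighted)
  finally show "(\<integral>x. f x \<partial>stationary_dist S K) = erg_mean f"
    using nu_integrable[OF f] nu.prob_space by (simp add: stationary_dist_eq)
  show "integrable (stationary_dist S K) f" using nu_integrable[OF f] by (simp add: stationary_dist_eq)
qed

end

section \<open>Poisson solutions uniformly in the parameter\<close>

lemma integral_measurable_kernel:
  fixes f :: "'a \<Rightarrow> 'b \<Rightarrow> 'c::{banach, second_countable_topology}"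
  assumes f[measurable]: "(\<lambda>(x, y). f x y) \<in> borel_measurable (M \<Otimes>\<^sub>M N)"
  assumes L[measurable]: "L \<in> measurable M (subprob_algebra N)"
  shows "(\<lambda>x. \<integral>y. f x y \<partial>L x) \<in> borel_measurable M"
proof -
  have "case_prod Pair = (\<lambda>p :: 'a \<times> 'b. p)" by (rule ext) auto
  then have "case_prod Pair \<in> M \<Otimes>\<^sub>M N \<rightarrow>\<^sub>M M \<Otimes>\<^sub>M N" by simp
  from measurable_distr2[OF this L]
  have k: "(\<lambda>x. distr (L x) (M \<Otimes>\<^sub>M N) (Pair x)) \<in> M \<rightarrow>\<^sub>M subprob_algebra (M \<Otimes>\<^sub>M N)" .
  have "(\<lambda>x. integral\<^sup>L (distr (L x) (M \<Otimes>\<^sub>M N) (Pair x)) (\<lambda>(x, y). f x y)) \<in> borel_measurable M"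
    by (rule measurable_compose[OF k integral_measurable_subprob_algebra[OF f]])
  moreover have "integral\<^sup>L (distr (L x) (M \<Otimes>\<^sub>M N) (Pair x)) (\<lambda>(x, y). f x y) = (\<integral>y. f x y \<partial>L x)"
    if x: "x \<in> space M" for x
  proof -
    have "Pair x \<in> L x \<rightarrow>\<^sub>M M \<Otimes>\<^sub>M N"
      using measurable_Pair1'[OF x, of N] by (simp cong: measurable_cong_sets add: sets_kernel[OF L x])
    from integral_distr[OF this f] show ?thesis by simp
  qed
  ultimately show ?thesis by (simp cong: measurable_cong)
qed

text \<open>The square root of \<open>U 2\<close>: equivalent to \<open>U 1\<close>, and it inherits a drift inequality from \<open>U 2\<close>.\<close>

definition lyap :: "'b::real_normed_vector \<Rightarrow> real" where "lyap w = sqrt (U 2 w)"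

lemma lyap_sq: "(lyap w)\<^sup>2 = U 2 w" by (simp add: lyap_def U_def)
lemma lyap_ge_1: "1 \<le> lyap w" by (simp add: lyap_def U_def)
lemma lyap_le: "lyap w \<le> 1 + norm w"
  unfolding lyap_def U_def by (rule real_le_lsqrt) (auto simp: power2_sum)
lemma le_lyap: "1 + norm w \<le> 2 * lyap w"
proof -
  have "norm w \<le> lyap w" unfolding lyap_def U_def by (rule real_le_rsqrt) simp
  then show ?thesis using lyap_ge_1[of w] by linarith
qed
lemma lyap_measurable[measurable]: "lyap \<in> borel_measurable borel"
  unfolding lyap_def[abs_def] U_def by measurable

lemma space_borel_on[simp]: "space (borel_on A) = A" by (simp add: space_restrict_space)

text \<open>Nonnegativity of the variance gives \<open>(\<integral>V)\<^sup>2 \<le> \<integral>V\<^sup>2\<close>, and \<open>\<rho> v\<^sup>2 + b i \<le> (sqrt \<rho> v + sqrt b i)\<^sup>2\<close> for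
\<open>i \<in> {0, 1}\<close>.\<close>

lemma sqrt_drift:
  fixes V :: "'b \<Rightarrow> real"
  assumes "prob_space \<mu>" and V[measurable]: "V \<in> borel_measurable \<mu>" and V1: "\<And>y. y \<in> space \<mu> \<Longrightarrow> 1 \<le> V y"
    and d: "(\<integral>\<^sup>+y. ennreal ((V y)\<^sup>2) \<partial>\<mu>) \<le> ennreal (\<rho> * v\<^sup>2 + b * i)"
    and nn: "0 \<le> \<rho>" "0 \<le> b" "0 \<le> v" "i = 0 \<or> i = 1"
  shows "(\<integral>\<^sup>+y. ennreal (V y) \<partial>\<mu>) \<le> ennreal (sqrt \<rho> * v + sqrt b * i)"
proof -
  interpret prob_space \<mu> by fact
  have r: "0 \<le> \<rho> * v\<^sup>2 + b * i" using nn by auto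
  have i2: "integrable \<mu> (\<lambda>y. (V y)\<^sup>2)"
    using d by (intro integrableI_bounded) (auto intro: le_less_trans)
  have i1: "integrable \<mu> V"
  proof (rule Bochner_Integration.integrable_bound[OF i2 V], rule AE_I2)
    fix y assume "y \<in> space \<mu>"
    then show "norm (V y) \<le> norm ((V y)\<^sup>2)" using V1[of y] by (simp add: power2_eq_square)
  qed
  have e2: "expectation (\<lambda>y. (V y)\<^sup>2) \<le> \<rho> * v\<^sup>2 + b * i"
    using d nn_integral_eq_integral[OF i2] r by simp
  have "(expectation V)\<^sup>2 \<le> expectation (\<lambda>y. (V y)\<^sup>2)"
    using variance_positive[of V] variance_eq[OF i1 i2] by simp
  also have "\<dots> \<le> (sqrt \<rho> * v + sqrt b * i)\<^sup>2"
  proof -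
    have "0 \<le> 2 * (sqrt \<rho> * v) * sqrt b" using nn by (intro mult_nonneg_nonneg) auto
    moreover have "(sqrt \<rho> * v + sqrt b)\<^sup>2 = \<rho> * v\<^sup>2 + b + 2 * (sqrt \<rho> * v) * sqrt b"
      using nn by (simp add: power2_sum power_mult_distrib)
    ultimately have "\<rho> * v\<^sup>2 + b \<le> (sqrt \<rho> * v + sqrt b)\<^sup>2" by linarith
    then show ?thesis using e2 nn by (auto simp: power_mult_distrib)
  qed
  finally have "expectation V \<le> sqrt \<rho> * v + sqrt b * i"
    using nn by (intro power2_le_imp_le[of "expectation V"]) auto
  moreover have "AE y in \<mu>. 0 \<le> V y" using V1 by (intro AE_I2) (force intro: order_trans[OF zero_le_one])
  ultimately show ?thesis using nn_integral_eq_integral[OF i1] by (simp add: ennreal_leI)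
qed

lemma measurable_kernel_op:
  assumes P: "(\<lambda>(t, w). P t w) \<in> A \<Otimes>\<^sub>M S \<rightarrow>\<^sub>M prob_algebra S"
    and g: "(\<lambda>(t, w). g t w) \<in> borel_measurable (A \<Otimes>\<^sub>M S)"
  shows "(\<lambda>(t, w). kernel_op (P t) (g t) w) \<in> borel_measurable (A \<Otimes>\<^sub>M S)"
proof -
  have P': "(\<lambda>x. P (fst x) (snd x)) \<in> A \<Otimes>\<^sub>M S \<rightarrow>\<^sub>M subprob_algebra S"
    using measurable_prob_algebraD[OF P] by (simp add: case_prod_beta')
  have "(\<lambda>x. \<integral>y. g (fst x) y \<partial>P (fst x) (snd x)) \<in> borel_measurable (A \<Otimes>\<^sub>M S)"
  proof (rule integral_measurable_kernel[OF _ P'])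
    have "(\<lambda>p. (fst (fst p), snd p)) \<in> (A \<Otimes>\<^sub>M S) \<Otimes>\<^sub>M S \<rightarrow>\<^sub>M A \<Otimes>\<^sub>M S" by measurable
    from measurable_compose[OF this g] show "(\<lambda>(x, y). g (fst x) y) \<in> borel_measurable ((A \<Otimes>\<^sub>M S) \<Otimes>\<^sub>M S)"
      by (simp add: case_prod_beta')
  qed
  then show ?thesis by (simp add: kernel_op_def case_prod_beta')
qed

lemma measurable_kernel_op_pow:
  assumes P: "(\<lambda>(t, w). P t w) \<in> A \<Otimes>\<^sub>M S \<rightarrow>\<^sub>M prob_algebra S"
    and g: "(\<lambda>(t, w). g t w) \<in> borel_measurable (A \<Otimes>\<^sub>M S)"
  shows "(\<lambda>(t, w). (kernel_op (P t) ^^ i) (g t) w) \<in> borel_measurable (A \<Otimes>\<^sub>M S)"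
proof (induction i)
  case (Suc i)
  from measurable_kernel_op[OF P Suc] show ?case by simp
qed (simp add: g)

lemma measurable_avg_op:
  assumes P: "(\<lambda>(t, w). P t w) \<in> A \<Otimes>\<^sub>M S \<rightarrow>\<^sub>M prob_algebra S"
    and g: "(\<lambda>(t, w). g t w) \<in> borel_measurable (A \<Otimes>\<^sub>M S)"
  shows "(\<lambda>(t, w). (avg_op (kernel_op (P t)) n N ^^ m) (g t) w) \<in> borel_measurable (A \<Otimes>\<^sub>M S)"
proof (induction m)
  case (Suc m)
  show ?case
    using measurable_kernel_op_pow[OF P Suc]
    by (simp add: avg_op_def case_prod_beta') 
qed (simp add: g)

lemma measurable_poisson_sol:
  assumes P: "(\<lambda>(t, w). P t w) \<in> A \<Otimes>\<^sub>M S \<rightarrow>\<^sub>M prob_algebra S"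
    and g: "(\<lambda>(t, w). g t w) \<in> borel_measurable (A \<Otimes>\<^sub>M S)" and x0: "x0 \<in> space S"
  shows "(\<lambda>(t, w). poisson_sol (kernel_op (P t)) n N x0 (g t) w) \<in> borel_measurable (A \<Otimes>\<^sub>M S)"
proof -
  have Q[measurable]: "(\<lambda>p. (avg_op (kernel_op (P (fst p))) n N ^^ m) (g (fst p)) (snd p)) \<in> borel_measurable (A \<Otimes>\<^sub>M S)" for m
    using measurable_avg_op[OF P g] by (simp add: case_prod_beta')
  have "(\<lambda>p. (fst p, x0)) \<in> A \<Otimes>\<^sub>M S \<rightarrow>\<^sub>M A \<Otimes>\<^sub>M S" using x0 by measurable
  from measurable_compose[OF this Q]
  have [measurable]: "(\<lambda>p. (avg_op (kernel_op (P (fst p))) n N ^^ m) (g (fst p)) x0) \<in> borel_measurable (A \<Otimes>\<^sub>M S)" for m by simp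
  have "(\<lambda>(t, w). (\<Sum>m. (avg_op (kernel_op (P t)) n N ^^ m) (g t) w - avg_limit (kernel_op (P t)) n N x0 (g t))) \<in> borel_measurable (A \<Otimes>\<^sub>M S)"
    unfolding avg_limit_def case_prod_beta' by measurable
  from measurable_kernel_op_pow[OF P this] show ?thesis
    by (simp add: poisson_sol_def potential_op_def case_prod_beta')
qed

lemma measurable_section:
  "(\<lambda>(t, w). f t w) \<in> A \<Otimes>\<^sub>M S \<rightarrow>\<^sub>M B \<Longrightarrow> t \<in> space A \<Longrightarrow> f t \<in> S \<rightarrow>\<^sub>M B"
  using measurable_compose[OF measurable_Pair1'[of t A S], of "\<lambda>(t, w). f t w" B] by simp

text \<open>The solutions are built coordinatewise and normalized to vanish at a point \<open>x0\<close>, so that bounds on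
oscillations are bounds on values.  For two parameters the difference of the solutions solves the
Poisson equation of the first kernel whose right-hand side consists of \<open>F t - F t'\<close> and of the difference of
the two kernels applied to the second solution; both are Lipschitz in the parameter.\<close>

theorem uniform_poisson_equation:
  fixes \<Theta> :: "'a::euclidean_space set" and \<W> :: "'b::euclidean_space set"
    and F :: "'a \<Rightarrow> 'b \<Rightarrow> 'a" and P :: "'a \<Rightarrow> 'b \<Rightarrow> 'b measure"
  assumes W_borel: "\<W> \<in> sets borel"
    and F_meas: "(\<lambda>(t, w). F t w) \<in> borel_on \<Theta> \<Otimes>\<^sub>M borel_on \<W> \<rightarrow>\<^sub>M borel"
    and P_kernel: "(\<lambda>(t, w). P t w) \<in> borel_on \<Theta> \<Otimes>\<^sub>M borel_on \<W> \<rightarrow>\<^sub>M prob_algebra (borel_on \<W>)"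
    and erg: "ergodicity \<Theta> \<W> P"
    and LP: "0 < LP" "\<And>t t' w f. t \<in> \<Theta> \<Longrightarrow> t' \<in> \<Theta> \<Longrightarrow> w \<in> \<W> \<Longrightarrow> f \<in> borel_measurable (borel_on \<W>) \<Longrightarrow> (\<forall>y\<in>\<W>. \<bar>f y\<bar> \<le> U 1 y) \<Longrightarrow>
            \<bar>(\<integral>y. f y \<partial>P t w) - (\<integral>y. f y \<partial>P t' w)\<bar> \<le> LP * U 1 w * norm (t - t')"
    and LF: "0 < LF" "\<And>t t' w. t \<in> \<Theta> \<Longrightarrow> t' \<in> \<Theta> \<Longrightarrow> w \<in> \<W> \<Longrightarrow> norm (F t w - F t' w) \<le> LF * (1 + norm w) * norm (t - t')"
    and CF: "0 < CF" "\<And>t w. t \<in> \<Theta> \<Longrightarrow> w \<in> \<W> \<Longrightarrow> norm (F t w) \<le> CF * (1 + norm w)"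
  obtains u Cu where "0 < Cu"
    "(\<lambda>(t, w). u t w) \<in> borel_on \<Theta> \<Otimes>\<^sub>M borel_on \<W> \<rightarrow>\<^sub>M (borel :: 'a measure)"
    "\<And>t w. t \<in> \<Theta> \<Longrightarrow> w \<in> \<W> \<Longrightarrow> norm (u t w) \<le> Cu * lyap w"
    "\<And>t t' w. t \<in> \<Theta> \<Longrightarrow> t' \<in> \<Theta> \<Longrightarrow> w \<in> \<W> \<Longrightarrow> norm (u t w - u t' w) \<le> Cu * lyap w * norm (t - t')"
    "\<And>t t' w. t \<in> \<Theta> \<Longrightarrow> t' \<in> \<Theta> \<Longrightarrow> w \<in> \<W> \<Longrightarrow> integrable (P t w) (u t')"
    "\<And>t w. t \<in> \<Theta> \<Longrightarrow> w \<in> \<W> \<Longrightarrow> u t w - (\<integral>y. u t y \<partial>P t w) = F t w - mean_field (borel_on \<W>) P F t"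
proof -
  let ?S = "borel_on \<W>" and ?V = "lyap :: 'b \<Rightarrow> real"
  obtain N W0 eps \<phi> \<rho> b where N: "0 < N" and W0: "W0 \<in> sets ?S" "W0 \<noteq> {}" and eps: "0 < eps"
    and phi: "\<phi> \<in> space (prob_algebra ?S)"
    and minor': "\<forall>t\<in>\<Theta>. \<forall>w\<in>W0. \<forall>E\<in>sets ?S. measure (kernel_iter ?S (P t) N w) E \<ge> eps * measure \<phi> E"
    and rho: "0 \<le> \<rho>" "\<rho> < 1" and b: "0 \<le> b"
    and drift': "\<forall>t\<in>\<Theta>. \<forall>w\<in>\<W>. (\<integral>\<^sup>+y. ennreal (U 2 y) \<partial>P t w) \<le> ennreal (\<rho> * U 2 w + b * indicator W0 w)"
    using erg unfolding ergodicity_def by (elim exE conjE) (rule that)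
  have minor: "eps * measure \<phi> E \<le> measure (kernel_iter ?S (P t) N w) E" if "t \<in> \<Theta>" "w \<in> W0" "E \<in> sets ?S" for t w E
    using minor' that by blast
  have drift: "(\<integral>\<^sup>+y. ennreal (U 2 y) \<partial>P t w) \<le> ennreal (\<rho> * U 2 w + b * indicator W0 w)" if "t \<in> \<Theta>" "w \<in> \<W>" for t w
    using drift' that by blast
  define lam where "lam = sqrt \<rho>"
  define b' where "b' = sqrt b"
  have lam: "0 \<le> lam" "lam < 1" and b': "0 \<le> b'" using rho b by (auto simp: lam_def b'_def)
  have W0sub: "W0 \<subseteq> \<W>" using sets.sets_into_space[OF W0(1)] by simp
  obtain x0 where "x0 \<in> W0" using W0 by auto
  then have x0: "x0 \<in> space ?S" using W0sub by auto
  have Vm: "?V \<in> borel_measurable ?S" by (intro measurable_restrict_space1) simp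
  have V1: "\<And>x. x \<in> space ?S \<Longrightarrow> 1 \<le> ?V x" by (rule lyap_ge_1)
  have Pt: "P t \<in> ?S \<rightarrow>\<^sub>M prob_algebra ?S" if "t \<in> \<Theta>" for t
    using measurable_section[OF P_kernel] that by simp
  have driftV: "(\<integral>\<^sup>+y. ennreal (?V y) \<partial>P t w) \<le> ennreal (lam * ?V w + b' * indicator W0 w)"
    if t: "t \<in> \<Theta>" and w: "w \<in> space ?S" for t w
    unfolding lam_def b'_def
  proof (rule sqrt_drift)
    note Pk = prob_kernelD[OF Pt[OF t] w]
    show "prob_space (P t w)" by (rule Pk)
    show "?V \<in> borel_measurable (P t w)" using Vm by (simp cong: measurable_cong_sets add: Pk)
    show "(\<integral>\<^sup>+y. ennreal ((?V y)\<^sup>2) \<partial>P t w) \<le> ennreal (\<rho> * (?V w)\<^sup>2 + b * indicator W0 w)"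
      using drift[OF t, of w] w by (simp add: lyap_sq)
  qed (use rho b lyap_ge_1 order_trans[OF zero_le_one lyap_ge_1] in \<open>auto simp: indicator_def\<close>)
  define L where "L = 1 + b' / (1 - lam)"
  have L0: "0 \<le> L" using lam b' by (simp add: L_def)
  have Lle: "lam + b' \<le> L"
  proof -
    have "b' * (1 - lam) \<le> b'" using lam b' by (intro mult_left_le) auto
    then have "b' \<le> b' / (1 - lam)" using lam by (simp add: le_divide_eq)
    then show ?thesis using lam by (simp add: L_def)
  qed
  have mk: "markov_kernel ?S ?V (P t) l" if t: "t \<in> \<Theta>" and l: "lam + b' \<le> l" for t l
  proof
    show "0 \<le> l" using lam b' l by simp
    fix x assume x: "x \<in> space ?S"
    have "lam * ?V x + b' * indicator W0 x \<le> lam * ?V x + b' * ?V x"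
      using b' lyap_ge_1[of x] by (intro add_left_mono mult_left_mono) (auto simp: indicator_def)
    also have "\<dots> \<le> l * ?V x" using mult_right_mono[OF l, of "?V x"] lyap_ge_1[of x] by (simp add: distrib_right)
    finally show "(\<integral>\<^sup>+y. ennreal (?V y) \<partial>P t x) \<le> ennreal (l * ?V x)"
      by (intro order_trans[OF driftV[OF t x]] ennreal_leI)
  qed (use Pt[OF t] Vm V1 in auto)
  have dop: "drift_operator ?S ?V (kernel_op (P t)) lam b' eps N W0 (\<lambda>f. \<integral>x. f x \<partial>\<phi>)" if t: "t \<in> \<Theta>" for t
    by (rule drift_operatorI[OF mk[OF t order_refl] lam b' eps N driftV[OF t] phi _ W0(2) minor[OF t]])
      (use W0sub in auto)
  obtain n C \<gamma> where C: "0 < C" and \<gamma>: "0 \<le> \<gamma>" "\<gamma> < 1" and contr: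
    "\<And>S (V :: 'b \<Rightarrow> real) T N W0 ph f a m x y. drift_operator S V T lam b' eps N W0 ph \<Longrightarrow> f \<in> borel_measurable S \<Longrightarrow>
       (\<And>x. x \<in> space S \<Longrightarrow> \<bar>f x\<bar> \<le> a * V x) \<Longrightarrow> x \<in> space S \<Longrightarrow> y \<in> space S \<Longrightarrow>
       \<bar>(avg_op T n N ^^ m) f x - (avg_op T n N ^^ m) f y\<bar> \<le> C * \<gamma> ^ m * a * (V x + V y)"
  proof (rule harris_constants[OF lam b' eps])
    fix C \<gamma> :: real and n
    assume 1: "0 < C" "0 \<le> \<gamma>" "\<gamma> < 1" and 2:
     "\<And>S (V :: 'b \<Rightarrow> real) T N W0 ph f a m x y. drift_operator S V T lam b' eps N W0 ph \<Longrightarrow> f \<in> borel_measurable S \<Longrightarrow>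
       (\<And>x. x \<in> space S \<Longrightarrow> \<bar>f x\<bar> \<le> a * V x) \<Longrightarrow> x \<in> space S \<Longrightarrow> y \<in> space S \<Longrightarrow>
       \<bar>(avg_op T n N ^^ m) f x - (avg_op T n N ^^ m) f y\<bar> \<le> C * \<gamma> ^ m * a * (V x + V y)"
    show thesis by (rule that[of C \<gamma> n, OF 1]) (rule 2)
  qed
  have ek: "ergodic_kernel ?S ?V (P t) L n N C \<gamma> x0" if t: "t \<in> \<Theta>" for t
  proof -
    interpret markov_kernel ?S ?V "P t" L by (rule mk[OF t Lle])
    show ?thesis
    proof
      show "x0 \<in> space ?S" "0 < C" "0 \<le> \<gamma>" "\<gamma> < 1" by fact+
      show "(kernel_op (P t) ^^ i) ?V x \<le> L * ?V x" if "x \<in> space ?S" for i x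
        unfolding L_def by (rule drift_operator.pow_V_bound[OF dop[OF t] that])
    qed (rule contr[OF dop[OF t]])
  qed
  define Mc where "Mc = C * L * real (n + N) / (1 - \<gamma>)"
  have Mc: "0 \<le> Mc" using C L0 \<gamma> by (simp add: Mc_def)
  define Vx where "Vx = 1 + ?V x0"
  have Vx: "1 \<le> Vx" using lyap_ge_1[of x0] by (simp add: Vx_def)
  have Vsum: "?V w + ?V x0 \<le> Vx * ?V w" for w
    using mult_left_mono[OF lyap_ge_1[of w], of "?V x0"] lyap_ge_1[of x0] by (simp add: Vx_def algebra_simps)
  define us where "us i t = (\<lambda>w. poisson_sol (kernel_op (P t)) n N x0 (\<lambda>w. F t w \<bullet> i) w
      - poisson_sol (kernel_op (P t)) n N x0 (\<lambda>w. F t w \<bullet> i) x0)" for i t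
  have Ft: "F t \<in> borel_measurable ?S" if "t \<in> \<Theta>" for t using measurable_section[OF F_meas] that by simp
  have Fi: "(\<lambda>w. F t w \<bullet> i) \<in> borel_measurable ?S" if "t \<in> \<Theta>" for t i using Ft[OF that] by measurable
  have Fb: "\<bar>F t w \<bullet> i\<bar> \<le> (2 * CF) * ?V w" if "t \<in> \<Theta>" "w \<in> space ?S" "i \<in> Basis" for t w i
  proof -
    have "\<bar>F t w \<bullet> i\<bar> \<le> CF * (1 + norm w)" using order_trans[OF Basis_le_norm[OF that(3)] CF(2)[OF that(1)]] that by simp
    also have "\<dots> \<le> CF * (2 * ?V w)" using CF(1) le_lyap[of w] by (intro mult_left_mono) auto
    finally show ?thesis by simp
  qed
  have FV: "(\<lambda>w. F t w \<bullet> i) \<in> weighted ?S ?V" if "t \<in> \<Theta>" "i \<in> Basis" for t i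
    by (rule weightedI[OF Fi[OF that(1)] Fb[OF that(1) _ that(2)]])
  have us_m: "(\<lambda>(t, w). us i t w) \<in> borel_measurable (borel_on \<Theta> \<Otimes>\<^sub>M ?S)" for i
  proof -
    have "(\<lambda>(t, w). F t w \<bullet> i) \<in> borel_measurable (borel_on \<Theta> \<Otimes>\<^sub>M ?S)"
      using F_meas by (simp add: case_prod_beta')
    from measurable_poisson_sol[OF P_kernel this x0, of n N]
    have 1: "(\<lambda>p. poisson_sol (kernel_op (P (fst p))) n N x0 (\<lambda>w. F (fst p) w \<bullet> i) (snd p)) \<in> borel_measurable (borel_on \<Theta> \<Otimes>\<^sub>M ?S)"
      by (simp add: case_prod_beta')
    have "(\<lambda>p. (fst p, x0)) \<in> borel_on \<Theta> \<Otimes>\<^sub>M ?S \<rightarrow>\<^sub>M borel_on \<Theta> \<Otimes>\<^sub>M ?S" using x0 by measurable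
    from measurable_compose[OF this 1] 1 show ?thesis by (simp add: us_def case_prod_beta')
  qed
  have us_weighted: "us i t \<in> weighted ?S ?V" and us_eq: "\<And>w. w \<in> space ?S \<Longrightarrow> us i t w - kernel_op (P t) (us i t) w = F t w \<bullet> i - avg_limit (kernel_op (P t)) n N x0 (\<lambda>w. F t w \<bullet> i)"
    if t: "t \<in> \<Theta>" and i: "i \<in> Basis" for i t
  proof -
    interpret ergodic_kernel ?S ?V "P t" L n N C \<gamma> x0 by (rule ek[OF t])
    note ps = poisson_solves[OF FV[OF t i]]
    show "us i t \<in> weighted ?S ?V" unfolding us_def by (intro weighted_diff ps const_weighted)
    show "\<And>w. w \<in> space ?S \<Longrightarrow> us i t w - kernel_op (P t) (us i t) w = F t w \<bullet> i - avg_limit (kernel_op (P t)) n N x0 (\<lambda>w. F t w \<bullet> i)"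
      unfolding us_def using ps(2) by (simp add: T_diff[OF ps(1) const_weighted] T_const)
  qed
  define A where "A = 2 * CF * Mc * Vx + 1"
  have A: "0 < A" using CF Mc Vx by (auto simp: A_def intro!: add_nonneg_pos)
  have us_bd: "\<bar>us i t w\<bar> \<le> A * ?V w" if t: "t \<in> \<Theta>" and i: "i \<in> Basis" and w: "w \<in> space ?S" for i t w
  proof -
    interpret ergodic_kernel ?S ?V "P t" L n N C \<gamma> x0 by (rule ek[OF t])
    have "\<bar>us i t w - us i t x0\<bar> \<le> (2 * CF) * (C * L * real (n + N) / (1 - \<gamma>)) * (?V w + ?V x0)"
      by (rule poisson_oscillation[OF us_weighted[OF t i] Fi[OF t] Fb[OF t _ i] us_eq[OF t i] w x0])
    also have "\<dots> \<le> (2 * CF) * Mc * (Vx * ?V w)"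
      using CF Mc Vsum by (simp only: Mc_def[symmetric]) (intro mult_left_mono, auto)
    also have "\<dots> \<le> A * ?V w" using lyap_ge_1[of w] by (simp add: A_def algebra_simps)
    finally show ?thesis by (simp add: us_def)
  qed
  define A' where "A' = (2 * LF + 2 * A * LP) * Mc * Vx"
  have A': "0 \<le> A'" using LF LP A Mc Vx by (simp add: A'_def)
  have us_lip: "\<bar>us i t w - us i t' w\<bar> \<le> A' * ?V w * norm (t - t')"
    if t: "t \<in> \<Theta>" and t': "t' \<in> \<Theta>" and i: "i \<in> Basis" and w: "w \<in> space ?S" for i t t' w
  proof -
    interpret ergodic_kernel ?S ?V "P t" L n N C \<gamma> x0 by (rule ek[OF t])
    interpret t': ergodic_kernel ?S ?V "P t'" L n N C \<gamma> x0 by (rule ek[OF t'])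
    define d where "d w = us i t w - us i t' w" for w
    define g where "g w = (F t w \<bullet> i - F t' w \<bullet> i) + (kernel_op (P t) (us i t') w - kernel_op (P t') (us i t') w)" for w
    have dV: "d \<in> weighted ?S ?V" unfolding d_def by (intro weighted_diff us_weighted t t' i)
    have gm: "g \<in> borel_measurable ?S"
      unfolding g_def using Fi[OF t] Fi[OF t'] T_meas[OF us_weighted[OF t' i]] t'.T_meas[OF us_weighted[OF t' i]]
      by (intro borel_measurable_add borel_measurable_diff)
    have gb: "\<bar>g w\<bar> \<le> ((2 * LF + 2 * A * LP) * norm (t - t')) * ?V w" if w: "w \<in> space ?S" for w
    proof -
      have 1: "\<bar>F t w \<bullet> i - F t' w \<bullet> i\<bar> \<le> LF * (1 + norm w) * norm (t - t')"
        using Basis_le_norm[OF i, of "F t w - F t' w"] LF(2)[OF t t', of w] w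
        by (simp add: inner_diff_left)
      have "\<bar>(\<integral>y. us i t' y / A \<partial>P t w) - (\<integral>y. us i t' y / A \<partial>P t' w)\<bar> \<le> LP * U 1 w * norm (t - t')"
      proof (rule LP(2)[OF t t'])
        show "(\<lambda>y. us i t' y / A) \<in> borel_measurable ?S" using weighted_measurable[OF us_weighted[OF t' i]] by measurable
        show "\<forall>y\<in>\<W>. \<bar>us i t' y / A\<bar> \<le> U 1 y"
        proof
          fix y assume "y \<in> \<W>"
          then have "\<bar>us i t' y\<bar> \<le> A * ?V y" using us_bd[OF t' i] by simp
          also have "\<dots> \<le> A * U 1 y" using A lyap_le[of y] by (intro mult_left_mono) (auto simp: U_def)
          finally show "\<bar>us i t' y / A\<bar> \<le> U 1 y" using A by (simp add: divide_le_eq mult.commute)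
        qed
      qed (use w in simp)
      then have "\<bar>kernel_op (P t) (us i t') w - kernel_op (P t') (us i t') w\<bar> / A \<le> LP * (1 + norm w) * norm (t - t')"
        using A by (simp add: kernel_op_def U_def diff_divide_distrib[symmetric])
      then have 2: "\<bar>kernel_op (P t) (us i t') w - kernel_op (P t') (us i t') w\<bar> \<le> A * LP * (1 + norm w) * norm (t - t')"
        using A by (simp add: divide_le_eq mult_ac)
      have "\<bar>g w\<bar> \<le> ((LF + A * LP) * norm (t - t')) * (1 + norm w)"
        unfolding g_def using 1 2 by (simp add: algebra_simps)
      also have "\<dots> \<le> ((LF + A * LP) * norm (t - t')) * (2 * ?V w)"
        using le_lyap[of w] LF LP A by (intro mult_left_mono) auto
      finally show ?thesis by (simp add: algebra_simps)
    qed
    have deq: "d w - kernel_op (P t) d w = g w - (avg_limit (kernel_op (P t)) n N x0 (\<lambda>w. F t w \<bullet> i) - avg_limit (kernel_op (P t')) n N x0 (\<lambda>w. F t' w \<bullet> i))"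
      if w: "w \<in> space ?S" for w
    proof -
      have "kernel_op (P t) d w = kernel_op (P t) (us i t) w - kernel_op (P t) (us i t') w"
        unfolding d_def by (intro T_diff us_weighted t t' i w)
      then show ?thesis using us_eq[OF t i w] us_eq[OF t' i w] by (simp add: d_def g_def)
    qed
    have "\<bar>d w - d x0\<bar> \<le> ((2 * LF + 2 * A * LP) * norm (t - t')) * (C * L * real (n + N) / (1 - \<gamma>)) * (?V w + ?V x0)"
      by (rule poisson_oscillation[OF dV gm gb deq w x0])
    also have "\<dots> \<le> ((2 * LF + 2 * A * LP) * norm (t - t')) * Mc * (Vx * ?V w)"
      using LF LP A Mc Vsum by (simp only: Mc_def[symmetric]) (intro mult_left_mono, auto)
    also have "\<dots> = A' * ?V w * norm (t - t')" by (simp add: A'_def)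
    finally show ?thesis by (simp add: us_def d_def)
  qed
  \<comment> \<open>The solution with coordinates \<open>us i\<close>; passing from coordinates to norms costs the dimension \<open>D\<close>.\<close>
  define u where "u t w = (\<Sum>i\<in>Basis. us i t w *\<^sub>R i)" for t w
  define D where "D = real DIM('a)"
  have D: "0 < D" by (simp add: D_def)
  have norm_le: "norm (\<Sum>i\<in>Basis. c i *\<^sub>R i :: 'a) \<le> D * B" if "\<And>i. i \<in> Basis \<Longrightarrow> \<bar>c i\<bar> \<le> B" for c :: "'a \<Rightarrow> real" and B
  proof -
    have "norm (\<Sum>i\<in>Basis. c i *\<^sub>R i :: 'a) \<le> (\<Sum>i\<in>(Basis :: 'a set). B)"
      using that by (intro sum_norm_le) auto
    then show ?thesis by (simp add: D_def)
  qed
  have us_int: "integrable (P t w) (us i t')" if "t \<in> \<Theta>" "t' \<in> \<Theta>" "w \<in> \<W>" "i \<in> Basis" for t t' w i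
    using markov_kernel.K_integrable[OF mk[OF that(1) Lle] us_weighted[OF that(2,4)]] that by simp
  show ?thesis
  proof (rule that[of "D * (A + A')" u])
    show "0 < D * (A + A')" using D A A' by simp
    show "(\<lambda>(t, w). u t w) \<in> borel_on \<Theta> \<Otimes>\<^sub>M borel_on \<W> \<rightarrow>\<^sub>M borel"
      using us_m unfolding u_def by (simp add: case_prod_beta')
    fix t w assume t: "t \<in> \<Theta>" and w: "w \<in> \<W>"
    have "norm (u t w) \<le> D * (A * ?V w)" unfolding u_def using us_bd[OF t _, of _ w] w by (intro norm_le) auto
    also have "\<dots> \<le> D * ((A + A') * ?V w)" using D A' lyap_ge_1[of w] by (intro mult_left_mono mult_right_mono) auto
    finally show "norm (u t w) \<le> D * (A + A') * ?V w" by simp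
    show "integrable (P t w) (u t')" if "t' \<in> \<Theta>" for t'
      unfolding u_def using us_int[OF t that w] by (intro Bochner_Integration.integrable_sum integrable_scaleR_left) auto
    show "norm (u t w - u t' w) \<le> D * (A + A') * ?V w * norm (t - t')" if t': "t' \<in> \<Theta>" for t'
    proof -
      have "u t w - u t' w = (\<Sum>i\<in>Basis. (us i t w - us i t' w) *\<^sub>R i)"
        by (simp add: u_def sum_subtractf scaleR_diff_left)
      also have "norm \<dots> \<le> D * (A' * ?V w * norm (t - t'))" using us_lip[OF t t' _, of _ w] w by (intro norm_le) auto
      also have "\<dots> \<le> D * ((A + A') * ?V w * norm (t - t'))"
        using D A lyap_ge_1[of w] by (intro mult_left_mono mult_right_mono) auto
      finally show ?thesis by (simp add: mult.assoc)
    qed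
    show "u t w - (\<integral>y. u t y \<partial>P t w) = F t w - mean_field (borel_on \<W>) P F t"
    proof (rule euclidean_eqI)
      fix i :: 'a assume i: "i \<in> Basis"
      interpret ergodic_kernel ?S ?V "P t" L n N C \<gamma> x0 by (rule ek[OF t])
      have ui: "u t y \<bullet> i = us i t y" for y unfolding u_def using i by (simp add: inner_sum_left_Basis)
      have u_int: "integrable (P t w) (u t)"
        unfolding u_def using us_int[OF t t w] by (intro Bochner_Integration.integrable_sum integrable_scaleR_left) auto
      have "(\<integral>y. u t y \<partial>P t w) \<bullet> i = (\<integral>y. u t y \<bullet> i \<partial>P t w)"
        using u_int by (intro integral_inner_left[symmetric]) auto
      then have 1: "(\<integral>y. u t y \<partial>P t w) \<bullet> i = kernel_op (P t) (us i t) w" by (simp add: ui kernel_op_def)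
      have F_int: "integrable (stationary_dist ?S (P t)) (F t)"
      proof -
        have "F t = (\<lambda>w. \<Sum>i\<in>Basis. (F t w \<bullet> i) *\<^sub>R i)" by (simp add: euclidean_representation)
        moreover have "integrable (stationary_dist ?S (P t)) (\<lambda>w. \<Sum>i\<in>Basis. (F t w \<bullet> i) *\<^sub>R i)"
          using integral_stationary_dist(1)[OF FV[OF t]]
          by (intro Bochner_Integration.integrable_sum integrable_scaleR_left) auto
        ultimately show ?thesis by simp
      qed
      have "mean_field ?S P F t \<bullet> i = (\<integral>w. F t w \<bullet> i \<partial>stationary_dist ?S (P t))"
        unfolding mean_field_def using F_int by (intro integral_inner_left[symmetric]) auto
      also have "\<dots> = avg_limit (kernel_op (P t)) n N x0 (\<lambda>w. F t w \<bullet> i)" by (rule integral_stationary_dist(2)[OF FV[OF t i]])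
      finally show "(u t w - (\<integral>y. u t y \<partial>P t w)) \<bullet> i = (F t w - mean_field ?S P F t) \<bullet> i"
        using us_eq[OF t i, of w] w by (simp add: inner_diff_left 1 ui)
    qed
  qed
qed

section \<open>Squared distance to a ball along a projected step\<close>

text \<open>\<open>shrink \<eta> x\<close> is \<open>x\<close> minus its projection onto the ball of radius \<open>\<eta>\<close>, half the gradient of the squared
distance to that ball.\<close>

definition shrink :: "real \<Rightarrow> 'a::euclidean_space \<Rightarrow> 'a" where
  "shrink \<eta> x = (if norm x \<le> \<eta> then 0 else (1 - \<eta> / norm x) *\<^sub>R x)"

lemma norm_shrink: "0 \<le> \<eta> \<Longrightarrow> norm (shrink \<eta> x) = max 0 (norm x - \<eta>)"
proof (cases "norm x \<le> \<eta>")
  case False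
  assume \<eta>: "0 \<le> \<eta>"
  have "norm (shrink \<eta> x) = \<bar>1 - \<eta> / norm x\<bar> * norm x" using False by (simp add: shrink_def)
  also have "\<bar>1 - \<eta> / norm x\<bar> = 1 - \<eta> / norm x"
  proof -
    have "0 < norm x" using False \<eta> by linarith
    then have "\<eta> / norm x \<le> 1" using False by (simp add: divide_le_eq)
    then show ?thesis by simp
  qed
  also have "(1 - \<eta> / norm x) * norm x = norm x - \<eta>" using False \<eta> by (cases "x = 0") (auto simp: field_simps)
  finally show ?thesis using False by simp
qed (simp add: shrink_def)

lemma norm_shrink_residual: "0 \<le> \<eta> \<Longrightarrow> norm (x - shrink \<eta> x) \<le> \<eta>"
proof (cases "norm x \<le> \<eta>")
  case False
  assume \<eta>: "0 \<le> \<eta>"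
  have "x - shrink \<eta> x = (\<eta> / norm x) *\<^sub>R x" using False by (simp add: shrink_def scaleR_diff_left)
  then show ?thesis using False \<eta> by simp
qed (simp add: shrink_def)

lemma norm_shrink_le: "0 \<le> \<eta> \<Longrightarrow> norm (shrink \<eta> y) \<le> norm (y - (x - shrink \<eta> x))"
  using norm_shrink_residual[of \<eta> x] norm_triangle_ineq2[of y "x - shrink \<eta> x"]
  by (simp add: norm_shrink)

lemma shrink_closest_point: assumes \<eta>: "0 \<le> \<eta>" shows "x - shrink \<eta> x = closest_point (cball 0 \<eta>) x"
proof (rule closest_point_unique)
  show "x - shrink \<eta> x \<in> cball 0 \<eta>" using norm_shrink_residual[OF \<eta>] by simp
  show "\<forall>z\<in>cball 0 \<eta>. dist x (x - shrink \<eta> x) \<le> dist x z"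
  proof
    fix z :: 'a assume "z \<in> cball 0 \<eta>"
    then show "dist x (x - shrink \<eta> x) \<le> dist x z"
      using norm_triangle_ineq2[of x z] by (simp add: dist_norm norm_shrink[OF \<eta>])
  qed
qed simp_all

lemma shrink_lipschitz: assumes \<eta>: "0 \<le> \<eta>" shows "norm (shrink \<eta> x - shrink \<eta> y) \<le> 2 * norm (x - y)"
proof -
  have "norm ((x - shrink \<eta> x) - (y - shrink \<eta> y)) \<le> norm (x - y)"
    using closest_point_lipschitz[of "cball 0 \<eta>" x y] \<eta> by (simp add: shrink_closest_point dist_norm)
  moreover have "shrink \<eta> x - shrink \<eta> y = (x - y) - ((x - shrink \<eta> x) - (y - shrink \<eta> y))" by simp
  ultimately show ?thesis using norm_triangle_ineq4[of "x - y" "(x - shrink \<eta> x) - (y - shrink \<eta> y)"] by simp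
qed

lemma shrink_scale: assumes \<eta>: "0 \<le> \<eta>" obtains r where "0 \<le> r" "shrink \<eta> x = r *\<^sub>R x"
proof (cases "norm x \<le> \<eta>")
  case True then show ?thesis using that[of 0] by (simp add: shrink_def)
next
  case False
  then have "0 < norm x" using \<eta> by linarith
  then have "\<eta> / norm x \<le> 1" using False by (simp add: divide_le_eq)
  then show ?thesis using False that[of "1 - \<eta> / norm x"] by (simp add: shrink_def)
qed

lemma shrink_measurable[measurable]: "shrink \<eta> \<in> borel_measurable borel"
  unfolding shrink_def[abs_def] by measurable

text \<open>The squared distance is at most the squared distance to the projection \<open>\<rho> e - v\<close> of the previous
point, which expands into \<open>|v|\<^sup>2 + 2 v \<bullet> h + |h|\<^sup>2\<close>.  The vector \<open>v\<close> is parallel to \<open>e\<close>, so \<open>mono\<close> bounds its inner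
product with \<open>fb\<close>; and where \<open>v \<noteq> 0\<close> the point lies outside the ball, so \<open>\<eta> \<le> \<rho> |e|\<close> and the bias is
dominated by the error itself.\<close>

lemma distance_descent:
  fixes e :: "'a::euclidean_space"
  assumes \<rho>: "0 < \<rho>" "\<rho> \<le> \<rho>'" and \<eta>: "0 \<le> \<eta>" and \<alpha>: "0 \<le> \<alpha>" and \<zeta>: "0 \<le> \<zeta>" and \<epsilon>: "0 \<le> \<epsilon>"
    and proj: "norm e' \<le> norm (e + \<alpha> *\<^sub>R (f + m + b))"
    and mono: "e \<bullet> fb \<le> - \<zeta> * (norm e)\<^sup>2"
    and bias: "\<rho>' * norm b \<le> \<epsilon> * \<eta>" and q: "0 \<le> q" "q \<le> (\<zeta> - \<epsilon>) * \<alpha> - (\<rho>' - \<rho>) / \<rho>"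
  shows "(norm (shrink \<eta> (\<rho>' *\<^sub>R e')))\<^sup>2 \<le> (1 - 2 * q) * (norm (shrink \<eta> (\<rho> *\<^sub>R e)))\<^sup>2
      + 2 * \<rho>' * \<alpha> * (shrink \<eta> (\<rho> *\<^sub>R e) \<bullet> (f - fb)) + 2 * \<rho>' * \<alpha> * (shrink \<eta> (\<rho> *\<^sub>R e) \<bullet> m)
      + (norm ((\<rho>' - \<rho>) *\<^sub>R e + (\<rho>' * \<alpha>) *\<^sub>R (f + m + b)))\<^sup>2"
proof -
  define v where "v = shrink \<eta> (\<rho> *\<^sub>R e)"
  define h where "h = (\<rho>' - \<rho>) *\<^sub>R e + (\<rho>' * \<alpha>) *\<^sub>R (f + m + b)"
  define D where "D = norm v"
  obtain r where r: "0 \<le> r" "v = r *\<^sub>R (\<rho> *\<^sub>R e)" using shrink_scale[OF \<eta>] unfolding v_def by blast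
  have Dr: "D = r * \<rho> * norm e" using r \<rho> by (simp add: D_def)
  have D0: "0 \<le> D" by (simp add: D_def)
  have "norm (shrink \<eta> (\<rho>' *\<^sub>R e')) \<le> norm (shrink \<eta> (\<rho>' *\<^sub>R (e + \<alpha> *\<^sub>R (f + m + b))))"
    using proj \<rho> unfolding norm_shrink[OF \<eta>] by (intro max.mono) (auto intro!: mult_left_mono)
  also have "\<dots> \<le> norm (\<rho>' *\<^sub>R (e + \<alpha> *\<^sub>R (f + m + b)) - (\<rho> *\<^sub>R e - v))"
    unfolding v_def by (rule norm_shrink_le[OF \<eta>])
  also have "\<rho>' *\<^sub>R (e + \<alpha> *\<^sub>R (f + m + b)) - (\<rho> *\<^sub>R e - v) = v + h"
    by (simp add: h_def algebra_simps)
  finally have "(norm (shrink \<eta> (\<rho>' *\<^sub>R e')))\<^sup>2 \<le> (norm (v + h))\<^sup>2" by (intro power_mono) auto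
  also have "\<dots> = D\<^sup>2 + 2 * (v \<bullet> h) + (norm h)\<^sup>2"
    by (simp add: D_def power2_norm_eq_inner inner_add_left inner_add_right inner_commute)
  also have "v \<bullet> h = (\<rho>' - \<rho>) * (v \<bullet> e) + \<rho>' * \<alpha> * (v \<bullet> fb) + \<rho>' * \<alpha> * (v \<bullet> b)
       + \<rho>' * \<alpha> * (v \<bullet> (f - fb)) + \<rho>' * \<alpha> * (v \<bullet> m)"
    by (simp add: h_def inner_add_right inner_diff_right algebra_simps)
  also have "(\<rho>' - \<rho>) * (v \<bullet> e) + \<rho>' * \<alpha> * (v \<bullet> fb) + \<rho>' * \<alpha> * (v \<bullet> b) \<le> - q * D\<^sup>2"
  proof (cases "D = 0")
    case True
    then show ?thesis by (simp add: D_def)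
  next
    case False
    then have "D = \<rho> * norm e - \<eta>" using D0 \<rho> by (auto simp: D_def v_def norm_shrink[OF \<eta>] max_def split: if_splits)
    then have le: "D \<le> \<rho> * norm e" "\<eta> \<le> \<rho> * norm e" using \<eta> D0 by auto
    have ve: "v \<bullet> e = D * norm e"
      by (simp add: r Dr power2_norm_eq_inner[symmetric] power2_eq_square)
    have "v \<bullet> fb = (r * \<rho>) * (e \<bullet> fb)" by (simp add: r)
    also have "\<dots> \<le> (r * \<rho>) * (- \<zeta> * (norm e)\<^sup>2)" using r \<rho> by (intro mult_left_mono mono) auto
    also have "\<dots> = - \<zeta> * (D * norm e)" by (simp add: Dr power2_eq_square)
    finally have vf: "\<rho>' * \<alpha> * (v \<bullet> fb) \<le> \<rho>' * \<alpha> * (- \<zeta> * (D * norm e))" using \<rho> \<alpha> by (intro mult_left_mono) auto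
    have "\<rho> * (\<alpha> * (\<zeta> * (D * norm e))) \<le> \<rho>' * (\<alpha> * (\<zeta> * (D * norm e)))"
      using \<rho> \<alpha> \<zeta> D0 by (intro mult_right_mono) auto
    with vf have vf': "\<rho>' * \<alpha> * (v \<bullet> fb) \<le> - (\<rho> * \<alpha> * \<zeta> * (D * norm e))" by (simp add: mult_ac)
    have "\<rho>' * \<alpha> * (v \<bullet> b) \<le> \<rho>' * \<alpha> * (D * norm b)"
      using \<rho> \<alpha> norm_cauchy_schwarz[of v b] by (intro mult_left_mono) (auto simp: D_def)
    also have "\<dots> = \<alpha> * D * (\<rho>' * norm b)" by simp
    also have "\<dots> \<le> \<alpha> * D * (\<epsilon> * (\<rho> * norm e))"
      using \<alpha> D0 bias \<epsilon> le by (intro mult_left_mono order_trans[OF bias]) auto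
    finally have vb: "\<rho>' * \<alpha> * (v \<bullet> b) \<le> \<alpha> * D * (\<epsilon> * (\<rho> * norm e))" .
    have "(\<rho>' - \<rho>) * (v \<bullet> e) + \<rho>' * \<alpha> * (v \<bullet> fb) + \<rho>' * \<alpha> * (v \<bullet> b)
      \<le> (\<rho>' - \<rho>) * (D * norm e) - (\<rho> * \<alpha> * \<zeta> * (D * norm e)) + \<alpha> * D * (\<epsilon> * (\<rho> * norm e))"
      using vf' vb by (simp add: ve)
    also have "\<dots> = - (((\<zeta> - \<epsilon>) * \<alpha> - (\<rho>' - \<rho>) / \<rho>) * (D * (\<rho> * norm e)))"
      using \<rho> by (simp add: field_simps)
    also have "\<dots> \<le> - (q * (D * (\<rho> * norm e)))"
      using q D0 \<rho> by (intro le_imp_neg_le mult_right_mono) auto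
    also have "\<dots> \<le> - (q * (D * D))"
      using q D0 le by (intro le_imp_neg_le mult_left_mono) auto
    finally show ?thesis by (simp add: power2_eq_square)
  qed
  finally have "(norm (shrink \<eta> (\<rho>' *\<^sub>R e')))\<^sup>2 \<le> (1 - 2 * q) * D\<^sup>2
      + 2 * \<rho>' * \<alpha> * (v \<bullet> (f - fb)) + 2 * \<rho>' * \<alpha> * (v \<bullet> m) + (norm h)\<^sup>2"
    by (simp add: algebra_simps)
  then show ?thesis by (simp only: v_def h_def D_def)
qed

text \<open>The increment splits into three differences: of the gradient, of the coefficient and of the Poisson
solution.  Each gains a factor of order \<open>\<alpha>\<close> over the corrector itself, which makes it of second order
like \<open>|h|\<^sup>2\<close>.  Up to constants, \<open>X\<close> bounds both the update direction and the Poisson solution.\<close>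

lemma corrector_increment:
  fixes e :: "'a::euclidean_space"
  assumes \<rho>: "0 < \<rho>" "\<rho> \<le> \<rho>'" "\<rho>' \<le> 2 * \<rho>" and \<eta>: "0 \<le> \<eta>" and \<alpha>: "0 \<le> \<alpha>"
    and c: "0 \<le> c0" "0 \<le> c1" "0 \<le> c2" "0 \<le> c3" "0 \<le> cu"
    and X: "1 \<le> X" and \<Delta>: "norm e \<le> \<Delta>"
    and g: "norm g \<le> c2 * X" and e': "norm (e' - e) \<le> \<alpha> * (c2 * X)"
    and \<rho>d: "\<rho>' - \<rho> \<le> c0 * (\<rho> * \<alpha>)" and a': "0 \<le> a'" "a' \<le> c3 * (\<rho> * \<alpha>)"
    and ad: "\<bar>a' - 2 * \<rho>' * \<alpha>\<bar> \<le> c1 * (\<rho> * \<alpha> * \<alpha>)"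
    and pu: "norm pu' \<le> cu * X" "norm (pu' - pu) \<le> cu * X * norm (e' - e)"
  shows "a' * (shrink \<eta> (\<rho>' *\<^sub>R e') \<bullet> pu') - 2 * \<rho>' * \<alpha> * (shrink \<eta> (\<rho> *\<^sub>R e) \<bullet> pu)
      + (norm ((\<rho>' - \<rho>) *\<^sub>R e + (\<rho>' * \<alpha>) *\<^sub>R g))\<^sup>2
     \<le> (c3 * (2 * (2 * c2 + c0 * \<Delta>)) * cu + c1 * \<Delta> * cu + 4 * \<Delta> * cu * c2 + (c0 * \<Delta> + 2 * c2)\<^sup>2) * (\<rho> * \<alpha> * X)\<^sup>2"
proof -
  define v where "v = shrink \<eta> (\<rho> *\<^sub>R e)"
  define v' where "v' = shrink \<eta> (\<rho>' *\<^sub>R e')"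
  define Y where "Y = \<rho> * \<alpha> * X"
  have \<Delta>0: "0 \<le> \<Delta>" using \<Delta> norm_ge_zero order_trans by blast
  have Y0: "0 \<le> Y" using \<rho> \<alpha> X by (simp add: Y_def)
  have raY: "\<rho> * \<alpha> \<le> Y" using mult_left_mono[OF X, of "\<rho> * \<alpha>"] \<rho> \<alpha> by (simp add: Y_def)
  have nv: "norm v \<le> \<rho> * \<Delta>"
  proof -
    have "norm v \<le> \<rho> * norm e" using \<eta> \<rho> by (simp add: v_def norm_shrink)
    also have "\<dots> \<le> \<rho> * \<Delta>" using \<Delta> \<rho> by (intro mult_left_mono) auto
    finally show ?thesis .
  qed
  have de: "(\<rho>' - \<rho>) * norm e \<le> c0 * \<Delta> * Y"
  proof -
    have "(\<rho>' - \<rho>) * norm e \<le> (c0 * (\<rho> * \<alpha>)) * \<Delta>" using \<rho> \<rho>d \<Delta> c \<alpha> by (intro mult_mono) auto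
    also have "\<dots> \<le> (c0 * Y) * \<Delta>" using raY c \<Delta>0 by (intro mult_right_mono mult_left_mono) auto
    finally show ?thesis by (simp add: mult_ac)
  qed
  have \<rho>'Y: "\<rho>' * (\<alpha> * (c2 * X)) \<le> 2 * c2 * Y"
  proof -
    have "\<rho>' * (\<alpha> * (c2 * X)) \<le> (2 * \<rho>) * (\<alpha> * (c2 * X))" using \<rho> \<alpha> c X by (intro mult_right_mono) auto
    then show ?thesis by (simp add: Y_def mult_ac)
  qed
  have h: "norm ((\<rho>' - \<rho>) *\<^sub>R e + (\<rho>' * \<alpha>) *\<^sub>R g) \<le> (c0 * \<Delta> + 2 * c2) * Y"
  proof -
    have "norm ((\<rho>' - \<rho>) *\<^sub>R e + (\<rho>' * \<alpha>) *\<^sub>R g) \<le> (\<rho>' - \<rho>) * norm e + \<rho>' * \<alpha> * norm g"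
      using \<rho> \<alpha> by (intro order_trans[OF norm_triangle_ineq]) (simp add: abs_mult)
    also have "\<rho>' * \<alpha> * norm g \<le> \<rho>' * \<alpha> * (c2 * X)" using \<rho> \<alpha> g by (intro mult_left_mono) auto
    finally show ?thesis using de \<rho>'Y by (simp add: algebra_simps)
  qed
  have h2: "(norm ((\<rho>' - \<rho>) *\<^sub>R e + (\<rho>' * \<alpha>) *\<^sub>R g))\<^sup>2 \<le> (c0 * \<Delta> + 2 * c2)\<^sup>2 * Y\<^sup>2"
    unfolding power_mult_distrib[symmetric] by (rule power_mono[OF h]) simp
  have excess: "norm (v' - v) \<le> 2 * (2 * c2 + c0 * \<Delta>) * Y"
  proof -
    have "norm (v' - v) \<le> 2 * norm (\<rho>' *\<^sub>R e' - \<rho> *\<^sub>R e)" unfolding v_def v'_def by (rule shrink_lipschitz[OF \<eta>])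
    also have "\<rho>' *\<^sub>R e' - \<rho> *\<^sub>R e = \<rho>' *\<^sub>R (e' - e) + (\<rho>' - \<rho>) *\<^sub>R e" by (simp add: algebra_simps)
    also have "norm \<dots> \<le> \<rho>' * norm (e' - e) + (\<rho>' - \<rho>) * norm e"
      using \<rho> by (intro order_trans[OF norm_triangle_ineq]) simp
    also have "\<rho>' * norm (e' - e) \<le> \<rho>' * (\<alpha> * (c2 * X))" using \<rho> e' by (intro mult_left_mono) auto
    finally show ?thesis using de \<rho>'Y by (simp add: algebra_simps)
  qed
  have eq: "a' * (v' \<bullet> pu') - 2 * \<rho>' * \<alpha> * (v \<bullet> pu)
     = a' * ((v' - v) \<bullet> pu') + (a' - 2 * \<rho>' * \<alpha>) * (v \<bullet> pu') + 2 * \<rho>' * \<alpha> * (v \<bullet> (pu' - pu))"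
    by (simp add: inner_diff_left inner_diff_right algebra_simps)
  have t1: "a' * ((v' - v) \<bullet> pu') \<le> c3 * (2 * (2 * c2 + c0 * \<Delta>)) * cu * Y\<^sup>2"
  proof -
    have "(v' - v) \<bullet> pu' \<le> norm (v' - v) * norm pu'" by (rule norm_cauchy_schwarz)
    also have "\<dots> \<le> (2 * (2 * c2 + c0 * \<Delta>) * Y) * (cu * X)"
      using excess pu(1) c \<Delta>0 Y0 by (intro mult_mono) auto
    finally have "a' * ((v' - v) \<bullet> pu') \<le> a' * ((2 * (2 * c2 + c0 * \<Delta>) * Y) * (cu * X))" by (rule mult_left_mono) fact
    also have "\<dots> \<le> (c3 * (\<rho> * \<alpha>)) * ((2 * (2 * c2 + c0 * \<Delta>) * Y) * (cu * X))"
      using a' c \<Delta>0 Y0 X by (intro mult_right_mono) auto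
    finally show ?thesis by (simp add: Y_def power2_eq_square mult_ac)
  qed
  have t2: "(a' - 2 * \<rho>' * \<alpha>) * (v \<bullet> pu') \<le> c1 * \<Delta> * cu * Y\<^sup>2"
  proof -
    have "(a' - 2 * \<rho>' * \<alpha>) * (v \<bullet> pu') \<le> \<bar>a' - 2 * \<rho>' * \<alpha>\<bar> * \<bar>v \<bullet> pu'\<bar>" by (metis abs_ge_self abs_mult)
    also have "\<dots> \<le> (c1 * (\<rho> * \<alpha> * \<alpha>)) * ((\<rho> * \<Delta>) * (cu * X))"
    proof (intro mult_mono ad)
      have "\<bar>v \<bullet> pu'\<bar> \<le> norm v * norm pu'" by (rule Cauchy_Schwarz_ineq2)
      also have "\<dots> \<le> (\<rho> * \<Delta>) * (cu * X)" using nv pu(1) \<rho> \<Delta>0 by (intro mult_mono) auto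
      finally show "\<bar>v \<bullet> pu'\<bar> \<le> (\<rho> * \<Delta>) * (cu * X)" .
    qed (use c \<rho> \<alpha> in auto)
    also have "\<dots> = (c1 * \<Delta> * cu) * ((\<rho> * \<alpha>) * Y)" by (simp add: Y_def mult_ac)
    also have "\<dots> \<le> (c1 * \<Delta> * cu) * (Y * Y)" using raY c \<Delta>0 Y0 by (intro mult_left_mono mult_right_mono) auto
    finally show ?thesis by (simp add: power2_eq_square)
  qed
  have t3: "2 * \<rho>' * \<alpha> * (v \<bullet> (pu' - pu)) \<le> 4 * \<Delta> * cu * c2 * Y\<^sup>2"
  proof -
    have "v \<bullet> (pu' - pu) \<le> norm v * norm (pu' - pu)" by (rule norm_cauchy_schwarz)
    also have "\<dots> \<le> (\<rho> * \<Delta>) * (cu * X * (\<alpha> * (c2 * X)))"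
    proof (intro mult_mono nv)
      have "cu * X * norm (e' - e) \<le> cu * X * (\<alpha> * (c2 * X))" using c X by (intro mult_left_mono e') auto
      then show "norm (pu' - pu) \<le> cu * X * (\<alpha> * (c2 * X))" using pu(2) by linarith
    qed (use \<rho> \<Delta>0 in auto)
    finally have "2 * \<rho>' * \<alpha> * (v \<bullet> (pu' - pu)) \<le> 2 * \<rho>' * \<alpha> * ((\<rho> * \<Delta>) * (cu * X * (\<alpha> * (c2 * X))))"
      using \<rho> \<alpha> by (intro mult_left_mono) auto
    also have "\<dots> \<le> 2 * (2 * \<rho>) * \<alpha> * ((\<rho> * \<Delta>) * (cu * X * (\<alpha> * (c2 * X))))"
      using \<rho> \<alpha> c \<Delta>0 X by (intro mult_right_mono mult_left_mono) auto
    finally show ?thesis by (simp add: Y_def power2_eq_square mult_ac)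
  qed
  show ?thesis
    using t1 t2 t3 h2 unfolding v_def[symmetric] v'_def[symmetric] eq Y_def[symmetric]
    by (simp only: distrib_right)
qed

section \<open>Sequences with polynomial step sizes\<close>

lemma powr_le_affine: fixes y p :: real assumes "0 < y" "0 \<le> p" "p \<le> 1" shows "y powr p \<le> 1 + p * (y - 1)"
  using Youngs_inequality_0[of p "1 - p" y 1] assms by (simp add: algebra_simps)

lemma powr_Suc_upper: fixes p :: real assumes "1 \<le> k" "0 \<le> p" "p \<le> 1"
  shows "real (Suc k) powr p \<le> (1 + p / real k) * real k powr p"
proof -
  have k: "0 < real k" using assms by simp
  have "real (Suc k) powr p = ((1 + 1 / real k) * real k) powr p" using k by (simp add: distrib_right add.commute)
  also have "\<dots> = (1 + 1 / real k) powr p * real k powr p" using k by (subst powr_mult) (auto simp: field_simps)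
  also have "\<dots> \<le> (1 + p * ((1 + 1 / real k) - 1)) * real k powr p"
    using k assms by (intro mult_right_mono powr_le_affine) (auto simp: field_simps)
  finally show ?thesis by simp
qed

lemma powr_Suc_neg_lower: fixes p :: real assumes "1 \<le> k" "0 \<le> p" "p \<le> 1"
  shows "(1 - p / real k) * real k powr (- p) \<le> real (Suc k) powr (- p)"
proof -
  have k: "0 < real k" using assms by simp
  have pos: "0 < 1 + p / real k" using k assms by (intro add_pos_nonneg) auto
  have "(1 - p / real k) * (1 + p / real k) \<le> 1" by (simp add: algebra_simps)
  then have "1 - p / real k \<le> 1 / (1 + p / real k)" using pos by (simp add: le_divide_eq)
  then have "(1 - p / real k) * real k powr (- p) \<le> 1 / (1 + p / real k) * real k powr (- p)"
    by (intro mult_right_mono) auto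
  also have "\<dots> = 1 / ((1 + p / real k) * real k powr p)" by (simp add: powr_minus_divide)
  also have "\<dots> \<le> 1 / (real (Suc k) powr p)"
    using powr_Suc_upper[OF assms] pos k by (intro divide_left_mono) auto
  finally show ?thesis by (simp add: powr_minus_divide)
qed

lemma powr_telescope: fixes p :: real assumes "1 \<le> k" "0 < p" "p \<le> 1"
  shows "real k powr (- (p + 1)) \<le> 2 / p * (real k powr (- p) - real (Suc k) powr (- p))"
proof -
  have k: "1 \<le> real k" using assms by simp
  have "(real k / real (Suc k)) powr p \<le> 1 + p * (real k / real (Suc k) - 1)"
    using assms by (intro powr_le_affine) auto
  also have "real k / real (Suc k) - 1 = - (1 / real (Suc k))" by (simp add: field_simps)
  finally have "(real k / real (Suc k)) powr p \<le> 1 - p / real (Suc k)" by simp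
  moreover have "real (Suc k) powr (- p) = real k powr (- p) * (real k / real (Suc k)) powr p"
    using k by (simp add: powr_divide powr_minus field_simps)
  ultimately have "real (Suc k) powr (- p) \<le> real k powr (- p) * (1 - p / real (Suc k))"
    by (simp add: mult_left_mono)
  moreover have "p / (2 * real k) \<le> p / real (Suc k)" using k assms by (intro divide_left_mono) auto
  then have "real k powr (- p) * (1 - p / real (Suc k)) \<le> real k powr (- p) * (1 - p / (2 * real k))"
    by (intro mult_left_mono) auto
  ultimately have "real k powr (- p) * (p / (2 * real k)) \<le> real k powr (- p) - real (Suc k) powr (- p)"
    by (simp add: algebra_simps)
  moreover have "real k powr (- (p + 1)) = 2 / p * (real k powr (- p) * (p / (2 * real k)))"
  proof -
    have "real k powr (- (p + 1)) = real k powr (- p) / real k"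
      using k by (simp add: powr_diff[of "real k" "- p" 1, simplified] diff_conv_add_uminus[symmetric] del: diff_conv_add_uminus)
    then show ?thesis using assms by simp
  qed
  ultimately show ?thesis using assms by (simp only:) (intro mult_left_mono, auto)
qed

text \<open>A contraction factor \<open>1 - \<kappa>/k\<close> with \<open>\<kappa> > r\<close> preserves the bound \<open>k\<^sup>-\<^sup>r\<close>, which shrinks only by
\<open>1 - r/k\<close>; the margin \<open>\<kappa> - r\<close> absorbs the forcing of order \<open>k\<^sup>-\<^sup>(\<^sup>r\<^sup>+\<^sup>1\<^sup>)\<close>.  The corrected quantity \<open>z\<close> may
be negative, so the contraction is supplied by the nonnegative \<open>x\<close>, to which \<open>z\<close> is comparable.\<close>

lemma decay_rate:
  fixes z x :: "nat \<Rightarrow> real"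
  assumes r: "0 < r" "r \<le> 1" and \<epsilon>: "0 \<le> \<epsilon>" and J: "0 \<le> J" and C: "0 \<le> C1" "0 \<le> C2"
    and \<kappa>: "r < \<kappa>" and K: "1 \<le> K" "\<kappa> \<le> real K"
    and x: "\<And>k. K \<le> k \<Longrightarrow> z k \<le> (1 + \<epsilon>) * x k + C2 * real k powr (- (r + 1)) * J"
    and dec: "\<And>k. K \<le> k \<Longrightarrow> z (Suc k) \<le> z k - (1 + \<epsilon>) * \<kappa> / real k * x k + C1 * real k powr (- (r + 1)) * J"
    and C4: "z K \<le> C4 * real K powr (- r) * J" "(C1 + \<kappa> * C2) / (\<kappa> - r) \<le> C4"
    and k: "K \<le> k"
  shows "z k \<le> C4 * real k powr (- r) * J"
  using k
proof (induction k rule: dec_induct)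
  case base show ?case by (rule C4)
next
  case (step k)
  define n where "n = real k powr (- (r + 1))"
  have k1: "1 \<le> real k" "\<kappa> \<le> real k" "K \<le> k" using K step by auto
  have n0: "0 \<le> n" by (simp add: n_def)
  have kn: "real k powr (- r) / real k = n"
    using k1 by (simp add: n_def powr_diff[of "real k" "- r" 1, simplified] diff_conv_add_uminus[symmetric] del: diff_conv_add_uminus)
  have \<kappa>0: "0 < \<kappa>" using r \<kappa> by simp
  have "\<kappa> / real k * (z k - C2 * n * J) \<le> \<kappa> / real k * ((1 + \<epsilon>) * x k)"
    using x[OF k1(3)] \<kappa>0 k1 by (intro mult_left_mono) (auto simp: n_def)
  moreover have "\<kappa> / real k * (C2 * n * J) \<le> \<kappa> * (C2 * n * J)"
    using \<kappa>0 k1 C n0 J by (intro mult_right_mono) (auto simp: divide_le_eq)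
  ultimately have "z (Suc k) \<le> (1 - \<kappa> / real k) * z k + (C1 + \<kappa> * C2) * n * J"
    using dec[OF k1(3)] unfolding n_def[symmetric] by (simp add: algebra_simps add_divide_distrib)
  also have "\<dots> \<le> (1 - \<kappa> / real k) * (C4 * real k powr (- r) * J) + (C4 * (\<kappa> - r)) * n * J"
  proof (intro add_mono mult_left_mono mult_right_mono)
    show "C1 + \<kappa> * C2 \<le> C4 * (\<kappa> - r)" using C4(2) \<kappa> by (simp add: divide_le_eq)
  qed (use step.IH k1 n0 J in \<open>auto simp: divide_le_eq\<close>)
  also have "\<dots> = C4 * J * ((1 - r / real k) * real k powr (- r))"
    using kn k1 by (simp add: field_simps kn[symmetric])
  also have "\<dots> \<le> C4 * J * real (Suc k) powr (- r)"
  proof (intro mult_left_mono powr_Suc_neg_lower)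
    have "0 \<le> (C1 + \<kappa> * C2) / (\<kappa> - r)" using C \<kappa>0 \<kappa> by simp
    then show "0 \<le> C4 * J" using C4(2) J by simp
  qed (use r k1 in auto)
  finally show ?case by (simp add: mult_ac)
qed

section \<open>Integration against a conditional kernel\<close>

text \<open>The hypothesis fixes the joint law of the past and \<open>Y\<close> on rectangles, which form an intersection-stable
generator.\<close>

lemma (in prob_space) cond_kernel_nn_integral:
  assumes G: "subalgebra M G" and \<kappa>: "\<kappa> \<in> G \<rightarrow>\<^sub>M prob_algebra S" and Y: "Y \<in> M \<rightarrow>\<^sub>M S"
    and cond: "\<And>E. E \<in> sets S \<Longrightarrow> AE x in M. cprob M G {y \<in> space M. Y y \<in> E} x = measure (\<kappa> x) E"
    and f: "(\<lambda>(x, y). f x y) \<in> borel_measurable (G \<Otimes>\<^sub>M S)"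
  shows "(\<integral>\<^sup>+x. f x (Y x) \<partial>M) = (\<integral>\<^sup>+x. \<integral>\<^sup>+y. f x y \<partial>\<kappa> x \<partial>M)"
proof -
  have sp: "space G = space M" and ss: "sets G \<subseteq> sets M" using G by (auto simp: subalgebra_def)
  interpret fm: finite_measure_subalgebra M G
    by unfold_locales (rule G)
  have \<kappa>': "\<kappa> \<in> G \<rightarrow>\<^sub>M subprob_algebra S" by (rule measurable_prob_algebraD[OF \<kappa>])
  let ?N = "restr_to_subalg M G"
  have ne: "space ?N \<noteq> {}" using not_empty by (simp add: space_restr_to_subalg)
  have Nsets: "sets ?N = sets G" by (rule sets_restr_to_subalg[OF G])
  define \<mu>1 where "\<mu>1 = distr M (G \<Otimes>\<^sub>M S) (\<lambda>x. (x, Y x))"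
  define k2 where "k2 x = distr (\<kappa> x) (G \<Otimes>\<^sub>M S) (Pair x)" for x
  define \<mu>2 where "\<mu>2 = ?N \<bind> k2"
  have idG: "(\<lambda>x. x) \<in> M \<rightarrow>\<^sub>M G" using G by (rule measurable_from_subalg) simp
  have pair: "(\<lambda>x. (x, Y x)) \<in> M \<rightarrow>\<^sub>M G \<Otimes>\<^sub>M S" by (rule measurable_Pair[OF idG Y])
  have k2: "k2 \<in> ?N \<rightarrow>\<^sub>M subprob_algebra (G \<Otimes>\<^sub>M S)"
  proof -
    have "case_prod Pair = (\<lambda>p :: 'a \<times> 'b. p)" by (rule ext) auto
    then have "case_prod Pair \<in> G \<Otimes>\<^sub>M S \<rightarrow>\<^sub>M G \<Otimes>\<^sub>M S" by simp
    from measurable_distr2[OF this \<kappa>'] show ?thesis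
      unfolding k2_def[abs_def] by (simp cong: measurable_cong_sets add: Nsets)
  qed
  have nn_k2: "(\<integral>\<^sup>+p. g p \<partial>k2 x) = (\<integral>\<^sup>+y. g (x, y) \<partial>\<kappa> x)"
    if g: "g \<in> borel_measurable (G \<Otimes>\<^sub>M S)" and x: "x \<in> space M" for g x
  proof -
    have "Pair x \<in> \<kappa> x \<rightarrow>\<^sub>M G \<Otimes>\<^sub>M S"
      using measurable_Pair1'[of x G S] x by (simp cong: measurable_cong_sets add: prob_kernelD[OF \<kappa>, unfolded sp, OF x] sp)
    then show ?thesis using g by (simp add: k2_def nn_integral_distr)
  qed
  have nn2: "(\<integral>\<^sup>+p. g p \<partial>\<mu>2) = (\<integral>\<^sup>+x. \<integral>\<^sup>+y. g (x, y) \<partial>\<kappa> x \<partial>M)"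
    if g: "g \<in> borel_measurable (G \<Otimes>\<^sub>M S)" for g
  proof -
    have "(\<integral>\<^sup>+p. g p \<partial>\<mu>2) = (\<integral>\<^sup>+x. \<integral>\<^sup>+p. g p \<partial>k2 x \<partial>?N)" unfolding \<mu>2_def by (rule nn_integral_bind[OF g k2])
    also have "\<dots> = (\<integral>\<^sup>+x. \<integral>\<^sup>+y. g (x, y) \<partial>\<kappa> x \<partial>?N)"
      by (intro nn_integral_cong nn_k2 g) (simp add: space_restr_to_subalg)
    also have "\<dots> = (\<integral>\<^sup>+x. \<integral>\<^sup>+y. g (x, y) \<partial>\<kappa> x \<partial>M)"
    proof (rule nn_integral_subalgebra2[OF G])
      show "(\<lambda>x. \<integral>\<^sup>+y. g (x, y) \<partial>\<kappa> x) \<in> borel_measurable G"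
        using g by (intro nn_integral_measurable_subprob_algebra2[OF _ \<kappa>']) (simp add: case_prod_beta')
    qed
    finally show ?thesis .
  qed
  have rect: "emeasure \<mu>1 (A \<times> E) = emeasure \<mu>2 (A \<times> E)" if A: "A \<in> sets G" and E: "E \<in> sets S" for A E
  proof -
    have AM: "A \<in> sets M" using A ss by auto
    have YE: "{y \<in> space M. Y y \<in> E} \<in> sets M" using measurable_sets[OF Y E] by (simp add: vimage_def Collect_conj_eq Int_commute)
    have AE: "A \<times> E \<in> sets (G \<Otimes>\<^sub>M S)" using A E by simp
    have "emeasure \<mu>1 (A \<times> E) = emeasure M (A \<inter> {y \<in> space M. Y y \<in> E})"
      unfolding \<mu>1_def using sets.sets_into_space[OF AM]
      by (subst emeasure_distr[OF pair AE]) (auto intro!: arg_cong[where f="emeasure M"])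
    also have "\<dots> = ennreal (\<integral>x. indicator A x * indicator {y \<in> space M. Y y \<in> E} x \<partial>M)"
      using AM YE by (simp add: emeasure_eq_measure indicator_inter_arith[symmetric] sets.Int)
    also have "(\<integral>x. indicator A x * indicator {y \<in> space M. Y y \<in> E} x \<partial>M)
        = (\<integral>x. indicator A x * real_cond_exp M G (indicator {y \<in> space M. Y y \<in> E}) x \<partial>M)"
    proof (rule fm.real_cond_exp_intg(2)[symmetric])
      show "integrable M (\<lambda>x. indicator A x * indicat_real {y \<in> space M. Y y \<in> E} x)"
        using AM YE by (intro integrable_const_bound[where B=1]) (auto simp: indicator_def)
    qed (use A YE in auto)
    also have "\<dots> = (\<integral>x. indicator A x * measure (\<kappa> x) E \<partial>M)"
    proof (rule integral_cong_AE)
      have m: "(\<lambda>x. measure (\<kappa> x) E) \<in> borel_measurable M"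
        by (rule measurable_from_subalg[OF G]) (rule measurable_compose[OF \<kappa> measurable_measure_prob_algebra[OF E]])
      show "(\<lambda>x. indicator A x * measure (\<kappa> x) E) \<in> borel_measurable M" using m AM by simp
      show "AE x in M. indicator A x * real_cond_exp M G (indicator {y \<in> space M. Y y \<in> E}) x = indicator A x * measure (\<kappa> x) E"
        using cond[OF E] by (auto simp: cprob_def)
    qed (use AM in \<open>auto intro!: borel_measurable_times measurable_from_subalg[OF G]\<close>)
    also have "ennreal \<dots> = (\<integral>\<^sup>+x. ennreal (indicator A x * measure (\<kappa> x) E) \<partial>M)"
    proof (rule nn_integral_eq_integral[symmetric])
      have m: "(\<lambda>x. measure (\<kappa> x) E) \<in> borel_measurable M"
        by (rule measurable_from_subalg[OF G]) (rule measurable_compose[OF \<kappa> measurable_measure_prob_algebra[OF E]])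
      show "integrable M (\<lambda>x. indicator A x * measure (\<kappa> x) E)"
        using m AM prob_space.prob_le_1[OF prob_kernelD(1)[OF \<kappa>], unfolded sp]
        by (intro integrable_const_bound[where B=1] AE_I2) (auto simp: indicator_def)
    qed simp
    also have "\<dots> = (\<integral>\<^sup>+x. \<integral>\<^sup>+y. indicator (A \<times> E) (x, y) \<partial>\<kappa> x \<partial>M)"
    proof (intro nn_integral_cong)
      fix x assume x: "x \<in> space M"
      interpret kx: prob_space "\<kappa> x" by (rule prob_kernelD[OF \<kappa>, unfolded sp, OF x])
      have "(\<integral>\<^sup>+y. indicator (A \<times> E) (x, y) \<partial>\<kappa> x) = (\<integral>\<^sup>+y. indicator A x * indicator E y \<partial>\<kappa> x)"
        by (intro nn_integral_cong) (auto simp: indicator_def)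
      also have "\<dots> = indicator A x * emeasure (\<kappa> x) E"
        using E prob_kernelD(2)[OF \<kappa>, unfolded sp, OF x] by (subst nn_integral_cmult) auto
      finally show "ennreal (indicator A x * measure (\<kappa> x) E) = (\<integral>\<^sup>+y. indicator (A \<times> E) (x, y) \<partial>\<kappa> x)"
        by (simp add: kx.emeasure_eq_measure indicator_def)
    qed
    also have "\<dots> = (\<integral>\<^sup>+p. indicator (A \<times> E) p \<partial>\<mu>2)" using AE by (intro nn2[symmetric]) simp
    also have "\<dots> = emeasure \<mu>2 (A \<times> E)"
    proof (rule nn_integral_indicator)
      show "A \<times> E \<in> sets \<mu>2" unfolding \<mu>2_def using AE ne by (subst sets_bind[where N="G \<Otimes>\<^sub>M S"]) (auto simp: k2_def)
    qed
    finally show ?thesis .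
  qed
  have "\<mu>1 = \<mu>2"
  proof (rule measure_eqI_generator_eq[OF Int_stable_pair_measure_generator[of G S], where A="\<lambda>_. space G \<times> space S" and \<Omega>="space G \<times> space S"])
    show "{a \<times> b |a b. a \<in> sets G \<and> b \<in> sets S} \<subseteq> Pow (space G \<times> space S)"
      using sets.space_closed[of G] sets.space_closed[of S] by auto
    show "sets \<mu>1 = sigma_sets (space G \<times> space S) {a \<times> b |a b. a \<in> sets G \<and> b \<in> sets S}"
      by (simp add: \<mu>1_def sets_pair_measure)
    show "sets \<mu>2 = sigma_sets (space G \<times> space S) {a \<times> b |a b. a \<in> sets G \<and> b \<in> sets S}"
      unfolding \<mu>2_def using ne by (subst sets_bind[where N="G \<Otimes>\<^sub>M S"]) (auto simp: k2_def sets_pair_measure)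
    show "emeasure \<mu>1 (space G \<times> space S) \<noteq> \<infinity>" for i :: nat
      unfolding \<mu>1_def by (subst emeasure_distr[OF pair]) auto
  qed (use rect in auto)
  have "(\<integral>\<^sup>+x. f x (Y x) \<partial>M) = (\<integral>\<^sup>+p. (\<lambda>(x, y). f x y) p \<partial>\<mu>1)"
    unfolding \<mu>1_def using f by (subst nn_integral_distr[OF pair]) auto
  also have "\<dots> = (\<integral>\<^sup>+x. \<integral>\<^sup>+y. f x y \<partial>\<kappa> x \<partial>M)" unfolding \<open>\<mu>1 = \<mu>2\<close> by (subst nn2[OF f]) simp
  finally show ?thesis .
qed

lemma (in prob_space) cond_kernel_integral:
  fixes f :: "'a \<Rightarrow> 'b \<Rightarrow> real"
  assumes G: "subalgebra M G" and \<kappa>: "\<kappa> \<in> G \<rightarrow>\<^sub>M prob_algebra S" and Y: "Y \<in> M \<rightarrow>\<^sub>M S"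
    and cond: "\<And>E. E \<in> sets S \<Longrightarrow> AE x in M. cprob M G {y \<in> space M. Y y \<in> E} x = measure (\<kappa> x) E"
    and f: "(\<lambda>(x, y). f x y) \<in> borel_measurable (G \<Otimes>\<^sub>M S)"
    and int: "\<And>x. x \<in> space M \<Longrightarrow> integrable (\<kappa> x) (f x)"
    and abs: "integrable M (\<lambda>x. \<integral>y. \<bar>f x y\<bar> \<partial>\<kappa> x)"
  shows "integrable M (\<lambda>x. f x (Y x))" "(\<integral>x. f x (Y x) \<partial>M) = (\<integral>x. \<integral>y. f x y \<partial>\<kappa> x \<partial>M)"
proof -
  have sp: "space G = space M" using G by (auto simp: subalgebra_def)
  have \<kappa>': "\<kappa> \<in> G \<rightarrow>\<^sub>M subprob_algebra S" by (rule measurable_prob_algebraD[OF \<kappa>])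
  have idG: "(\<lambda>x. x) \<in> M \<rightarrow>\<^sub>M G" using G by (rule measurable_from_subalg) simp
  have pair: "(\<lambda>x. (x, Y x)) \<in> M \<rightarrow>\<^sub>M G \<Otimes>\<^sub>M S" by (rule measurable_Pair[OF idG Y])
  have fY: "(\<lambda>x. g x (Y x)) \<in> borel_measurable M" if "(\<lambda>(x, y). g x y) \<in> borel_measurable (G \<Otimes>\<^sub>M S)" for g :: "'a \<Rightarrow> 'b \<Rightarrow> real"
    using measurable_compose[OF pair that] by simp
  have core: "integrable M (\<lambda>x. g x (Y x)) \<and> integrable M (\<lambda>x. \<integral>y. g x y \<partial>\<kappa> x) \<and> (\<integral>x. g x (Y x) \<partial>M) = (\<integral>x. \<integral>y. g x y \<partial>\<kappa> x \<partial>M)"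
    if g: "(\<lambda>(x, y). g x y) \<in> borel_measurable (G \<Otimes>\<^sub>M S)" and g0: "\<And>x y. 0 \<le> g x y" and gf: "\<And>x y. g x y \<le> \<bar>f x y\<bar>" for g
  proof -
    have gi: "integrable (\<kappa> x) (g x)" if x: "x \<in> space M" for x
    proof (rule Bochner_Integration.integrable_bound[OF int[OF x]])
      show "g x \<in> borel_measurable (\<kappa> x)"
        using measurable_section[OF g] x by (simp cong: measurable_cong_sets add: sp prob_kernelD[OF \<kappa>, unfolded sp, OF x])
    qed (use g0 gf in auto)
    have gm: "(\<lambda>x. \<integral>y. g x y \<partial>\<kappa> x) \<in> borel_measurable M"
      by (rule measurable_from_subalg[OF G integral_measurable_kernel[OF g \<kappa>']])
    have gi2: "integrable M (\<lambda>x. \<integral>y. g x y \<partial>\<kappa> x)"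
    proof (rule Bochner_Integration.integrable_bound[OF abs gm], rule AE_I2)
      fix x assume x: "x \<in> space M"
      have "(\<integral>y. g x y \<partial>\<kappa> x) \<le> (\<integral>y. \<bar>f x y\<bar> \<partial>\<kappa> x)" using gi[OF x] int[OF x] gf by (intro integral_mono) auto
      moreover have "0 \<le> (\<integral>y. g x y \<partial>\<kappa> x)" using g0 by simp
      ultimately show "norm (\<integral>y. g x y \<partial>\<kappa> x) \<le> norm (\<integral>y. \<bar>f x y\<bar> \<partial>\<kappa> x)" by simp
    qed
    have "(\<lambda>(x, y). ennreal (g x y)) \<in> borel_measurable (G \<Otimes>\<^sub>M S)" using g by (simp add: case_prod_beta')
    from cond_kernel_nn_integral[OF G \<kappa> Y cond this]
    have "(\<integral>\<^sup>+x. ennreal (g x (Y x)) \<partial>M) = (\<integral>\<^sup>+x. \<integral>\<^sup>+y. ennreal (g x y) \<partial>\<kappa> x \<partial>M)" .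
    also have "\<dots> = (\<integral>\<^sup>+x. ennreal (\<integral>y. g x y \<partial>\<kappa> x) \<partial>M)"
      using gi g0 by (intro nn_integral_cong nn_integral_eq_integral) auto
    also have "\<dots> = ennreal (\<integral>x. \<integral>y. g x y \<partial>\<kappa> x \<partial>M)"
      using g0 by (intro nn_integral_eq_integral gi2) auto
    finally have eq: "(\<integral>\<^sup>+x. ennreal (g x (Y x)) \<partial>M) = ennreal (\<integral>x. \<integral>y. g x y \<partial>\<kappa> x \<partial>M)" .
    have "integrable M (\<lambda>x. g x (Y x))"
      using fY[OF g] g0 eq by (intro integrableI_bounded) auto
    moreover have "(\<integral>x. g x (Y x) \<partial>M) = (\<integral>x. \<integral>y. g x y \<partial>\<kappa> x \<partial>M)"
      using fY[OF g] g0 eq by (subst integral_eq_nn_integral) (auto intro!: integral_nonneg_AE)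
    ultimately show ?thesis using gi2 by blast
  qed
  define p where "p x y = (\<bar>f x y\<bar> + f x y) / 2" for x y
  define m where "m x y = (\<bar>f x y\<bar> - f x y) / 2" for x y
  have pm: "(\<lambda>(x, y). p x y) \<in> borel_measurable (G \<Otimes>\<^sub>M S)" "(\<lambda>(x, y). m x y) \<in> borel_measurable (G \<Otimes>\<^sub>M S)"
    using f unfolding p_def m_def by (auto simp: case_prod_beta')
  have cp: "integrable M (\<lambda>x. p x (Y x)) \<and> integrable M (\<lambda>x. \<integral>y. p x y \<partial>\<kappa> x) \<and> (\<integral>x. p x (Y x) \<partial>M) = (\<integral>x. \<integral>y. p x y \<partial>\<kappa> x \<partial>M)"
    by (rule core[OF pm(1)]) (auto simp: p_def)
  have cm: "integrable M (\<lambda>x. m x (Y x)) \<and> integrable M (\<lambda>x. \<integral>y. m x y \<partial>\<kappa> x) \<and> (\<integral>x. m x (Y x) \<partial>M) = (\<integral>x. \<integral>y. m x y \<partial>\<kappa> x \<partial>M)"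
    by (rule core[OF pm(2)]) (auto simp: m_def)
  have f_eq: "f x y = p x y - m x y" for x y by (simp add: p_def m_def field_simps)
  show "integrable M (\<lambda>x. f x (Y x))" unfolding f_eq using cp cm by auto
  have "(\<integral>x. f x (Y x) \<partial>M) = (\<integral>x. \<integral>y. p x y \<partial>\<kappa> x \<partial>M) - (\<integral>x. \<integral>y. m x y \<partial>\<kappa> x \<partial>M)"
    unfolding f_eq using cp cm by simp
  also have "\<dots> = (\<integral>x. (\<integral>y. p x y \<partial>\<kappa> x) - (\<integral>y. m x y \<partial>\<kappa> x) \<partial>M)" using cp cm by simp
  also have "\<dots> = (\<integral>x. \<integral>y. f x y \<partial>\<kappa> x \<partial>M)"
  proof (intro Bochner_Integration.integral_cong refl)
    fix x assume x: "x \<in> space M"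
    have "integrable (\<kappa> x) (p x)" "integrable (\<kappa> x) (m x)" using int[OF x] by (auto simp: p_def[abs_def] m_def[abs_def])
    then show "(\<integral>y. p x y \<partial>\<kappa> x) - (\<integral>y. m x y \<partial>\<kappa> x) = (\<integral>y. f x y \<partial>\<kappa> x)" unfolding f_eq by simp
  qed
  finally show "(\<integral>x. f x (Y x) \<partial>M) = (\<integral>x. \<integral>y. f x y \<partial>\<kappa> x \<partial>M)" .
qed

section \<open>Moments along the recursion\<close>

text \<open>The recursion after replacing each iterate by its projection, so that \<open>th k\<close> lies in \<open>\<Theta>\<close> everywhere and
not only almost surely.  \<open>u\<close> solves the Poisson equation with mean field \<open>Fb\<close>.\<close>

locale sa_process = prob_space M
  for M :: "'w measure" +
  fixes Gm Gp :: "nat \<Rightarrow> 'w measure"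
    and \<Theta> :: "'a::euclidean_space set" and \<W> :: "'b::euclidean_space set"
    and F :: "'a \<Rightarrow> 'b \<Rightarrow> 'a" and P :: "'a \<Rightarrow> 'b \<Rightarrow> 'b measure" and \<alpha> :: "nat \<Rightarrow> real"
    and th :: "nat \<Rightarrow> 'w \<Rightarrow> 'a" and W :: "nat \<Rightarrow> 'w \<Rightarrow> 'b" and Mt B :: "nat \<Rightarrow> 'w \<Rightarrow> 'a"
    and Fb :: "'a \<Rightarrow> 'a" and u :: "'a \<Rightarrow> 'b \<Rightarrow> 'a" and \<theta>s :: 'a
    and \<rho>0 b0 cF cV cu :: real and mm :: "nat \<Rightarrow> real"
  assumes Gm: "\<And>k. subalgebra M (Gm k)" and Gp: "\<And>k. subalgebra M (Gp k)"
    and Gmp: "\<And>k. sets (Gm k) \<subseteq> sets (Gp k)" and Gpm: "\<And>k. sets (Gp k) \<subseteq> sets (Gm (Suc k))"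
    and th: "\<And>k. th k \<in> Gm k \<rightarrow>\<^sub>M borel_on \<Theta>" and W: "\<And>k. W k \<in> Gm k \<rightarrow>\<^sub>M borel_on \<W>"
    and B: "\<And>k. B k \<in> borel_measurable (Gm k)" and Mt: "\<And>k. Mt (Suc k) \<in> borel_measurable (Gp k)"
    and rec: "\<And>k. AE x in M. th (Suc k) x =
        closest_point \<Theta> (th k x + \<alpha> k *\<^sub>R (F (th k x) (W k x) + Mt (Suc k) x + B k x))"
    and trans: "\<And>k E. E \<in> sets (borel_on \<W>) \<Longrightarrow> AE x in M.
        cprob M (Gp k) {y \<in> space M. W (Suc k) y \<in> E} x = measure (P (th k x) (W k x)) E"
    and Mt0: "\<And>k. cond_mean_zero M (Gm k) (Mt (Suc k))"
    and Mt2: "\<And>k. AE x in M. nn_cond_exp M (Gm k) (\<lambda>y. ennreal ((norm (Mt (Suc k) y))\<^sup>2)) x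
        \<le> ennreal ((mm k)\<^sup>2 * U 2 (W k x))"
    and \<Theta>: "\<Theta> \<noteq> {}" "compact \<Theta>" "convex \<Theta>" "\<theta>s \<in> \<Theta>"
    and F_meas: "(\<lambda>(t, w). F t w) \<in> borel_on \<Theta> \<Otimes>\<^sub>M borel_on \<W> \<rightarrow>\<^sub>M borel"
    and P_kernel: "(\<lambda>(t, w). P t w) \<in> borel_on \<Theta> \<Otimes>\<^sub>M borel_on \<W> \<rightarrow>\<^sub>M prob_algebra (borel_on \<W>)"
    and u_meas: "(\<lambda>(t, w). u t w) \<in> borel_on \<Theta> \<Otimes>\<^sub>M borel_on \<W> \<rightarrow>\<^sub>M borel"
    and \<alpha>: "\<And>k. 0 \<le> \<alpha> k"
    and \<rho>0: "0 \<le> \<rho>0" "\<rho>0 < 1" and b0: "0 \<le> b0"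
    and drift: "\<And>t w. t \<in> \<Theta> \<Longrightarrow> w \<in> \<W> \<Longrightarrow> (\<integral>\<^sup>+y. ennreal (U 2 y) \<partial>P t w) \<le> ennreal (\<rho>0 * U 2 w + b0)"
    and cV: "0 \<le> cV" and PV: "\<And>t w. t \<in> \<Theta> \<Longrightarrow> w \<in> \<W> \<Longrightarrow> (\<integral>\<^sup>+y. ennreal (lyap y) \<partial>P t w) \<le> ennreal (cV * lyap w)"
    and cF: "0 \<le> cF" and F_bd: "\<And>t w. t \<in> \<Theta> \<Longrightarrow> w \<in> \<W> \<Longrightarrow> norm (F t w) \<le> cF * lyap w"
    and cu: "0 \<le> cu" and u_bd: "\<And>t w. t \<in> \<Theta> \<Longrightarrow> w \<in> \<W> \<Longrightarrow> norm (u t w) \<le> cu * lyap w"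
    and u_lip: "\<And>t t' w. t \<in> \<Theta> \<Longrightarrow> t' \<in> \<Theta> \<Longrightarrow> w \<in> \<W> \<Longrightarrow> norm (u t w - u t' w) \<le> cu * lyap w * norm (t - t')"
    and u_int: "\<And>t t' w. t \<in> \<Theta> \<Longrightarrow> t' \<in> \<Theta> \<Longrightarrow> w \<in> \<W> \<Longrightarrow> integrable (P t w) (u t')"
    and poisson: "\<And>t w. t \<in> \<Theta> \<Longrightarrow> w \<in> \<W> \<Longrightarrow> u t w - (\<integral>y. u t y \<partial>P t w) = F t w - Fb t"
    and W0_int: "integrable M (\<lambda>x. U 2 (W 0 x))"
begin

lemma space_Gm: "space (Gm k) = space M" using Gm by (auto simp: subalgebra_def)
lemma space_Gp: "space (Gp k) = space M" using Gp by (auto simp: subalgebra_def)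

lemma sub_mp: "subalgebra (Gp k) (Gm k)" using Gmp by (auto simp: subalgebra_def space_Gm space_Gp)

lemma Gm_mono: "j \<le> k \<Longrightarrow> sets (Gm j) \<subseteq> sets (Gm k)"
  by (induction k rule: dec_induct) (use Gmp Gpm in blast)+

lemma Gp0_Gm: "1 \<le> k \<Longrightarrow> sets (Gp 0) \<subseteq> sets (Gm k)"
  using Gpm[of 0] Gm_mono[of 1 k] by auto

lemma th_in: "x \<in> space M \<Longrightarrow> th k x \<in> \<Theta>"
  using measurable_space[OF th, of x k] by (simp add: space_Gm)

lemma W_in: "x \<in> space M \<Longrightarrow> W k x \<in> \<W>"
  using measurable_space[OF W, of x k] by (simp add: space_Gm)

lemma thp: "th k \<in> Gp k \<rightarrow>\<^sub>M borel_on \<Theta>" by (rule measurable_from_subalg[OF sub_mp th])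
lemma Wp: "W k \<in> Gp k \<rightarrow>\<^sub>M borel_on \<W>" by (rule measurable_from_subalg[OF sub_mp W])
lemma WM: "W k \<in> M \<rightarrow>\<^sub>M borel_on \<W>" by (rule measurable_from_subalg[OF Gm W])

lemma borel_onD: "f \<in> A \<rightarrow>\<^sub>M borel_on X \<Longrightarrow> f \<in> borel_measurable A"
  by (simp add: measurable_restrict_space2_iff)

lemma kernel_measurable: "(\<lambda>x. P (th k x) (W k x)) \<in> Gp k \<rightarrow>\<^sub>M prob_algebra (borel_on \<W>)"
  using measurable_compose[OF measurable_Pair[OF thp[of k] Wp[of k]] P_kernel] by simp

lemma U2_meas: "(\<lambda>x. U 2 (W k x)) \<in> borel_measurable (Gm k)"
  using borel_onD[OF W] unfolding U_def by measurable

lemma U2_measM[measurable]: "(\<lambda>x. U 2 (W k x)) \<in> borel_measurable M"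
  by (rule measurable_from_subalg[OF Gm U2_meas])

lemma U_nonneg: "0 \<le> U 2 (w :: 'b)" by (simp add: U_def)
lemma U_ge_1: "1 \<le> U 2 (w :: 'b)" by (simp add: U_def)

lemma integrable_on_set: "A \<in> sets M \<Longrightarrow> integrable M f \<Longrightarrow> integrable M (\<lambda>x. indicat_real A x * f x)"
  using integrable_real_mult_indicator[of A M f] by (simp add: mult.commute)

lemma nn_drift:
  assumes A: "A \<in> sets (Gp k)" and int: "integrable M (\<lambda>x. U 2 (W k x))"
  shows "(\<integral>\<^sup>+x. ennreal (indicator A x * U 2 (W (Suc k) x)) \<partial>M)
    \<le> ennreal (\<rho>0 * (\<integral>x. indicator A x * U 2 (W k x) \<partial>M) + b0 * measure M A)"
proof -
  have AM: "A \<in> sets M" using A Gp by (auto simp: subalgebra_def)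
  have iA: "integrable M (\<lambda>x. indicator A x * U 2 (W k x))"
    by (rule integrable_on_set[OF AM int])
  have "(\<lambda>(x, y). ennreal (indicator A x * U 2 y)) \<in> borel_measurable (Gp k \<Otimes>\<^sub>M borel_on \<W>)"
  proof -
    have "(\<lambda>y :: 'b. U 2 y) \<in> borel_measurable (borel_on \<W>)"
      unfolding U_def by (intro measurable_restrict_space1) measurable
    then show ?thesis using A by measurable
  qed
  from cond_kernel_nn_integral[OF Gp kernel_measurable WM trans this]
  have "(\<integral>\<^sup>+x. ennreal (indicator A x * U 2 (W (Suc k) x)) \<partial>M)
     = (\<integral>\<^sup>+x. \<integral>\<^sup>+y. ennreal (indicator A x * U 2 y) \<partial>P (th k x) (W k x) \<partial>M)" .
  also have "\<dots> \<le> (\<integral>\<^sup>+x. ennreal (indicator A x * (\<rho>0 * U 2 (W k x) + b0)) \<partial>M)"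
  proof (intro nn_integral_mono)
    fix x assume x: "x \<in> space M"
    show "(\<integral>\<^sup>+y. ennreal (indicator A x * U 2 y) \<partial>P (th k x) (W k x)) \<le> ennreal (indicator A x * (\<rho>0 * U 2 (W k x) + b0))"
      using drift[OF th_in[OF x] W_in[OF x], of k k] by (cases "x \<in> A") auto
  qed
  also have "\<dots> = ennreal (\<integral>x. indicator A x * (\<rho>0 * U 2 (W k x) + b0) \<partial>M)"
  proof (rule nn_integral_eq_integral)
    show "integrable M (\<lambda>x. indicator A x * (\<rho>0 * U 2 (W k x) + b0))"
      using int by (intro integrable_on_set[OF AM]) simp
  qed (use \<rho>0 b0 U_nonneg in auto)
  also have "(\<integral>x. indicator A x * (\<rho>0 * U 2 (W k x) + b0) \<partial>M) = \<rho>0 * (\<integral>x. indicator A x * U 2 (W k x) \<partial>M) + b0 * measure M A"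
    using iA AM by (simp add: distrib_left mult.left_commute[of _ \<rho>0] integrable_real_indicator mult.commute[of _ b0] less_top[symmetric])
  finally show ?thesis .
qed

lemma U2_integrable: "integrable M (\<lambda>x. U 2 (W k x))"
proof (induction k)
  case 0 show ?case by (rule W0_int)
next
  case (Suc k)
  have "space M \<in> sets (Gp k)" using sets.top[of "Gp k"] by (simp add: space_Gp)
  from nn_drift[OF this Suc]
  have "(\<integral>\<^sup>+x. ennreal (U 2 (W (Suc k) x)) \<partial>M) < \<infinity>"
    by (subst nn_integral_cong[of M _ "\<lambda>x. ennreal (indicator (space M) x * U 2 (W (Suc k) x))"]) (auto intro: le_less_trans)
  then show ?case using U_nonneg by (intro integrableI_bounded) auto
qed

lemma U2_step:
  assumes A: "A \<in> sets (Gp k)"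
  shows "(\<integral>x. indicator A x * U 2 (W (Suc k) x) \<partial>M) \<le> \<rho>0 * (\<integral>x. indicator A x * U 2 (W k x) \<partial>M) + b0 * measure M A"
proof -
  have AM: "A \<in> sets M" using A Gp by (auto simp: subalgebra_def)
  have "ennreal (\<integral>x. indicator A x * U 2 (W (Suc k) x) \<partial>M) = (\<integral>\<^sup>+x. ennreal (indicator A x * U 2 (W (Suc k) x)) \<partial>M)"
    using U_nonneg by (intro nn_integral_eq_integral[symmetric] integrable_on_set AM U2_integrable) auto
  also note nn_drift[OF A U2_integrable]
  finally show ?thesis
    using \<rho>0 b0 U_nonneg by (subst (asm) ennreal_le_iff) (auto intro!: add_nonneg_nonneg mult_nonneg_nonneg integral_nonneg_AE)
qed

lemma U2_bound:
  assumes A: "A \<in> sets (Gp 0)"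
  shows "(\<integral>x. indicator A x * U 2 (W k x) \<partial>M) \<le> (1 + b0 / (1 - \<rho>0)) * (\<integral>x. indicator A x * U 2 (W 0 x) \<partial>M)"
proof (induction k)
  case 0
  have "0 \<le> (\<integral>x. indicator A x * U 2 (W 0 x) \<partial>M)" using U_nonneg by (intro integral_nonneg_AE) auto
  then show ?case using \<rho>0 b0 by (simp add: distrib_right)
next
  case (Suc k)
  let ?J = "\<integral>x. indicator A x * U 2 (W 0 x) \<partial>M"
  have AM: "A \<in> sets M" using A Gp by (auto simp: subalgebra_def)
  have Ak: "A \<in> sets (Gp k)" using A Gp0_Gm[of k] Gmp[of k] by (cases k) auto
  have "measure M A = (\<integral>x. indicator A x * 1 \<partial>M)" using AM by simp
  also have "\<dots> \<le> ?J" using U_ge_1 AM by (intro integral_mono integrable_on_set U2_integrable) (auto simp: indicator_def)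
  finally have m: "measure M A \<le> ?J" .
  have "(\<integral>x. indicator A x * U 2 (W (Suc k) x) \<partial>M) \<le> \<rho>0 * ((1 + b0 / (1 - \<rho>0)) * ?J) + b0 * ?J"
    using U2_step[OF Ak] mult_left_mono[OF Suc \<rho>0(1)] mult_left_mono[OF m b0] by linarith
  also have "\<dots> = (\<rho>0 + b0 / (1 - \<rho>0)) * ?J" using \<rho>0 by (simp add: field_simps)
  also have "\<dots> \<le> (1 + b0 / (1 - \<rho>0)) * ?J"
    using \<rho>0 U_nonneg by (intro mult_right_mono integral_nonneg_AE) auto
  finally show ?case .
qed

lemma U2_bound_subset:
  assumes A: "A \<in> sets (Gp 0)" and S: "S \<in> sets M" "S \<subseteq> A"
  shows "(\<integral>x. indicator S x * U 2 (W k x) \<partial>M) \<le> (1 + b0 / (1 - \<rho>0)) * (\<integral>x. indicator A x * U 2 (W 0 x) \<partial>M)"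
proof (rule order_trans[OF _ U2_bound[OF A]])
  have "A \<in> sets M" using A Gp by (auto simp: subalgebra_def)
  then show "(\<integral>x. indicator S x * U 2 (W k x) \<partial>M) \<le> (\<integral>x. indicator A x * U 2 (W k x) \<partial>M)"
    using S U_nonneg by (intro integral_mono integrable_on_set U2_integrable) (auto simp: indicator_def)
qed

lemma Mt_M[measurable]: "Mt (Suc k) \<in> borel_measurable M" by (rule measurable_from_subalg[OF Gp Mt])

lemma nn_Mt2:
  assumes A: "A \<in> sets (Gm k)"
  shows "(\<integral>\<^sup>+x. ennreal (indicator A x * (norm (Mt (Suc k) x))\<^sup>2) \<partial>M) \<le> ennreal ((mm k)\<^sup>2 * (\<integral>x. indicator A x * U 2 (W k x) \<partial>M))"
proof -
  interpret fm: finite_measure_subalgebra M "Gm k" by unfold_locales (rule Gm)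
  have AM: "A \<in> sets M" using A Gm by (auto simp: subalgebra_def)
  have "(\<integral>\<^sup>+x. ennreal (indicator A x * (norm (Mt (Suc k) x))\<^sup>2) \<partial>M) = (\<integral>\<^sup>+x. indicator A x * ennreal ((norm (Mt (Suc k) x))\<^sup>2) \<partial>M)"
    by (intro nn_integral_cong) (simp add: indicator_def)
  also have "\<dots> = (\<integral>\<^sup>+x. indicator A x * nn_cond_exp M (Gm k) (\<lambda>y. ennreal ((norm (Mt (Suc k) y))\<^sup>2)) x \<partial>M)"
    using A by (intro fm.nn_cond_exp_intg[symmetric]) auto
  also have "\<dots> \<le> (\<integral>\<^sup>+x. ennreal (indicator A x * ((mm k)\<^sup>2 * U 2 (W k x))) \<partial>M)"
    using Mt2[of k] by (intro nn_integral_mono_AE) (auto simp: indicator_def)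
  also have "\<dots> = ennreal (\<integral>x. indicator A x * ((mm k)\<^sup>2 * U 2 (W k x)) \<partial>M)"
    using U_nonneg by (intro nn_integral_eq_integral integrable_on_set AM integrable_mult_right U2_integrable) auto
  also have "(\<integral>x. indicator A x * ((mm k)\<^sup>2 * U 2 (W k x)) \<partial>M) = (mm k)\<^sup>2 * (\<integral>x. indicator A x * U 2 (W k x) \<partial>M)"
    by (subst integral_mult_right_zero[symmetric], rule Bochner_Integration.integral_cong) (auto simp: mult_ac)
  finally show ?thesis .
qed

lemma Mt2_integrable: "integrable M (\<lambda>x. (norm (Mt (Suc k) x))\<^sup>2)"
proof -
  have "space M \<in> sets (Gm k)" using sets.top[of "Gm k"] by (simp add: space_Gm)
  from nn_Mt2[OF this]
  have "(\<integral>\<^sup>+x. ennreal ((norm (Mt (Suc k) x))\<^sup>2) \<partial>M) < \<infinity>"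
    by (subst nn_integral_cong[of M _ "\<lambda>x. ennreal (indicator (space M) x * (norm (Mt (Suc k) x))\<^sup>2)"]) (auto intro: le_less_trans)
  then show ?thesis by (intro integrableI_bounded) auto
qed

lemma Mt2_bound:
  assumes A: "A \<in> sets (Gm k)"
  shows "(\<integral>x. indicator A x * (norm (Mt (Suc k) x))\<^sup>2 \<partial>M) \<le> (mm k)\<^sup>2 * (\<integral>x. indicator A x * U 2 (W k x) \<partial>M)"
proof -
  have AM: "A \<in> sets M" using A Gm by (auto simp: subalgebra_def)
  have "ennreal (\<integral>x. indicator A x * (norm (Mt (Suc k) x))\<^sup>2 \<partial>M) = (\<integral>\<^sup>+x. ennreal (indicator A x * (norm (Mt (Suc k) x))\<^sup>2) \<partial>M)"
    by (intro nn_integral_eq_integral[symmetric] integrable_on_set AM Mt2_integrable) auto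
  also note nn_Mt2[OF A]
  finally show ?thesis
    using U_nonneg by (subst (asm) ennreal_le_iff) (auto intro!: mult_nonneg_nonneg integral_nonneg_AE)
qed

text \<open>Coordinatewise, a bounded factor from the past can be moved inside the conditional expectation;
the second moment provides the integrability that this requires.\<close>

lemma Mt_orth:
  assumes v: "v \<in> borel_measurable (Gm k)" and bd: "\<And>x. x \<in> space M \<Longrightarrow> norm (v x) \<le> c"
  shows "integrable M (\<lambda>x. v x \<bullet> Mt (Suc k) x)" "(\<integral>x. v x \<bullet> Mt (Suc k) x \<partial>M) = 0"
proof -
  interpret fm: finite_measure_subalgebra M "Gm k" by unfold_locales (rule Gm)
  have vM[measurable]: "v \<in> borel_measurable M" by (rule measurable_from_subalg[OF Gm v])
  have int: "integrable M (\<lambda>x. (v x \<bullet> i) * (Mt (Suc k) x \<bullet> i))" if i: "i \<in> Basis" for i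
  proof (rule Bochner_Integration.integrable_bound)
    show "integrable M (\<lambda>x. \<bar>c\<bar> * (1 + (norm (Mt (Suc k) x))\<^sup>2))"
      using Mt2_integrable by simp
    show "AE x in M. norm ((v x \<bullet> i) * (Mt (Suc k) x \<bullet> i)) \<le> norm (\<bar>c\<bar> * (1 + (norm (Mt (Suc k) x))\<^sup>2))"
    proof (rule AE_I2)
      fix x assume x: "x \<in> space M"
      let ?m = "norm (Mt (Suc k) x)"
      have "\<bar>v x \<bullet> i\<bar> \<le> \<bar>c\<bar>" using order_trans[OF Basis_le_norm[OF i] bd[OF x]] by simp
      moreover have "\<bar>Mt (Suc k) x \<bullet> i\<bar> \<le> 1 + ?m\<^sup>2"
      proof -
        have "0 \<le> (?m - 1)\<^sup>2 + 1 + ?m\<^sup>2" by simp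
        then have "?m \<le> 1 + ?m\<^sup>2" by (simp add: power2_diff)
        then show ?thesis using Basis_le_norm[OF i, of "Mt (Suc k) x"] by linarith
      qed
      ultimately have "\<bar>v x \<bullet> i\<bar> * \<bar>Mt (Suc k) x \<bullet> i\<bar> \<le> \<bar>c\<bar> * (1 + ?m\<^sup>2)" by (intro mult_mono) auto
      then show "norm ((v x \<bullet> i) * (Mt (Suc k) x \<bullet> i)) \<le> norm (\<bar>c\<bar> * (1 + ?m\<^sup>2))" by (simp add: abs_mult)
    qed
  qed measurable
  have zero: "(\<integral>x. (v x \<bullet> i) * (Mt (Suc k) x \<bullet> i) \<partial>M) = 0" if i: "i \<in> Basis" for i
  proof -
    have "(\<integral>x. (v x \<bullet> i) * (Mt (Suc k) x \<bullet> i) \<partial>M)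
       = (\<integral>x. (v x \<bullet> i) * real_cond_exp M (Gm k) (\<lambda>x. Mt (Suc k) x \<bullet> i) x \<partial>M)"
      using v by (intro fm.real_cond_exp_intg(2)[symmetric] int i) auto
    also have "\<dots> = (\<integral>x. 0 \<partial>M)"
      using Mt0[of k] i by (intro integral_cong_AE) (auto simp: cond_mean_zero_def intro: AE_mp)
    finally show ?thesis by simp
  qed
  have eq: "v x \<bullet> Mt (Suc k) x = (\<Sum>i\<in>Basis. (v x \<bullet> i) * (Mt (Suc k) x \<bullet> i))" for x
    by (rule euclidean_inner)
  show "integrable M (\<lambda>x. v x \<bullet> Mt (Suc k) x)" unfolding eq by (intro Bochner_Integration.integrable_sum int)
  show "(\<integral>x. v x \<bullet> Mt (Suc k) x \<partial>M) = 0"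
    unfolding eq by (subst Bochner_Integration.integral_sum) (auto simp: int zero)
qed

section \<open>The corrected Lyapunov function\<close>

text \<open>\<open>excess\<close> is the vector whose norm is \<open>D\<^sub>k\<close>, half the gradient of the squared distance; \<open>lyapunov\<close>
adds the corrector of the Markovian noise, with coefficient \<open>a k = 2 \<rho>\<^sub>k\<^sub>+\<^sub>1 \<alpha>\<^sub>k\<close> in the applications.\<close>

definition excess :: "(nat \<Rightarrow> real) \<Rightarrow> real \<Rightarrow> nat \<Rightarrow> 'w \<Rightarrow> 'a" where
  "excess \<rho> \<eta> k x = shrink \<eta> (\<rho> k *\<^sub>R (th k x - \<theta>s))"

definition lyapunov :: "(nat \<Rightarrow> real) \<Rightarrow> real \<Rightarrow> (nat \<Rightarrow> real) \<Rightarrow> nat \<Rightarrow> 'w \<Rightarrow> real" where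
  "lyapunov \<rho> \<eta> a k x = (norm (excess \<rho> \<eta> k x))\<^sup>2 + a k * (excess \<rho> \<eta> k x \<bullet> u (th k x) (W k x))"

lemma lyap_integrable: "integrable M (\<lambda>x. lyap (W k x))"
proof (rule Bochner_Integration.integrable_bound[OF U2_integrable[of k]])
  show "(\<lambda>x. lyap (W k x)) \<in> borel_measurable M"
    using measurable_compose[OF borel_onD[OF WM] lyap_measurable] .
  show "AE x in M. norm (lyap (W k x)) \<le> norm (U 2 (W k x))"
  proof (rule AE_I2)
    fix x
    show "norm (lyap (W k x)) \<le> norm (U 2 (W k x))"
      using lyap_ge_1[of "W k x"] unfolding lyap_sq[symmetric] by (simp add: power2_eq_square)
  qed
qed

lemma excess_meas: "excess \<rho> \<eta> k \<in> borel_measurable (Gm k)"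
  unfolding excess_def[abs_def] using borel_onD[OF th[of k]] by measurable

lemma norm_excess:
  assumes \<eta>: "0 \<le> \<eta>" and \<rho>: "0 \<le> \<rho> k" and \<Delta>: "\<And>t. t \<in> \<Theta> \<Longrightarrow> norm (t - \<theta>s) \<le> \<Delta>" and x: "x \<in> space M"
  shows "norm (excess \<rho> \<eta> k x) \<le> \<rho> k * \<Delta>"
proof -
  have "norm (excess \<rho> \<eta> k x) \<le> \<rho> k * norm (th k x - \<theta>s)" using \<eta> \<rho> by (simp add: excess_def norm_shrink)
  also have "\<dots> \<le> \<rho> k * \<Delta>" using \<rho> \<Delta>[OF th_in[OF x]] by (intro mult_left_mono)
  finally show ?thesis .
qed

lemma kernel_lyap:
  assumes t: "t \<in> \<Theta>" and w: "w \<in> \<W>"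
  shows "integrable (P t w) lyap" "(\<integral>y. lyap y \<partial>P t w) \<le> cV * lyap w"
proof -
  have Pt: "P t \<in> borel_on \<W> \<rightarrow>\<^sub>M prob_algebra (borel_on \<W>)" using measurable_section[OF P_kernel] t by simp
  have Ps: "sets (P t w) = sets (borel_on \<W>)" using prob_kernelD(2)[OF Pt] w by simp
  have m: "(lyap :: 'b \<Rightarrow> real) \<in> borel_measurable (P t w)"
    unfolding measurable_cong_sets[OF Ps refl] by (intro measurable_restrict_space1) simp
  have l0: "0 \<le> lyap (y :: 'b)" for y using lyap_ge_1[of y] by linarith
  show int: "integrable (P t w) lyap"
    using PV[OF t w] l0 m by (intro integrableI_bounded) (auto intro: le_less_trans)
  have "ennreal (\<integral>y. lyap y \<partial>P t w) \<le> ennreal (cV * lyap w)"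
    using PV[OF t w] nn_integral_eq_integral[OF int] l0 by simp
  then show "(\<integral>y. lyap y \<partial>P t w) \<le> cV * lyap w" using cV l0 by simp
qed

lemma kernel_u:
  assumes t: "t \<in> \<Theta>" and w: "w \<in> \<W>" and t1: "t1 \<in> \<Theta>" and t2: "t2 \<in> \<Theta>"
  shows "norm (\<integral>y. u t1 y \<partial>P t w) \<le> cu * cV * lyap w"
    "norm ((\<integral>y. u t1 y \<partial>P t w) - (\<integral>y. u t2 y \<partial>P t w)) \<le> cu * cV * lyap w * norm (t1 - t2)"
proof -
  have Pt: "P t \<in> borel_on \<W> \<rightarrow>\<^sub>M prob_algebra (borel_on \<W>)" using measurable_section[OF P_kernel] t by simp
  have Ps: "space (P t w) = \<W>" using prob_kernelD(3)[OF Pt] w by simp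
  have "norm (\<integral>y. u t1 y \<partial>P t w) \<le> (\<integral>y. cu * lyap y \<partial>P t w)"
    using u_int[OF t t1 w] kernel_lyap(1)[OF t w] u_bd[OF t1]
    by (intro Bochner_Integration.integral_norm_bound_integral) (auto simp: Ps)
  also have "\<dots> \<le> cu * (cV * lyap w)" using kernel_lyap(2)[OF t w] cu by (simp add: mult_left_mono)
  finally show "norm (\<integral>y. u t1 y \<partial>P t w) \<le> cu * cV * lyap w" by simp
  have "norm (\<integral>y. u t1 y - u t2 y \<partial>P t w) \<le> (\<integral>y. (cu * norm (t1 - t2)) * lyap y \<partial>P t w)"
    using u_int[OF t t1 w] u_int[OF t t2 w] kernel_lyap(1)[OF t w] u_lip[OF t1 t2]
    by (intro Bochner_Integration.integral_norm_bound_integral) (auto simp: Ps mult_ac)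
  also have "\<dots> \<le> (cu * norm (t1 - t2)) * (cV * lyap w)" using kernel_lyap(2)[OF t w] cu by (simp add: mult_left_mono)
  finally show "norm ((\<integral>y. u t1 y \<partial>P t w) - (\<integral>y. u t2 y \<partial>P t w)) \<le> cu * cV * lyap w * norm (t1 - t2)"
    using u_int[OF t t1 w] u_int[OF t t2 w] by (simp add: mult_ac)
qed

lemma u_comp_meas: "(\<lambda>x. u (th k x) (W k x)) \<in> borel_measurable (Gm k)"
  using measurable_compose[OF measurable_Pair[OF th[of k] W[of k]] u_meas] by simp

lemma excess_integrable:
  assumes \<eta>: "0 \<le> \<eta>" and \<rho>: "0 \<le> \<rho> k" and \<Delta>: "\<And>t. t \<in> \<Theta> \<Longrightarrow> norm (t - \<theta>s) \<le> \<Delta>"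
  shows "integrable M (\<lambda>x. (norm (excess \<rho> \<eta> k x))\<^sup>2)"
proof (rule integrable_const_bound[where B="(\<rho> k * \<Delta>)\<^sup>2"])
  show "AE x in M. norm ((norm (excess \<rho> \<eta> k x))\<^sup>2) \<le> (\<rho> k * \<Delta>)\<^sup>2"
    using norm_excess[where \<rho>=\<rho> and k=k and \<Delta>=\<Delta>, OF \<eta> \<rho> \<Delta>] by (intro AE_I2) (auto intro!: power_mono)
qed (use measurable_from_subalg[OF Gm excess_meas] in measurable)

lemma corrector_integrable:
  assumes \<eta>: "0 \<le> \<eta>" and \<rho>: "0 \<le> \<rho> k" and \<Delta>: "\<And>t. t \<in> \<Theta> \<Longrightarrow> norm (t - \<theta>s) \<le> \<Delta>"
  shows "integrable M (\<lambda>x. a * (excess \<rho> \<eta> k x \<bullet> u (th k x) (W k x)))"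
proof (rule integrable_mult_right, rule Bochner_Integration.integrable_bound)
  show "integrable M (\<lambda>x. (\<rho> k * \<Delta>) * (cu * lyap (W k x)))" using lyap_integrable by simp
  show "(\<lambda>x. excess \<rho> \<eta> k x \<bullet> u (th k x) (W k x)) \<in> borel_measurable M"
    using measurable_from_subalg[OF Gm excess_meas[of \<rho> \<eta> k]] measurable_from_subalg[OF Gm u_comp_meas[of k]] by measurable
  show "AE x in M. norm (excess \<rho> \<eta> k x \<bullet> u (th k x) (W k x)) \<le> norm ((\<rho> k * \<Delta>) * (cu * lyap (W k x)))"
  proof (rule AE_I2)
    fix x assume x: "x \<in> space M"
    have "\<bar>excess \<rho> \<eta> k x \<bullet> u (th k x) (W k x)\<bar> \<le> norm (excess \<rho> \<eta> k x) * norm (u (th k x) (W k x))"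
      by (rule Cauchy_Schwarz_ineq2)
    also have "\<dots> \<le> (\<rho> k * \<Delta>) * (cu * lyap (W k x))"
      using norm_excess[where \<rho>=\<rho> and k=k and \<Delta>=\<Delta>, OF \<eta> \<rho> \<Delta> x] u_bd[OF th_in[OF x] W_in[OF x]]
      by (intro mult_mono) (auto intro: order_trans[OF norm_ge_zero])
    finally show "norm (excess \<rho> \<eta> k x \<bullet> u (th k x) (W k x)) \<le> norm ((\<rho> k * \<Delta>) * (cu * lyap (W k x)))"
      by simp
  qed
qed

lemma lyapunov_integrable:
  assumes \<eta>: "0 \<le> \<eta>" and \<rho>: "0 \<le> \<rho> k" and \<Delta>: "\<And>t. t \<in> \<Theta> \<Longrightarrow> norm (t - \<theta>s) \<le> \<Delta>"
  shows "integrable M (lyapunov \<rho> \<eta> a k)"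
  unfolding lyapunov_def[abs_def] by (intro Bochner_Integration.integrable_add excess_integrable[where \<Delta>=\<Delta>] corrector_integrable[where \<Delta>=\<Delta>] assms)

text \<open>The next iterate is known once the update has been revealed, so integrating the new corrector over
\<open>W (Suc k)\<close> replaces \<open>u (t' x)\<close> by its image under the kernel at \<open>(th k x, W k x)\<close>.  The pointwise inequalities for
distance and corrector then combine, with the Poisson equation turning \<open>F - Fb\<close> plus that image
into \<open>u\<close>, and the martingale term integrates to zero.\<close>

lemma lyapunov_step:
  assumes A: "A \<in> sets (Gm k)" and \<eta>: "0 \<le> \<eta>" and \<epsilon>: "0 \<le> \<epsilon>" and \<zeta>: "0 \<le> \<zeta>"
    and \<rho>: "1 \<le> \<rho> k" "\<rho> k \<le> \<rho> (Suc k)" "\<rho> (Suc k) \<le> 2 * \<rho> k"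
    and q: "0 \<le> q" "q \<le> (\<zeta> - \<epsilon>) * \<alpha> k - (\<rho> (Suc k) - \<rho> k) / \<rho> k"
    and bias: "AE x in M. \<rho> (Suc k) * norm (B k x) \<le> \<epsilon> * \<eta>"
    and mono: "\<And>t. t \<in> \<Theta> \<Longrightarrow> (t - \<theta>s) \<bullet> Fb t \<le> - \<zeta> * (norm (t - \<theta>s))\<^sup>2"
    and \<Delta>: "\<And>t. t \<in> \<Theta> \<Longrightarrow> norm (t - \<theta>s) \<le> \<Delta>"
    and c: "0 \<le> c0" "0 \<le> c1" "0 \<le> c3"
    and \<rho>d: "\<rho> (Suc k) - \<rho> k \<le> c0 * (\<rho> k * \<alpha> k)"
    and a: "a k = 2 * \<rho> (Suc k) * \<alpha> k" "0 \<le> a (Suc k)" "a (Suc k) \<le> c3 * (\<rho> k * \<alpha> k)"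
    and ad: "\<bar>a (Suc k) - a k\<bar> \<le> c1 * (\<rho> k * \<alpha> k * \<alpha> k)"
  defines "c2 \<equiv> cF + 1 + \<epsilon> * \<eta>"
  defines "Cc \<equiv> c3 * (2 * (2 * c2 + c0 * \<Delta>)) * (cu * cV) + c1 * \<Delta> * (cu * cV) + 4 * \<Delta> * (cu * cV) * c2 + (c0 * \<Delta> + 2 * c2)\<^sup>2"
  shows "(\<integral>x. indicator A x * lyapunov \<rho> \<eta> a (Suc k) x \<partial>M) \<le> (\<integral>x. indicator A x * lyapunov \<rho> \<eta> a k x \<partial>M)
     - 2 * q * (\<integral>x. indicator A x * (norm (excess \<rho> \<eta> k x))\<^sup>2 \<partial>M)
     + Cc * (\<rho> k * \<alpha> k)\<^sup>2 * (2 * (1 + (mm k)\<^sup>2)) * (\<integral>x. indicator A x * U 2 (W k x) \<partial>M)"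
proof -
  have AM: "A \<in> sets M" using A Gm by (auto simp: subalgebra_def)
  have Ap: "A \<in> sets (Gp k)" using A Gmp by auto
  have \<Delta>0: "0 \<le> \<Delta>" using \<Delta>[OF \<Theta>(4)] by simp
  have c2: "0 \<le> c2" using cF \<epsilon> \<eta> by (simp add: c2_def)
  have cu2: "0 \<le> cu * cV" using cu cV by simp
  have Cc: "0 \<le> Cc" unfolding Cc_def using c c2 cu cV \<Delta>0 by (intro add_nonneg_nonneg mult_nonneg_nonneg) auto
  define g where "g x = F (th k x) (W k x) + Mt (Suc k) x + B k x" for x
  define t' where "t' x = closest_point \<Theta> (th k x + \<alpha> k *\<^sub>R g x)" for x
  define v' where "v' x = shrink \<eta> (\<rho> (Suc k) *\<^sub>R (t' x - \<theta>s))" for x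
  have \<Theta>c: "closed \<Theta>" using \<Theta> compact_imp_closed by blast
  have t'_in: "t' x \<in> \<Theta>" for x unfolding t'_def by (rule closest_point_in_set[OF \<Theta>c \<Theta>(1)])
  have g_m: "g \<in> borel_measurable (Gp k)"
  proof -
    have [measurable]: "(\<lambda>x. F (th k x) (W k x)) \<in> borel_measurable (Gp k)"
      using measurable_compose[OF measurable_Pair[OF thp[of k] Wp[of k]] F_meas] by simp
    have [measurable]: "B k \<in> borel_measurable (Gp k)" by (rule measurable_from_subalg[OF sub_mp B])
    note Mt[measurable]
    show ?thesis unfolding g_def[abs_def] by measurable
  qed
  have t'_m: "t' \<in> borel_measurable (Gp k)"
  proof -
    have "closest_point \<Theta> \<in> borel_measurable borel"
      by (rule borel_measurable_continuous_onI[OF continuous_on_closest_point[OF \<Theta>(3) \<Theta>c \<Theta>(1)]])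
    moreover have "(\<lambda>x. th k x + \<alpha> k *\<^sub>R g x) \<in> borel_measurable (Gp k)"
      using borel_onD[OF thp[of k]] g_m by measurable
    ultimately show ?thesis unfolding t'_def[abs_def] by (rule measurable_compose[rotated])
  qed
  have t'_m\<Theta>: "t' \<in> Gp k \<rightarrow>\<^sub>M borel_on \<Theta>"
    using t'_m t'_in by (simp add: measurable_restrict_space2_iff)
  have v'_m: "v' \<in> borel_measurable (Gp k)" unfolding v'_def[abs_def] using t'_m by measurable
  have v'_bd: "norm (v' x) \<le> \<rho> (Suc k) * \<Delta>" for x
  proof -
    have "norm (v' x) \<le> \<rho> (Suc k) * norm (t' x - \<theta>s)" using \<eta> \<rho> by (simp add: v'_def norm_shrink)
    also have "\<dots> \<le> \<rho> (Suc k) * \<Delta>" using \<rho> \<Delta>[OF t'_in] by (intro mult_left_mono) auto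
    finally show ?thesis .
  qed
  define pu' where "pu' x = (\<integral>y. u (t' x) y \<partial>P (th k x) (W k x))" for x
  define pu where "pu x = (\<integral>y. u (th k x) y \<partial>P (th k x) (W k x))" for x
  \<comment> \<open>The new corrector on \<open>A\<close>, as a function of the revealed past \<open>x\<close> and of the value \<open>y\<close> of \<open>W (Suc k)\<close>.\<close>
  define f where "f x y = indicat_real A x * (a (Suc k) * (v' x \<bullet> u (t' x) y))" for x y
  have f_m: "(\<lambda>(x, y). f x y) \<in> borel_measurable (Gp k \<Otimes>\<^sub>M borel_on \<W>)"
  proof -
    have 1: "(\<lambda>p. t' (fst p)) \<in> Gp k \<Otimes>\<^sub>M borel_on \<W> \<rightarrow>\<^sub>M borel_on \<Theta>"
      by (rule measurable_compose[OF measurable_fst t'_m\<Theta>])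
    have [measurable]: "(\<lambda>p. u (t' (fst p)) (snd p)) \<in> borel_measurable (Gp k \<Otimes>\<^sub>M borel_on \<W>)"
      using measurable_compose[OF measurable_Pair[OF 1 measurable_snd] u_meas] by simp
    note v'_m[measurable] Ap[measurable]
    show ?thesis unfolding f_def case_prod_beta' by measurable
  qed
  have f_bd: "\<bar>f x y\<bar> \<le> (a (Suc k) * (\<rho> (Suc k) * \<Delta>) * cu) * lyap y" if "y \<in> \<W>" for x y
  proof -
    have "\<bar>v' x \<bullet> u (t' x) y\<bar> \<le> norm (v' x) * norm (u (t' x) y)" by (rule Cauchy_Schwarz_ineq2)
    also have "\<dots> \<le> (\<rho> (Suc k) * \<Delta>) * (cu * lyap y)"
      using v'_bd[of x] u_bd[OF t'_in that] \<rho> \<Delta>0 by (intro mult_mono) auto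
    finally have "a (Suc k) * \<bar>v' x \<bullet> u (t' x) y\<bar> \<le> a (Suc k) * ((\<rho> (Suc k) * \<Delta>) * (cu * lyap y))"
      using a(2) by (intro mult_left_mono)
    moreover have "\<bar>f x y\<bar> \<le> a (Suc k) * \<bar>v' x \<bullet> u (t' x) y\<bar>"
      using a(2) by (simp add: f_def abs_mult indicator_def)
    ultimately show ?thesis by (simp add: mult_ac)
  qed
  have Ps: "space (P (th k x) (W k x)) = \<W>" if "x \<in> space M" for x
    using prob_kernelD(3)[OF kernel_measurable, of x k] that by (simp add: space_Gp)
  have f_int: "integrable (P (th k x) (W k x)) (f x)" if x: "x \<in> space M" for x
    unfolding f_def using u_int[OF th_in[OF x] t'_in W_in[OF x]] by simp
  have f_abs: "integrable M (\<lambda>x. \<integral>y. \<bar>f x y\<bar> \<partial>P (th k x) (W k x))"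
  proof (rule Bochner_Integration.integrable_bound)
    show "integrable M (\<lambda>x. (a (Suc k) * (\<rho> (Suc k) * \<Delta>) * cu) * (cV * lyap (W k x)))" using lyap_integrable by simp
    have "(\<lambda>(x, y). \<bar>f x y\<bar>) \<in> borel_measurable (Gp k \<Otimes>\<^sub>M borel_on \<W>)" using f_m by (simp add: case_prod_beta')
    then show "(\<lambda>x. \<integral>y. \<bar>f x y\<bar> \<partial>P (th k x) (W k x)) \<in> borel_measurable M"
      by (rule measurable_from_subalg[OF Gp integral_measurable_kernel[OF _ measurable_prob_algebraD[OF kernel_measurable[of k]]]])
    show "AE x in M. norm (\<integral>y. \<bar>f x y\<bar> \<partial>P (th k x) (W k x)) \<le> norm ((a (Suc k) * (\<rho> (Suc k) * \<Delta>) * cu) * (cV * lyap (W k x)))"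
    proof (rule AE_I2)
      fix x assume x: "x \<in> space M"
      have "norm (\<integral>y. \<bar>f x y\<bar> \<partial>P (th k x) (W k x)) = (\<integral>y. \<bar>f x y\<bar> \<partial>P (th k x) (W k x))" by simp
      also have "\<dots> \<le> (\<integral>y. (a (Suc k) * (\<rho> (Suc k) * \<Delta>) * cu) * lyap y \<partial>P (th k x) (W k x))"
        using f_int[OF x] kernel_lyap(1)[OF th_in[OF x] W_in[OF x]] f_bd Ps[OF x] by (intro integral_mono) auto
      also have "\<dots> \<le> (a (Suc k) * (\<rho> (Suc k) * \<Delta>) * cu) * (cV * lyap (W k x))"
        using kernel_lyap(2)[OF th_in[OF x] W_in[OF x], of k k] a(2) \<rho> \<Delta>0 cu by (simp add: mult_left_mono)
      finally show "norm (\<integral>y. \<bar>f x y\<bar> \<partial>P (th k x) (W k x)) \<le> norm ((a (Suc k) * (\<rho> (Suc k) * \<Delta>) * cu) * (cV * lyap (W k x)))"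
        by (simp add: abs_le_iff)
    qed
  qed
  note transport = cond_kernel_integral[OF Gp[of k] kernel_measurable[of k] WM[of "Suc k"] trans f_m f_int f_abs]
  have f_pu: "(\<integral>y. f x y \<partial>P (th k x) (W k x)) = indicator A x * (a (Suc k) * (v' x \<bullet> pu' x))" if x: "x \<in> space M" for x
    unfolding f_def pu'_def using u_int[OF th_in[OF x] t'_in W_in[OF x]] by simp
  have corr': "(\<integral>x. f x (W (Suc k) x) \<partial>M) = (\<integral>x. indicator A x * (a (Suc k) * (v' x \<bullet> pu' x)) \<partial>M)"
    using transport(2) f_pu by (simp cong: Bochner_Integration.integral_cong)
  have pu'_m: "pu' \<in> borel_measurable M"
  proof -
    have 1: "(\<lambda>p. t' (fst p)) \<in> Gp k \<Otimes>\<^sub>M borel_on \<W> \<rightarrow>\<^sub>M borel_on \<Theta>"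
      by (rule measurable_compose[OF measurable_fst t'_m\<Theta>])
    have "(\<lambda>(x, y). u (t' x) y) \<in> borel_measurable (Gp k \<Otimes>\<^sub>M borel_on \<W>)"
      using measurable_compose[OF measurable_Pair[OF 1 measurable_snd] u_meas] by (simp add: case_prod_beta')
    then show ?thesis unfolding pu'_def[abs_def]
      by (rule measurable_from_subalg[OF Gp integral_measurable_kernel[OF _ measurable_prob_algebraD[OF kernel_measurable[of k]]]])
  qed
  have v'_M[measurable]: "v' \<in> borel_measurable M" by (rule measurable_from_subalg[OF Gp v'_m])
  have corr'_int: "integrable M (\<lambda>x. indicat_real A x * (a (Suc k) * (v' x \<bullet> pu' x)))"
  proof (intro integrable_on_set AM integrable_mult_right, rule Bochner_Integration.integrable_bound)
    show "integrable M (\<lambda>x. (\<rho> (Suc k) * \<Delta>) * (cu * cV * lyap (W k x)))" using lyap_integrable by simp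
    show "(\<lambda>x. v' x \<bullet> pu' x) \<in> borel_measurable M" using pu'_m by measurable
    show "AE x in M. norm (v' x \<bullet> pu' x) \<le> norm ((\<rho> (Suc k) * \<Delta>) * (cu * cV * lyap (W k x)))"
    proof (rule AE_I2)
      fix x assume x: "x \<in> space M"
      have "\<bar>v' x \<bullet> pu' x\<bar> \<le> norm (v' x) * norm (pu' x)" by (rule Cauchy_Schwarz_ineq2)
      also have "\<dots> \<le> (\<rho> (Suc k) * \<Delta>) * (cu * cV * lyap (W k x))"
        using v'_bd[of x] kernel_u(1)[OF th_in[OF x] W_in[OF x] t'_in t'_in] \<rho> \<Delta>0
        unfolding pu'_def by (intro mult_mono) auto
      finally show "norm (v' x \<bullet> pu' x) \<le> norm ((\<rho> (Suc k) * \<Delta>) * (cu * cV * lyap (W k x)))" by simp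
    qed
  qed
  have d'_int: "integrable M (\<lambda>x. indicat_real A x * (norm (v' x))\<^sup>2)"
  proof (intro integrable_on_set AM integrable_const_bound[where B="(\<rho> (Suc k) * \<Delta>)\<^sup>2"] AE_I2)
    show "norm ((norm (v' x))\<^sup>2) \<le> (\<rho> (Suc k) * \<Delta>)\<^sup>2" for x using power_mono[OF v'_bd[of x]] by simp
  qed measurable
  have th_eq: "AE x in M. th (Suc k) x = t' x" using rec[of k] by (simp add: t'_def g_def)
  have Zm: "lyapunov \<rho> \<eta> a (Suc k) \<in> borel_measurable M"
    using lyapunov_integrable[of \<eta> \<rho> "Suc k" \<Delta> a] \<eta> \<rho> \<Delta> by (auto dest: borel_measurable_integrable)
  have LHS: "(\<integral>x. indicator A x * lyapunov \<rho> \<eta> a (Suc k) x \<partial>M) = (\<integral>x. indicator A x * (norm (v' x))\<^sup>2 + indicator A x * (a (Suc k) * (v' x \<bullet> pu' x)) \<partial>M)"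
  proof -
    have "(\<integral>x. indicator A x * lyapunov \<rho> \<eta> a (Suc k) x \<partial>M) = (\<integral>x. indicator A x * (norm (v' x))\<^sup>2 + f x (W (Suc k) x) \<partial>M)"
    proof (rule integral_cong_AE)
      show "AE x in M. indicator A x * lyapunov \<rho> \<eta> a (Suc k) x = indicator A x * (norm (v' x))\<^sup>2 + f x (W (Suc k) x)"
        using th_eq by eventually_elim (simp add: lyapunov_def excess_def v'_def f_def distrib_left)
    qed (use Zm AM borel_measurable_integrable[OF transport(1)] in measurable)
    also have "\<dots> = (\<integral>x. indicator A x * (norm (v' x))\<^sup>2 \<partial>M) + (\<integral>x. f x (W (Suc k) x) \<partial>M)"
      by (rule Bochner_Integration.integral_add[OF d'_int transport(1)])
    finally show ?thesis using d'_int corr'_int by (simp add: corr')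
  qed
  define v where "v x = excess \<rho> \<eta> k x" for x
  have pointwise: "AE x in M. (norm (v' x))\<^sup>2 + a (Suc k) * (v' x \<bullet> pu' x) \<le>
      (1 - 2 * q) * (norm (v x))\<^sup>2 + a k * (v x \<bullet> u (th k x) (W k x)) + a k * (v x \<bullet> Mt (Suc k) x)
      + Cc * (\<rho> k * \<alpha> k)\<^sup>2 * (2 * (U 2 (W k x) + (norm (Mt (Suc k) x))\<^sup>2))"
  proof (rule AE_mp[OF bias], rule AE_I2, rule impI)
    fix x assume x: "x \<in> space M" and bx: "\<rho> (Suc k) * norm (B k x) \<le> \<epsilon> * \<eta>"
    define e where "e = th k x - \<theta>s"
    define e' where "e' = t' x - \<theta>s"
    define X where "X = lyap (W k x) + norm (Mt (Suc k) x)"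
    have X: "1 \<le> X" "lyap (W k x) \<le> X" using lyap_ge_1[of "W k x"] by (auto simp: X_def intro: add_increasing2)
    have tx: "th k x \<in> \<Theta>" and wx: "W k x \<in> \<W>" using th_in W_in x by auto
    have Bx: "norm (B k x) \<le> \<epsilon> * \<eta>"
    proof -
      have "1 * norm (B k x) \<le> \<rho> (Suc k) * norm (B k x)" using \<rho> by (intro mult_right_mono) auto
      then show ?thesis using bx by linarith
    qed
    have gx: "norm (g x) \<le> c2 * X"
    proof -
      have "norm (g x) \<le> norm (F (th k x) (W k x)) + norm (Mt (Suc k) x) + norm (B k x)"
        unfolding g_def by (intro order_trans[OF norm_triangle_ineq] add_mono norm_triangle_ineq order_refl)
      also have "\<dots> \<le> cF * X + X + (\<epsilon> * \<eta>) * X"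
      proof (intro add_mono)
        show "norm (F (th k x) (W k x)) \<le> cF * X" using F_bd[OF tx wx] mult_left_mono[OF X(2) cF] by linarith
        show "norm (Mt (Suc k) x) \<le> X" using lyap_ge_1[of "W k x"] by (simp add: X_def)
        show "norm (B k x) \<le> (\<epsilon> * \<eta>) * X" using Bx mult_left_mono[OF X(1), of "\<epsilon> * \<eta>"] \<epsilon> \<eta> by simp
      qed
      finally show ?thesis by (simp add: c2_def algebra_simps)
    qed
    have self: "closest_point \<Theta> t = t" if "t \<in> \<Theta>" for t using closest_point_self[OF that] .
    have ee': "norm (e' - e) \<le> \<alpha> k * (c2 * X)"
    proof -
      have "norm (t' x - th k x) \<le> norm ((th k x + \<alpha> k *\<^sub>R g x) - th k x)"
        using closest_point_lipschitz[OF \<Theta>(3) \<Theta>c \<Theta>(1), of "th k x + \<alpha> k *\<^sub>R g x" "th k x"]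
        by (simp add: t'_def self[OF tx] dist_norm)
      also have "\<dots> \<le> \<alpha> k * (c2 * X)" using gx \<alpha>[of k] by (simp add: mult_left_mono)
      finally show ?thesis by (simp add: e_def e'_def)
    qed
    have proj: "norm e' \<le> norm (e + \<alpha> k *\<^sub>R (F (th k x) (W k x) + Mt (Suc k) x + B k x))"
      using closest_point_lipschitz[OF \<Theta>(3) \<Theta>c \<Theta>(1), of "th k x + \<alpha> k *\<^sub>R g x" \<theta>s]
      by (simp add: t'_def self[OF \<Theta>(4)] dist_norm e_def e'_def g_def algebra_simps)
    have d1: "(norm (v' x))\<^sup>2 \<le> (1 - 2 * q) * (norm (v x))\<^sup>2
      + 2 * \<rho> (Suc k) * \<alpha> k * (v x \<bullet> (F (th k x) (W k x) - Fb (th k x))) + 2 * \<rho> (Suc k) * \<alpha> k * (v x \<bullet> Mt (Suc k) x)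
      + (norm ((\<rho> (Suc k) - \<rho> k) *\<^sub>R e + (\<rho> (Suc k) * \<alpha> k) *\<^sub>R g x))\<^sup>2"
      unfolding v'_def v_def excess_def e_def[symmetric] e'_def[symmetric] g_def
      by (rule distance_descent[OF _ \<rho>(2) \<eta> \<alpha> \<zeta> \<epsilon> proj _ bx q]) (use \<rho> mono[OF tx] in \<open>auto simp: e_def\<close>)
    have d2: "a (Suc k) * (v' x \<bullet> pu' x) - 2 * \<rho> (Suc k) * \<alpha> k * (v x \<bullet> pu x)
      + (norm ((\<rho> (Suc k) - \<rho> k) *\<^sub>R e + (\<rho> (Suc k) * \<alpha> k) *\<^sub>R g x))\<^sup>2 \<le> Cc * (\<rho> k * \<alpha> k * X)\<^sup>2"
      unfolding v'_def v_def excess_def e_def[symmetric] e'_def[symmetric] Cc_def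
    proof (rule corrector_increment[OF _ \<rho>(2,3) \<eta> \<alpha> c(1,2) c2 c(3) cu2 X(1) _ gx ee' \<rho>d a(2,3)])
      show "0 < \<rho> k" using \<rho> by simp
      show "norm e \<le> \<Delta>" unfolding e_def by (rule \<Delta>[OF tx])
      show "\<bar>a (Suc k) - 2 * \<rho> (Suc k) * \<alpha> k\<bar> \<le> c1 * (\<rho> k * \<alpha> k * \<alpha> k)" using ad a(1) by simp
      show "norm (pu' x) \<le> cu * cV * X"
        using kernel_u(1)[OF tx wx t'_in t'_in, of x] mult_left_mono[OF X(2) cu2] unfolding pu'_def by linarith
      have "norm (pu' x - pu x) \<le> cu * cV * lyap (W k x) * norm (e' - e)"
        using kernel_u(2)[OF tx wx t'_in tx, of x] by (simp add: pu'_def pu_def e_def e'_def)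
      also have "\<dots> \<le> cu * cV * X * norm (e' - e)" using X(2) cu2 by (intro mult_right_mono mult_left_mono) auto
      finally show "norm (pu' x - pu x) \<le> cu * cV * X * norm (e' - e)" .
    qed
    have ps: "F (th k x) (W k x) - Fb (th k x) = u (th k x) (W k x) - pu x"
      using poisson[OF tx wx] by (simp add: pu_def)
    have "X\<^sup>2 \<le> 2 * (U 2 (W k x) + (norm (Mt (Suc k) x))\<^sup>2)"
    proof -
      have "0 \<le> (lyap (W k x) - norm (Mt (Suc k) x))\<^sup>2" by simp
      then show ?thesis by (simp add: X_def lyap_sq[symmetric] power2_sum power2_diff)
    qed
    then have "Cc * (\<rho> k * \<alpha> k)\<^sup>2 * X\<^sup>2 \<le> Cc * (\<rho> k * \<alpha> k)\<^sup>2 * (2 * (U 2 (W k x) + (norm (Mt (Suc k) x))\<^sup>2))"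
      using Cc by (intro mult_left_mono) auto
    then show "(norm (v' x))\<^sup>2 + a (Suc k) * (v' x \<bullet> pu' x) \<le>
      (1 - 2 * q) * (norm (v x))\<^sup>2 + a k * (v x \<bullet> u (th k x) (W k x)) + a k * (v x \<bullet> Mt (Suc k) x)
      + Cc * (\<rho> k * \<alpha> k)\<^sup>2 * (2 * (U 2 (W k x) + (norm (Mt (Suc k) x))\<^sup>2))"
      using d1 d2 unfolding ps a(1) by (simp add: inner_diff_right power_mult_distrib algebra_simps)
  qed
  have \<rho>0': "0 \<le> \<rho> k" using \<rho> by simp
  have iD: "integrable M (\<lambda>x. (norm (v x))\<^sup>2)" unfolding v_def by (rule excess_integrable[where \<rho>=\<rho> and k=k and \<Delta>=\<Delta>, OF \<eta> \<rho>0' \<Delta>])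
  have iC: "integrable M (\<lambda>x. a k * (v x \<bullet> u (th k x) (W k x)))" unfolding v_def by (rule corrector_integrable[where \<rho>=\<rho> and k=k and \<Delta>=\<Delta>, OF \<eta> \<rho>0' \<Delta>])
  define w where "w x = (indicator A x * a k) *\<^sub>R v x" for x
  have w_m: "w \<in> borel_measurable (Gm k)"
    unfolding w_def[abs_def] v_def using excess_meas[of \<rho> \<eta> k] A by measurable
  have w_bd: "norm (w x) \<le> \<bar>a k\<bar> * (\<rho> k * \<Delta>)" if x: "x \<in> space M" for x
  proof -
    have "norm (w x) \<le> \<bar>a k\<bar> * norm (v x)" by (simp add: w_def indicator_def)
    also have "\<dots> \<le> \<bar>a k\<bar> * (\<rho> k * \<Delta>)" unfolding v_def using norm_excess[where \<rho>=\<rho> and k=k and \<Delta>=\<Delta>, OF \<eta> \<rho>0' \<Delta> x] by (intro mult_left_mono) auto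
    finally show ?thesis .
  qed
  note orth = Mt_orth[OF w_m w_bd]
  have w_eq: "w x \<bullet> Mt (Suc k) x = indicator A x * (a k * (v x \<bullet> Mt (Suc k) x))" for x by (simp add: w_def)
  define R where "R x = Cc * (\<rho> k * \<alpha> k)\<^sup>2 * (2 * (U 2 (W k x) + (norm (Mt (Suc k) x))\<^sup>2))" for x
  have iR: "integrable M R" unfolding R_def[abs_def] using U2_integrable Mt2_integrable by simp
  have "(\<integral>x. indicator A x * (norm (v' x))\<^sup>2 + indicator A x * (a (Suc k) * (v' x \<bullet> pu' x)) \<partial>M)
     \<le> (\<integral>x. (1 - 2 * q) * (indicator A x * (norm (v x))\<^sup>2) + indicator A x * (a k * (v x \<bullet> u (th k x) (W k x)))
        + w x \<bullet> Mt (Suc k) x + indicator A x * R x \<partial>M)"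
  proof (rule integral_mono_AE)
    show "AE x in M. indicator A x * (norm (v' x))\<^sup>2 + indicator A x * (a (Suc k) * (v' x \<bullet> pu' x))
      \<le> (1 - 2 * q) * (indicator A x * (norm (v x))\<^sup>2) + indicator A x * (a k * (v x \<bullet> u (th k x) (W k x)))
        + w x \<bullet> Mt (Suc k) x + indicator A x * R x"
      using pointwise by eventually_elim (auto simp: w_eq R_def indicator_def)
    show "integrable M (\<lambda>x. indicator A x * (norm (v' x))\<^sup>2 + indicator A x * (a (Suc k) * (v' x \<bullet> pu' x)))"
      by (rule Bochner_Integration.integrable_add[OF d'_int corr'_int])
    have "integrable M (\<lambda>x. (1 - 2 * q) * (indicator A x * (norm (v x))\<^sup>2))"
      by (intro integrable_mult_right integrable_on_set[OF AM iD])
    from Bochner_Integration.integrable_add[OF Bochner_Integration.integrable_add[OF Bochner_Integration.integrable_add[OF this integrable_on_set[OF AM iC]] orth(1)] integrable_on_set[OF AM iR]]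
    show "integrable M (\<lambda>x. (1 - 2 * q) * (indicator A x * (norm (v x))\<^sup>2) + indicator A x * (a k * (v x \<bullet> u (th k x) (W k x)))
        + w x \<bullet> Mt (Suc k) x + indicator A x * R x)" .
  qed
  also have "\<dots> = (1 - 2 * q) * (\<integral>x. indicator A x * (norm (v x))\<^sup>2 \<partial>M) + (\<integral>x. indicator A x * (a k * (v x \<bullet> u (th k x) (W k x))) \<partial>M)
        + (\<integral>x. indicator A x * R x \<partial>M)"
    using integrable_on_set[OF AM iD] integrable_on_set[OF AM iC] integrable_on_set[OF AM iR] orth by simp
  also have "(\<integral>x. indicator A x * R x \<partial>M) = Cc * (\<rho> k * \<alpha> k)\<^sup>2 * (2 * ((\<integral>x. indicator A x * U 2 (W k x) \<partial>M) + (\<integral>x. indicator A x * (norm (Mt (Suc k) x))\<^sup>2 \<partial>M)))"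
  proof -
    have "(\<integral>x. indicator A x * R x \<partial>M) = (\<integral>x. Cc * (\<rho> k * \<alpha> k)\<^sup>2 * (2 * (indicator A x * U 2 (W k x) + indicator A x * (norm (Mt (Suc k) x))\<^sup>2)) \<partial>M)"
      by (intro Bochner_Integration.integral_cong refl) (simp add: R_def algebra_simps)
    then show ?thesis using integrable_on_set[OF AM U2_integrable] integrable_on_set[OF AM Mt2_integrable] by simp
  qed
  also have "\<dots> \<le> Cc * (\<rho> k * \<alpha> k)\<^sup>2 * (2 * ((\<integral>x. indicator A x * U 2 (W k x) \<partial>M) + (mm k)\<^sup>2 * (\<integral>x. indicator A x * U 2 (W k x) \<partial>M)))"
    using Mt2_bound[OF A] Cc by (intro mult_left_mono) auto
  finally have "(\<integral>x. indicator A x * lyapunov \<rho> \<eta> a (Suc k) x \<partial>M) \<le> (1 - 2 * q) * (\<integral>x. indicator A x * (norm (v x))\<^sup>2 \<partial>M)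
     + (\<integral>x. indicator A x * (a k * (v x \<bullet> u (th k x) (W k x))) \<partial>M)
     + Cc * (\<rho> k * \<alpha> k)\<^sup>2 * (2 * (1 + (mm k)\<^sup>2)) * (\<integral>x. indicator A x * U 2 (W k x) \<partial>M)"
    unfolding LHS by (simp add: algebra_simps)
  moreover have "(\<integral>x. indicator A x * lyapunov \<rho> \<eta> a k x \<partial>M) = (\<integral>x. indicator A x * (norm (v x))\<^sup>2 \<partial>M) + (\<integral>x. indicator A x * (a k * (v x \<bullet> u (th k x) (W k x))) \<partial>M)"
    using integrable_on_set[OF AM iD] integrable_on_set[OF AM iC] by (simp add: lyapunov_def v_def distrib_left)
  ultimately show ?thesis by (simp add: v_def algebra_simps)
qed

end

section \<open>Rates and failure probabilities\<close>

lemma step_sequences: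
  fixes \<alpha>0 \<delta> \<beta> :: real
  assumes \<alpha>0: "0 < \<alpha>0" and \<delta>: "0 \<le> \<delta>" "\<delta> \<le> 1" and \<beta>: "0 \<le> \<beta>" "\<beta> \<le> 1" and k: "1 \<le> k"
  defines "\<rho> \<equiv> \<lambda>k. real k powr \<beta>" and "\<alpha> \<equiv> \<lambda>k. \<alpha>0 * real k powr (- \<delta>)"
  defines "a \<equiv> \<lambda>k. 2 * \<rho> (Suc k) * \<alpha> k"
  shows "1 \<le> \<rho> k" "\<rho> k \<le> \<rho> (Suc k)" "\<rho> (Suc k) \<le> 2 * \<rho> k" "(\<rho> (Suc k) - \<rho> k) / \<rho> k \<le> \<beta> / real k"
    "\<rho> (Suc k) - \<rho> k \<le> \<beta> / \<alpha>0 * (\<rho> k * \<alpha> k)" "0 \<le> a (Suc k)" "a (Suc k) \<le> 8 * (\<rho> k * \<alpha> k)"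
    "\<bar>a (Suc k) - a k\<bar> \<le> 4 * (\<beta> + \<delta>) / \<alpha>0 * (\<rho> k * \<alpha> k * \<alpha> k)" "0 \<le> \<alpha> k"
proof -
  have k1: "1 \<le> real k" using k by simp
  have \<rho>0: "0 \<le> \<rho> j" for j by (simp add: \<rho>_def)
  have up: "\<rho> (Suc j) \<le> (1 + \<beta> / real j) * \<rho> j" if "1 \<le> j" for j
    unfolding \<rho>_def using that \<beta> by (rule powr_Suc_upper)
  show 1: "1 \<le> \<rho> k" unfolding \<rho>_def using k1 \<beta>(1) by (rule ge_one_powr_ge_zero)
  have mono: "\<rho> j \<le> \<rho> (Suc j)" for j unfolding \<rho>_def using \<beta> by (intro powr_mono2) auto
  show "\<rho> k \<le> \<rho> (Suc k)" by (rule mono)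
  have two: "\<rho> (Suc j) \<le> 2 * \<rho> j" if "1 \<le> j" for j
  proof -
    have "(1 + \<beta> / real j) * \<rho> j \<le> 2 * \<rho> j" using that \<beta> \<rho>0 by (intro mult_right_mono) (auto simp: divide_le_eq)
    then show ?thesis using up[OF that] by linarith
  qed
  show 2: "\<rho> (Suc k) \<le> 2 * \<rho> k" by (rule two[OF k])
  have d: "\<rho> (Suc k) - \<rho> k \<le> \<beta> / real k * \<rho> k" using up[OF k] by (simp add: algebra_simps)
  then show "(\<rho> (Suc k) - \<rho> k) / \<rho> k \<le> \<beta> / real k" using 1 by (simp add: divide_le_eq)
  have \<alpha>pos: "0 \<le> \<alpha> j" for j using \<alpha>0 by (simp add: \<alpha>_def)
  show "0 \<le> \<alpha> k" by (rule \<alpha>pos)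
  have inv: "1 / real k \<le> \<alpha> k / \<alpha>0"
  proof -
    have "real k powr (- 1) \<le> real k powr (- \<delta>)" using k1 \<delta> by (intro powr_mono) auto
    then show ?thesis using k1 \<alpha>0 by (simp add: \<alpha>_def powr_minus_divide)
  qed
  have "\<beta> / real k * \<rho> k \<le> \<beta> * \<rho> k * (\<alpha> k / \<alpha>0)"
    using mult_left_mono[OF inv, of "\<beta> * \<rho> k"] \<beta> \<rho>0[of k] by simp
  then show "\<rho> (Suc k) - \<rho> k \<le> \<beta> / \<alpha>0 * (\<rho> k * \<alpha> k)" using d by (simp add: mult_ac)
  show "0 \<le> a (Suc k)" using \<rho>0 \<alpha>pos by (simp add: a_def)
  have \<alpha>dec: "\<alpha> (Suc k) \<le> \<alpha> k" unfolding \<alpha>_def using \<alpha>0 k1 \<delta>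
    by (intro mult_left_mono powr_mono2') auto
  have \<alpha>d: "\<alpha> k - \<alpha> (Suc k) \<le> \<delta> / real k * \<alpha> k"
  proof -
    have "(1 - \<delta> / real k) * real k powr (- \<delta>) \<le> real (Suc k) powr (- \<delta>)" by (rule powr_Suc_neg_lower[OF k \<delta>])
    from mult_left_mono[OF this, of \<alpha>0] show ?thesis using \<alpha>0 by (simp add: \<alpha>_def algebra_simps)
  qed
  have "\<rho> (Suc (Suc k)) \<le> 4 * \<rho> k" using two[of "Suc k"] two[OF k] by simp
  then have "\<rho> (Suc (Suc k)) * \<alpha> (Suc k) \<le> (4 * \<rho> k) * \<alpha> k" using \<alpha>dec \<rho>0 \<alpha>pos by (intro mult_mono) auto
  then have "\<rho> (Suc (Suc k)) * \<alpha> (Suc k) \<le> 4 * (\<rho> k * \<alpha> k)" by (simp only: mult.assoc)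
  moreover have "a (Suc k) = 2 * (\<rho> (Suc (Suc k)) * \<alpha> (Suc k))" by (simp add: a_def)
  ultimately show "a (Suc k) \<le> 8 * (\<rho> k * \<alpha> k)" by linarith
  have d2: "\<rho> (Suc (Suc k)) - \<rho> (Suc k) \<le> \<beta> / real k * (2 * \<rho> k)"
  proof -
    have "\<rho> (Suc (Suc k)) - \<rho> (Suc k) \<le> \<beta> / real (Suc k) * \<rho> (Suc k)" using up[of "Suc k"] by (simp add: algebra_simps)
    also have "\<dots> \<le> \<beta> / real k * (2 * \<rho> k)" using \<beta> k1 2 \<rho>0 by (intro mult_mono divide_left_mono) auto
    finally show ?thesis .
  qed
  have e1: "(\<rho> (Suc (Suc k)) - \<rho> (Suc k)) * \<alpha> (Suc k) \<le> \<beta> / real k * (2 * \<rho> k) * \<alpha> k"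
    using d2 \<alpha>dec \<alpha>pos \<beta> \<rho>0 mono[of "Suc k"] by (intro mult_mono) auto
  have e2: "\<rho> (Suc k) * (\<alpha> k - \<alpha> (Suc k)) \<le> (2 * \<rho> k) * (\<delta> / real k * \<alpha> k)"
    using \<alpha>d 2 \<rho>0 \<alpha>dec by (intro mult_mono) auto
  have p1: "0 \<le> (\<rho> (Suc (Suc k)) - \<rho> (Suc k)) * \<alpha> (Suc k)" using mono[of "Suc k"] \<alpha>pos by simp
  have p2: "0 \<le> \<rho> (Suc k) * (\<alpha> k - \<alpha> (Suc k))" using \<rho>0 \<alpha>dec by simp
  have "a (Suc k) - a k = 2 * ((\<rho> (Suc (Suc k)) - \<rho> (Suc k)) * \<alpha> (Suc k) - \<rho> (Suc k) * (\<alpha> k - \<alpha> (Suc k)))"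
    by (simp add: a_def algebra_simps)
  then have "\<bar>a (Suc k) - a k\<bar> \<le> 2 * (\<beta> / real k * (2 * \<rho> k) * \<alpha> k + (2 * \<rho> k) * (\<delta> / real k * \<alpha> k))"
  proof -
    have "\<bar>2 * (p - q)\<bar> \<le> 2 * (p' + q')" if "0 \<le> p" "p \<le> p'" "0 \<le> q" "q \<le> q'" for p q p' q' :: real
      using that by (simp add: abs_le_iff)
    from this[OF p1 e1 p2 e2] \<open>a (Suc k) - a k = _\<close> show ?thesis by simp
  qed
  also have "\<dots> = (4 * (\<beta> + \<delta>) * (\<rho> k * \<alpha> k)) * (1 / real k)" by (simp add: algebra_simps add_divide_distrib)
  also have "\<dots> \<le> (4 * (\<beta> + \<delta>) * (\<rho> k * \<alpha> k)) * (\<alpha> k / \<alpha>0)"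
    using inv \<beta> \<delta> \<rho>0 \<alpha>pos by (intro mult_left_mono) auto
  finally show "\<bar>a (Suc k) - a k\<bar> \<le> 4 * (\<beta> + \<delta>) / \<alpha>0 * (\<rho> k * \<alpha> k * \<alpha> k)" by (simp add: mult_ac)
qed

text \<open>For \<open>\<delta> = 1\<close> all terms are of order \<open>1/k\<close> and the strict inequality \<open>crit\<close> leaves room for both \<open>\<kappa>\<close>
and \<open>\<epsilon>\<close>.  For \<open>\<delta> < 1\<close> the step size eventually exceeds every multiple of \<open>1/k\<close>.\<close>

lemma contraction_margin:
  fixes \<alpha>0 \<delta> \<beta> \<zeta> r :: real
  assumes \<alpha>0: "0 < \<alpha>0" and \<delta>: "0 \<le> \<delta>" "\<delta> \<le> 1" and \<zeta>: "0 < \<zeta>" and r: "0 < r"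
    and crit: "\<delta> = 1 \<Longrightarrow> r + 2 * \<beta> < 2 * \<zeta> * \<alpha>0"
  obtains \<kappa> \<epsilon> K where "r / 2 < \<kappa>" "0 < \<epsilon>"
    "\<And>k. K \<le> k \<Longrightarrow> 1 \<le> k \<Longrightarrow> \<kappa> / real k \<le> (\<zeta> - \<epsilon>) * (\<alpha>0 * real k powr (- \<delta>)) - \<beta> / real k"
proof (cases "\<delta> = 1")
  case True
  define s where "s = \<zeta> * \<alpha>0 - \<beta>"
  define \<kappa> where "\<kappa> = (r / 2 + s) / 2"
  define \<epsilon> where "\<epsilon> = (s - \<kappa>) / \<alpha>0"
  have lt: "r / 2 < s" using crit[OF True] by (simp add: s_def)
  show ?thesis
  proof (rule that[of \<kappa> \<epsilon> 1])
    show "r / 2 < \<kappa>" using lt by (simp add: \<kappa>_def field_simps)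
    have "\<kappa> < s" using lt by (simp add: \<kappa>_def field_simps)
    then show "0 < \<epsilon>" using \<alpha>0 by (simp add: \<epsilon>_def)
    fix k :: nat assume "1 \<le> k"
    have "\<epsilon> * \<alpha>0 = s - \<kappa>" using \<alpha>0 by (simp add: \<epsilon>_def)
    then have "(\<zeta> - \<epsilon>) * \<alpha>0 = \<kappa> + \<beta>" by (simp add: s_def left_diff_distrib)
    then have "(\<zeta> - \<epsilon>) * (\<alpha>0 * real k powr (- \<delta>)) = (\<kappa> + \<beta>) / real k"
      using \<open>1 \<le> k\<close> by (simp add: True powr_minus_divide mult.assoc[symmetric])
    then show "\<kappa> / real k \<le> (\<zeta> - \<epsilon>) * (\<alpha>0 * real k powr (- \<delta>)) - \<beta> / real k" by (simp add: add_divide_distrib)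
  qed
next
  case False
  then have lt: "0 < 1 - \<delta>" using \<delta> by simp
  define D where "D = max 1 (2 * (r + \<beta>) / (\<zeta> * \<alpha>0))"
  define K where "K = nat \<lceil>D powr (1 / (1 - \<delta>))\<rceil>"
  have K: "2 * (r + \<beta>) / (\<zeta> * \<alpha>0) \<le> real k powr (1 - \<delta>)" if "K \<le> k" for k
  proof -
    have "D powr (1 / (1 - \<delta>)) \<le> real k" using that by (simp add: K_def nat_le_iff ceiling_le_iff)
    then have "(D powr (1 / (1 - \<delta>))) powr (1 - \<delta>) \<le> real k powr (1 - \<delta>)" using lt by (intro powr_mono2) auto
    moreover have "(D powr (1 / (1 - \<delta>))) powr (1 - \<delta>) = D" using lt by (simp add: powr_powr D_def)
    ultimately show ?thesis by (simp add: D_def)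
  qed
  show ?thesis
  proof (rule that[of r "\<zeta> / 2" K])
    fix k assume k: "K \<le> k" "1 \<le> k"
    have k1: "1 \<le> real k" using k by simp
    have "r + \<beta> \<le> \<zeta> / 2 * \<alpha>0 * real k powr (1 - \<delta>)"
      using K[OF k(1)] \<zeta> \<alpha>0 by (simp add: divide_le_eq mult_ac)
    also have "real k powr (1 - \<delta>) = real k * real k powr (- \<delta>)"
      using k1 by (simp add: powr_mult_base)
    finally have "(r + \<beta>) / real k \<le> \<zeta> / 2 * \<alpha>0 * real k powr (- \<delta>)" using k1 by (simp add: divide_le_eq mult_ac)
    moreover have "(\<zeta> - \<zeta> / 2) * (\<alpha>0 * real k powr (- \<delta>)) = \<zeta> / 2 * \<alpha>0 * real k powr (- \<delta>)" by simp
    ultimately show "r / real k \<le> (\<zeta> - \<zeta> / 2) * (\<alpha>0 * real k powr (- \<delta>)) - \<beta> / real k"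
      unfolding add_divide_distrib by linarith
  qed (use \<zeta> r in auto)
qed

text \<open>Ville's maximal inequality in integrated form.  The process is followed on the event that no failure
has occurred yet; whenever a failure occurs, mass is removed on which \<open>G\<close> is at least \<open>h\<close>.\<close>

lemma (in prob_space) first_failure_bound:
  fixes G :: "nat \<Rightarrow> 'a \<Rightarrow> real"
  assumes A: "A \<in> sets M" and Fl: "\<And>k. Fl k \<in> sets M" and G: "\<And>k. integrable M (G k)" and h: "0 \<le> h"
    and G0: "\<And>k x. k0 \<le> k \<Longrightarrow> x \<in> space M \<Longrightarrow> 0 \<le> G k x" and Gh: "\<And>k x. k0 \<le> k \<Longrightarrow> x \<in> Fl k \<Longrightarrow> h \<le> G k x"
    and step: "\<And>n. k0 \<le> n \<Longrightarrow> (\<integral>x. indicator (A - (\<Union>k\<in>{k0..n}. Fl k)) x * G (Suc n) x \<partial>M)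
        \<le> (\<integral>x. indicator (A - (\<Union>k\<in>{k0..n}. Fl k)) x * G n x \<partial>M) + s n"
    and T: "\<And>n. k0 \<le> n \<Longrightarrow> (\<Sum>k\<in>{k0..<n}. s k) \<le> T"
  shows "h * measure M (A \<inter> (\<Union>k\<in>{k0..}. Fl k)) \<le> (\<integral>x. indicator A x * G k0 x \<partial>M) + T"
proof -
  define S where "S n = A - (\<Union>k\<in>{k0..n}. Fl k)" for n
  define H where "H n = A \<inter> (\<Union>k\<in>{k0..n}. Fl k)" for n
  have SM[measurable]: "S n \<in> sets M" and HM[measurable]: "H n \<in> sets M" for n using A Fl by (auto simp: S_def H_def)
  have ii: "integrable M (\<lambda>x. indicat_real X x * G k x)" if "X \<in> sets M" for X k
    using integrable_real_mult_indicator[OF that G[of k]] by (simp add: mult.commute)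
  have split: "(\<integral>x. indicator X x * G n x \<partial>M) \<ge> (\<integral>x. indicator Y x * G n x \<partial>M) + h * measure M D"
    if X: "X \<in> sets M" "Y \<in> sets M" "D \<in> sets M" "Y \<union> D = X" "Y \<inter> D = {}" "D \<subseteq> Fl n" "k0 \<le> n" for X Y D n
  proof -
    have "h * measure M D = (\<integral>x. indicator D x * h \<partial>M)" using X by simp
    also have "\<dots> \<le> (\<integral>x. indicator D x * G n x \<partial>M)"
    proof (rule integral_mono[OF _ ii])
      show "integrable M (\<lambda>x. indicat_real D x * h)"
        using integrable_real_mult_indicator[OF X(3) integrable_const[of h]] by (simp add: mult.commute)
    qed (use X Gh[of n] in \<open>auto simp: indicator_def\<close>)
    finally have "(\<integral>x. indicator Y x * G n x \<partial>M) + h * measure M D \<le> (\<integral>x. indicator Y x * G n x \<partial>M) + (\<integral>x. indicator D x * G n x \<partial>M)" by simp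
    also have "\<dots> = (\<integral>x. indicator Y x * G n x + indicator D x * G n x \<partial>M)"
      using X by (intro Bochner_Integration.integral_add[symmetric] ii) auto
    also have "\<dots> = (\<integral>x. indicator X x * G n x \<partial>M)"
      using X(4,5) by (intro Bochner_Integration.integral_cong refl) (auto simp: indicator_def)
    finally show ?thesis .
  qed
  have main: "h * measure M (H n) + (\<integral>x. indicator (S n) x * G n x \<partial>M) \<le> (\<integral>x. indicator A x * G k0 x \<partial>M) + (\<Sum>k\<in>{k0..<n}. s k)"
    if "k0 \<le> n" for n
    using that
  proof (induction n rule: dec_induct)
    case base
    have "A - Fl k0 \<union> A \<inter> Fl k0 = A" "(A - Fl k0) \<inter> (A \<inter> Fl k0) = {}" by auto
    from split[of A "A - Fl k0" "A \<inter> Fl k0" k0, OF A _ _ this] show ?case using A Fl by (simp add: S_def H_def sets.Diff sets.Int)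
  next
    case (step n)
    define D where "D = S n \<inter> Fl (Suc n)"
    have DM: "D \<in> sets M" using SM Fl by (auto simp: D_def)
    have n: "{k0..Suc n} = insert (Suc n) {k0..n}" using step by auto
    have "(\<integral>x. indicator (S (Suc n)) x * G (Suc n) x \<partial>M) + h * measure M D \<le> (\<integral>x. indicator (S n) x * G (Suc n) x \<partial>M)"
      using step by (intro split SM DM) (auto simp: D_def S_def n)
    also have "\<dots> \<le> (\<integral>x. indicator (S n) x * G n x \<partial>M) + s n" unfolding S_def using step by (intro assms(7))
    finally have 1: "(\<integral>x. indicator (S (Suc n)) x * G (Suc n) x \<partial>M) + h * measure M D \<le> (\<integral>x. indicator (S n) x * G n x \<partial>M) + s n" .
    have "H (Suc n) = H n \<union> D" by (auto simp: H_def D_def S_def n)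
    moreover have "H n \<inter> D = {}" by (auto simp: H_def D_def S_def)
    ultimately have "measure M (H (Suc n)) = measure M (H n) + measure M D"
      using finite_measure_Union[OF HM DM] by simp
    then show ?case using 1 step by (simp add: distrib_left)
  qed
  have bound: "h * measure M (H n) \<le> (\<integral>x. indicator A x * G k0 x \<partial>M) + T" if "k0 \<le> n" for n
  proof -
    have "0 \<le> (\<integral>x. indicator (S n) x * G n x \<partial>M)" using G0 that by (intro integral_nonneg_AE AE_I2) auto
    then show ?thesis using main[OF that] T[OF that] by linarith
  qed
  have "(\<lambda>n. measure M (H n)) \<longlonglongrightarrow> measure M (\<Union>n. H n)"
  proof (rule finite_Lim_measure_incseq)
    show "range H \<subseteq> sets M" using HM by blast
    show "incseq H" unfolding incseq_def H_def by (intro allI impI Int_mono UN_mono) auto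
  qed
  then have "(\<lambda>n. h * measure M (H n)) \<longlonglongrightarrow> h * measure M (\<Union>n. H n)" by (intro tendsto_intros)
  moreover have "(\<Union>n. H n) = A \<inter> (\<Union>k\<in>{k0..}. Fl k)"
    unfolding H_def by (auto, meson atLeastAtMost_iff order_refl)
  ultimately show ?thesis using bound by (auto intro!: LIMSEQ_le_const2)
qed

context sa_process
begin

lemma corrector_bound:
  assumes \<eta>: "0 \<le> \<eta>" and e1: "0 < e1" and y: "0 \<le> a k" "a k \<le> 4 * y" and x: "x \<in> space M"
  shows "\<bar>a k * (excess \<rho> \<eta> k x \<bullet> u (th k x) (W k x))\<bar>
     \<le> e1 * (norm (excess \<rho> \<eta> k x))\<^sup>2 + 4 * cu\<^sup>2 / e1 * y\<^sup>2 * U 2 (W k x)"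
proof -
  define d where "d = norm (excess \<rho> \<eta> k x)"
  define z where "z = 4 * y * (cu * lyap (W k x))"
  have l: "0 \<le> lyap (W k x)" using lyap_ge_1[of "W k x"] by linarith
  have "\<bar>a k * (excess \<rho> \<eta> k x \<bullet> u (th k x) (W k x))\<bar> \<le> a k * (d * norm (u (th k x) (W k x)))"
    using y Cauchy_Schwarz_ineq2[of "excess \<rho> \<eta> k x" "u (th k x) (W k x)"] by (simp add: abs_mult d_def mult_left_mono)
  also have "\<dots> \<le> (4 * y) * (d * (cu * lyap (W k x)))"
    using y u_bd[OF th_in[OF x] W_in[OF x]] by (intro mult_mono) (auto simp: d_def)
  also have "\<dots> = d * z" by (simp add: z_def)
  also have "\<dots> \<le> e1 * d\<^sup>2 + z\<^sup>2 / (4 * e1)"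
  proof -
    have "0 \<le> (2 * e1 * d - z)\<^sup>2 / (4 * e1)" using e1 by simp
    also have "\<dots> = e1 * d\<^sup>2 + z\<^sup>2 / (4 * e1) - d * z" using e1 by (simp add: power2_diff field_simps power2_eq_square)
    finally show ?thesis by simp
  qed
  also have "z\<^sup>2 / (4 * e1) = 4 * cu\<^sup>2 / e1 * y\<^sup>2 * U 2 (W k x)"
    using e1 by (simp add: z_def power_mult_distrib lyap_sq)
  finally show ?thesis by (simp add: d_def)
qed

text \<open>The sequence \<open>lyapunov + Y * U 2 (W k)\<close> dominates half the squared excess, so that it is nonnegative and
at least \<open>\<eta>\<^sup>2/2\<close> at a failure; \<open>Y\<close> is of second order in the step size and its contribution is
absorbed in the error terms.\<close>

lemma tail_bound:
  fixes \<alpha>0 \<delta> \<beta> \<omega> \<zeta> c CM \<Delta> :: real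
  assumes \<alpha>_eq: "\<And>k. 1 \<le> k \<Longrightarrow> \<alpha> k = \<alpha>0 * real k powr (- \<delta>)" and \<alpha>0: "0 < \<alpha>0" and \<delta>: "1 / 2 < \<delta>" "\<delta> \<le> 1"
    and \<zeta>: "0 < \<zeta>" and mono: "\<And>t. t \<in> \<Theta> \<Longrightarrow> (t - \<theta>s) \<bullet> Fb t \<le> - \<zeta> * (norm (t - \<theta>s))\<^sup>2"
    and crit: "\<delta> = 1 \<Longrightarrow> 1 < 2 * \<zeta> * \<alpha>0"
    and \<Delta>: "\<And>t. t \<in> \<Theta> \<Longrightarrow> norm (t - \<theta>s) \<le> \<Delta>"
    and \<omega>: "0 \<le> \<omega>" and \<beta>: "0 \<le> \<beta>" "\<beta> < \<delta> - \<omega> - 1 / 2"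
    and mm: "\<And>k. 0 \<le> mm k" "\<And>k. mm k \<le> CM * (real k + 1) powr \<omega>" and CM: "0 \<le> CM"
    and bias: "\<And>e. 0 < e \<Longrightarrow> \<exists>K. \<forall>k\<ge>K. AE x in M. (real k + 1) powr \<beta> * norm (B k x) \<le> e"
    and c: "0 < c"
  obtains C K where "0 < C" "0 < K"
    "\<And>k0 A. K \<le> k0 \<Longrightarrow> A \<in> sets (Gp 0) \<Longrightarrow>
       measure M (A \<inter> {x \<in> space M. \<exists>k\<ge>k0. c * real k powr (- \<beta>) < norm (th k x - \<theta>s)})
        \<le> C * real k0 powr (- (2 * (\<delta> - \<beta> - \<omega>) - 1)) * (\<integral>x. indicator A x * U 2 (W 0 x) \<partial>M)"
proof -
  define r where "r = 2 * (\<delta> - \<beta> - \<omega>) - 1"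
  have r: "0 < r" "r \<le> 1" using \<beta> \<delta> \<omega> by (auto simp: r_def)
  have \<beta>1: "\<beta> \<le> 1" using \<beta> \<delta> \<omega> by linarith
  have \<delta>0: "0 \<le> \<delta>" using \<delta> by simp
  have crit': "r + 2 * \<beta> < 2 * \<zeta> * \<alpha>0" if "\<delta> = 1"
    using crit[OF that] \<omega> that by (simp add: r_def)
  obtain \<kappa>' \<epsilon> K1 where \<kappa>': "r / 2 < \<kappa>'" and \<epsilon>: "0 < \<epsilon>"
    and K1: "\<And>k. K1 \<le> k \<Longrightarrow> 1 \<le> k \<Longrightarrow> \<kappa>' / real k \<le> (\<zeta> - \<epsilon>) * (\<alpha>0 * real k powr (- \<delta>)) - \<beta> / real k"
    using contraction_margin[OF \<alpha>0 \<delta>0 \<delta>(2) \<zeta> r(1) crit'] by blast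
  \<comment> \<open>A ball of half the target radius: at a failure the excess is then at least \<open>c / 2\<close>.\<close>
  define \<eta> where "\<eta> = c / 2"
  have \<eta>: "0 < \<eta>" using c by (simp add: \<eta>_def)
  obtain K2 where K2: "\<forall>k\<ge>K2. AE x in M. (real k + 1) powr \<beta> * norm (B k x) \<le> \<epsilon> * \<eta>"
    using bias[of "\<epsilon> * \<eta>"] \<epsilon> \<eta> by auto
  define q where "q = 2 * \<kappa>' / r"
  \<comment> \<open>\<open>e1\<close> is the share of \<open>D\<^sup>2\<close> given up to absorb the corrector: small enough to keep the rate \<open>\<kappa> > r\<close>,
    and at most \<open>1/2\<close> so that the corrected function still dominates \<open>D\<^sup>2/2\<close>.\<close>
  define e1 where "e1 = min (1 / 2) ((q - 1) / 2)"
  have "1 < q" using \<kappa>' r by (simp add: q_def less_divide_eq)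
  then have "0 < e1" "e1 \<le> 1 / 2" "1 + e1 < q" by (auto simp: e1_def min_def field_simps)
  then have e1: "0 < e1" "e1 \<le> 1 / 2" "1 + e1 < 2 * \<kappa>' / r" by (simp_all only: q_def)
  define \<kappa> where "\<kappa> = 2 * \<kappa>' / (1 + e1)"
  have \<kappa>: "r < \<kappa>" using e1 r by (simp add: \<kappa>_def field_simps)
  have \<kappa>pos: "0 < \<kappa>'" using \<kappa>' r by simp
  define \<rho> where "\<rho> = (\<lambda>k. real k powr \<beta>)"
  define a where "a = (\<lambda>k. 2 * \<rho> (Suc k) * (\<alpha>0 * real k powr (- \<delta>)))"
  define N where "N k = real k powr (- (r + 1))" for k :: nat
  define CU where "CU = 1 + b0 / (1 - \<rho>0)"
  have CU: "0 \<le> CU" using \<rho>0 b0 by (simp add: CU_def)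
  define c0 where "c0 = \<beta> / \<alpha>0"
  define c1 where "c1 = 4 * (\<beta> + \<delta>) / \<alpha>0"
  have c01: "0 \<le> c0" "0 \<le> c1" using \<alpha>0 \<beta> \<delta> by (auto simp: c0_def c1_def)
  define c2 where "c2 = cF + 1 + \<epsilon> * \<eta>"
  have \<Delta>0: "0 \<le> \<Delta>" using \<Delta>[OF \<Theta>(4)] by simp
  define Cc where "Cc = 8 * (2 * (2 * c2 + c0 * \<Delta>)) * (cu * cV) + c1 * \<Delta> * (cu * cV) + 4 * \<Delta> * (cu * cV) * c2 + (c0 * \<Delta> + 2 * c2)\<^sup>2"
  have c2: "0 \<le> c2" using cF \<epsilon> \<eta> by (simp add: c2_def)
  have Cc: "0 \<le> Cc" unfolding Cc_def using c01 c2 cu cV \<Delta>0 by (intro add_nonneg_nonneg mult_nonneg_nonneg) auto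
  define Dm where "Dm = 2 * (1 + 4 * CM\<^sup>2)"
  have Dm: "0 \<le> Dm" by (simp add: Dm_def)
  define C1 where "C1 = Cc * (\<alpha>0\<^sup>2 * Dm) * CU"
  define C2' where "C2' = 4 * cu\<^sup>2 / e1"
  define C2 where "C2 = C2' * \<alpha>0\<^sup>2 * CU"
  have C12: "0 \<le> C1" "0 \<le> C2'" "0 \<le> C2" using Cc Dm CU e1 by (auto simp: C1_def C2'_def C2_def)
  note ss = step_sequences[OF \<alpha>0 \<delta>0 \<delta>(2) \<beta>(1) \<beta>1, folded \<rho>_def]
  have y2: "(\<rho> k * \<alpha> k)\<^sup>2 = \<alpha>0\<^sup>2 * real k powr (2 * \<beta> - 2 * \<delta>)" if "1 \<le> k" for k
  proof -
    have "(\<rho> k * \<alpha> k)\<^sup>2 = \<alpha>0\<^sup>2 * ((real k powr \<beta> * real k powr (- \<delta>)) * (real k powr \<beta> * real k powr (- \<delta>)))"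
      by (simp add: \<rho>_def \<alpha>_eq[OF that] power2_eq_square)
    also have "\<dots> = \<alpha>0\<^sup>2 * real k powr (2 * \<beta> - 2 * \<delta>)" by (simp add: powr_add[symmetric])
    finally show ?thesis .
  qed
  have y2N: "(\<rho> k * \<alpha> k)\<^sup>2 \<le> \<alpha>0\<^sup>2 * N k" if k: "1 \<le> k" for k
    unfolding y2[OF k] N_def r_def using k \<omega> by (intro mult_left_mono powr_mono) auto
  have noise: "(\<rho> k * \<alpha> k)\<^sup>2 * (2 * (1 + (mm k)\<^sup>2)) \<le> \<alpha>0\<^sup>2 * Dm * N k" if k: "1 \<le> k" for k
  proof -
    have k1: "1 \<le> real k" using k by simp
    have \<omega>1: "\<omega> \<le> 1" using \<beta> \<delta> by linarith
    have "(real k + 1) powr \<omega> \<le> (1 + \<omega> / real k) * real k powr \<omega>"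
      using powr_Suc_upper[OF k \<omega> \<omega>1] by (simp add: add.commute)
    also have "\<dots> \<le> 2 * real k powr \<omega>" using k1 \<omega> \<omega>1 by (intro mult_right_mono) (auto simp: divide_le_eq)
    finally have "CM * (real k + 1) powr \<omega> \<le> CM * (2 * real k powr \<omega>)" using CM by (intro mult_left_mono)
    then have "mm k \<le> CM * (2 * real k powr \<omega>)" using mm(2)[of k] by linarith
    then have "(mm k)\<^sup>2 \<le> (CM * (2 * real k powr \<omega>))\<^sup>2" using mm(1) by (intro power_mono)
    also have "\<dots> = 4 * CM\<^sup>2 * real k powr (2 * \<omega>)"
      by (simp add: power_mult_distrib) (simp add: power2_eq_square powr_add[symmetric])
    finally have m2: "(mm k)\<^sup>2 \<le> 4 * CM\<^sup>2 * real k powr (2 * \<omega>)" .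
    have "1 \<le> real k powr (2 * \<omega>)" using k1 \<omega> by (intro ge_one_powr_ge_zero) auto
    then have "2 * (1 + (mm k)\<^sup>2) \<le> Dm * real k powr (2 * \<omega>)" using m2 by (simp add: Dm_def algebra_simps)
    then have "(\<rho> k * \<alpha> k)\<^sup>2 * (2 * (1 + (mm k)\<^sup>2)) \<le> (\<alpha>0\<^sup>2 * real k powr (2 * \<beta> - 2 * \<delta>)) * (Dm * real k powr (2 * \<omega>))"
      unfolding y2[OF k] by (intro mult_left_mono) auto
    also have "\<dots> = \<alpha>0\<^sup>2 * Dm * (real k powr (2 * \<beta> - 2 * \<delta>) * real k powr (2 * \<omega>))" by simp
    also have "real k powr (2 * \<beta> - 2 * \<delta>) * real k powr (2 * \<omega>) = N k"
      unfolding N_def powr_add[symmetric] by (simp add: r_def algebra_simps)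
    finally show ?thesis .
  qed
  define K where "K = max (max K1 K2) (max 1 (nat \<lceil>\<kappa>\<rceil>))"
  have K: "K1 \<le> k" "K2 \<le> k" "1 \<le> k" "\<kappa> \<le> real k" if "K \<le> k" for k
    using that by (auto simp: K_def nat_le_iff ceiling_le_iff)
  have step: "(\<integral>x. indicator S x * lyapunov \<rho> \<eta> a (Suc k) x \<partial>M) \<le> (\<integral>x. indicator S x * lyapunov \<rho> \<eta> a k x \<partial>M)
      - 2 * (\<kappa>' / real k) * (\<integral>x. indicator S x * (norm (excess \<rho> \<eta> k x))\<^sup>2 \<partial>M)
      + C1 * N k * (\<integral>x. indicator A x * U 2 (W 0 x) \<partial>M)"
    if k: "K \<le> k" and A: "A \<in> sets (Gp 0)" and S: "S \<in> sets (Gm k)" "S \<subseteq> A" for k A S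
  proof -
    note k1 = K(3)[OF k]
    have AM: "A \<in> sets M" using A Gp by (auto simp: subalgebra_def)
    have SM: "S \<in> sets M" using S Gm by (auto simp: subalgebra_def)
    have EU: "(\<integral>x. indicator S x * U 2 (W k x) \<partial>M) \<le> CU * (\<integral>x. indicator A x * U 2 (W 0 x) \<partial>M)"
      unfolding CU_def by (rule U2_bound_subset[OF A SM S(2)])
    have ES: "0 \<le> (\<integral>x. indicator S x * U 2 (W k x) \<partial>M)" using U_nonneg by (intro integral_nonneg_AE) auto
    have \<alpha>S: "\<alpha>0 * real (Suc k) powr (- \<delta>) = \<alpha> (Suc k)" using \<alpha>_eq[of "Suc k"] by simp
    have "(\<integral>x. indicator S x * lyapunov \<rho> \<eta> a (Suc k) x \<partial>M) \<le> (\<integral>x. indicator S x * lyapunov \<rho> \<eta> a k x \<partial>M)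
      - 2 * (\<kappa>' / real k) * (\<integral>x. indicator S x * (norm (excess \<rho> \<eta> k x))\<^sup>2 \<partial>M)
      + Cc * (\<rho> k * \<alpha> k)\<^sup>2 * (2 * (1 + (mm k)\<^sup>2)) * (\<integral>x. indicator S x * U 2 (W k x) \<partial>M)"
      unfolding Cc_def c2_def
    proof (rule lyapunov_step[where \<rho>=\<rho> and k=k and a=a and \<eta>=\<eta> and \<epsilon>=\<epsilon> and \<zeta>=\<zeta> and \<Delta>=\<Delta> and q="\<kappa>' / real k"
          and ?c0.0=c0 and ?c1.0=c1 and ?c3.0=8, OF S(1)])
      show "0 \<le> \<kappa>' / real k" using \<kappa>pos by simp
      have "(\<rho> (Suc k) - \<rho> k) / \<rho> k \<le> \<beta> / real k" using ss(4)[OF k1] by (simp add: \<rho>_def)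
      then show "\<kappa>' / real k \<le> (\<zeta> - \<epsilon>) * \<alpha> k - (\<rho> (Suc k) - \<rho> k) / \<rho> k"
        using K1[OF K(1)[OF k] k1] \<alpha>_eq[OF k1] by simp
      show "AE x in M. \<rho> (Suc k) * norm (B k x) \<le> \<epsilon> * \<eta>" using K2 K(2)[OF k] by (simp add: \<rho>_def add.commute)
      show "1 \<le> \<rho> k" "\<rho> k \<le> \<rho> (Suc k)" "\<rho> (Suc k) \<le> 2 * \<rho> k" "\<rho> (Suc k) - \<rho> k \<le> c0 * (\<rho> k * \<alpha> k)"
        using ss(1,2,3,5)[OF k1] by (auto simp: \<rho>_def c0_def \<alpha>_eq[OF k1])
      show "a k = 2 * \<rho> (Suc k) * \<alpha> k" by (simp add: a_def \<alpha>_eq[OF k1])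
      show "0 \<le> a (Suc k)" "a (Suc k) \<le> 8 * (\<rho> k * \<alpha> k)" "\<bar>a (Suc k) - a k\<bar> \<le> c1 * (\<rho> k * \<alpha> k * \<alpha> k)"
        using ss(6,7,8)[OF k1] by (auto simp: \<rho>_def a_def c1_def \<alpha>_eq[OF k1])
    qed (use \<eta> \<epsilon> \<zeta> mono \<Delta> c01 in auto)
    also have "Cc * (\<rho> k * \<alpha> k)\<^sup>2 * (2 * (1 + (mm k)\<^sup>2)) * (\<integral>x. indicator S x * U 2 (W k x) \<partial>M)
      = Cc * ((\<rho> k * \<alpha> k)\<^sup>2 * (2 * (1 + (mm k)\<^sup>2))) * (\<integral>x. indicator S x * U 2 (W k x) \<partial>M)" by simp
    also have "\<dots> \<le> Cc * (\<alpha>0\<^sup>2 * Dm * N k) * (CU * (\<integral>x. indicator A x * U 2 (W 0 x) \<partial>M))"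
    proof (rule mult_mono[OF mult_left_mono[OF noise[OF k1] Cc] EU _ ES])
      show "0 \<le> Cc * (\<alpha>0\<^sup>2 * Dm * N k)" using Cc Dm by (simp add: N_def)
    qed
    finally show ?thesis by (simp add: C1_def mult_ac)
  qed
  have ay: "0 \<le> a k" "a k \<le> 4 * (\<rho> k * \<alpha> k)" if "1 \<le> k" for k
  proof -
    have "\<rho> (Suc k) * \<alpha> k \<le> 2 * \<rho> k * \<alpha> k" using ss(3)[OF that] \<alpha>[of k] by (intro mult_right_mono) (auto simp: \<rho>_def)
    then have "\<rho> (Suc k) * \<alpha> k \<le> 2 * (\<rho> k * \<alpha> k)" by (simp only: mult.assoc)
    moreover have "a k = 2 * (\<rho> (Suc k) * \<alpha> k)" by (simp add: a_def \<alpha>_eq[OF that])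
    ultimately show "a k \<le> 4 * (\<rho> k * \<alpha> k)" by linarith
    show "0 \<le> a k" using \<alpha>0 by (simp add: a_def \<rho>_def)
  qed
  have \<eta>0: "0 \<le> \<eta>" using \<eta> by simp
  have \<rho>nn: "0 \<le> \<rho> k" for k by (simp add: \<rho>_def)
  have iZ: "integrable M (lyapunov \<rho> \<eta> a k)" for k by (rule lyapunov_integrable[OF \<eta>0 \<rho>nn \<Delta>])
  have iD: "integrable M (\<lambda>x. (norm (excess \<rho> \<eta> k x))\<^sup>2)" for k
    by (rule excess_integrable[where \<rho>=\<rho> and k=k and \<Delta>=\<Delta>, OF \<eta>0 \<rho>nn \<Delta>])
  define Y where "Y k = C2' * (\<rho> k * \<alpha> k)\<^sup>2" for k
  have Y0: "0 \<le> Y k" for k using C12 by (simp add: Y_def)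
  have YE: "Y k * (\<integral>x. indicator S x * U 2 (W k x) \<partial>M) \<le> C2 * N k * (\<integral>x. indicator A x * U 2 (W 0 x) \<partial>M)"
    if k: "1 \<le> k" and A: "A \<in> sets (Gp 0)" and S: "S \<in> sets M" "S \<subseteq> A" for k A S
  proof -
    have AM: "A \<in> sets M" using A Gp by (auto simp: subalgebra_def)
    have EU: "(\<integral>x. indicator S x * U 2 (W k x) \<partial>M) \<le> CU * (\<integral>x. indicator A x * U 2 (W 0 x) \<partial>M)"
      unfolding CU_def by (rule U2_bound_subset[OF A S])
    have ES: "0 \<le> (\<integral>x. indicator S x * U 2 (W k x) \<partial>M)" using U_nonneg by (intro integral_nonneg_AE) auto
    have "Y k * (\<integral>x. indicator S x * U 2 (W k x) \<partial>M) \<le> (C2' * (\<alpha>0\<^sup>2 * N k)) * (CU * (\<integral>x. indicator A x * U 2 (W 0 x) \<partial>M))"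
      unfolding Y_def using y2N[OF k] C12 ES EU by (intro mult_mono mult_left_mono) (auto simp: N_def)
    then show ?thesis by (simp add: C2_def mult_ac)
  qed
  have Zup: "lyapunov \<rho> \<eta> a k x \<le> (1 + e1) * (norm (excess \<rho> \<eta> k x))\<^sup>2 + Y k * U 2 (W k x)"
    and Zlo: "(norm (excess \<rho> \<eta> k x))\<^sup>2 / 2 \<le> lyapunov \<rho> \<eta> a k x + Y k * U 2 (W k x)"
    if k: "1 \<le> k" and x: "x \<in> space M" for k x
  proof -
    have *: "\<bar>a k * (excess \<rho> \<eta> k x \<bullet> u (th k x) (W k x))\<bar> \<le> e1 * (norm (excess \<rho> \<eta> k x))\<^sup>2 + Y k * U 2 (W k x)"
      unfolding Y_def C2'_def using corrector_bound[where a=a and k=k and \<rho>=\<rho>, OF \<eta>0 e1(1) ay[OF k] x] by simp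
    then show "lyapunov \<rho> \<eta> a k x \<le> (1 + e1) * (norm (excess \<rho> \<eta> k x))\<^sup>2 + Y k * U 2 (W k x)"
      unfolding lyapunov_def by (simp add: algebra_simps abs_le_iff)
    have "e1 * (norm (excess \<rho> \<eta> k x))\<^sup>2 \<le> 1 / 2 * (norm (excess \<rho> \<eta> k x))\<^sup>2" using e1 by (intro mult_right_mono) auto
    then show "(norm (excess \<rho> \<eta> k x))\<^sup>2 / 2 \<le> lyapunov \<rho> \<eta> a k x + Y k * U 2 (W k x)"
      using * unfolding lyapunov_def by (simp add: abs_le_iff)
  qed
  define C3 where "C3 = (1 + e1) * (\<rho> K * \<Delta>)\<^sup>2 + C2 * N K"
  define C4 where "C4 = max (C3 * real K powr r) ((C1 + \<kappa> * C2) / (\<kappa> - r))"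
  have KK: "1 \<le> K" "\<kappa> \<le> real K" using K[OF order_refl] by auto
  have rate: "(\<integral>x. indicator A x * lyapunov \<rho> \<eta> a k x \<partial>M) \<le> C4 * real k powr (- r) * (\<integral>x. indicator A x * U 2 (W 0 x) \<partial>M)"
    if A: "A \<in> sets (Gp 0)" and k: "K \<le> k" for A k
  proof -
    let ?J = "\<integral>x. indicator A x * U 2 (W 0 x) \<partial>M"
    let ?x = "\<lambda>k. \<integral>x. indicator A x * (norm (excess \<rho> \<eta> k x))\<^sup>2 \<partial>M"
    let ?z = "\<lambda>k. \<integral>x. indicator A x * lyapunov \<rho> \<eta> a k x \<partial>M"
    have AM: "A \<in> sets M" using A Gp by (auto simp: subalgebra_def)
    have J: "0 \<le> ?J" using U_nonneg by (intro integral_nonneg_AE) auto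
    have zx: "?z k \<le> (1 + e1) * ?x k + C2 * N k * ?J" if k: "1 \<le> k" for k
    proof -
      have "?z k \<le> (\<integral>x. (1 + e1) * (indicator A x * (norm (excess \<rho> \<eta> k x))\<^sup>2) + Y k * (indicator A x * U 2 (W k x)) \<partial>M)"
      proof (rule integral_mono)
        fix x assume x: "x \<in> space M"
        show "indicator A x * lyapunov \<rho> \<eta> a k x \<le> (1 + e1) * (indicator A x * (norm (excess \<rho> \<eta> k x))\<^sup>2) + Y k * (indicator A x * U 2 (W k x))"
          using Zup[OF k x] by (simp add: indicator_def)
      qed (intro integrable_on_set AM iZ Bochner_Integration.integrable_add integrable_mult_right iD U2_integrable)+
      also have "\<dots> = (1 + e1) * ?x k + Y k * (\<integral>x. indicator A x * U 2 (W k x) \<partial>M)"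
        using integrable_on_set[OF AM iD] integrable_on_set[OF AM U2_integrable] by simp
      also have "\<dots> \<le> (1 + e1) * ?x k + C2 * N k * ?J" using YE[OF k A AM] by simp
      finally show ?thesis .
    qed
    show ?thesis
    proof (rule decay_rate[where x="?x" and \<epsilon>=e1 and ?C1.0=C1 and ?C2.0=C2 and \<kappa>=\<kappa> and K=K and r=r])
      show "?z k \<le> (1 + e1) * ?x k + C2 * real k powr (- (r + 1)) * ?J" if "K \<le> k" for k
        using zx[OF K(3)[OF that]] by (simp add: N_def)
      show "?z (Suc k) \<le> ?z k - (1 + e1) * \<kappa> / real k * ?x k + C1 * real k powr (- (r + 1)) * ?J" if kk: "K \<le> k" for k
      proof -
        have "A \<in> sets (Gm k)" using A Gp0_Gm[OF K(3)[OF kk]] by auto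
        from step[OF kk A this order_refl]
        have "?z (Suc k) \<le> ?z k - 2 * (\<kappa>' / real k) * ?x k + C1 * N k * ?J" .
        moreover have "(1 + e1) * \<kappa> / real k = 2 * (\<kappa>' / real k)" using e1 by (simp add: \<kappa>_def)
        ultimately show ?thesis unfolding N_def by (simp only:)
      qed
      show "?z K \<le> C4 * real K powr (- r) * ?J"
      proof -
        have "?x K \<le> (\<integral>x. indicator A x * ((\<rho> K * \<Delta>)\<^sup>2 * U 2 (W 0 x)) \<partial>M)"
        proof (rule integral_mono)
          fix x assume x: "x \<in> space M"
          have "(norm (excess \<rho> \<eta> K x))\<^sup>2 \<le> (\<rho> K * \<Delta>)\<^sup>2"
            using norm_excess[where \<rho>=\<rho> and k=K and \<Delta>=\<Delta>, OF \<eta>0 \<rho>nn \<Delta> x] by (intro power_mono) auto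
          also have "\<dots> \<le> (\<rho> K * \<Delta>)\<^sup>2 * U 2 (W 0 x)" using mult_left_mono[OF U_ge_1, of "(\<rho> K * \<Delta>)\<^sup>2" "W 0 x"] by simp
          finally show "indicator A x * (norm (excess \<rho> \<eta> K x))\<^sup>2 \<le> indicator A x * ((\<rho> K * \<Delta>)\<^sup>2 * U 2 (W 0 x))"
            by (simp add: indicator_def)
        qed (intro integrable_on_set AM iD integrable_mult_right U2_integrable)+
        also have "\<dots> = (\<integral>x. (\<rho> K * \<Delta>)\<^sup>2 * (indicator A x * U 2 (W 0 x)) \<partial>M)"
          by (intro Bochner_Integration.integral_cong) auto
        also have "\<dots> = (\<rho> K * \<Delta>)\<^sup>2 * ?J" by simp
        finally have "(1 + e1) * ?x K \<le> (1 + e1) * ((\<rho> K * \<Delta>)\<^sup>2 * ?J)" using e1 by (intro mult_left_mono) auto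
        then have "?z K \<le> C3 * ?J" using zx[OF KK(1)] by (simp add: C3_def algebra_simps)
        also have "\<dots> = (C3 * real K powr r) * real K powr (- r) * ?J"
          using KK by (simp add: powr_minus field_simps)
        also have "\<dots> \<le> C4 * real K powr (- r) * ?J" using J by (intro mult_right_mono) (auto simp: C4_def)
        finally show ?thesis .
      qed
      show "(C1 + \<kappa> * C2) / (\<kappa> - r) \<le> C4" by (simp add: C4_def)
    qed (use r e1 J C12 \<kappa> KK k in auto)
  qed
  define C5 where "C5 = C1 + C2"
  define h where "h = \<eta>\<^sup>2 / 2"
  have h: "0 < h" using \<eta> by (simp add: h_def)
  define Cf where "Cf = (\<bar>C4\<bar> + C2 + C5 * (2 / r)) / h + 1"
  show ?thesis
  proof (rule that[of Cf K])
    have C5: "0 \<le> C5" using C12 by (simp add: C5_def)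
    have "0 \<le> (\<bar>C4\<bar> + C2 + C5 * (2 / r)) / h"
    proof (rule divide_nonneg_pos[OF _ h])
      have "0 \<le> C5 * (2 / r)" using C5 r by (intro mult_nonneg_nonneg) auto
      then show "0 \<le> \<bar>C4\<bar> + C2 + C5 * (2 / r)" using C12 by linarith
    qed
    then show "0 < Cf" unfolding Cf_def by linarith
    show "0 < K" using KK by simp
    fix k0 A assume k0: "K \<le> k0" and A: "A \<in> sets (Gp 0)"
    let ?J = "\<integral>x. indicator A x * U 2 (W 0 x) \<partial>M"
    define Fl where "Fl k = {x \<in> space M. c * real k powr (- \<beta>) < norm (th k x - \<theta>s)}" for k
    define G where "G k x = lyapunov \<rho> \<eta> a k x + Y k * U 2 (W k x)" for k x
    have AM: "A \<in> sets M" using A Gp by (auto simp: subalgebra_def)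
    have J: "0 \<le> ?J" using U_nonneg by (intro integral_nonneg_AE) auto
    have FlG: "Fl k \<in> sets (Gm k)" for k
    proof -
      have m: "th k \<in> borel_measurable (Gm k)" by (rule borel_onD[OF th])
      have "(\<lambda>t. norm (t - \<theta>s)) \<in> borel_measurable borel" by measurable
      from measurable_compose[OF m this]
      have "(\<lambda>x. norm (th k x - \<theta>s)) \<in> borel_measurable (Gm k)" .
      from this[unfolded borel_measurable_iff_greater, THEN spec, of "c * real k powr (- \<beta>)"]
      show ?thesis unfolding Fl_def space_Gm .
    qed
    have FlM: "Fl k \<in> sets M" for k
    proof -
      have "sets (Gm k) \<subseteq> sets M" using Gm[of k] by (simp add: subalgebra_def)
      then show ?thesis using FlG[of k] by (rule subsetD)
    qed
    have iG: "integrable M (G k)" for k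
      unfolding G_def by (rule Bochner_Integration.integrable_add[OF iZ integrable_mult_right[OF U2_integrable]])
    have k01: "1 \<le> k" if "k0 \<le> k" for k using K(3)[of k] k0 that by auto
    have "h * measure M (A \<inter> (\<Union>k\<in>{k0..}. Fl k)) \<le> (\<integral>x. indicator A x * G k0 x \<partial>M) + C5 * ?J * (2 / r * real k0 powr (- r))"
    proof (rule first_failure_bound[where s="\<lambda>k. C5 * ?J * N k"])
      show "0 \<le> h" using h by simp
      show "0 \<le> G k x" if "k0 \<le> k" "x \<in> space M" for k x
        using Zlo[OF k01[OF that(1)] that(2)] unfolding G_def by (rule order_trans[rotated]) simp
      show "h \<le> G k x" if k: "k0 \<le> k" and x: "x \<in> Fl k" for k x
      proof -
        have xM: "x \<in> space M" and gt: "c * real k powr (- \<beta>) < norm (th k x - \<theta>s)" using x by (auto simp: Fl_def)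
        have kp: "0 < real k" using k01[OF k] by simp
        have "c = real k powr \<beta> * (c * real k powr (- \<beta>))" using kp by (simp add: powr_minus field_simps)
        also have "\<dots> \<le> real k powr \<beta> * norm (th k x - \<theta>s)" using gt by (intro mult_left_mono) auto
        finally have "\<eta> \<le> norm (excess \<rho> \<eta> k x)" using \<eta>0 by (simp add: excess_def norm_shrink \<rho>_def \<eta>_def)
        then have "\<eta>\<^sup>2 \<le> (norm (excess \<rho> \<eta> k x))\<^sup>2" using \<eta>0 by (intro power_mono)
        then show ?thesis using Zlo[OF k01[OF k] xM] by (simp add: h_def G_def)
      qed
      show "(\<Sum>k\<in>{k0..<n}. C5 * ?J * N k) \<le> C5 * ?J * (2 / r * real k0 powr (- r))" if "k0 \<le> n" for n
      proof -
        have "(\<Sum>k\<in>{k0..<n}. N k) \<le> (\<Sum>k\<in>{k0..<n}. 2 / r * (real k powr (- r) - real (Suc k) powr (- r)))"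
          unfolding N_def using k01 r by (intro sum_mono powr_telescope) auto
        also have "\<dots> = 2 / r * (real k0 powr (- r) - real n powr (- r))"
          unfolding sum_distrib_left[symmetric] using sum_Suc_diff'[OF that, of "\<lambda>k. - (real k powr (- r))"] by simp
        also have "\<dots> \<le> 2 / r * real k0 powr (- r)" using r by (intro mult_left_mono) auto
        finally show ?thesis unfolding sum_distrib_left[symmetric] using C5 J by (intro mult_left_mono) auto
      qed
      fix n assume n: "k0 \<le> n"
      let ?S = "A - (\<Union>k\<in>{k0..n}. Fl k)"
      have "Fl k \<in> sets (Gm n)" if "k \<in> {k0..n}" for k using FlG[of k] Gm_mono[of k n] that by auto
      moreover have "A \<in> sets (Gm n)" using A Gp0_Gm[OF k01[OF n]] by auto
      ultimately have S: "?S \<in> sets (Gm n)" by auto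
      have SM: "?S \<in> sets M" using S Gm by (auto simp: subalgebra_def)
      have Gsplit: "(\<integral>x. indicator ?S x * G m x \<partial>M) = (\<integral>x. indicator ?S x * lyapunov \<rho> \<eta> a m x \<partial>M) + Y m * (\<integral>x. indicator ?S x * U 2 (W m x) \<partial>M)" for m
      proof -
        have "(\<integral>x. indicator ?S x * G m x \<partial>M) = (\<integral>x. indicator ?S x * lyapunov \<rho> \<eta> a m x + Y m * (indicator ?S x * U 2 (W m x)) \<partial>M)"
          by (rule Bochner_Integration.integral_cong[OF refl]) (simp add: G_def distrib_left)
        also have "\<dots> = (\<integral>x. indicator ?S x * lyapunov \<rho> \<eta> a m x \<partial>M) + (\<integral>x. Y m * (indicator ?S x * U 2 (W m x)) \<partial>M)"
          by (rule Bochner_Integration.integral_add[OF integrable_on_set[OF SM iZ] integrable_mult_right[OF integrable_on_set[OF SM U2_integrable]]])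
        finally show ?thesis by (simp only: integral_mult_right_zero)
      qed
      have N_dec: "N (Suc n) \<le> N n" unfolding N_def using k01[OF n] r by (intro powr_mono2') auto
      have "(\<integral>x. indicator ?S x * lyapunov \<rho> \<eta> a (Suc n) x \<partial>M) \<le> (\<integral>x. indicator ?S x * lyapunov \<rho> \<eta> a n x \<partial>M)
        - 2 * (\<kappa>' / real n) * (\<integral>x. indicator ?S x * (norm (excess \<rho> \<eta> n x))\<^sup>2 \<partial>M) + C1 * N n * ?J"
        using k0 n by (intro step A S) auto
      have "0 \<le> 2 * (\<kappa>' / real n) * (\<integral>x. indicator ?S x * (norm (excess \<rho> \<eta> n x))\<^sup>2 \<partial>M)"
        using \<kappa>pos by (intro mult_nonneg_nonneg integral_nonneg_AE) auto
      have "Y (Suc n) * (\<integral>x. indicator ?S x * U 2 (W (Suc n) x) \<partial>M) \<le> C2 * N (Suc n) * ?J"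
        by (rule YE[OF _ A SM]) auto
      have "C2 * N (Suc n) * ?J \<le> C2 * N n * ?J" using N_dec C12 J by (intro mult_right_mono mult_left_mono) auto
      have "0 \<le> Y n * (\<integral>x. indicator ?S x * U 2 (W n x) \<partial>M)"
        using Y0 U_nonneg by (intro mult_nonneg_nonneg integral_nonneg_AE) auto
      show "(\<integral>x. indicator ?S x * G (Suc n) x \<partial>M) \<le> (\<integral>x. indicator ?S x * G n x \<partial>M) + C5 * ?J * N n"
      proof -
        have "C5 * ?J * N n = C1 * N n * ?J + C2 * N n * ?J" unfolding C5_def by (simp only: algebra_simps)
        then show ?thesis unfolding Gsplit
          using \<open>(\<integral>x. indicator ?S x * lyapunov \<rho> \<eta> a (Suc n) x \<partial>M) \<le> _\<close> \<open>0 \<le> 2 * (\<kappa>' / real n) * _\<close>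
            \<open>Y (Suc n) * _ \<le> _\<close> \<open>C2 * N (Suc n) * ?J \<le> _\<close> \<open>0 \<le> Y n * _\<close> by linarith
      qed
    qed (rule AM FlM iG)+
    also have "(\<integral>x. indicator A x * G k0 x \<partial>M) \<le> (\<bar>C4\<bar> + C2) * real k0 powr (- r) * ?J"
    proof -
      have "(\<integral>x. indicator A x * G k0 x \<partial>M) = (\<integral>x. indicator A x * lyapunov \<rho> \<eta> a k0 x \<partial>M) + Y k0 * (\<integral>x. indicator A x * U 2 (W k0 x) \<partial>M)"
      proof -
        have "(\<integral>x. indicator A x * G k0 x \<partial>M) = (\<integral>x. indicator A x * lyapunov \<rho> \<eta> a k0 x + Y k0 * (indicator A x * U 2 (W k0 x)) \<partial>M)"
          by (rule Bochner_Integration.integral_cong[OF refl]) (simp add: G_def distrib_left)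
        also have "\<dots> = (\<integral>x. indicator A x * lyapunov \<rho> \<eta> a k0 x \<partial>M) + (\<integral>x. Y k0 * (indicator A x * U 2 (W k0 x)) \<partial>M)"
          by (rule Bochner_Integration.integral_add[OF integrable_on_set[OF AM iZ] integrable_mult_right[OF integrable_on_set[OF AM U2_integrable]]])
        finally show ?thesis by (simp only: integral_mult_right_zero)
      qed
      also have "\<dots> \<le> C4 * real k0 powr (- r) * ?J + C2 * N k0 * ?J"
        by (intro add_mono rate A k0 YE k01 AM) auto
      also have "\<dots> \<le> \<bar>C4\<bar> * real k0 powr (- r) * ?J + C2 * real k0 powr (- r) * ?J"
      proof (intro add_mono mult_right_mono mult_left_mono J)
        show "N k0 \<le> real k0 powr (- r)" unfolding N_def using k01[of k0] by (intro powr_mono) auto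
      qed (use C12 in auto)
      finally show ?thesis by (simp add: algebra_simps)
    qed
    finally have fin: "h * measure M (A \<inter> (\<Union>k\<in>{k0..}. Fl k)) \<le> (\<bar>C4\<bar> + C2 + C5 * (2 / r)) * (real k0 powr (- r) * ?J)"
      by (simp add: algebra_simps)
    have "measure M (A \<inter> (\<Union>k\<in>{k0..}. Fl k)) \<le> (\<bar>C4\<bar> + C2 + C5 * (2 / r)) / h * (real k0 powr (- r) * ?J)"
      using fin h by (simp add: field_simps)
    also have "\<dots> \<le> Cf * (real k0 powr (- r) * ?J)"
      using J by (intro mult_right_mono) (auto simp: Cf_def)
    finally show "measure M (A \<inter> {x \<in> space M. \<exists>k\<ge>k0. c * real k powr (- \<beta>) < norm (th k x - \<theta>s)})
        \<le> Cf * real k0 powr (- (2 * (\<delta> - \<beta> - \<omega>) - 1)) * ?J"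
    proof -
      assume *: "measure M (A \<inter> (\<Union>k\<in>{k0..}. Fl k)) \<le> Cf * (real k0 powr (- r) * ?J)"
      have "(\<Union>k\<in>{k0..}. Fl k) = {x \<in> space M. \<exists>k\<ge>k0. c * real k powr (- \<beta>) < norm (th k x - \<theta>s)}"
        by (auto simp: Fl_def)
      with * show ?thesis by (simp add: r_def mult.assoc)
    qed
  qed
qed

end

section \<open>The conditional probability of staying close\<close>

lemma sigma_join_subalgebra:
  assumes "subalgebra M A" "subalgebra M B"
  shows "subalgebra M (sigma_join A B)" "sets A \<subseteq> sets (sigma_join A B)" "sets B \<subseteq> sets (sigma_join A B)"
proof -
  have sp: "space A = space M" "space B = space M" and ss: "sets A \<subseteq> sets M" "sets B \<subseteq> sets M"
    using assms by (auto simp: subalgebra_def)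
  have cl: "sets A \<union> sets B \<subseteq> Pow (space A)" using sets.space_closed[of A] sets.space_closed[of B] sp by auto
  have eq: "sets (sigma_join A B) = sigma_sets (space A) (sets A \<union> sets B)"
    unfolding sigma_join_def by (rule sets_measure_of[OF cl])
  show "sets A \<subseteq> sets (sigma_join A B)" "sets B \<subseteq> sets (sigma_join A B)" unfolding eq by auto
  have "sigma_sets (space M) (sets A \<union> sets B) \<subseteq> sets M" by (rule sets.sigma_sets_subset) (use ss in auto)
  then show "subalgebra M (sigma_join A B)"
    unfolding subalgebra_def eq by (simp add: sp sigma_join_def space_measure_of_conv)
qed

lemma vimage_subalgebra: "f \<in> M \<rightarrow>\<^sub>M N \<Longrightarrow> subalgebra M (vimage_algebra (space M) f N)"
  unfolding subalgebra_def by (auto simp: measurable_vimage_algebra1 sets_vimage_algebra2 measurable_space intro: measurable_sets)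

text \<open>Test the inequality on the event of \<open>G\<close> where it fails.\<close>

lemma (in prob_space) cprob_lower_bound:
  assumes G: "subalgebra M G" and Good: "Good \<in> sets M" and g: "g \<in> borel_measurable G" "integrable M g"
    and le: "\<And>A. A \<in> sets G \<Longrightarrow> measure M (A - Good) \<le> (\<integral>x. indicator A x * g x \<partial>M)"
  shows "AE x in M. 1 - g x \<le> cprob M G Good x"
proof -
  interpret fm: finite_measure_subalgebra M G by unfold_locales (rule G)
  define f where "f x = cprob M G Good x - (1 - g x)" for x
  have iGood: "integrable M (indicat_real Good)" using Good by (simp add: integrable_real_indicator less_top[symmetric])
  have cp: "cprob M G Good \<in> borel_measurable G" by (simp add: cprob_def)
  have icp: "integrable M (cprob M G Good)" unfolding cprob_def by (rule fm.real_cond_exp_int(1)[OF iGood])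
  have fm: "f \<in> borel_measurable G" unfolding f_def[abs_def] using cp g by measurable
  have fi: "integrable M f" unfolding f_def[abs_def] using icp g by simp
  define A where "A = {x \<in> space G. f x < 0}"
  have A: "A \<in> sets G" unfolding A_def using fm by measurable
  have AM: "A \<in> sets M" using A G by (auto simp: subalgebra_def)
  have sp: "space G = space M" using G by (auto simp: subalgebra_def)
  have ii: "integrable M (\<lambda>x. indicat_real A x * h x)" if "integrable M h" for h
    using integrable_real_mult_indicator[OF AM that] by (simp add: mult.commute)
  have "(\<integral>x. indicator A x * cprob M G Good x \<partial>M) = (\<integral>x. indicator A x * indicator Good x \<partial>M)"
    unfolding cprob_def using A Good by (intro fm.real_cond_exp_intg(2) ii iGood) auto
  also have "\<dots> = measure M (A \<inter> Good)" using AM Good by (simp add: indicator_inter_arith[symmetric])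
  finally have 1: "(\<integral>x. indicator A x * cprob M G Good x \<partial>M) = measure M (A \<inter> Good)" .
  have "(\<integral>x. indicator A x * f x \<partial>M) = (\<integral>x. indicator A x * cprob M G Good x - (indicator A x * 1 - indicator A x * g x) \<partial>M)"
    by (intro Bochner_Integration.integral_cong) (auto simp: f_def algebra_simps)
  also have "\<dots> = measure M (A \<inter> Good) - (measure M A - (\<integral>x. indicator A x * g x \<partial>M))"
    using ii[OF icp] ii[OF integrable_const[of 1]] ii[OF g(2)] AM by (simp add: 1)
  also have "\<dots> \<ge> 0"
  proof -
    have "measure M A = measure M (A \<inter> Good) + measure M (A - Good)"
      using AM Good by (subst finite_measure_Union[symmetric]) (auto intro!: arg_cong[where f="measure M"])
    then show ?thesis using le[OF A] by simp
  qed
  finally have ge: "0 \<le> (\<integral>x. indicator A x * f x \<partial>M)" .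
  have nn: "AE x in M. 0 \<le> - (indicator A x * f x)" by (intro AE_I2) (auto simp: A_def indicator_def)
  have "0 \<le> (\<integral>x. - (indicator A x * f x) \<partial>M)" by (rule integral_nonneg_AE[OF nn])
  then have "(\<integral>x. - (indicator A x * f x) \<partial>M) = 0" using ge by simp
  then have "AE x in M. - (indicator A x * f x) = 0"
    using integral_nonneg_eq_0_iff_AE[OF _ nn] ii[OF fi] by simp
  then show ?thesis
  proof (rule AE_mp, intro AE_I2 impI)
    fix x assume "x \<in> space M" "- (indicator A x * f x) = 0"
    then show "1 - g x \<le> cprob M G Good x" by (cases "f x < 0") (auto simp: A_def sp f_def)
  qed
qed

lemma ergodicity_drift:
  fixes \<W> :: "'b::euclidean_space set"
  assumes erg: "ergodicity \<Theta> \<W> P" and Pt: "\<And>t. t \<in> \<Theta> \<Longrightarrow> P t \<in> borel_on \<W> \<rightarrow>\<^sub>M prob_algebra (borel_on \<W>)"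
  obtains \<rho> b cV where "0 \<le> \<rho>" "\<rho> < 1" "0 \<le> b" "0 \<le> cV"
    "\<And>t w. t \<in> \<Theta> \<Longrightarrow> w \<in> \<W> \<Longrightarrow> (\<integral>\<^sup>+y. ennreal (U 2 y) \<partial>P t w) \<le> ennreal (\<rho> * U 2 w + b)"
    "\<And>t w. t \<in> \<Theta> \<Longrightarrow> w \<in> \<W> \<Longrightarrow> (\<integral>\<^sup>+y. ennreal (lyap y) \<partial>P t w) \<le> ennreal (cV * lyap w)"
proof -
  obtain N W0 eps \<phi> \<rho> b where "0 < N" "W0 \<in> sets (borel_on \<W>)" "W0 \<noteq> {}" "0 < eps"
    "\<phi> \<in> space (prob_algebra (borel_on \<W>))"
    "\<forall>t\<in>\<Theta>. \<forall>w\<in>W0. \<forall>E\<in>sets (borel_on \<W>). measure (kernel_iter (borel_on \<W>) (P t) N w) E \<ge> eps * measure \<phi> E"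
    and rho: "0 \<le> \<rho>" "\<rho> < 1" and b: "0 \<le> b"
    and drift': "\<forall>t\<in>\<Theta>. \<forall>w\<in>\<W>. (\<integral>\<^sup>+y. ennreal (U 2 y) \<partial>P t w) \<le> ennreal (\<rho> * U 2 w + b * indicator W0 w)"
    using erg unfolding ergodicity_def by (elim exE conjE) (rule that)
  have drift: "(\<integral>\<^sup>+y. ennreal (U 2 y) \<partial>P t w) \<le> ennreal (\<rho> * U 2 w + b)" if "t \<in> \<Theta>" "w \<in> \<W>" for t w
  proof -
    have "ennreal (\<rho> * U 2 w + b * indicator W0 w) \<le> ennreal (\<rho> * U 2 w + b)"
      using b by (intro ennreal_leI) (auto simp: indicator_def)
    then show ?thesis using drift' that order_trans by blast
  qed
  have l0: "0 \<le> lyap (y :: 'b)" for y using lyap_ge_1[of y] by linarith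
  show ?thesis
  proof (rule that[of \<rho> b "sqrt \<rho> + sqrt b"])
    fix t w assume t: "t \<in> \<Theta>" and w: "w \<in> \<W>"
    note Pk = prob_kernelD[OF Pt[OF t], of w, simplified, OF w]
    have m: "(lyap :: 'b \<Rightarrow> real) \<in> borel_measurable (P t w)"
      unfolding measurable_cong_sets[OF Pk(2) refl] by (intro measurable_restrict_space1) simp
    have "(\<integral>\<^sup>+y. ennreal (lyap y) \<partial>P t w) \<le> ennreal (sqrt \<rho> * lyap w + sqrt b * 1)"
      using drift[OF t w] rho b l0 lyap_ge_1 by (intro sqrt_drift Pk(1) m) (auto simp: lyap_sq)
    also have "\<dots> \<le> ennreal ((sqrt \<rho> + sqrt b) * lyap w)"
      using b mult_left_mono[OF lyap_ge_1[of w], of "sqrt b"] by (intro ennreal_leI) (simp add: distrib_right)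
    finally show "(\<integral>\<^sup>+y. ennreal (lyap y) \<partial>P t w) \<le> ennreal ((sqrt \<rho> + sqrt b) * lyap w)" .
  qed (use rho b drift in auto)
qed

lemma bias_eventually_small:
  fixes \<beta> \<omega> CB e :: real
  assumes "\<beta> < \<omega>" "0 \<le> CB" "0 < e"
  obtains K :: nat where "\<And>k. K \<le> k \<Longrightarrow> (real k + 1) powr \<beta> * (CB * (real k + 1) powr (- \<omega>)) \<le> e"
proof -
  define D where "D = (CB + 1) / e"
  have D: "0 < D" using assms by (simp add: D_def)
  define K where "K = nat \<lceil>D powr (1 / (\<omega> - \<beta>))\<rceil>"
  show ?thesis
  proof (rule that[of K])
    fix k assume "K \<le> k"
    then have "D powr (1 / (\<omega> - \<beta>)) \<le> real k + 1" by (simp add: K_def nat_le_iff ceiling_le_iff)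
    then have "(D powr (1 / (\<omega> - \<beta>))) powr (\<omega> - \<beta>) \<le> (real k + 1) powr (\<omega> - \<beta>)" using assms by (intro powr_mono2) auto
    moreover have "(D powr (1 / (\<omega> - \<beta>))) powr (\<omega> - \<beta>) = D" using assms D by (simp add: powr_powr)
    ultimately have le: "CB + 1 \<le> e * (real k + 1) powr (\<omega> - \<beta>)" using assms by (simp add: D_def divide_le_eq mult.commute)
    have pos: "0 < (real k + 1) powr (\<omega> - \<beta>)" by simp
    have "(real k + 1) powr \<beta> * (CB * (real k + 1) powr (- \<omega>)) = CB * ((real k + 1) powr \<beta> * (real k + 1) powr (- \<omega>))" by simp
    also have "(real k + 1) powr \<beta> * (real k + 1) powr (- \<omega>) = 1 / (real k + 1) powr (\<omega> - \<beta>)"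
      unfolding powr_add[symmetric] powr_minus_divide[symmetric] by simp
    also have "CB * (1 / (real k + 1) powr (\<omega> - \<beta>)) \<le> e" using le pos by (simp add: divide_le_eq)
    finally show "(real k + 1) powr \<beta> * (CB * (real k + 1) powr (- \<omega>)) \<le> e" .
  qed
qed

theorem theorem3:
  fixes M :: "'w measure"
    and X :: "nat \<Rightarrow> 'c measure"
    and \<Theta> :: "'a::euclidean_space set"
    and \<W> :: "'b::euclidean_space set"
    and F :: "'a \<Rightarrow> 'b \<Rightarrow> 'a"
    and P :: "'a \<Rightarrow> 'b \<Rightarrow> 'b measure"
    and \<theta> :: "nat \<Rightarrow> 'w \<Rightarrow> 'a"
    and W :: "nat \<Rightarrow> 'w \<Rightarrow> 'b"
    and \<xi> :: "nat \<Rightarrow> 'w \<Rightarrow> 'c"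
    and Mt B :: "nat \<Rightarrow> 'w \<Rightarrow> 'a"
    and \<theta>s :: 'a
    and m b :: "nat \<Rightarrow> real"
    and \<alpha>0 \<delta> \<zeta> CM CB \<omega>M \<omega>B \<beta> c :: real
  assumes W_borel: "\<W> \<in> sets borel"
    and F_meas: "(\<lambda>(t, w). F t w) \<in> borel_on \<Theta> \<Otimes>\<^sub>M borel_on \<W> \<rightarrow>\<^sub>M borel"
    and P_kernel: "(\<lambda>(t, w). P t w) \<in> borel_on \<Theta> \<Otimes>\<^sub>M borel_on \<W> \<rightarrow>\<^sub>M prob_algebra (borel_on \<W>)"
    and recursion: "extended_recursion M X \<Theta> \<W> F P (step_size \<alpha>0 \<delta>) \<theta> W \<xi> Mt B"
    and step_sizes: "0 < \<alpha>0" "1/2 < \<delta>" "\<delta> \<le> 1"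
    and compactness: "\<Theta> \<noteq> {}" "compact \<Theta>" "convex \<Theta>"
    and ergodicity_i: "ergodicity \<Theta> \<W> P"
    and ergodicity_ii: "integrable M (\<lambda>x. U 2 (W 0 x))"
    and kernel_continuity: "\<exists>L>0. \<forall>t\<in>\<Theta>. \<forall>t'\<in>\<Theta>. \<forall>w\<in>\<W>.
          \<forall>f::'b \<Rightarrow> real. f \<in> borel_measurable (borel_on \<W>) \<longrightarrow> (\<forall>y\<in>\<W>. \<bar>f y\<bar> \<le> U 1 y) \<longrightarrow>
            \<bar>(\<integral>y. f y \<partial>P t w) - (\<integral>y. f y \<partial>P t' w)\<bar> \<le> L * U 1 w * norm (t - t')"
    and growth: "\<exists>LF>0. \<exists>CF>0.
          (\<forall>t\<in>\<Theta>. \<forall>t'\<in>\<Theta>. \<forall>w\<in>\<W>. norm (F t w - F t' w) \<le> LF * (1 + norm w) * norm (t - t')) \<and>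
          (\<forall>t\<in>\<Theta>. \<forall>w\<in>\<W>. norm (F t w) \<le> CF * (1 + norm w))"
    and interior_target: "\<theta>s \<in> interior \<Theta>" "mean_field (borel_on \<W>) P F \<theta>s = 0"
    and monotonicity: "0 < \<zeta>"
          "\<And>t. t \<in> \<Theta> \<Longrightarrow>
             (t - \<theta>s) \<bullet> mean_field (borel_on \<W>) P F t \<le> - \<zeta> * (norm (t - \<theta>s))\<^sup>2"
    and error: "error_condition M X \<theta> W \<xi> Mt B m b CM CB \<omega>M \<omega>B"
    and critical_step: "\<delta> = 1 \<Longrightarrow> 2 * \<zeta> * \<alpha>0 > 1"
    and noise_small: "noise_exponent M Mt \<omega>M < \<delta> - 1/2"
    and \<beta>_range: "0 \<le> \<beta>"
          "ereal \<beta> < min (bias_exponent M B \<omega>B) (ereal (\<delta> - noise_exponent M Mt \<omega>M - 1/2))"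
    and c_pos: "0 < c"
  shows "\<exists>C>0. \<exists>K>0. \<forall>k0::nat. k0 \<ge> K \<longrightarrow> (AE x in M.
           cprob M (G_plus M X \<theta> W \<xi> 0)
             {y \<in> space M. \<forall>k\<ge>k0. norm (\<theta> k y - \<theta>s) \<le> c * real k powr (- \<beta>)} x
           \<ge> 1 - C * U 2 (W 0 x) * (1 + ln (real k0))\<^sup>2
                 * real k0 powr (- (2 * (\<delta> - \<beta> - noise_exponent M Mt \<omega>M) - 1)))"
proof -
  let ?S = "borel_on \<W>"
  let ?Gm = "G_minus M X \<theta> W \<xi>" and ?Gp = "G_plus M X \<theta> W \<xi>"
  define \<omega> where "\<omega> = noise_exponent M Mt \<omega>M"
  note R = recursion[unfolded extended_recursion_def]
  note E = error[unfolded error_condition_def]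
  interpret prob_space M using R by blast
  have \<theta>0: "\<theta> 0 \<in> M \<rightarrow>\<^sub>M borel_on \<Theta>" and WM: "\<And>k. W k \<in> M \<rightarrow>\<^sub>M ?S" and \<xi>M: "\<And>k. \<xi> (Suc k) \<in> M \<rightarrow>\<^sub>M X (Suc k)"
    using R by blast+
  have \<theta>rec: "AE x in M. \<theta> (Suc k) x = closest_point \<Theta> (\<theta> k x + step_size \<alpha>0 \<delta> k *\<^sub>R (F (\<theta> k x) (W k x) + Mt (Suc k) x + B k x))" for k
    using R by blast
  have \<theta>G: "\<theta> k \<in> borel_measurable (?Gm k)" and WG: "W k \<in> borel_measurable (?Gm k)"
    and BG: "B k \<in> borel_measurable (?Gm k)" and MtG: "Mt (Suc k) \<in> borel_measurable (?Gp k)" for k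
    using R by blast+
  have trans: "AE x in M. cprob M (?Gp k) {y \<in> space M. W (Suc k) y \<in> E} x = measure (P (\<theta> k x) (W k x)) E"
    if "E \<in> sets ?S" for k E
    using R that by blast
  have borel_onM: "f \<in> borel_measurable A" if "f \<in> A \<rightarrow>\<^sub>M borel_on Y" for f :: "'w \<Rightarrow> 'd::topological_space" and A Y
    using that by (simp add: measurable_restrict_space2_iff)
  have sub: "subalgebra M (?Gm k) \<and> subalgebra M (?Gp k) \<and> sets (?Gm k) \<subseteq> sets (?Gp k) \<and> sets (?Gp k) \<subseteq> sets (?Gm (Suc k))" for k
  proof -
    have m: "subalgebra M (?Gm k)" for k
    proof (induction k)
      case 0
      have "(\<lambda>x. (\<theta> 0 x, W 0 x)) \<in> M \<rightarrow>\<^sub>M borel \<Otimes>\<^sub>M borel"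
        using borel_onM[OF \<theta>0] borel_onM[OF WM] by (rule measurable_Pair)
      then show ?case by (simp add: vimage_subalgebra)
    next
      case (Suc k)
      show ?case
        using Suc by (auto intro!: sigma_join_subalgebra vimage_subalgebra \<xi>M borel_onM[OF WM])
    qed
    have p: "subalgebra M (?Gp k)" unfolding G_plus_def by (intro sigma_join_subalgebra(1) m vimage_subalgebra \<xi>M)
    have "sets (?Gm k) \<subseteq> sets (?Gp k)" unfolding G_plus_def by (intro sigma_join_subalgebra(2)[OF m] vimage_subalgebra \<xi>M)
    moreover have "?Gm (Suc k) = sigma_join (?Gp k) (vimage_algebra (space M) (W (Suc k)) borel)" by (simp add: G_plus_def)
    then have "sets (?Gp k) \<subseteq> sets (?Gm (Suc k))"
      using sigma_join_subalgebra(2)[OF p vimage_subalgebra[OF borel_onM[OF WM]]] by simp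
    ultimately show ?thesis using m p by blast
  qed
  have spm: "space (?Gm k) = space M" for k using sub[of k] by (auto simp: subalgebra_def)
  have \<Theta>c: "closed \<Theta>" using compactness compact_imp_closed by blast
  \<comment> \<open>The recursion holds almost surely, so an iterate may leave \<open>\<Theta>\<close> on a null set, while \<open>F\<close> and \<open>P\<close> are
    measurable on \<open>\<Theta>\<close>; projecting once more puts every iterate into \<open>\<Theta>\<close> at every sample point.\<close>
  define th where "th k x = closest_point \<Theta> (\<theta> k x)" for k x
  have th_in: "th k x \<in> \<Theta>" for k x unfolding th_def by (rule closest_point_in_set[OF \<Theta>c compactness(1)])
  have th_eq: "AE x in M. th k x = \<theta> k x" for k
  proof (cases k)
    case 0
    have "\<theta> 0 x \<in> \<Theta>" if "x \<in> space M" for x using measurable_space[OF \<theta>0 that] by simp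
    then show ?thesis unfolding 0 th_def by (intro AE_I2 closest_point_self) auto
  next
    case (Suc j)
    show ?thesis unfolding Suc th_def using \<theta>rec[of j]
    proof eventually_elim
      case (elim x)
      then have "\<theta> (Suc j) x \<in> \<Theta>" using closest_point_in_set[OF \<Theta>c compactness(1)] by simp
      then show ?case by (rule closest_point_self)
    qed
  qed
  have th_m: "th k \<in> ?Gm k \<rightarrow>\<^sub>M borel_on \<Theta>" for k
  proof -
    have "closest_point \<Theta> \<in> borel_measurable borel"
      by (rule borel_measurable_continuous_onI[OF continuous_on_closest_point[OF compactness(3) \<Theta>c compactness(1)]])
    from measurable_compose[OF \<theta>G this] show ?thesis
      using th_in by (simp add: measurable_restrict_space2_iff th_def[abs_def])
  qed
  have W_m: "W k \<in> ?Gm k \<rightarrow>\<^sub>M ?S" for k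
    using WG measurable_space[OF WM] by (auto simp: measurable_restrict_space2_iff spm)
  \<comment> \<open>If the noise vanishes, scale 0 is consistent with the exponent 0 of \<open>noise_exponent\<close>.\<close>
  define mm where "mm k = (if \<forall>k. AE x in M. Mt (Suc k) x = 0 then 0 else m k)" for k
  have CM: "0 \<le> CM" and mCM: "\<And>k. 0 \<le> m k" "\<And>k. m k \<le> CM * (real k + 1) powr \<omega>M" and \<omega>M: "0 \<le> \<omega>M" using E by blast+
  have \<omega>: "0 \<le> \<omega>" using \<omega>M by (simp add: \<omega>_def noise_exponent_def)
  have mm0: "0 \<le> mm k" for k using mCM by (simp add: mm_def)
  have mmle: "mm k \<le> CM * (real k + 1) powr \<omega>" for k
    using mCM CM by (simp add: mm_def \<omega>_def noise_exponent_def)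
  have MtM: "Mt (Suc k) \<in> borel_measurable M" for k
    using sub[of k] MtG by (blast intro: measurable_from_subalg)
  have mm2: "AE x in M. nn_cond_exp M (?Gm k) (\<lambda>y. ennreal ((norm (Mt (Suc k) y))\<^sup>2)) x \<le> ennreal ((mm k)\<^sup>2 * U 2 (W k x))" for k
  proof (cases "\<forall>k. AE x in M. Mt (Suc k) x = 0")
    case True
    interpret fm: finite_measure_subalgebra M "?Gm k" by unfold_locales (use sub in blast)
    have z: "AE x in M. Mt (Suc k) x = 0" using True by blast
    have 1: "AE x in M. nn_cond_exp M (?Gm k) (\<lambda>y. ennreal ((norm (Mt (Suc k) y))\<^sup>2)) x = nn_cond_exp M (?Gm k) (\<lambda>y. 0) x"
    proof (rule fm.nn_cond_exp_cong)
      show "AE x in M. ennreal ((norm (Mt (Suc k) x))\<^sup>2) = 0" using z by eventually_elim simp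
    qed (use MtM[of k] in measurable)
    have 2: "AE x in M. 0 = nn_cond_exp M (?Gm k) (\<lambda>y. 0) x" by (rule fm.nn_cond_exp_F_meas) simp
    show ?thesis using 1 2 by eventually_elim simp
  next
    case False
    have "mm k = m k" unfolding mm_def by (rule if_not_P[OF False])
    then show ?thesis using E by simp
  qed
  have bias: "\<exists>K. \<forall>k\<ge>K. AE x in M. (real k + 1) powr \<beta> * norm (B k x) \<le> e" if e: "0 < e" for e
  proof (cases "\<forall>k. AE x in M. B k x = 0")
    case True
    have "AE x in M. (real k + 1) powr \<beta> * norm (B k x) \<le> e" for k
    proof -
      have "AE x in M. B k x = 0" using True by blast
      then show ?thesis by eventually_elim (use e in simp)
    qed
    then show ?thesis by blast
  next
    case False
    have "bias_exponent M B \<omega>B = ereal \<omega>B" unfolding bias_exponent_def by (rule if_not_P[OF False])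
    then have lt: "\<beta> < \<omega>B" using \<beta>_range(2) by simp
    have CB: "0 \<le> CB" and Bb: "\<And>k. AE x in M. norm (B k x) \<le> b k" and bCB: "\<And>k. b k \<le> CB * (real k + 1) powr (- \<omega>B)"
      using E by blast+
    obtain K :: nat where K: "\<And>k. K \<le> k \<Longrightarrow> (real k + 1) powr \<beta> * (CB * (real k + 1) powr (- \<omega>B)) \<le> e"
      using bias_eventually_small[OF lt CB e] by blast
    have "AE x in M. (real k + 1) powr \<beta> * norm (B k x) \<le> e" if "K \<le> k" for k
      using Bb[of k]
    proof eventually_elim
      case (elim x)
      then have "norm (B k x) \<le> CB * (real k + 1) powr (- \<omega>B)" using bCB[of k] by linarith
      then have "(real k + 1) powr \<beta> * norm (B k x) \<le> (real k + 1) powr \<beta> * (CB * (real k + 1) powr (- \<omega>B))"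
        by (intro mult_left_mono) auto
      then show ?case using K[OF that] by linarith
    qed
    then show ?thesis by blast
  qed
  obtain LP where LP: "0 < LP" and LPl: "\<forall>t\<in>\<Theta>. \<forall>t'\<in>\<Theta>. \<forall>w\<in>\<W>.
          \<forall>f::'b \<Rightarrow> real. f \<in> borel_measurable (borel_on \<W>) \<longrightarrow> (\<forall>y\<in>\<W>. \<bar>f y\<bar> \<le> U 1 y) \<longrightarrow>
            \<bar>(\<integral>y. f y \<partial>P t w) - (\<integral>y. f y \<partial>P t' w)\<bar> \<le> LP * U 1 w * norm (t - t')"
    using kernel_continuity by blast
  obtain LF CF where LF: "0 < LF" and CF: "0 < CF"
    and LFl: "\<forall>t\<in>\<Theta>. \<forall>t'\<in>\<Theta>. \<forall>w\<in>\<W>. norm (F t w - F t' w) \<le> LF * (1 + norm w) * norm (t - t')"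
    and CFl: "\<forall>t\<in>\<Theta>. \<forall>w\<in>\<W>. norm (F t w) \<le> CF * (1 + norm w)"
    using growth by blast
  obtain u Cu where Cu: "0 < Cu" and um: "(\<lambda>(t, w). u t w) \<in> borel_on \<Theta> \<Otimes>\<^sub>M ?S \<rightarrow>\<^sub>M (borel :: 'a measure)"
    and ub: "\<And>t w. t \<in> \<Theta> \<Longrightarrow> w \<in> \<W> \<Longrightarrow> norm (u t w) \<le> Cu * lyap w"
    and ul: "\<And>t t' w. t \<in> \<Theta> \<Longrightarrow> t' \<in> \<Theta> \<Longrightarrow> w \<in> \<W> \<Longrightarrow> norm (u t w - u t' w) \<le> Cu * lyap w * norm (t - t')"
    and ui: "\<And>t t' w. t \<in> \<Theta> \<Longrightarrow> t' \<in> \<Theta> \<Longrightarrow> w \<in> \<W> \<Longrightarrow> integrable (P t w) (u t')"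
    and up: "\<And>t w. t \<in> \<Theta> \<Longrightarrow> w \<in> \<W> \<Longrightarrow> u t w - (\<integral>y. u t y \<partial>P t w) = F t w - mean_field ?S P F t"
  proof (rule uniform_poisson_equation[OF W_borel F_meas P_kernel ergodicity_i LP _ LF _ CF])
    show "\<bar>(\<integral>y. f y \<partial>P t w) - (\<integral>y. f y \<partial>P t' w)\<bar> \<le> LP * U 1 w * norm (t - t')"
      if "t \<in> \<Theta>" "t' \<in> \<Theta>" "w \<in> \<W>" "f \<in> borel_measurable ?S" "\<forall>y\<in>\<W>. \<bar>f y\<bar> \<le> U 1 y" for t t' w f
      using LPl that by blast
    show "norm (F t w - F t' w) \<le> LF * (1 + norm w) * norm (t - t')" if "t \<in> \<Theta>" "t' \<in> \<Theta>" "w \<in> \<W>" for t t' w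
      using LFl that by blast
    show "norm (F t w) \<le> CF * (1 + norm w)" if "t \<in> \<Theta>" "w \<in> \<W>" for t w
      using CFl that by blast
  qed (rule that)
  have Pt: "P t \<in> ?S \<rightarrow>\<^sub>M prob_algebra ?S" if "t \<in> \<Theta>" for t using measurable_section[OF P_kernel] that by simp
  obtain \<rho> b' cV where \<rho>: "0 \<le> \<rho>" "\<rho> < 1" and b': "0 \<le> b'" and cV: "0 \<le> cV"
    and drift: "\<And>t w. t \<in> \<Theta> \<Longrightarrow> w \<in> \<W> \<Longrightarrow> (\<integral>\<^sup>+y. ennreal (U 2 y) \<partial>P t w) \<le> ennreal (\<rho> * U 2 w + b')"
    and PV: "\<And>t w. t \<in> \<Theta> \<Longrightarrow> w \<in> \<W> \<Longrightarrow> (\<integral>\<^sup>+y. ennreal (lyap y) \<partial>P t w) \<le> ennreal (cV * lyap w)"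
    by (rule ergodicity_drift[OF ergodicity_i Pt]) (assumption, rule that)
  have \<theta>s: "\<theta>s \<in> \<Theta>" using interior_target(1) interior_subset by blast
  interpret sa: sa_process M ?Gm ?Gp \<Theta> \<W> F P "step_size \<alpha>0 \<delta>" th W Mt B "mean_field ?S P F" u \<theta>s \<rho> b' "2 * CF" cV Cu mm
  proof
    show "AE x in M. th (Suc k) x = closest_point \<Theta> (th k x + step_size \<alpha>0 \<delta> k *\<^sub>R (F (th k x) (W k x) + Mt (Suc k) x + B k x))" for k
      using \<theta>rec[of k] th_eq[of k] th_eq[of "Suc k"] by eventually_elim simp
    show "AE x in M. cprob M (?Gp k) {y \<in> space M. W (Suc k) y \<in> E} x = measure (P (th k x) (W k x)) E" if "E \<in> sets ?S" for k E
      using trans[OF that, of k] th_eq[of k] by eventually_elim simp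
    show "norm (F t w) \<le> 2 * CF * lyap w" if "t \<in> \<Theta>" "w \<in> \<W>" for t w
    proof -
      have "norm (F t w) \<le> CF * (1 + norm w)" using CFl that by blast
      also have "\<dots> \<le> CF * (2 * lyap w)" using CF le_lyap[of w] by (intro mult_left_mono) auto
      finally show ?thesis by simp
    qed
    show "cond_mean_zero M (?Gm k) (Mt (Suc k))" for k using E by blast
    show "0 \<le> step_size \<alpha>0 \<delta> k" for k using step_sizes by (simp add: step_size_def)
    show "subalgebra M (?Gm k)" "subalgebra M (?Gp k)" "sets (?Gm k) \<subseteq> sets (?Gp k)" "sets (?Gp k) \<subseteq> sets (?Gm (Suc k))" for k
      by (rule sub[of k, THEN conjunct1] sub[of k, THEN conjunct2, THEN conjunct1]
          sub[of k, THEN conjunct2, THEN conjunct2, THEN conjunct1] sub[of k, THEN conjunct2, THEN conjunct2, THEN conjunct2])+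
    show "0 \<le> 2 * CF" "0 \<le> Cu" using CF Cu by simp_all
  qed (rule th_m W_m BG MtG mm2 compactness \<theta>s F_meas P_kernel um \<rho> b' cV drift PV ub ul ui up ergodicity_ii; assumption)+
  obtain \<Delta> where \<Delta>: "\<And>t. t \<in> \<Theta> \<Longrightarrow> norm (t - \<theta>s) \<le> \<Delta>"
  proof -
    have "bounded ((\<lambda>t. t - \<theta>s) ` \<Theta>)" using compactness by (intro bounded_translation_minus compact_imp_bounded)
    then show ?thesis using that by (auto simp: bounded_iff)
  qed
  have \<beta>lt: "\<beta> < \<delta> - \<omega> - 1 / 2" using \<beta>_range(2) by (simp add: \<omega>_def)
  have \<alpha>_eq: "step_size \<alpha>0 \<delta> k = \<alpha>0 * real k powr (- \<delta>)" if "1 \<le> k" for k using that by (simp add: step_size_def)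
  obtain C K where C: "0 < C" and K: "0 < K" and tail:
    "\<And>k0 A. K \<le> k0 \<Longrightarrow> A \<in> sets (?Gp 0) \<Longrightarrow>
       measure M (A \<inter> {x \<in> space M. \<exists>k\<ge>k0. c * real k powr (- \<beta>) < norm (th k x - \<theta>s)})
        \<le> C * real k0 powr (- (2 * (\<delta> - \<beta> - \<omega>) - 1)) * (\<integral>x. indicator A x * U 2 (W 0 x) \<partial>M)"
    by (rule sa.tail_bound[OF \<alpha>_eq step_sizes(1) step_sizes(2,3) monotonicity critical_step \<Delta> \<omega> \<beta>_range(1) \<beta>lt mm0 mmle CM bias c_pos])
      (assumption+ | rule that)+
  show ?thesis
  proof (intro exI conjI allI impI)
    show "0 < C" "0 < K" by fact+
    fix k0 :: nat assume k0: "K \<le> k0"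
    have k01: "1 \<le> real k0" using k0 K by simp
    let ?r = "real k0 powr (- (2 * (\<delta> - \<beta> - \<omega>) - 1))"
    define Good where "Good = {y \<in> space M. \<forall>k\<ge>k0. norm (\<theta> k y - \<theta>s) \<le> c * real k powr (- \<beta>)}"
    define g where "g x = C * U 2 (W 0 x) * ?r" for x
    have \<theta>M[measurable]: "\<theta> k \<in> borel_measurable M" for k using sub[of k] \<theta>G by (blast intro: measurable_from_subalg)
    have thM[measurable]: "th k \<in> borel_measurable M" for k
      using sub[of k] borel_onM[OF th_m[of k]] by (blast intro: measurable_from_subalg)
    have GoodM: "Good \<in> sets M" unfolding Good_def by measurable
    have U0: "(\<lambda>x. U 2 (W 0 x)) \<in> borel_measurable (?Gp 0)"
      using measurable_from_subalg[OF sa.sub_mp sa.U2_meas[of 0]] .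
    have "AE x in M. 1 - g x \<le> cprob M (?Gp 0) Good x"
    proof (rule cprob_lower_bound[OF _ GoodM])
      show "subalgebra M (?Gp 0)" using sub by blast
      show "g \<in> borel_measurable (?Gp 0)" unfolding g_def[abs_def] using U0 by measurable
      show "integrable M g" unfolding g_def[abs_def] using ergodicity_ii by simp
      fix A assume A: "A \<in> sets (?Gp 0)"
      have AM: "A \<in> sets M" using A sub[of 0] by (auto simp: subalgebra_def)
      let ?bad = "{x \<in> space M. \<exists>k\<ge>k0. c * real k powr (- \<beta>) < norm (th k x - \<theta>s)}"
      have "AE x in M. \<forall>k. th k x = \<theta> k x" using th_eq by (simp add: AE_all_countable)
      then have "measure M (A - Good) = measure M (A \<inter> ?bad)"
      proof (intro finite_measure_eq_AE)
        assume "AE x in M. \<forall>k. th k x = \<theta> k x"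
        then show "AE x in M. x \<in> A - Good \<longleftrightarrow> x \<in> A \<inter> ?bad"
        proof (rule AE_mp, intro AE_I2 impI)
          fix x assume x: "x \<in> space M" and eq: "\<forall>k. th k x = \<theta> k x"
          show "x \<in> A - Good \<longleftrightarrow> x \<in> A \<inter> ?bad" using x eq by (auto simp: Good_def not_le)
        qed
      qed (use AM GoodM in measurable)
      also have "\<dots> \<le> C * ?r * (\<integral>x. indicator A x * U 2 (W 0 x) \<partial>M)" by (rule tail[OF k0 A])
      also have "\<dots> = (\<integral>x. (C * ?r) * (indicator A x * U 2 (W 0 x)) \<partial>M)" by simp
      also have "\<dots> = (\<integral>x. indicator A x * g x \<partial>M)"
        by (intro Bochner_Integration.integral_cong) (auto simp: g_def)
      finally show "measure M (A - Good) \<le> (\<integral>x. indicator A x * g x \<partial>M)" .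
    qed
    then show "AE x in M. cprob M (?Gp 0) {y \<in> space M. \<forall>k\<ge>k0. norm (\<theta> k y - \<theta>s) \<le> c * real k powr (- \<beta>)} x
           \<ge> 1 - C * U 2 (W 0 x) * (1 + ln (real k0))\<^sup>2
                 * real k0 powr (- (2 * (\<delta> - \<beta> - noise_exponent M Mt \<omega>M) - 1))"
      unfolding Good_def[symmetric] \<omega>_def[symmetric]
    proof (rule AE_mp, intro AE_I2 impI)
      fix x assume "x \<in> space M" and le: "1 - g x \<le> cprob M (?Gp 0) Good x"
      have "1 \<le> (1 + ln (real k0))\<^sup>2" using k01 by (intro one_le_power) simp
      then have "C * U 2 (W 0 x) * 1 * ?r \<le> C * U 2 (W 0 x) * (1 + ln (real k0))\<^sup>2 * ?r"
        using C by (intro mult_right_mono mult_left_mono) (auto simp: U_def)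
      then show "cprob M (?Gp 0) Good x \<ge> 1 - C * U 2 (W 0 x) * (1 + ln (real k0))\<^sup>2 * ?r"
        using le by (simp add: g_def)
    qed
  qed
qed

end
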